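(* Let $\Omega$ be a domain in a Carnot group $\mathbb{G}$ with homogeneous dimension $Q$, and let $p(\cdot)\in\mathcal{P}(\Omega)$, $1<p^-\le p^+<Q$. Let $\omega>0$ be a weight, and let $A:\Omega\to\mathbb{R}^{n_1\times n_1}$ be a measurable function with $A(x)$ symmetric for each $x$, for which there are constants $\eta_1,\eta_2>0$ with $$\omega(x)^2\eta_1|\xi|^2\le\langle A(x)\xi,\xi\rangle\le\omega(x)^2\eta_2|\xi|^2\qquad\text{for all }x\in\Omega,\ \xi\in\mathbb{R}^{n_1}.$$ Let $f\in L^{p'(\cdot)}_{\omega^{-1}}(\Omega)$. Assume that one of the following holds: (a) $p(\cdot)$ is the restriction to $\Omega$ of an exponent in $\mathcal P(\mathbb G)$ (still denoted $p(\cdot)$) with $1<p^-\le p^+<Q$ on $\mathbb G$, and $\omega\in A_{p(\cdot),p^*(\cdot)}$ is such that $(p^*(\cdot)/Q',\omega^{Q'})$ is an $M$-pair, where $p^*(x)=\frac{Qp(x)}{Q-p(x)}$, $Q'=\frac Q{Q-1}$; or (b) $p(\cdot)$ satisfies the jump condition in $\Omega$ with some constant $\delta>0$ and $\omega\in A_{p^-,(p^-)^*}$, where $(p^-)^*=\frac{Qp^-}{Q-p^-}$. Define, for $u\in W^{1,p(\cdot)}_{\omega,0}(\Omega)$, $$\mathcal F(u)=\int_\Omega\frac{\langle A(x)Xu(x),Xu(x)\rangle^{\frac{p(x)}2}}{p(x)}dx+\int_\Omega\frac{|u(x)\omega(x)|^{p(x)}}{p(x)}dx-\int_\Omega f(x)u(x)\,dx.$$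 Then there exists a unique $u\in W^{1,p(\cdot)}_{\omega,0}(\Omega)$ with $\mathcal F(u)=\min_{v\in W^{1,p(\cdot)}_{\omega,0}(\Omega)}\mathcal F(v)$. Moreover, $u$ is the unique weak solution of the Dirichlet problem $$-\operatorname{div}\!\left(\langle A\,Xu,Xu\rangle^{\frac{p(x)-2}2}A\,Xu\right)+|u|^{p(x)-2}u\,\omega^{p(x)}=f\ \text{ in }\Omega,\qquad u=0\ \text{ on }\partial\Omega,$$ that is, the unique $u\in W^{1,p(\cdot)}_{\omega,0}(\Omega)$ such that for all $v\in W^{1,p(\cdot)}_{\omega,0}(\Omega)$ $$\int_\Omega\langle A\,Xu,Xu\rangle^{\frac{p(x)-2}2}\langle A\,Xu,Xv\rangle\,dx+\int_\Omega|u|^{p(x)-2}u\,v\,\omega^{p(x)}\,dx=\int_\Omega fv\,dx.$$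
   Context: Carnot group: a connected, simply connected Lie group $\mathbb{G}$ whose Lie algebra is stratified, $\mathfrak g=V_1\oplus\cdots\oplus V_s$, $[V_1,V_k]=V_{k+1}$ for $k=1,\dots,s-1$, with dilations $\delta_\epsilon$ acting on $V_k$ as multiplication by $\epsilon^k$. $Q=\sum_kk\dim V_k$ is the homogeneous dimension. $X=(X_1,\dots,X_{n_1})$ is a basis of $V_1$ (left invariant vector fields), $Xu=(X_1u,\dots,X_{n_1}u)$, $\operatorname{div}(g)=\sum_{j\le n_1}X_jg_j$. $\mathbb G$ carries Haar (Lebesgue) measure $dx$, $|E|$, and the Carnot-Carathéodory metric $d$: $d(x,y)$ is the infimum of $T>0$ such that some absolutely continuous $\gamma:[0,T]\to\mathbb G$ joins $x$ to $y$ with $\gamma'=\sum_j c_jX_j(\gamma)$ a.e., $c_j$ measurable, $\sum c_j^2\le1$; balls are $d$-balls. Domain: open, bounded, connected set. Variable exponents. $\mathcal{P}(E)$ is the set of measurable $p(\cdot):E\to[1,\infty]$; $p^-,p^+$ are the essential infimum and supremum, and $p^\pm_{F}$ those over $F$ (over $F\cap\Omega$ if $p$ is defined on $\Omega$); $\frac1{p(x)}+\frac1{p'(x)}=1$. $\|f\|_{L^{p(\cdot)}(E)}=\inf\{\lambda>0:\rho(f/\lambda)\le1\}$ with $\rho(f)=\int_{\{p<\infty\}}|f|^{p(x)}dx+\|f\|_{L^\infty(\{p=\infty\})}$. For a weight $\omega$ (locally integrable, $0<\omega<\infty$ a.e., or a real power of such), $\|f\|_{L^{p(\cdot)}_\omega(E)}=\|f\omega\|_{L^{p(\cdot)}(E)}$.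 Muckenhoupt class. For exponents on $\mathbb G$ with $1<q(\cdot)<\infty$ and $\frac1{p(x)}-\frac1{q(x)}=\gamma$ constant, $0\le\gamma<1$, $\omega\in A_{p(\cdot),q(\cdot)}$ means $\sup_B|B|^{\gamma-1}\|\omega\chi_B\|_{L^{q(\cdot)}}\|\omega^{-1}\chi_B\|_{L^{p'(\cdot)}}<\infty$, the supremum over all balls $B\subset\mathbb G$ (constant exponents included). Maximal operator: $Mf(x)=\sup_{B\ni x}\frac1{|B|}\int_B|f|\,dy$; $(p(\cdot),\omega)$ is an $M$-pair if $M$ is bounded on both $L^{p(\cdot)}_\omega(\mathbb G)$ and $L^{p'(\cdot)}_{\omega^{-1}}(\mathbb G)$. Jump condition in $\Omega$ with constant $\delta$: $p^+_\Omega<\infty$ and for every $x\in\Omega$ either $p^-_{B(x,\delta)}\ge Q$ or $p^+_{B(x,\delta)}\le\frac{Qp^-_{B(x,\delta)}}{Q-p^-_{B(x,\delta)}}$. Sobolev space. $W^{1,p(\cdot)}_\omega(\Omega)$: all $u\in L^{p(\cdot)}_\omega(\Omega)$ with distributional derivatives $X_ju\in L^{p(\cdot)}_\omega(\Omega)$ (i.e. $\int_\Omega uX_j\phi=-\int_\Omega (X_ju)\phi$ for $\phi\in C_0^\infty(\Omega)$), $j=1,\dots,n_1$, with norm $\|u\|_{L^{p(\cdot)}_\omega(\Omega)}+\sum_j\|X_ju\|_{L^{p(\cdot)}_\omega(\Omega)}$; $W^{1,p(\cdot)}_{\omega,0}(\Omega)$ is the closure of $C_0^1(\Omega)$ in this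 norm. Convention: $\langle A\xi,\xi\rangle^{(p-2)/2}A\xi=0$ when $\xi=0$ and $|t|^{p-2}t=0$ when $t=0$. *)

theory Defs
  imports
    "HOL-Analysis.Analysis"
    "HOL-Probability.Essential_Supremum"
    "HOL-Library.Function_Algebras"
begin

section \<open>Smooth functions on Euclidean spaces and on manifolds\<close>

text \<open>The pointwise vector space structure on function spaces; it makes the derivations
  \<open>C\<^sup>\<infinity>(G) \<rightarrow> C\<^sup>\<infinity>(G)\<close> below elements of a real vector space, so that the library notions
  of subspace, span, independence and dimension apply to the Lie algebra.\<close>

instantiation "fun" :: (type, real_vector) real_vector
begin

definition scaleR_fun_def: "scaleR r f = (\<lambda>x. scaleR r (f x))"

instance
  by standard
    (simp_all add: scaleR_fun_def fun_eq_iff scaleR_add_right scaleR_add_left)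

end

text \<open>Used for open \<open>S\<close> and finite-dimensional domains only: there this is the usual class
  \<open>C\<^sup>k(S)\<close>, since differentiability together with continuity of all directional derivatives
  is continuous differentiability.\<close>

primrec Ck_on :: "nat \<Rightarrow> 'a::real_normed_vector set \<Rightarrow> ('a \<Rightarrow> 'b::real_normed_vector) \<Rightarrow> bool" where
  "Ck_on 0 S f \<longleftrightarrow> continuous_on S f"
| "Ck_on (Suc k) S f \<longleftrightarrow> (\<forall>x\<in>S. f differentiable (at x)) \<and>
     (\<forall>v. Ck_on k S (\<lambda>x. frechet_derivative f (at x) v))"

definition smooth_on :: "'a::real_normed_vector set \<Rightarrow> ('a \<Rightarrow> 'b::real_normed_vector) \<Rightarrow> bool" where
  "smooth_on S f \<longleftrightarrow> (\<forall>k. Ck_on k S f)"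

text \<open>A chart is a pair \<open>(U, \<phi>)\<close> of an open set and a map that is a homeomorphism from \<open>U\<close> onto
  an open subset of the model space; the values of \<open>\<phi>\<close> off \<open>U\<close> are irrelevant.\<close>

type_synonym ('g, 'e) chart = "'g set \<times> ('g \<Rightarrow> 'e)"

definition smooth_atlas ::
  "('g::topological_space, 'e::euclidean_space) chart set \<Rightarrow> bool" where
  "smooth_atlas \<A> \<longleftrightarrow>
     (\<Union>(U, \<phi>)\<in>\<A>. U) = UNIV \<and>
     (\<forall>(U, \<phi>)\<in>\<A>. open U \<and> open (\<phi> ` U) \<and> homeomorphism U (\<phi> ` U) \<phi> (inv_into U \<phi>)) \<and>
     (\<forall>(U, \<phi>)\<in>\<A>. \<forall>(V, \<psi>)\<in>\<A>. smooth_on (\<phi> ` (U \<inter> V)) (\<psi> \<circ> inv_into U \<phi>))"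

definition Ck_fun ::
  "('g, 'e::euclidean_space) chart set \<Rightarrow> nat \<Rightarrow> ('g \<Rightarrow> real) \<Rightarrow> bool" where
  "Ck_fun \<A> k f \<longleftrightarrow> (\<forall>(U, \<phi>)\<in>\<A>. Ck_on k (\<phi> ` U) (f \<circ> inv_into U \<phi>))"

definition smooth_fun ::
  "('g, 'e::euclidean_space) chart set \<Rightarrow> ('g \<Rightarrow> real) \<Rightarrow> bool" where
  "smooth_fun \<A> f \<longleftrightarrow> (\<forall>k. Ck_fun \<A> k f)"

section \<open>Lie groups and their Lie algebras\<close>

text \<open>The topological space and the underlying set of the group are the type \<open>'g\<close>;
  \<open>group\<close> is the group locale of HOL.Groups.\<close>

definition lie_group ::
  "('g::{t2_space, second_countable_topology}, 'e::euclidean_space) chart set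
     \<Rightarrow> ('g \<Rightarrow> 'g \<Rightarrow> 'g) \<Rightarrow> 'g \<Rightarrow> ('g \<Rightarrow> 'g) \<Rightarrow> bool" where
  "lie_group \<A> mul one iv \<longleftrightarrow>
     smooth_atlas \<A> \<and> group mul one iv \<and>
     continuous_on UNIV (\<lambda>(x, y). mul x y) \<and> continuous_on UNIV iv \<and>
     (\<forall>(U, \<phi>)\<in>\<A>. \<forall>(V, \<psi>)\<in>\<A>. \<forall>(W, \<theta>)\<in>\<A>.
        smooth_on {(\<phi> x, \<psi> y) |x y. x \<in> U \<and> y \<in> V \<and> mul x y \<in> W}
          (\<lambda>(a, b). \<theta> (mul (inv_into U \<phi> a) (inv_into V \<psi> b)))) \<and>
     (\<forall>(U, \<phi>)\<in>\<A>. \<forall>(V, \<psi>)\<in>\<A>.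
        smooth_on (\<phi> ` {x \<in> U. iv x \<in> V}) (\<lambda>a. \<psi> (iv (inv_into U \<phi> a))))"

text \<open>Smooth vector fields as derivations of \<open>C\<^sup>\<infinity>(G)\<close>. The last clause fixes the value at
  functions that are not smooth, so that equality of vector fields is equality in HOL.\<close>

type_synonym 'g vfield = "('g \<Rightarrow> real) \<Rightarrow> 'g \<Rightarrow> real"

definition vector_field :: "('g, 'e::euclidean_space) chart set \<Rightarrow> 'g vfield \<Rightarrow> bool" where
  "vector_field \<A> X \<longleftrightarrow>
     (\<forall>f. smooth_fun \<A> f \<longrightarrow> smooth_fun \<A> (X f)) \<and>
     (\<forall>f g a b. smooth_fun \<A> f \<longrightarrow> smooth_fun \<A> g \<longrightarrow>
        X (\<lambda>x. a * f x + b * g x) = (\<lambda>x. a * X f x + b * X g x)) \<and>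
     (\<forall>f g. smooth_fun \<A> f \<longrightarrow> smooth_fun \<A> g \<longrightarrow>
        X (\<lambda>x. f x * g x) = (\<lambda>x. f x * X g x + g x * X f x)) \<and>
     (\<forall>f. \<not> smooth_fun \<A> f \<longrightarrow> X f = 0)"

definition lie_algebra ::
  "('g, 'e::euclidean_space) chart set \<Rightarrow> ('g \<Rightarrow> 'g \<Rightarrow> 'g) \<Rightarrow> 'g vfield set" where
  "lie_algebra \<A> mul = {X. vector_field \<A> X \<and>
     (\<forall>f g. smooth_fun \<A> f \<longrightarrow> X (\<lambda>x. f (mul g x)) = (\<lambda>x. X f (mul g x)))}"

definition lie_bracket :: "'g vfield \<Rightarrow> 'g vfield \<Rightarrow> 'g vfield" where
  "lie_bracket X Y = (\<lambda>f. X (Y f) - Y (X f))"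

text \<open>\<open>\<gg> = V\<^sub>1 \<oplus> \<dots> \<oplus> V\<^sub>s\<close> with \<open>[V\<^sub>1, V\<^sub>k] = V\<^bsub>k+1\<^esub>\<close> for \<open>k < s\<close>. The usual
  convention \<open>V\<^bsub>s+1\<^esub> = 0\<close>, i.e. \<open>[V\<^sub>1, V\<^sub>s] = 0\<close>, is what makes the dilations (multiplication
  by \<open>\<epsilon>\<^sup>k\<close> on \<open>V\<^sub>k\<close>) Lie algebra automorphisms.\<close>

definition stratification :: "'g vfield set \<Rightarrow> (nat \<Rightarrow> 'g vfield set) \<Rightarrow> nat \<Rightarrow> bool" where
  "stratification \<gg> V s \<longleftrightarrow>
     1 \<le> s \<and>
     (\<forall>k\<in>{1..s}. subspace (V k)) \<and>
     span (\<Union>k\<in>{1..s}. V k) = \<gg> \<and>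
     (\<forall>Y. (\<forall>k\<in>{1..s}. Y k \<in> V k) \<and> (\<Sum>k=1..s. Y k) = 0 \<longrightarrow> (\<forall>k\<in>{1..s}. Y k = 0)) \<and>
     (\<forall>k\<in>{1..s}. span {lie_bracket X Y |X Y. X \<in> V 1 \<and> Y \<in> V k} = (if k < s then V (k + 1) else {0}))"

section \<open>Carnot groups\<close>

text \<open>The cardinality of the index type \<open>'n\<close> of the frame is \<open>n\<^sub>1 = dim V\<^sub>1\<close>.\<close>

record ('g, 'e, 'n) carnot =
  gatlas :: "('g, 'e) chart set"
  gmult :: "'g \<Rightarrow> 'g \<Rightarrow> 'g"
  gone :: 'g
  ginv :: "'g \<Rightarrow> 'g"
  layer :: "nat \<Rightarrow> 'g vfield set"
  gstep :: nat
  frame :: "'n \<Rightarrow> 'g vfield"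
  haar :: "'g measure"

definition haar_measure ::
  "('g::topological_space \<Rightarrow> 'g \<Rightarrow> 'g) \<Rightarrow> 'g measure \<Rightarrow> bool" where
  "haar_measure mul \<nu> \<longleftrightarrow>
     sets \<nu> = sets borel \<and>
     (\<forall>K. compact K \<longrightarrow> emeasure \<nu> K < \<infinity>) \<and>
     emeasure \<nu> UNIV \<noteq> 0 \<and>
     (\<forall>g. \<forall>E\<in>sets borel. emeasure \<nu> (mul g ` E) = emeasure \<nu> E)"

definition carnot_group ::
  "('g::{t2_space, second_countable_topology}, 'e::euclidean_space, 'n::finite) carnot \<Rightarrow> bool" where
  "carnot_group G \<longleftrightarrow>
     lie_group (gatlas G) (gmult G) (gone G) (ginv G) \<and>
     connected (UNIV :: 'g set) \<and> simply_connected (UNIV :: 'g set) \<and>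
     stratification (lie_algebra (gatlas G) (gmult G)) (layer G) (gstep G) \<and>
     inj (frame G) \<and> independent (range (frame G)) \<and> span (range (frame G)) = layer G 1 \<and>
     haar_measure (gmult G) (haar G)"

definition hom_dim :: "('g, 'e, 'n) carnot \<Rightarrow> nat" where
  "hom_dim G = (\<Sum>k=1..gstep G. k * dim (layer G k))"

text \<open>The completed Haar measure: in exponential coordinates it is Lebesgue measure on the
  Lebesgue sets (up to a constant factor).\<close>

definition vol :: "('g, 'e, 'n) carnot \<Rightarrow> 'g measure" where
  "vol G = completion (haar G)"

definition abs_cont :: "real \<Rightarrow> real \<Rightarrow> (real \<Rightarrow> real) \<Rightarrow> bool" where
  "abs_cont a b h \<longleftrightarrow> (\<forall>\<epsilon>>0. \<exists>\<delta>>0. \<forall>I. finite I \<and>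
     (\<forall>(s, t)\<in>I. a \<le> s \<and> s \<le> t \<and> t \<le> b) \<and>
     pairwise (\<lambda>(s, t) (s', t'). t \<le> s' \<or> t' \<le> s) I \<and> (\<Sum>(s, t)\<in>I. t - s) < \<delta>
       \<longrightarrow> (\<Sum>(s, t)\<in>I. \<bar>h t - h s\<bar>) < \<epsilon>)"

text \<open>Tangent vectors act on smooth functions: a curve in the manifold is absolutely continuous
  iff its composition with every smooth function is, and \<open>\<gamma>' = \<Sum>\<^sub>j c\<^sub>j X\<^sub>j(\<gamma>)\<close> means
  \<open>(h \<circ> \<gamma>)' = \<Sum>\<^sub>j c\<^sub>j (X\<^sub>j h)(\<gamma>)\<close> for every smooth \<open>h\<close>.\<close>

definition subunit_curve ::
  "('g::topological_space, 'e::euclidean_space, 'n::finite) carnot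
     \<Rightarrow> real \<Rightarrow> (real \<Rightarrow> 'g) \<Rightarrow> bool" where
  "subunit_curve G T \<gamma> \<longleftrightarrow>
     continuous_on {0..T} \<gamma> \<and>
     (\<forall>h. smooth_fun (gatlas G) h \<longrightarrow> abs_cont 0 T (h \<circ> \<gamma>)) \<and>
     (\<exists>c :: real \<Rightarrow> real^'n. c \<in> borel_measurable (lebesgue_on {0..T}) \<and>
        (\<forall>t\<in>{0..T}. (\<Sum>j\<in>UNIV. (c t $ j)\<^sup>2) \<le> 1) \<and>
        (AE t in lebesgue_on {0..T}. \<forall>h. smooth_fun (gatlas G) h \<longrightarrow>
           ((h \<circ> \<gamma>) has_real_derivative (\<Sum>j\<in>UNIV. c t $ j * frame G j h (\<gamma> t)))
             (at t within {0..T})))"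

definition cc_dist ::
  "('g::topological_space, 'e::euclidean_space, 'n::finite) carnot \<Rightarrow> 'g \<Rightarrow> 'g \<Rightarrow> ennreal" where
  "cc_dist G x y = Inf {ennreal T |T. 0 < T \<and>
     (\<exists>\<gamma>. subunit_curve G T \<gamma> \<and> \<gamma> 0 = x \<and> \<gamma> T = y)}"

definition cc_ball ::
  "('g::topological_space, 'e::euclidean_space, 'n::finite) carnot \<Rightarrow> 'g \<Rightarrow> real \<Rightarrow> 'g set" where
  "cc_ball G x r = {y. cc_dist G x y < ennreal r}"

definition cc_balls ::
  "('g::topological_space, 'e::euclidean_space, 'n::finite) carnot \<Rightarrow> 'g set set" where
  "cc_balls G = {cc_ball G x r |x r. 0 < r}"

definition carnot_domain ::
  "('g::topological_space, 'e::euclidean_space, 'n::finite) carnot \<Rightarrow> 'g set \<Rightarrow> bool" where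
  "carnot_domain G \<Omega> \<longleftrightarrow> open \<Omega> \<and> connected \<Omega> \<and> (\<exists>B\<in>cc_balls G. \<Omega> \<subseteq> B)"

section \<open>Variable exponents\<close>

text \<open>Exponents take values in \<open>ennreal\<close>, where \<open>inverse 0 = \<infinity>\<close> and \<open>inverse \<infinity> = 0\<close>.\<close>

definition var_exponent :: "'g measure \<Rightarrow> 'g set \<Rightarrow> ('g \<Rightarrow> ennreal) \<Rightarrow> bool" where
  "var_exponent M E p \<longleftrightarrow> p \<in> borel_measurable (restrict_space M E) \<and> (\<forall>x\<in>E. 1 \<le> p x)"

definition exp_plus :: "'g measure \<Rightarrow> 'g set \<Rightarrow> ('g \<Rightarrow> ennreal) \<Rightarrow> ennreal" where
  "exp_plus M F p = esssup (restrict_space M F) p"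

definition exp_minus :: "'g measure \<Rightarrow> 'g set \<Rightarrow> ('g \<Rightarrow> ennreal) \<Rightarrow> ennreal" where
  "exp_minus M F p = Sup {z. AE x in restrict_space M F. z \<le> p x}"

definition conj_exp :: "ennreal \<Rightarrow> ennreal" where
  "conj_exp p = inverse (1 - inverse p)"

definition sobolev_exp :: "nat \<Rightarrow> ennreal \<Rightarrow> ennreal" where
  "sobolev_exp Q p = of_nat Q * p / (of_nat Q - p)"

definition ennreal_powr :: "ennreal \<Rightarrow> real \<Rightarrow> ennreal" where
  "ennreal_powr x a = (if x = \<infinity> then \<infinity> else ennreal (enn2real x powr a))"

text \<open>The modular and the Luxemburg norm are defined for \<open>[0,\<infinity>]\<close>-valued functions, because
  they are also applied to maximal functions.\<close>

definition modular :: "'g measure \<Rightarrow> 'g set \<Rightarrow> ('g \<Rightarrow> ennreal) \<Rightarrow> ('g \<Rightarrow> ennreal) \<Rightarrow> ennreal" where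
  "modular M E p h =
     (\<integral>\<^sup>+x\<in>{x\<in>E. p x < \<infinity>}. ennreal_powr (h x) (enn2real (p x)) \<partial>M)
     + esssup (restrict_space M {x\<in>E. p x = \<infinity>}) h"

definition Lp_norm :: "'g measure \<Rightarrow> 'g set \<Rightarrow> ('g \<Rightarrow> ennreal) \<Rightarrow> ('g \<Rightarrow> ennreal) \<Rightarrow> ennreal" where
  "Lp_norm M E p h = Inf {ennreal l |l. 0 < l \<and> modular M E p (\<lambda>x. h x / ennreal l) \<le> 1}"

definition wLp_norm ::
  "'g measure \<Rightarrow> 'g set \<Rightarrow> ('g \<Rightarrow> ennreal) \<Rightarrow> ('g \<Rightarrow> real) \<Rightarrow> ('g \<Rightarrow> real) \<Rightarrow> ennreal" where
  "wLp_norm M E p w f = Lp_norm M E p (\<lambda>x. ennreal \<bar>f x * w x\<bar>)"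

definition wLp ::
  "'g measure \<Rightarrow> 'g set \<Rightarrow> ('g \<Rightarrow> ennreal) \<Rightarrow> ('g \<Rightarrow> real) \<Rightarrow> ('g \<Rightarrow> real) set" where
  "wLp M E p w = {f \<in> borel_measurable (restrict_space M E). wLp_norm M E p w f < \<infinity>}"

section \<open>Weights and the maximal operator\<close>

definition weight :: "('g::topological_space, 'e, 'n) carnot \<Rightarrow> ('g \<Rightarrow> real) \<Rightarrow> bool" where
  "weight G \<omega> \<longleftrightarrow> (\<exists>w a. w \<in> borel_measurable (vol G) \<and>
     (\<forall>K. compact K \<longrightarrow> set_integrable (vol G) K w) \<and>
     (AE x in vol G. 0 < w x) \<and> (AE x in vol G. \<omega> x = w x powr a))"

definition muckenhoupt ::
  "('g::topological_space, 'e::euclidean_space, 'n::finite) carnot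
     \<Rightarrow> ('g \<Rightarrow> ennreal) \<Rightarrow> ('g \<Rightarrow> ennreal) \<Rightarrow> ('g \<Rightarrow> real) \<Rightarrow> bool" where
  "muckenhoupt G p q \<omega> \<longleftrightarrow> weight G \<omega> \<and>
     var_exponent (vol G) UNIV p \<and> q \<in> borel_measurable (vol G) \<and>
     (AE x in vol G. 1 < q x \<and> q x < \<infinity>) \<and>
     (\<exists>\<gamma>. 0 \<le> \<gamma> \<and> \<gamma> < 1 \<and>
        (AE x in vol G. inverse (p x) = inverse (q x) + ennreal \<gamma>) \<and>
        (SUP B\<in>cc_balls G. ennreal (measure (vol G) B powr (\<gamma> - 1))
           * wLp_norm (vol G) UNIV q \<omega> (indicator B)
           * wLp_norm (vol G) UNIV (\<lambda>x. conj_exp (p x)) (\<lambda>x. inverse (\<omega> x)) (indicator B)) < \<infinity>)"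

definition maximal_fun ::
  "('g::topological_space, 'e::euclidean_space, 'n::finite) carnot \<Rightarrow> ('g \<Rightarrow> real) \<Rightarrow> 'g \<Rightarrow> ennreal" where
  "maximal_fun G f x =
     (SUP B\<in>{B\<in>cc_balls G. x \<in> B}. (\<integral>\<^sup>+y\<in>B. ennreal \<bar>f y\<bar> \<partial>vol G) / emeasure (vol G) B)"

definition maximal_bounded ::
  "('g::topological_space, 'e::euclidean_space, 'n::finite) carnot
     \<Rightarrow> ('g \<Rightarrow> ennreal) \<Rightarrow> ('g \<Rightarrow> real) \<Rightarrow> bool" where
  "maximal_bounded G p w \<longleftrightarrow> (\<exists>C::real. \<forall>f\<in>wLp (vol G) UNIV p w.
     Lp_norm (vol G) UNIV p (\<lambda>x. maximal_fun G f x * ennreal \<bar>w x\<bar>)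
       \<le> ennreal C * wLp_norm (vol G) UNIV p w f)"

definition M_pair ::
  "('g::topological_space, 'e::euclidean_space, 'n::finite) carnot
     \<Rightarrow> ('g \<Rightarrow> ennreal) \<Rightarrow> ('g \<Rightarrow> real) \<Rightarrow> bool" where
  "M_pair G p w \<longleftrightarrow> maximal_bounded G p w \<and>
     maximal_bounded G (\<lambda>x. conj_exp (p x)) (\<lambda>x. inverse (w x))"

definition jump_condition ::
  "('g::topological_space, 'e::euclidean_space, 'n::finite) carnot
     \<Rightarrow> 'g set \<Rightarrow> real \<Rightarrow> ('g \<Rightarrow> ennreal) \<Rightarrow> bool" where
  "jump_condition G \<Omega> \<delta> p \<longleftrightarrow>
     exp_plus (vol G) \<Omega> p < \<infinity> \<and>
     (\<forall>x\<in>\<Omega>.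
        exp_minus (vol G) (cc_ball G x \<delta> \<inter> \<Omega>) p \<ge> of_nat (hom_dim G) \<or>
        exp_plus (vol G) (cc_ball G x \<delta> \<inter> \<Omega>) p
          \<le> sobolev_exp (hom_dim G) (exp_minus (vol G) (cc_ball G x \<delta> \<inter> \<Omega>) p))"

section \<open>Sobolev spaces\<close>

text \<open>Elements of \<open>C\<^sub>0\<^sup>k(\<Omega>)\<close> are represented by their extension by zero to the group.\<close>

definition compactly_supported :: "'g::topological_space set \<Rightarrow> ('g \<Rightarrow> real) \<Rightarrow> bool" where
  "compactly_supported \<Omega> \<phi> \<longleftrightarrow>
     compact (closure {x. \<phi> x \<noteq> 0}) \<and> closure {x. \<phi> x \<noteq> 0} \<subseteq> \<Omega>"

definition C1_0 ::
  "('g::topological_space, 'e::euclidean_space, 'n) carnot \<Rightarrow> 'g set \<Rightarrow> ('g \<Rightarrow> real) set" where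
  "C1_0 G \<Omega> = {\<phi>. Ck_fun (gatlas G) 1 \<phi> \<and> compactly_supported \<Omega> \<phi>}"

definition test_functions ::
  "('g::topological_space, 'e::euclidean_space, 'n) carnot \<Rightarrow> 'g set \<Rightarrow> ('g \<Rightarrow> real) set" where
  "test_functions G \<Omega> = {\<phi>. smooth_fun (gatlas G) \<phi> \<and> compactly_supported \<Omega> \<phi>}"

definition weak_deriv ::
  "('g::topological_space, 'e::euclidean_space, 'n) carnot
     \<Rightarrow> 'g set \<Rightarrow> 'n \<Rightarrow> ('g \<Rightarrow> real) \<Rightarrow> ('g \<Rightarrow> real) \<Rightarrow> bool" where
  "weak_deriv G \<Omega> j u g \<longleftrightarrow>
     u \<in> borel_measurable (restrict_space (vol G) \<Omega>) \<and>
     g \<in> borel_measurable (restrict_space (vol G) \<Omega>) \<and>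
     (\<forall>\<phi>\<in>test_functions G \<Omega>.
        set_integrable (vol G) \<Omega> (\<lambda>x. u x * frame G j \<phi> x) \<and>
        set_integrable (vol G) \<Omega> (\<lambda>x. g x * \<phi> x) \<and>
        (LINT x:\<Omega>|vol G. u x * frame G j \<phi> x) = - (LINT x:\<Omega>|vol G. g x * \<phi> x))"

text \<open>Weak derivatives are unique up to null sets; \<open>hgrad\<close> picks a representative of \<open>Xu\<close>.\<close>

definition hgrad ::
  "('g::topological_space, 'e::euclidean_space, 'n::finite) carnot
     \<Rightarrow> 'g set \<Rightarrow> ('g \<Rightarrow> real) \<Rightarrow> 'g \<Rightarrow> real^'n" where
  "hgrad G \<Omega> u = (SOME D. \<forall>j. weak_deriv G \<Omega> j u (\<lambda>x. D x $ j))"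

definition sobolev ::
  "('g::topological_space, 'e::euclidean_space, 'n::finite) carnot
     \<Rightarrow> 'g set \<Rightarrow> ('g \<Rightarrow> ennreal) \<Rightarrow> ('g \<Rightarrow> real) \<Rightarrow> ('g \<Rightarrow> real) set" where
  "sobolev G \<Omega> p \<omega> = {u \<in> wLp (vol G) \<Omega> p \<omega>.
     \<forall>j. \<exists>g\<in>wLp (vol G) \<Omega> p \<omega>. weak_deriv G \<Omega> j u g}"

definition sobolev_norm ::
  "('g::topological_space, 'e::euclidean_space, 'n::finite) carnot
     \<Rightarrow> 'g set \<Rightarrow> ('g \<Rightarrow> ennreal) \<Rightarrow> ('g \<Rightarrow> real) \<Rightarrow> ('g \<Rightarrow> real) \<Rightarrow> ennreal" where
  "sobolev_norm G \<Omega> p \<omega> u = wLp_norm (vol G) \<Omega> p \<omega> u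
     + (\<Sum>j\<in>UNIV. wLp_norm (vol G) \<Omega> p \<omega> (\<lambda>x. hgrad G \<Omega> u x $ j))"

definition sobolev0 ::
  "('g::topological_space, 'e::euclidean_space, 'n::finite) carnot
     \<Rightarrow> 'g set \<Rightarrow> ('g \<Rightarrow> ennreal) \<Rightarrow> ('g \<Rightarrow> real) \<Rightarrow> ('g \<Rightarrow> real) set" where
  "sobolev0 G \<Omega> p \<omega> = {u \<in> sobolev G \<Omega> p \<omega>.
     \<forall>\<epsilon>>0. \<exists>\<phi>\<in>C1_0 G \<Omega> \<inter> sobolev G \<Omega> p \<omega>.
       sobolev_norm G \<Omega> p \<omega> (\<lambda>x. u x - \<phi> x) < ennreal \<epsilon>}"

section \<open>The energy functional and the Dirichlet problem\<close>

definition energy ::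
  "('g::topological_space, 'e::euclidean_space, 'n::finite) carnot
     \<Rightarrow> 'g set \<Rightarrow> ('g \<Rightarrow> ennreal) \<Rightarrow> ('g \<Rightarrow> real) \<Rightarrow> ('g \<Rightarrow> real^'n^'n) \<Rightarrow> ('g \<Rightarrow> real)
     \<Rightarrow> ('g \<Rightarrow> real) \<Rightarrow> real" where
  "energy G \<Omega> p \<omega> A f u =
     (LINT x:\<Omega>|vol G.
        ((A x *v hgrad G \<Omega> u x) \<bullet> hgrad G \<Omega> u x) powr (enn2real (p x) / 2) / enn2real (p x))
     + (LINT x:\<Omega>|vol G. \<bar>u x * \<omega> x\<bar> powr enn2real (p x) / enn2real (p x))
     - (LINT x:\<Omega>|vol G. f x * u x)"

text \<open>Since \<open>0 powr a = 0\<close>, the conventions on the vanishing of the nonlinear terms at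
  \<open>Xu = 0\<close> and \<open>u = 0\<close> hold automatically.\<close>

definition weak_solution ::
  "('g::topological_space, 'e::euclidean_space, 'n::finite) carnot
     \<Rightarrow> 'g set \<Rightarrow> ('g \<Rightarrow> ennreal) \<Rightarrow> ('g \<Rightarrow> real) \<Rightarrow> ('g \<Rightarrow> real^'n^'n) \<Rightarrow> ('g \<Rightarrow> real)
     \<Rightarrow> ('g \<Rightarrow> real) \<Rightarrow> bool" where
  "weak_solution G \<Omega> p \<omega> A f u \<longleftrightarrow>
     u \<in> sobolev0 G \<Omega> p \<omega> \<and>
     (\<forall>v\<in>sobolev0 G \<Omega> p \<omega>.
        (LINT x:\<Omega>|vol G.
           ((A x *v hgrad G \<Omega> u x) \<bullet> hgrad G \<Omega> u x) powr ((enn2real (p x) - 2) / 2)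
             * ((A x *v hgrad G \<Omega> u x) \<bullet> hgrad G \<Omega> v x))
        + (LINT x:\<Omega>|vol G.
             \<bar>u x\<bar> powr (enn2real (p x) - 2) * u x * v x * \<omega> x powr enn2real (p x))
        = (LINT x:\<Omega>|vol G. f x * v x))"

end

theory Submission
  imports Defs "HOL-Computational_Algebra.Polynomial"
begin

text \<open>
  Write the energy as \<open>T u - ell u\<close>, where \<open>T\<close> is the sum of the gradient term and the
  zero-order term and \<open>ell u\<close> is the integral of \<open>f u\<close>. For exponents in a compact subinterval of \<open>(1, \<infinity>)\<close>,
  powers of quadratic forms are uniformly convex, with a modulus that depends on the interval alone
  (\<open>uniform_convexity_scalar\<close>), and so is \<open>T\<close> (\<open>T_uniformly_convex\<close>). By Young's inequality half of the
  zero-order term absorbs \<open>ell\<close> (\<open>coercive\<close>). Hence minimizing sequences are Cauchy, and two minimizers agree.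
  Minimizers and weak solutions are the same: one direction is convexity of \<open>T\<close> (\<open>weak_sol_imp_minimizer\<close>), the
  other is differentiation along segments (\<open>minimizer_imp_weak_sol\<close>). The argument is carried out with modulars,
  which for bounded exponents define the same convergence as the norms.

  The limit of a minimizing sequence must lie in the space, that is, \<open>W\<^sub>0\<close> must be complete
  (\<open>sobolev0_complete\<close>). Weak derivatives pass to the limit as soon as modular convergence implies convergence in
  \<open>L\<^sup>1(\<Omega>)\<close>, and by Young's inequality this follows from \<open>\<integral>\<^sub>\<Omega> \<omega>\<^bsup>-p'\<^esup> < \<infinity>\<close> (\<open>L1_le_rho\<close>). Here the Muckenhoupt
  condition is used. The domain lies in a ball \<open>B\<close>, and the condition for this one ball bounds the dual norm of
  \<open>\<omega>\<^sup>-\<^sup>1\<close> on \<open>B\<close> (\<open>muckenhoupt_dual_integrable\<close>); in the second alternative this is the norm at the constant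
  exponent \<open>p\<^sup>-\<close>, which controls the one at \<open>p(\<cdot>) \<ge> p\<^sup>-\<close> on a set of finite volume
  (\<open>dual_integrable_of_constant\<close>).

  For this, \<open>B\<close> has to be measurable with finite and positive volume, whereas Carnot-Caratheodory balls are
  defined by curves. The end points of subunit curves of length at most \<open>t\<close> that start at the identity form a set
  with compact closure. Every point of the closure is the end point of a curve whose increments lie in such
  closures (\<open>relaxed_curve_to\<close>, by Tychonoff's theorem), and such a curve is again subunit
  (\<open>relaxed_imp_subunit_curve\<close>): smooth functions are Lipschitz along it, hence differentiable almost everywhere
  (\<open>lipschitz_imp_differentiable_AE\<close>), with derivative bounded by the horizontal gradient. So balls are countable
  unions of closed sets (\<open>cc_ball_eq_UN\<close>).

  Horizontal gradients are determined almost everywhere by the fundamental lemma of the calculus of variations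
  (\<open>fundamental_lemma\<close>); the required test functions are built from chart bumps (\<open>chart_bump\<close>).
\<close>

section \<open>Functions of class \<open>C\<^sup>k\<close> on open subsets of Euclidean spaces\<close>

lemma Ck_on_Suc_imp: "Ck_on (Suc k) S f \<Longrightarrow> Ck_on k S f"
proof (induction k arbitrary: f)
  case 0
  then show ?case
    unfolding Ck_on.simps
    by (meson continuous_at_imp_continuous_on differentiable_imp_continuous_within)
next
  case (Suc k)
  then show ?case by simp
qed

lemma Ck_on_le: "Ck_on m S f \<Longrightarrow> k \<le> m \<Longrightarrow> Ck_on k S f"
  by (induction m) (auto simp: le_Suc_eq simp del: Ck_on.simps(2) dest: Ck_on_Suc_imp)

lemma Ck_on_subset: "Ck_on k S f \<Longrightarrow> T \<subseteq> S \<Longrightarrow> Ck_on k T f"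
  by (induction k arbitrary: f) (auto intro: continuous_on_subset)

lemma Ck_on_cong:
  assumes "open S" "\<And>x. x \<in> S \<Longrightarrow> f x = g x" "Ck_on k S f"
  shows "Ck_on k S g"
  using assms(2,3)
proof (induction k arbitrary: f g)
  case 0
  then show ?case by (simp cong: continuous_on_cong)
next
  case (Suc k)
  have d: "(g has_derivative frechet_derivative f (at x)) (at x)" if "x \<in> S" for x
  proof (rule has_derivative_transform_within_open[OF _ \<open>open S\<close> that])
    show "(f has_derivative frechet_derivative f (at x)) (at x)"
      using Suc.prems(2) that by (simp add: frechet_derivative_works[symmetric])
  qed (use Suc.prems in auto)
  then have e: "frechet_derivative g (at x) = frechet_derivative f (at x)" if "x \<in> S" for x
    using frechet_derivative_at that by metis
  have "Ck_on k S (\<lambda>x. frechet_derivative g (at x) v)" for v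
    by (rule Suc.IH[of "\<lambda>x. frechet_derivative f (at x) v"]) (use Suc.prems(2) e in auto)
  then show ?case using d by (metis Ck_on.simps(2) differentiableI)
qed

lemma Ck_on_local:
  assumes "\<And>x. x \<in> S \<Longrightarrow> \<exists>T. open T \<and> x \<in> T \<and> Ck_on k T f"
  shows "Ck_on k S f"
  using assms
proof (induction k arbitrary: f)
  case 0
  then show ?case
    by (auto simp: continuous_on_eq_continuous_within)
      (metis at_within_open continuous_at_imp_continuous_at_within)
next
  case (Suc k)
  show ?case
    unfolding Ck_on.simps
  proof (intro conjI ballI allI)
    fix x assume "x \<in> S" then show "f differentiable (at x)" using Suc.prems by fastforce
  next
    fix v show "Ck_on k S (\<lambda>x. frechet_derivative f (at x) v)"
      by (rule Suc.IH) (use Suc.prems in fastforce)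
  qed
qed

text \<open>Any formula for the derivative will do, in place of the one that \<open>frechet_derivative\<close> chooses.\<close>

lemma Ck_on_SucI:
  assumes "open S" "\<And>x. x \<in> S \<Longrightarrow> (f has_derivative f' x) (at x)"
    "\<And>v. Ck_on k S (\<lambda>x. f' x v)"
  shows "Ck_on (Suc k) S f"
proof -
  have "frechet_derivative f (at x) = f' x" if "x \<in> S" for x
    using frechet_derivative_at assms(2) that by metis
  then have "Ck_on k S (\<lambda>x. frechet_derivative f (at x) v)" for v
    by (intro Ck_on_cong[of S "\<lambda>x. f' x v" "\<lambda>x. frechet_derivative f (at x) v"]) (use assms in auto)
  then show ?thesis
    using assms(2) by (metis Ck_on.simps(2) differentiableI)
qed

lemma Ck_on_SucD:
  assumes "Ck_on (Suc k) S f"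
  shows "x \<in> S \<Longrightarrow> (f has_derivative frechet_derivative f (at x)) (at x)"
    "Ck_on k S (\<lambda>x. frechet_derivative f (at x) v)"
  using assms by (auto simp: frechet_derivative_works[symmetric])

lemma Ck_on_const: "open S \<Longrightarrow> Ck_on k S (\<lambda>x. c)"
proof (induction k arbitrary: c)
  case (Suc k)
  show ?case by (rule Ck_on_SucI[where f' = "\<lambda>x v. 0"]) (use Suc in auto)
qed simp

lemma Ck_on_linear_comp:
  assumes L: "bounded_linear L" and "open S" "Ck_on k S f"
  shows "Ck_on k S (\<lambda>x. L (f x))"
  using assms(3)
proof (induction k arbitrary: f)
  case 0
  then show ?case by (auto intro: bounded_linear.continuous_on[OF L])
next
  case (Suc k)
  note D = Ck_on_SucD[OF Suc.prems]
  show ?case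
    by (rule Ck_on_SucI[where f' = "\<lambda>x v. L (frechet_derivative f (at x) v)"])
      (use \<open>open S\<close> D Suc.IH in \<open>auto intro: bounded_linear.has_derivative[OF L]\<close>)
qed

lemma Ck_on_ident: "open S \<Longrightarrow> Ck_on k S (\<lambda>x. x)"
proof (cases k)
  case (Suc k)
  assume "open S" then show ?thesis unfolding Suc
    by (intro Ck_on_SucI[where f' = "\<lambda>x v. v"]) (auto intro: Ck_on_const)
qed simp

lemma Ck_on_add:
  assumes "open S" "Ck_on k S f" "Ck_on k S g"
  shows "Ck_on k S (\<lambda>x. f x + g x)"
  using assms(2,3)
proof (induction k arbitrary: f g)
  case 0
  then show ?case by (auto intro: continuous_on_add)
next
  case (Suc k)
  note D = Ck_on_SucD[OF Suc.prems(1)] Ck_on_SucD[OF Suc.prems(2)]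
  show ?case
    by (rule Ck_on_SucI[where f' = "\<lambda>x v. frechet_derivative f (at x) v + frechet_derivative g (at x) v"])
      (use \<open>open S\<close> D Suc.IH in \<open>auto intro: has_derivative_add\<close>)
qed

lemma Ck_on_sum:
  assumes "open S" "finite I" "\<And>i. i \<in> I \<Longrightarrow> Ck_on k S (f i)"
  shows "Ck_on k S (\<lambda>x. \<Sum>i\<in>I. f i x)"
  using assms(2,3) by (induction I) (auto intro: Ck_on_const Ck_on_add assms(1))

lemma Ck_on_scaleR:
  assumes "open S" "Ck_on k S f" "Ck_on k S g"
  shows "Ck_on k S (\<lambda>x. f x *\<^sub>R g x)"
  using assms(2,3)
proof (induction k arbitrary: f g)
  case 0
  then show ?case by (auto intro: continuous_on_scaleR)
next
  case (Suc k)
  note D = Ck_on_SucD[OF Suc.prems(1)] Ck_on_SucD[OF Suc.prems(2)]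
  show ?case
    by (rule Ck_on_SucI[where f' = "\<lambda>x v. f x *\<^sub>R frechet_derivative g (at x) v + frechet_derivative f (at x) v *\<^sub>R g x"])
      (use \<open>open S\<close> D Suc.IH Suc.prems in \<open>auto intro!: has_derivative_scaleR Ck_on_add simp del: Ck_on.simps(2) dest: Ck_on_Suc_imp\<close>)
qed

lemma Ck_on_mult:
  fixes f g :: "'a::real_normed_vector \<Rightarrow> real"
  assumes "open S" "Ck_on k S f" "Ck_on k S g"
  shows "Ck_on k S (\<lambda>x. f x * g x)"
  using Ck_on_scaleR[OF assms] by simp

text \<open>By the chain rule, the derivative of \<open>g \<circ> f\<close> in direction \<open>v\<close> is the sum over the standard basis of the
  coordinates of the derivative of \<open>f\<close> times the partial derivatives of \<open>g\<close> composed with \<open>f\<close>; the induction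
  hypothesis applies to these compositions.\<close>

lemma Ck_on_compose:
  fixes g :: "'b::euclidean_space \<Rightarrow> 'c::real_normed_vector"
  assumes "open S" "f ` S \<subseteq> T" "Ck_on k S f" "Ck_on k T g"
  shows "Ck_on k S (\<lambda>x. g (f x))"
  using assms(3,4)
proof (induction k arbitrary: g)
  case 0
  then show ?case using assms(2) by (auto intro: continuous_on_compose2)
next
  case (Suc k)
  note D = Ck_on_SucD[OF Suc.prems(1)] Ck_on_SucD[OF Suc.prems(2)]
  have lin: "linear (frechet_derivative g (at (f x)))" if "x \<in> S" for x
    using D(3)[of "f x"] that assms(2) has_derivative_linear by blast
  have expand: "frechet_derivative g (at (f x)) w
      = (\<Sum>i\<in>Basis. (w \<bullet> i) *\<^sub>R frechet_derivative g (at (f x)) i)" if "x \<in> S" for x w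
    using arg_cong[OF euclidean_representation[of w], of "frechet_derivative g (at (f x))"] lin[OF that]
    by (simp add: linear_sum linear_scale)
  show ?case
  proof (rule Ck_on_SucI[where f' = "\<lambda>x v. \<Sum>i\<in>Basis. (frechet_derivative f (at x) v \<bullet> i) *\<^sub>R frechet_derivative g (at (f x)) i"])
    show "open S" by fact
    fix x assume x: "x \<in> S"
    then have "(g \<circ> f has_derivative frechet_derivative g (at (f x)) \<circ> frechet_derivative f (at x)) (at x)"
      using D assms(2) by (intro diff_chain_at) auto
    moreover have "frechet_derivative g (at (f x)) \<circ> frechet_derivative f (at x)
        = (\<lambda>v. \<Sum>i\<in>Basis. (frechet_derivative f (at x) v \<bullet> i) *\<^sub>R frechet_derivative g (at (f x)) i)"
      by (rule ext, simp only: o_def, rule expand[OF x])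
    ultimately show "((\<lambda>x. g (f x)) has_derivative
        (\<lambda>v. \<Sum>i\<in>Basis. (frechet_derivative f (at x) v \<bullet> i) *\<^sub>R frechet_derivative g (at (f x)) i)) (at x)"
      by (simp add: o_def)
  next
    fix v
    show "Ck_on k S (\<lambda>x. \<Sum>i\<in>Basis. (frechet_derivative f (at x) v \<bullet> i) *\<^sub>R frechet_derivative g (at (f x)) i)"
    proof (intro Ck_on_sum Ck_on_scaleR \<open>open S\<close> finite_Basis)
      fix i :: 'b
      show "Ck_on k S (\<lambda>x. frechet_derivative f (at x) v \<bullet> i)"
        by (rule Ck_on_linear_comp[OF bounded_linear_inner_left \<open>open S\<close> D(2)])
      show "Ck_on k S (\<lambda>x. frechet_derivative g (at (f x)) i)"
        by (rule Suc.IH[OF Ck_on_Suc_imp[OF Suc.prems(1)] D(4)])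
    qed
  qed
qed

section \<open>A smooth function vanishing exactly on a half-line\<close>

text \<open>The functions \<open>t \<mapsto> q(1/t) exp(-1/t)\<close>, extended by zero, are closed under differentiation,
  which turns \<open>q\<close> into \<open>X\<^sup>2 (q - q')\<close>; hence they are smooth.\<close>

definition flat :: "real poly \<Rightarrow> real \<Rightarrow> real" where
  "flat q t = (if 0 < t then poly q (1/t) * exp (-1/t) else 0)"

lemma poly_times_exp_minus_tendsto_0:
  "((\<lambda>s::real. s ^ k * poly q s * exp (-s)) \<longlongrightarrow> 0) at_top"
proof (induction q arbitrary: k)
  case (pCons a q)
  have "((\<lambda>s. a * (s ^ k / exp s) + s ^ Suc k * poly q s * exp (-s)) \<longlongrightarrow> a * 0 + 0) at_top"
    by (intro tendsto_intros tendsto_power_div_exp_0 pCons.IH)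
  then show ?case by (simp add: algebra_simps exp_minus divide_simps)
qed simp

lemma flat_has_derivative:
  "(flat q has_real_derivative flat ([:0, 0, 1:] * (q - pderiv q)) t) (at t)"
proof -
  consider "t < 0" | "t > 0" | "t = 0" by linarith
  then show ?thesis
  proof cases
    case 1
    have "((\<lambda>_. 0) has_real_derivative 0) (at t)" by simp
    moreover have "\<forall>\<^sub>F s in nhds t. 0 = flat q s"
      using eventually_nhds_in_open[of "{..<0}" t] 1 by (auto simp: flat_def elim!: eventually_mono)
    ultimately have "(flat q has_real_derivative 0) (at t)"
      using DERIV_cong_ev[of t t "\<lambda>_. 0" "flat q" 0 0] by simp
    then show ?thesis using 1 by (simp add: flat_def)
  next
    case 2
    have "((\<lambda>t. poly q (1/t) * exp (-1/t)) has_real_derivative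
        poly ([:0, 0, 1:] * (q - pderiv q)) (1/t) * exp (-1/t)) (at t)"
      using 2 by (auto intro!: derivative_eq_intros poly_DERIV[THEN DERIV_chain2]
          simp: field_simps power2_eq_square)
    moreover have "\<forall>\<^sub>F s in nhds t. poly q (1/s) * exp (-1/s) = flat q s"
      using eventually_nhds_in_open[of "{0<..}" t] 2 by (auto simp: flat_def elim!: eventually_mono)
    ultimately have "(flat q has_real_derivative poly ([:0, 0, 1:] * (q - pderiv q)) (1/t) * exp (-1/t)) (at t)"
      using DERIV_cong_ev[of t t "\<lambda>s. poly q (1/s) * exp (-1/s)" "flat q"] by simp
    then show ?thesis using 2 by (simp add: flat_def)
  next
    case 3
    have "((\<lambda>h. flat q h / h) \<longlongrightarrow> 0) (at_right 0)"
    proof -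
      have "((\<lambda>s. s ^ 1 * poly q s * exp (-s)) \<longlongrightarrow> 0) at_top"
        by (rule poly_times_exp_minus_tendsto_0)
      then have "((\<lambda>h. inverse h ^ 1 * poly q (inverse h) * exp (- inverse h)) \<longlongrightarrow> 0) (at_right 0)"
        by (rule filterlim_compose[OF _ filterlim_inverse_at_top_right])
      then show ?thesis
        by (rule Lim_transform_eventually)
          (auto simp: eventually_at_right_less flat_def field_simps intro!: eventually_at_rightI[of 0 1])
    qed
    moreover have "((\<lambda>h. flat q h / h) \<longlongrightarrow> 0) (at_left 0)"
      by (rule Lim_transform_eventually[OF tendsto_const])
        (auto simp: flat_def intro!: eventually_at_leftI[of "-1" 0])
    ultimately have "((\<lambda>h. flat q h / h) \<longlongrightarrow> 0) (at 0)"
      by (simp add: filterlim_split_at)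
    then show ?thesis using 3 by (simp add: DERIV_def flat_def)
  qed
qed

lemma Ck_on_flat: "Ck_on k UNIV (flat q)"
proof (induction k arbitrary: q)
  case 0
  show ?case using DERIV_isCont[OF flat_has_derivative] by (auto intro!: continuous_at_imp_continuous_on)
next
  case (Suc k)
  let ?q = "[:0, 0, 1:] * (q - pderiv q)"
  show ?case
    using flat_has_derivative[of q] Suc[of ?q] unfolding has_field_derivative_def
    by (intro Ck_on_SucI[where f' = "\<lambda>t. (*) (flat ?q t)"] Ck_on_mult Ck_on_const) auto
qed

lemma Ck_on_exp: "Ck_on k UNIV (exp :: real \<Rightarrow> real)"
proof (induction k)
  case (Suc k)
  show ?case
    using DERIV_exp Suc unfolding has_field_derivative_def
    by (intro Ck_on_SucI[where f' = "\<lambda>t. (*) (exp t)"] Ck_on_mult Ck_on_const) auto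
qed (auto intro: continuous_intros)

section \<open>Smooth functions on manifolds\<close>

lemma smooth_atlasD:
  assumes "smooth_atlas \<A>" "(U, \<phi>) \<in> \<A>"
  shows "open U" "open (\<phi> ` U)" "homeomorphism U (\<phi> ` U) \<phi> (inv_into U \<phi>)"
    "(V, \<psi>) \<in> \<A> \<Longrightarrow> smooth_on (\<phi> ` (U \<inter> V)) (\<psi> \<circ> inv_into U \<phi>)"
  using assms unfolding smooth_atlas_def by auto

lemma smooth_atlas_chart_at:
  assumes "smooth_atlas \<A>"
  obtains U \<phi> where "(U, \<phi>) \<in> \<A>" "x \<in> U"
proof -
  have "x \<in> (\<Union>(U, \<phi>)\<in>\<A>. U)" using assms unfolding smooth_atlas_def by simp
  then show thesis using that by auto
qed

lemma chart_inv:
  assumes "smooth_atlas \<A>" "(U, \<phi>) \<in> \<A>" "x \<in> U"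
  shows "inv_into U \<phi> (\<phi> x) = x"
  using smooth_atlasD(3)[OF assms(1,2)] assms(3) by (simp add: homeomorphism_def)

lemma chart_open_image:
  assumes "smooth_atlas \<A>" "(U, \<phi>) \<in> \<A>" "open W" "W \<subseteq> U"
  shows "open (\<phi> ` W)"
proof -
  have "openin (top_of_set U) W"
    using assms(3,4) by (simp add: openin_open_eq[OF smooth_atlasD(1)[OF assms(1,2)]])
  then have "openin (top_of_set (\<phi> ` U)) (\<phi> ` W)"
    using homeomorphism_imp_open_map[OF smooth_atlasD(3)[OF assms(1,2)]] by blast
  then show ?thesis
    using smooth_atlasD(2)[OF assms(1,2)] openin_open_trans by blast
qed

lemma Ck_fun_imp_continuous:
  fixes \<A> :: "('g::t2_space, 'e::euclidean_space) chart set"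
  assumes \<A>: "smooth_atlas \<A>" and f: "Ck_fun \<A> k f"
  shows "continuous_on UNIV f"
proof -
  have "isCont f x" for x
  proof -
    obtain U \<phi> where U: "(U, \<phi>) \<in> \<A>" "x \<in> U" using smooth_atlas_chart_at[OF \<A>] .
    note D = smooth_atlasD[OF \<A> U(1)]
    have "Ck_on 0 (\<phi> ` U) (f \<circ> inv_into U \<phi>)"
      using f U(1) by (auto simp: Ck_fun_def simp del: Ck_on.simps intro: Ck_on_le[OF _ le0])
    then have "continuous_on (\<phi> ` U) (f \<circ> inv_into U \<phi>)" by simp
    then have "continuous_on U (\<lambda>y. (f \<circ> inv_into U \<phi>) (\<phi> y))"
      by (rule continuous_on_compose2) (use D(3) in \<open>auto simp: homeomorphism_def\<close>)
    then have "continuous_on U f"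
      by (rule continuous_on_eq) (simp add: chart_inv[OF \<A> U(1)])
    then show ?thesis using D(1) U(2) by (simp add: continuous_on_eq_continuous_at)
  qed
  then show ?thesis by (simp add: continuous_at_imp_continuous_on)
qed

lemma smooth_fun_imp_continuous:
  fixes \<A> :: "('g::t2_space, 'e::euclidean_space) chart set"
  shows "smooth_atlas \<A> \<Longrightarrow> smooth_fun \<A> f \<Longrightarrow> continuous_on UNIV f"
  unfolding smooth_fun_def using Ck_fun_imp_continuous by blast

lemma Ck_fun_const: "smooth_atlas \<A> \<Longrightarrow> Ck_fun \<A> k (\<lambda>x. c)"
  by (auto simp: Ck_fun_def o_def dest: smooth_atlasD intro: Ck_on_const)

lemma Ck_fun_add: "smooth_atlas \<A> \<Longrightarrow> Ck_fun \<A> k f \<Longrightarrow> Ck_fun \<A> k g \<Longrightarrow> Ck_fun \<A> k (\<lambda>x. f x + g x)"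
  by (auto simp: Ck_fun_def o_def dest: smooth_atlasD intro: Ck_on_add)

lemma Ck_fun_mult: "smooth_atlas \<A> \<Longrightarrow> Ck_fun \<A> k f \<Longrightarrow> Ck_fun \<A> k g \<Longrightarrow> Ck_fun \<A> k (\<lambda>x. f x * g x)"
  by (auto simp: Ck_fun_def o_def dest: smooth_atlasD intro: Ck_on_mult)

lemma Ck_fun_compose:
  "smooth_atlas \<A> \<Longrightarrow> Ck_fun \<A> k f \<Longrightarrow> Ck_on k UNIV g \<Longrightarrow> Ck_fun \<A> k (\<lambda>x. g (f x))"
  by (auto simp: Ck_fun_def o_def dest: smooth_atlasD intro: Ck_on_compose[where T = UNIV])

lemma smooth_fun_const: "smooth_atlas \<A> \<Longrightarrow> smooth_fun \<A> (\<lambda>x. c)"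
  by (simp add: smooth_fun_def Ck_fun_const)

lemma smooth_fun_add:
  "smooth_atlas \<A> \<Longrightarrow> smooth_fun \<A> f \<Longrightarrow> smooth_fun \<A> g \<Longrightarrow> smooth_fun \<A> (\<lambda>x. f x + g x)"
  by (simp add: smooth_fun_def Ck_fun_add)

lemma smooth_fun_mult:
  "smooth_atlas \<A> \<Longrightarrow> smooth_fun \<A> f \<Longrightarrow> smooth_fun \<A> g \<Longrightarrow> smooth_fun \<A> (\<lambda>x. f x * g x)"
  by (simp add: smooth_fun_def Ck_fun_mult)

lemma smooth_fun_sum:
  assumes "smooth_atlas \<A>" "finite I" "\<And>i. i \<in> I \<Longrightarrow> smooth_fun \<A> (f i)"
  shows "smooth_fun \<A> (\<lambda>x. \<Sum>i\<in>I. f i x)"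
  using assms(2,3) by (induction I) (simp_all add: assms(1) smooth_fun_const smooth_fun_add)

text \<open>A compact set is closed in a Hausdorff space, so its complement is open and the extension by zero
  is smooth there. All bump functions arise in this way.\<close>

lemma smooth_fun_extend_by_zero:
  fixes \<A> :: "('g::t2_space, 'e::euclidean_space) chart set" and B :: "'e \<Rightarrow> real"
  assumes \<A>: "smooth_atlas \<A>" and U: "(U, \<phi>) \<in> \<A>"
    and B: "\<And>k. Ck_on k (\<phi> ` U) B"
    and K: "compact K" "K \<subseteq> U" "\<And>y. y \<in> U \<Longrightarrow> y \<notin> K \<Longrightarrow> B (\<phi> y) = 0"
  shows "smooth_fun \<A> (\<lambda>y. if y \<in> U then B (\<phi> y) else 0)"
  unfolding smooth_fun_def Ck_fun_def
proof (clarify)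
  fix k W \<theta> assume W: "(W, \<theta>) \<in> \<A>"
  let ?f = "(\<lambda>y. if y \<in> U then B (\<phi> y) else 0) \<circ> inv_into W \<theta>"
  note D = smooth_atlasD[OF \<A> U] and E = smooth_atlasD[OF \<A> W]
  show "Ck_on k (\<theta> ` W) ?f"
  proof (rule Ck_on_local)
    fix b assume "b \<in> \<theta> ` W"
    then obtain y where y: "y \<in> W" "b = \<theta> y" by auto
    show "\<exists>T. open T \<and> b \<in> T \<and> Ck_on k T ?f"
    proof (cases "y \<in> U")
      case True
      let ?T = "\<theta> ` (W \<inter> U)"
      have T: "open ?T" using chart_open_image[OF \<A> W] D(1) E(1) by blast
      have "Ck_on k ?T (\<lambda>b. B ((\<phi> \<circ> inv_into W \<theta>) b))"
        by (rule Ck_on_compose[OF T _ _ B])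
          (use E(4)[OF U] in \<open>auto simp: smooth_on_def chart_inv[OF \<A> W] simp del: o_apply\<close>, simp add: chart_inv[OF \<A> W])
      then have "Ck_on k ?T ?f"
        by (rule Ck_on_cong[OF T, rotated -1]) (auto simp: chart_inv[OF \<A> W])
      then show ?thesis using T True y by blast
    next
      case False
      let ?T = "\<theta> ` (W - K)"
      have T: "open ?T"
        using chart_open_image[OF \<A> W] K(1) E(1) by (metis Diff_subset compact_imp_closed open_Diff)
      have "Ck_on k ?T ?f"
        by (rule Ck_on_cong[OF T, rotated -1, OF Ck_on_const[OF T, of k 0]])
          (auto simp: chart_inv[OF \<A> W] K)
      then show ?thesis using T False y K(2) by blast
    qed
  qed
qed

text \<open>The bump is \<open>exp(-1/(r\<^sup>2 - \<bar>a - \<phi> x\<bar>\<^sup>2))\<close> in the chart. Its products with the coordinates serve as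
  globally defined substitutes for the coordinates near \<open>x\<close>.\<close>

lemma chart_bump:
  fixes \<A> :: "('g::t2_space, 'e::euclidean_space) chart set"
  assumes \<A>: "smooth_atlas \<A>" and N: "open N" "x \<in> N"
  obtains U \<phi> \<psi> where "(U, \<phi>) \<in> \<A>" "x \<in> U" "smooth_fun \<A> \<psi>" "\<And>y. 0 \<le> \<psi> y" "0 < \<psi> x"
    "compact (closure {y. \<psi> y \<noteq> 0})" "closure {y. \<psi> y \<noteq> 0} \<subseteq> N \<inter> U"
    "\<And>i. smooth_fun \<A> (\<lambda>y. if y \<in> U then (\<phi> y \<bullet> i) * \<psi> y else 0)"
proof -
  obtain U \<phi> where U: "(U, \<phi>) \<in> \<A>" "x \<in> U" using smooth_atlas_chart_at[OF \<A>] .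
  note D = smooth_atlasD[OF \<A> U(1)]
  have V: "open (\<phi> ` (U \<inter> N))" using chart_open_image[OF \<A> U(1)] D(1) N(1) by blast
  then obtain r where r: "r > 0" "cball (\<phi> x) r \<subseteq> \<phi> ` (U \<inter> N)"
    using N(2) U(2) open_contains_cball by (metis IntI image_eqI)
  define B where "B = (\<lambda>a. flat 1 (r\<^sup>2 - (a - \<phi> x) \<bullet> (a - \<phi> x)))"
  define K where "K = inv_into U \<phi> ` cball (\<phi> x) r"
  have K: "compact K" unfolding K_def
    using D(3) r(2) by (intro compact_continuous_image)
      (auto simp: homeomorphism_def intro: continuous_on_subset)
  have KU: "K \<subseteq> U \<inter> N"
  proof
    fix y assume "y \<in> K"
    then obtain a where a: "a \<in> cball (\<phi> x) r" "y = inv_into U \<phi> a" by (auto simp: K_def)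
    then obtain z where "z \<in> U \<inter> N" "a = \<phi> z" using r(2) by blast
    then show "y \<in> U \<inter> N" using a chart_inv[OF \<A> U(1)] by simp
  qed
  have sm: "Ck_on k (UNIV::'e set) (\<lambda>a. \<Sum>i\<in>Basis. ((a - \<phi> x) \<bullet> i) * ((a - \<phi> x) \<bullet> i))" for k
  proof (intro Ck_on_sum Ck_on_mult open_UNIV finite_Basis)
    fix i :: 'e
    have "Ck_on k UNIV (\<lambda>a. a \<bullet> i + (- \<phi> x \<bullet> i))"
      by (intro Ck_on_add Ck_on_linear_comp[OF bounded_linear_inner_left] Ck_on_const Ck_on_ident) auto
    then show "Ck_on k UNIV (\<lambda>a. (a - \<phi> x) \<bullet> i)" "Ck_on k UNIV (\<lambda>a. (a - \<phi> x) \<bullet> i)"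
      by (simp_all add: inner_diff_left)
  qed
  have B: "Ck_on k (UNIV::'e set) B" for k
  proof -
    have "Ck_on k UNIV (\<lambda>a. r\<^sup>2 + (-1) * (\<Sum>i\<in>Basis. ((a - \<phi> x) \<bullet> i) * ((a - \<phi> x) \<bullet> i)))"
      by (intro Ck_on_add Ck_on_mult Ck_on_const sm) auto
    moreover have "B = (\<lambda>a. flat 1 (r\<^sup>2 + (-1) * (\<Sum>i\<in>Basis. ((a - \<phi> x) \<bullet> i) * ((a - \<phi> x) \<bullet> i))))"
      unfolding B_def fun_eq_iff by (subst euclidean_inner) simp
    ultimately show ?thesis
      using Ck_on_compose[OF open_UNIV subset_UNIV _ Ck_on_flat[of k 1]] by simp
  qed
  have B0: "B a = 0" if "a \<notin> cball (\<phi> x) r" for a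
  proof -
    have "r < norm (a - \<phi> x)" using that by (auto simp: dist_norm norm_minus_commute)
    then have "r\<^sup>2 < (norm (a - \<phi> x))\<^sup>2" using r(1) by (simp add: power_strict_mono)
    then show ?thesis by (simp add: B_def flat_def power2_norm_eq_inner)
  qed
  have Bnn: "0 \<le> B a" for a by (simp add: B_def flat_def)
  have Bx: "0 < B (\<phi> x)" using r(1) by (simp add: B_def flat_def)
  have offK: "\<phi> y \<notin> cball (\<phi> x) r" if "y \<in> U" "y \<notin> K" for y
    using that chart_inv[OF \<A> U(1) that(1)] unfolding K_def by (metis image_eqI)
  define \<psi> where "\<psi> = (\<lambda>y. if y \<in> U then B (\<phi> y) else 0)"
  have supp: "{y. \<psi> y \<noteq> 0} \<subseteq> K"
    using offK B0 by (auto simp: \<psi>_def split: if_splits)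
  then have cl: "closure {y. \<psi> y \<noteq> 0} \<subseteq> K"
    using K by (simp add: closure_minimal compact_imp_closed)
  have "smooth_fun \<A> \<psi>" unfolding \<psi>_def
    by (rule smooth_fun_extend_by_zero[OF \<A> U(1) _ K])
      (use KU B offK B0 in \<open>auto intro: Ck_on_subset\<close>)
  moreover have "smooth_fun \<A> (\<lambda>y. if y \<in> U then (\<phi> y \<bullet> i) * \<psi> y else 0)" for i
  proof -
    have "Ck_on k (UNIV::'e set) (\<lambda>a. (a \<bullet> i) * B a)" for k
      by (intro Ck_on_mult Ck_on_linear_comp[OF bounded_linear_inner_left] Ck_on_ident B) auto
    then have "smooth_fun \<A> (\<lambda>y. if y \<in> U then (\<phi> y \<bullet> i) * B (\<phi> y) else 0)"
      by (intro smooth_fun_extend_by_zero[OF \<A> U(1) _ K, of "\<lambda>a. (a \<bullet> i) * B a"])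
        (use KU offK B0 in \<open>auto intro: Ck_on_subset\<close>)
    then show ?thesis by (simp add: \<psi>_def cong: if_cong)
  qed
  moreover have "compact (closure {y. \<psi> y \<noteq> 0})"
    using compact_Int_closed[OF K closed_closure, of "{y. \<psi> y \<noteq> 0}"] cl by (simp add: Int_absorb1)
  moreover have "\<And>y. 0 \<le> \<psi> y" "0 < \<psi> x"
    using Bnn Bx U(2) by (simp_all add: \<psi>_def)
  moreover have "closure {y. \<psi> y \<noteq> 0} \<subseteq> N \<inter> U" using cl KU by blast
  ultimately show thesis
    using that[OF U, of \<psi>] by blast
qed

section \<open>Vector fields are local\<close>

lemma vector_fieldD:
  assumes "vector_field \<A> X"
  shows "smooth_fun \<A> f \<Longrightarrow> smooth_fun \<A> (X f)"
    "smooth_fun \<A> f \<Longrightarrow> smooth_fun \<A> g \<Longrightarrow> X (\<lambda>x. a * f x + b * g x) x = a * X f x + b * X g x"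
    "smooth_fun \<A> f \<Longrightarrow> smooth_fun \<A> g \<Longrightarrow> X (\<lambda>x. f x * g x) x = f x * X g x + g x * X f x"
    "\<not> smooth_fun \<A> f \<Longrightarrow> X f = 0"
  using assms unfolding vector_field_def by simp_all

text \<open>The Leibniz rule for \<open>1 \<cdot> 1\<close> gives \<open>X 1 = 2 X 1\<close>.\<close>

lemma vector_field_const:
  assumes X: "vector_field \<A> X" and \<A>: "smooth_atlas \<A>"
  shows "X (\<lambda>x. c) x = 0"
proof -
  have "X (\<lambda>x. 1 * 1) x = 1 * X (\<lambda>x. 1) x + 1 * X (\<lambda>x. 1) x"
    by (rule vector_fieldD(3)[OF X]) (simp_all add: smooth_fun_const[OF \<A>])
  then have 1: "X (\<lambda>x. 1) x = 0" by simp
  have "X (\<lambda>x. c * 1 + 0 * 1) x = c * X (\<lambda>x. 1) x + 0 * X (\<lambda>x. 1) x"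
    by (rule vector_fieldD(2)[OF X]) (simp_all add: smooth_fun_const[OF \<A>])
  then show ?thesis using 1 by simp
qed

text \<open>If \<open>f\<close> vanishes near \<open>x\<close> and \<open>\<psi>\<close> is a bump supported there, then \<open>\<psi> f = 0\<close>, and the
  Leibniz rule leaves \<open>\<psi>(x) (X f)(x) = 0\<close>.\<close>

lemma vector_field_local:
  fixes \<A> :: "('g::t2_space, 'e::euclidean_space) chart set"
  assumes X: "vector_field \<A> X" and \<A>: "smooth_atlas \<A>" and f: "smooth_fun \<A> f"
    and N: "open N" "x \<in> N" "\<And>y. y \<in> N \<Longrightarrow> f y = 0"
  shows "X f x = 0"
proof -
  obtain U \<phi> \<psi> where \<psi>: "smooth_fun \<A> \<psi>" "0 < \<psi> x" "closure {y. \<psi> y \<noteq> 0} \<subseteq> N \<inter> U"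
    using chart_bump[OF \<A> N(1,2)] by metis
  have "\<psi> y * f y = 0" for y
    using N(3)[of y] \<psi>(3) closure_subset[of "{y. \<psi> y \<noteq> 0}"] by (cases "\<psi> y = 0") auto
  then have "(\<lambda>y. \<psi> y * f y) = (\<lambda>y. 0)" by auto
  then have "X (\<lambda>y. \<psi> y * f y) x = 0" using vector_field_const[OF X \<A>] by simp
  moreover have "X (\<lambda>y. \<psi> y * f y) x = \<psi> x * X f x + f x * X \<psi> x"
    by (rule vector_fieldD(3)[OF X \<psi>(1) f])
  ultimately show ?thesis
    using \<psi>(2) N(3)[OF N(2)] by simp
qed

lemma vector_field_support:
  fixes \<A> :: "('g::t2_space, 'e::euclidean_space) chart set"
  assumes X: "vector_field \<A> X" and \<A>: "smooth_atlas \<A>" and f: "smooth_fun \<A> f"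
    and x: "x \<notin> closure {y. f y \<noteq> 0}"
  shows "X f x = 0"
proof (rule vector_field_local[OF X \<A> f])
  show "open (- closure {y. f y \<noteq> 0})" by auto
  show "f y = 0" if "y \<in> - closure {y. f y \<noteq> 0}" for y
    using that closure_subset[of "{y. f y \<noteq> 0}"] by blast
qed (use x in simp)

lemma continuous_compact_support_bounded:
  fixes f :: "'g::t2_space \<Rightarrow> real"
  assumes "continuous_on UNIV f" "compact K" "\<And>x. x \<notin> K \<Longrightarrow> f x = 0"
  obtains M where "M > 0" "\<And>x. \<bar>f x\<bar> \<le> M"
proof -
  have "compact (f ` K)" using assms by (auto intro: compact_continuous_image continuous_on_subset)
  then obtain M where M: "M > 0" "\<And>x. x \<in> K \<Longrightarrow> \<bar>f x\<bar> \<le> M"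
    using compact_imp_bounded bounded_pos by (metis imageI real_norm_def)
  then have "\<bar>f x\<bar> \<le> M" for x using assms(3)[of x] by (cases "x \<in> K") auto
  then show thesis using that M by blast
qed

section \<open>Test functions\<close>

lemma test_functionsI:
  "smooth_fun (gatlas G) \<psi> \<Longrightarrow> compact (closure {y. \<psi> y \<noteq> 0}) \<Longrightarrow> closure {y. \<psi> y \<noteq> 0} \<subseteq> \<Omega>
    \<Longrightarrow> \<psi> \<in> test_functions G \<Omega>"
  by (simp add: test_functions_def compactly_supported_def)

lemma test_functionsD:
  assumes "\<psi> \<in> test_functions G \<Omega>"
  shows "smooth_fun (gatlas G) \<psi>" "compact (closure {y. \<psi> y \<noteq> 0})" "closure {y. \<psi> y \<noteq> 0} \<subseteq> \<Omega>"
    "x \<notin> \<Omega> \<Longrightarrow> \<psi> x = 0"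
  using assms closure_subset[of "{y. \<psi> y \<noteq> 0}"]
  by (auto simp: test_functions_def compactly_supported_def)

text \<open>A countable family of bumps whose positivity sets cover \<open>W\<close> gives \<open>S\<^sub>n = \<Sum>\<^sub>i\<^sub>\<le>\<^sub>n \<psi>\<^sub>i\<close>, and
  \<open>1 - exp(-n S\<^sub>n)\<close> increases to the indicator of \<open>W\<close>.\<close>

lemma test_functions_exhaust_open:
  fixes G :: "('g::{t2_space, second_countable_topology}, 'e::euclidean_space, 'n) carnot"
  assumes \<A>: "smooth_atlas (gatlas G)" and W: "open W"
  obtains S where "\<And>n::nat. S n \<in> test_functions G W" "\<And>n x. 0 \<le> S n x \<and> S n x \<le> 1"
    "\<And>x. x \<in> W \<Longrightarrow> (\<lambda>n. S n x) \<longlonglongrightarrow> 1"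
proof -
  let ?good = "\<lambda>\<psi>. \<psi> \<in> test_functions G W \<and> (\<forall>y. 0 \<le> \<psi> y)"
  let ?F = "{{y. \<psi> y > 0} |\<psi>. ?good \<psi>}"
  have opn: "open {y. \<psi> y > 0}" if "?good \<psi>" for \<psi>
    using smooth_fun_imp_continuous[OF \<A> test_functionsD(1)[of \<psi> G W]] that
    by (intro open_Collect_less) auto
  have "\<Union>?F = W"
  proof (intro equalityI subsetI)
    fix x assume "x \<in> \<Union>?F"
    then obtain \<psi> where "?good \<psi>" "0 < \<psi> x" by auto
    then show "x \<in> W" using test_functionsD(4)[of \<psi> G W x] by force
  next
    fix x assume "x \<in> W"
    obtain U \<phi> \<psi> where "(U, \<phi>) \<in> gatlas G" "x \<in> U" "smooth_fun (gatlas G) \<psi>" "\<And>y. 0 \<le> \<psi> y"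
      "0 < \<psi> x" "compact (closure {y. \<psi> y \<noteq> 0})" "closure {y. \<psi> y \<noteq> 0} \<subseteq> W \<inter> U"
      "\<And>i. smooth_fun (gatlas G) (\<lambda>y. if y \<in> U then (\<phi> y \<bullet> i) * \<psi> y else 0)"
      by (rule chart_bump[OF \<A> W \<open>x \<in> W\<close>]) (rule that)
    then have "?good \<psi>" "0 < \<psi> x" by (auto intro: test_functionsI)
    then show "x \<in> \<Union>?F" by auto
  qed
  moreover have opn': "\<And>S. S \<in> ?F \<Longrightarrow> open S" using opn by auto
  obtain F' where "F' \<subseteq> ?F" "countable F'" "\<Union>F' = \<Union>?F"
    by (rule Lindelof[of ?F]) (erule opn', rule that)
  ultimately have F': "F' \<subseteq> ?F" "countable F'" "\<Union>F' = W" by simp_all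
  define F'' where "F'' = insert {} F'"
  have zero: "?good (\<lambda>_. 0)" by (auto intro!: test_functionsI smooth_fun_const \<A>)
  have "\<exists>\<psi>. ?good \<psi> \<and> N = {y. \<psi> y > 0}" if "N \<in> F''" for N
  proof (cases "N = {}")
    case True
    then show ?thesis using zero by (intro exI[of _ "\<lambda>_. 0"]) simp
  next
    case False
    then have "N \<in> ?F" using that F'(1) by (auto simp: F''_def)
    then show ?thesis by auto
  qed
  then have F'': "F'' \<noteq> {}" "countable F''" "\<Union>F'' = W" "\<forall>N\<in>F''. \<exists>\<psi>. ?good \<psi> \<and> N = {y. \<psi> y > 0}"
    using F' by (auto simp: F''_def)
  define b where "b = (\<lambda>n. SOME \<psi>. ?good \<psi> \<and> from_nat_into F'' n = {y. \<psi> y > 0})"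
  have b: "?good (b n)" "from_nat_into F'' n = {y. b n y > 0}" for n
    using someI_ex[OF F''(4)[rule_format, OF from_nat_into[OF F''(1), of n]]] unfolding b_def by auto
  define S where "S = (\<lambda>n x. 1 - exp (- (real n * (\<Sum>i\<le>n. b i x))))"
  have pos: "0 \<le> real n * (\<Sum>i\<le>n. b i x)" for n x
    using b(1) by (intro mult_nonneg_nonneg sum_nonneg) auto
  show thesis
  proof
    fix n :: nat
    have sm: "smooth_fun (gatlas G) (S n)"
    proof -
      have "smooth_fun (gatlas G) (\<lambda>x. (- real n) * (\<Sum>i\<le>n. b i x))"
        using b(1) by (intro smooth_fun_mult smooth_fun_const smooth_fun_sum \<A>)
          (auto dest: test_functionsD)
      then have "smooth_fun (gatlas G) (\<lambda>x. 1 + (-1) * exp ((- real n) * (\<Sum>i\<le>n. b i x)))"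
        using Ck_on_exp by (intro smooth_fun_mult smooth_fun_const smooth_fun_add \<A>)
          (auto simp: smooth_fun_def intro: Ck_fun_compose[OF \<A>])
      then show ?thesis by (simp add: S_def)
    qed
    define K where "K = (\<Union>i\<le>n. closure {y. b i y \<noteq> 0})"
    have "compact (closure {y. b i y \<noteq> 0})" "closure {y. b i y \<noteq> 0} \<subseteq> W" for i
      using b(1)[of i] by (auto dest: test_functionsD)
    then have K: "compact K" "K \<subseteq> W"
      unfolding K_def by (auto intro!: compact_UN)
    have "S n y = 0" if "y \<notin> K" for y
    proof -
      have "b i y = 0" if "i \<le> n" for i
        using \<open>y \<notin> K\<close> that closure_subset[of "{y. b i y \<noteq> 0}"] by (auto simp: K_def)
      then show ?thesis by (simp add: S_def)
    qed
    then have "{y. S n y \<noteq> 0} \<subseteq> K" by blast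
    then have cl: "closure {y. S n y \<noteq> 0} \<subseteq> K"
      by (meson K(1) closure_minimal compact_imp_closed)
    moreover have "compact (closure {y. S n y \<noteq> 0})"
      using compact_Int_closed[OF K(1) closed_closure, of "{y. S n y \<noteq> 0}"] cl
      by (simp add: Int_absorb1)
    ultimately show "S n \<in> test_functions G W"
      using K(2) sm by (intro test_functionsI) auto
    show "0 \<le> S n x \<and> S n x \<le> 1" for x using pos[of n x] by (simp add: S_def)
  next
    fix x assume "x \<in> W"
    then obtain k where k: "b k x > 0"
      using F'' b(2) range_from_nat_into[OF F''(1,2)] by (metis UnionE imageE mem_Collect_eq)
    have "filterlim (\<lambda>n. b k x * real n) at_top sequentially"
      by (rule filterlim_tendsto_pos_mult_at_top[OF tendsto_const k filterlim_real_sequentially])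
    moreover have "\<forall>\<^sub>F n in sequentially. b k x * real n \<le> real n * (\<Sum>i\<le>n. b i x)"
    proof (rule eventually_sequentiallyI[of k])
      fix n assume "k \<le> n"
      then have "b k x \<le> (\<Sum>i\<le>n. b i x)" using b(1) by (intro member_le_sum) auto
      then show "b k x * real n \<le> real n * (\<Sum>i\<le>n. b i x)"
        by (simp add: mult.commute mult_left_mono)
    qed
    ultimately have "filterlim (\<lambda>n. real n * (\<Sum>i\<le>n. b i x)) at_top sequentially"
      by (rule filterlim_at_top_mono)
    then have "filterlim (\<lambda>n. - (real n * (\<Sum>i\<le>n. b i x))) at_bot sequentially"
      by (simp add: filterlim_uminus_at_bot)
    then have "(\<lambda>n. exp (- (real n * (\<Sum>i\<le>n. b i x)))) \<longlonglongrightarrow> 0"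
      by (rule filterlim_compose[OF exp_at_bot])
    then show "(\<lambda>n. S n x) \<longlonglongrightarrow> 1"
      unfolding S_def using tendsto_diff[OF tendsto_const[of 1]] by fastforce
  qed
qed

section \<open>Left translations\<close>

lemma ball_pairs3D:
  "\<forall>(a, b)\<in>A. \<forall>(c, d)\<in>A. \<forall>(e, f)\<in>A. P a b c d e f \<Longrightarrow> (a, b) \<in> A \<Longrightarrow> (c, d) \<in> A \<Longrightarrow> (e, f) \<in> A
    \<Longrightarrow> P a b c d e f"
  by fast

lemma lie_groupD:
  assumes "lie_group \<A> mul one iv"
  shows "smooth_atlas \<A>" "group mul one iv"
    "continuous_on UNIV (\<lambda>(x, y). mul x y)" "continuous_on UNIV iv"
  using assms unfolding lie_group_def by simp_all

lemma lie_group_smooth_mul: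
  assumes "lie_group \<A> mul one iv" "(U, \<phi>) \<in> \<A>" "(V, \<psi>) \<in> \<A>" "(W, \<theta>) \<in> \<A>"
  shows "smooth_on {(\<phi> x, \<psi> y) |x y. x \<in> U \<and> y \<in> V \<and> mul x y \<in> W}
          (\<lambda>(a, b). \<theta> (mul (inv_into U \<phi> a) (inv_into V \<psi> b)))"
proof (rule ball_pairs3D[OF _ assms(2-4)])
  show "\<forall>(U, \<phi>)\<in>\<A>. \<forall>(V, \<psi>)\<in>\<A>. \<forall>(W, \<theta>)\<in>\<A>.
        smooth_on {(\<phi> x, \<psi> y) |x y. x \<in> U \<and> y \<in> V \<and> mul x y \<in> W}
          (\<lambda>(a, b). \<theta> (mul (inv_into U \<phi> a) (inv_into V \<psi> b)))"
    using assms(1) unfolding lie_group_def by (elim conjE)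
qed

lemma lie_group_mul_continuous:
  assumes "lie_group \<A> mul one iv" "continuous_on S f" "continuous_on S g"
  shows "continuous_on S (\<lambda>x. mul (f x) (g x))"
proof -
  have "continuous_on S (\<lambda>x. (\<lambda>(x, y). mul x y) (f x, g x))"
    by (rule continuous_on_compose2[OF lie_groupD(3)[OF assms(1)]])
      (use assms(2,3) in \<open>auto intro: continuous_on_Pair\<close>)
  then show ?thesis by simp
qed

text \<open>In charts a left translation is the product map with its first argument frozen.\<close>

lemma smooth_fun_left_translate:
  fixes \<A> :: "('g::{t2_space, second_countable_topology}, 'e::euclidean_space) chart set"
  assumes L: "lie_group \<A> mul one iv" and h: "smooth_fun \<A> h"
  shows "smooth_fun \<A> (\<lambda>x. h (mul g x))"
  unfolding smooth_fun_def Ck_fun_def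
proof clarify
  fix k V \<psi> assume V: "(V, \<psi>) \<in> \<A>"
  note \<A> = lie_groupD(1)[OF L]
  let ?f = "(\<lambda>x. h (mul g x)) \<circ> inv_into V \<psi>"
  show "Ck_on k (\<psi> ` V) ?f"
  proof (rule Ck_on_local)
    fix b assume "b \<in> \<psi> ` V"
    then obtain y where y: "y \<in> V" "b = \<psi> y" by auto
    obtain U \<phi> where U: "(U, \<phi>) \<in> \<A>" "g \<in> U" using smooth_atlas_chart_at[OF \<A>] .
    obtain W \<theta> where W: "(W, \<theta>) \<in> \<A>" "mul g y \<in> W" using smooth_atlas_chart_at[OF \<A>] .
    let ?N = "{z \<in> V. mul g z \<in> W}" let ?T = "\<psi> ` ?N"
    let ?S = "{(\<phi> x, \<psi> y) |x y. x \<in> U \<and> y \<in> V \<and> mul x y \<in> W}"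
    let ?m = "\<lambda>(a, b). \<theta> (mul (inv_into U \<phi> a) (inv_into V \<psi> b))"
    have "open ((\<lambda>z. mul g z) -` W)"
      using smooth_atlasD(1)[OF \<A> W(1)] lie_group_mul_continuous[OF L, of UNIV "\<lambda>_. g" "\<lambda>z. z"]
      by (intro open_vimage) (auto intro: continuous_on_const continuous_on_id)
    then have "open ?N"
      using smooth_atlasD(1)[OF \<A> V] by (simp add: Collect_conj_eq vimage_def open_Int)
    then have T: "open ?T" by (intro chart_open_image[OF \<A> V]) auto
    have "Ck_on k ?T (\<lambda>a. (\<phi> g, 0) + (0, a))"
      by (intro Ck_on_add Ck_on_const Ck_on_linear_comp[of "\<lambda>a. (0, a)"] Ck_on_ident T
          bounded_linear_Pair bounded_linear_zero bounded_linear_ident)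
    then have 1: "Ck_on k ?T (\<lambda>a. (\<phi> g, a))" by simp
    have "Ck_on k ?T (\<lambda>a. ?m (\<phi> g, a))"
      by (rule Ck_on_compose[OF T _ 1, of ?S])
        (use U lie_group_smooth_mul[OF L U(1) V W(1)] in \<open>auto simp: smooth_on_def\<close>)
    then have 2: "Ck_on k ?T (\<lambda>a. \<theta> (mul g (inv_into V \<psi> a)))"
      by (simp add: chart_inv[OF \<A> U])
    have 3: "Ck_on k (\<theta> ` W) (h \<circ> inv_into W \<theta>)"
      using h W(1) unfolding smooth_fun_def Ck_fun_def by blast
    have "Ck_on k ?T (\<lambda>a. (h \<circ> inv_into W \<theta>) (\<theta> (mul g (inv_into V \<psi> a))))"
      by (rule Ck_on_compose[OF T _ 2 3]) (auto simp: chart_inv[OF \<A> V])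
    then have "Ck_on k ?T ?f"
      by (rule Ck_on_cong[OF T, rotated -1]) (auto simp: chart_inv[OF \<A> V] chart_inv[OF \<A> W(1)])
    then show "\<exists>T. open T \<and> b \<in> T \<and> Ck_on k T ?f" using T y W(2) by blast
  qed
qed

section \<open>Differentiability of curves is tested by finitely many smooth functions\<close>

text \<open>The test functions are a chart bump \<open>\<psi>\<close> and its products with the coordinates; where
  \<open>\<psi> > 0\<close> the coordinates are quotients of these.\<close>

lemma curve_differentiable_test:
  fixes \<A> :: "('g::t2_space, 'e::euclidean_space) chart set"
  assumes \<A>: "smooth_atlas \<A>"
  obtains N F where "open N" "x \<in> N" "finite F" "\<And>f. f \<in> F \<Longrightarrow> smooth_fun \<A> f"
    "\<And>\<gamma> t S h. continuous (at t within S) \<gamma> \<Longrightarrow> t \<in> S \<Longrightarrow> \<gamma> t \<in> N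
      \<Longrightarrow> \<forall>f\<in>F. (f \<circ> \<gamma>) differentiable (at (t::real) within S)
      \<Longrightarrow> smooth_fun \<A> h \<Longrightarrow> (h \<circ> \<gamma>) differentiable (at t within S)"
proof -
  obtain U \<phi> \<psi> where U: "(U, \<phi>) \<in> \<A>" "x \<in> U"
    and \<psi>: "smooth_fun \<A> \<psi>" "\<And>y. 0 \<le> \<psi> y" "0 < \<psi> x"
      "compact (closure {y. \<psi> y \<noteq> 0})" "closure {y. \<psi> y \<noteq> 0} \<subseteq> UNIV \<inter> U"
    and co: "\<And>i. smooth_fun \<A> (\<lambda>y. if y \<in> U then (\<phi> y \<bullet> i) * \<psi> y else 0)"
    by (rule chart_bump[OF \<A> open_UNIV UNIV_I]) (rule that)
  define y where "y = (\<lambda>i z. if z \<in> U then (\<phi> z \<bullet> i) * \<psi> z else 0)"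
  define N where "N = {z. \<psi> z > 0}"
  define F where "F = insert \<psi> (y ` Basis)"
  have N: "open N" unfolding N_def
    using smooth_fun_imp_continuous[OF \<A> \<psi>(1)] by (intro open_Collect_less) auto
  have NU: "N \<subseteq> U" using \<psi>(5) closure_subset[of "{y. \<psi> y \<noteq> 0}"] by (force simp: N_def)
  show thesis
  proof (rule that[OF N, of F])
    show "x \<in> N" using \<psi>(3) by (simp add: N_def)
    show "finite F" by (simp add: F_def)
    show "smooth_fun \<A> f" if "f \<in> F" for f using that \<psi>(1) co by (auto simp: F_def y_def)
    fix \<gamma> :: "real \<Rightarrow> 'g" and t S h
    assume cont: "continuous (at t within S) \<gamma>" and t: "t \<in> S" and tN: "\<gamma> t \<in> N"
      and d: "\<forall>f\<in>F. (f \<circ> \<gamma>) differentiable (at t within S)" and h: "smooth_fun \<A> h"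
    have ev: "\<forall>\<^sub>F s in at t within S. \<gamma> s \<in> N"
      using cont N tN unfolding continuous_within by (rule topological_tendstoD)
    let ?q = "\<lambda>s. \<Sum>i\<in>Basis. ((y i \<circ> \<gamma>) s / (\<psi> \<circ> \<gamma>) s) *\<^sub>R i"
    have q: "?q differentiable (at t within S)"
    proof (intro differentiable_sum[OF finite_Basis] ballI)
      have nz: "(\<psi> \<circ> \<gamma>) t \<noteq> 0" using tN by (simp add: N_def)
      fix i :: 'e assume "i \<in> Basis"
      then have "(\<lambda>s. (y i \<circ> \<gamma>) s / (\<psi> \<circ> \<gamma>) s) differentiable (at t within S)"
        using d nz by (intro differentiable_divide) (auto simp: F_def simp del: o_apply)
      then show "(\<lambda>s. ((y i \<circ> \<gamma>) s / (\<psi> \<circ> \<gamma>) s) *\<^sub>R i) differentiable (at t within S)"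
        unfolding differentiable_def using has_derivative_scaleR_left by blast
    qed
    have qeq: "?q s = \<phi> (\<gamma> s)" if "\<gamma> s \<in> N" for s
    proof -
      have "?q s = (\<Sum>i\<in>Basis. (\<phi> (\<gamma> s) \<bullet> i) *\<^sub>R i)"
        using that NU by (intro sum.cong) (auto simp: y_def N_def)
      then show ?thesis by (simp add: euclidean_representation)
    qed
    have "Ck_on 1 (\<phi> ` U) (h \<circ> inv_into U \<phi>)"
      using h U(1) by (auto simp: smooth_fun_def Ck_fun_def simp del: One_nat_def)
    then have "(h \<circ> inv_into U \<phi>) differentiable (at (?q t))"
      using qeq[OF tN] tN NU by auto
    then have "(h \<circ> inv_into U \<phi>) differentiable (at (?q t) within ?q ` S)"
      by (rule differentiable_at_withinI)
    then have "((h \<circ> inv_into U \<phi>) \<circ> ?q) differentiable (at t within S)"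
      by (intro differentiable_chain_within q)
    then obtain D where "(((h \<circ> inv_into U \<phi>) \<circ> ?q) has_derivative D) (at t within S)"
      unfolding differentiable_def by auto
    then have "((h \<circ> \<gamma>) has_derivative D) (at t within S)"
    proof (rule has_derivative_transform_eventually)
      have *: "((h \<circ> inv_into U \<phi>) \<circ> ?q) s = (h \<circ> \<gamma>) s" if "\<gamma> s \<in> N" for s
        using qeq[OF that] chart_inv[OF \<A> U(1), of "\<gamma> s"] that NU by auto
      show "\<forall>\<^sub>F s in at t within S. ((h \<circ> inv_into U \<phi>) \<circ> ?q) s = (h \<circ> \<gamma>) s"
        using ev by (rule eventually_mono) (rule *)
      show "((h \<circ> inv_into U \<phi>) \<circ> ?q) t = (h \<circ> \<gamma>) t" using *[OF tN] .
    qed (rule t)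
    then show "(h \<circ> \<gamma>) differentiable (at t within S)" unfolding differentiable_def by auto
  qed
qed

section \<open>Two facts of real analysis on an interval\<close>

text \<open>Let \<open>W\<close> be an open set of small measure that contains the exceptional set \<open>E\<close>. Bisection shows
  that \<open>f b - f a\<close> is bounded by \<open>L (b - a)\<close>, a small error, and the increments of \<open>f\<close> over finitely many
  disjoint intervals whose total length is at most the measure of \<open>W\<close>: near a point of \<open>E\<close> a short
  interval lies in \<open>W\<close>, near any other point the derivative bound applies, and such estimates on adjacent
  intervals add up. Absolute continuity makes the increments over \<open>W\<close> small.\<close>

lemma abs_cont_bounded_derivative_imp_bound:
  fixes f :: "real \<Rightarrow> real"
  assumes ac: "abs_cont a b f" and ab: "a \<le> b"
    and E: "negligible E"
    and d: "\<And>t. t \<in> {a..b} - E \<Longrightarrow> \<exists>D. (f has_real_derivative D) (at t within {a..b}) \<and> \<bar>D\<bar> \<le> L"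
  shows "\<bar>f b - f a\<bar> \<le> L * (b - a)"
proof (rule field_le_epsilon)
  fix e :: real assume e: "0 < e"
  define e1 where "e1 = e / 2 / (b - a + 1)"
  have e1: "0 < e1" "e1 * (b - a) \<le> e / 2" using e ab by (auto simp: e1_def field_simps)
  have "e / 2 > 0" using e by simp
  then obtain dl where dl: "dl > 0" and ac': "\<forall>I. finite I \<and> (\<forall>(s, t)\<in>I. a \<le> s \<and> s \<le> t \<and> t \<le> b)
      \<and> pairwise (\<lambda>(s, t) (s', t'). t \<le> s' \<or> t' \<le> s) I \<and> (\<Sum>(s, t)\<in>I. t - s) < dl
      \<longrightarrow> (\<Sum>(s, t)\<in>I. \<bar>f t - f s\<bar>) < e / 2"
    using ac[unfolded abs_cont_def, THEN spec, THEN mp, of "e / 2"] by blast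
  obtain W where W: "open W" "E \<subseteq> W" "W \<in> lmeasurable" "measure lebesgue W < dl"
  proof -
    obtain W where W: "open W" "E \<subseteq> W" "W - E \<in> lmeasurable" "emeasure lebesgue (W - E) < ennreal dl"
      using sets_lebesgue_outer_open[OF negligible_imp_sets[OF E] dl] by metis
    have "W = (W - E) \<union> E" using W(2) by auto
    then have "W \<in> lmeasurable" "measure lebesgue W = measure lebesgue (W - E)"
      using W(3) E negligible_imp_measurable[OF E] measure_Un3_negligible
      by (metis fmeasurable.Un, metis measure_negligible_finite_Union measure_Un_null_set fmeasurableD negligible_iff_null_sets)
    moreover have "measure lebesgue (W - E) < dl"
      using W(3,4) dl by (simp add: emeasure_eq_measure2 ennreal_less_iff)
    ultimately show thesis using that W by metis
  qed
  define R where "R = (\<lambda>c d I. finite I \<and> (\<forall>(s, t)\<in>I. c \<le> s \<and> s < t \<and> t \<le> d)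
      \<and> pairwise (\<lambda>(s, t) (s', t'). t \<le> s' \<or> t' \<le> s) I
      \<and> (\<Sum>(s, t)\<in>I. t - s) \<le> measure lebesgue (W \<inter> {c..d})
      \<and> \<bar>f d - f c\<bar> \<le> (L + e1) * (d - c) + (\<Sum>(s, t)\<in>I. \<bar>f t - f s\<bar>))"
  define P where "P = (\<lambda>c d. a \<le> c \<longrightarrow> d \<le> b \<longrightarrow> (\<exists>I. R c d I))"
  have "P a b"
  proof (rule Bolzano[OF ab])
    fix u v w assume P: "P u v" "P v w" and uvw: "u \<le> v" "v \<le> w"
    show "P u w"
      unfolding P_def
    proof (intro impI)
      assume "a \<le> u" "w \<le> b"
      then obtain I J where "R u v I" "R v w J"
        using P uvw unfolding P_def by (meson order_trans)
      then have I: "finite I" "\<forall>(s, t)\<in>I. u \<le> s \<and> s < t \<and> t \<le> v"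
          "pairwise (\<lambda>(s, t) (s', t'). t \<le> s' \<or> t' \<le> s) I"
          "(\<Sum>(s, t)\<in>I. t - s) \<le> measure lebesgue (W \<inter> {u..v})"
          "\<bar>f v - f u\<bar> \<le> (L + e1) * (v - u) + (\<Sum>(s, t)\<in>I. \<bar>f t - f s\<bar>)"
        and J: "finite J" "\<forall>(s, t)\<in>J. v \<le> s \<and> s < t \<and> t \<le> w"
          "pairwise (\<lambda>(s, t) (s', t'). t \<le> s' \<or> t' \<le> s) J"
          "(\<Sum>(s, t)\<in>J. t - s) \<le> measure lebesgue (W \<inter> {v..w})"
          "\<bar>f w - f v\<bar> \<le> (L + e1) * (w - v) + (\<Sum>(s, t)\<in>J. \<bar>f t - f s\<bar>)"
        unfolding R_def by blast+
      have dj: "I \<inter> J = {}" using I(2) J(2) by fastforce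
      have sum: "sum g (I \<union> J) = sum g I + sum g J" for g :: "_ \<Rightarrow> real"
        using I(1) J(1) dj by (rule sum.union_disjoint)
      have "measure lebesgue (W \<inter> {u..w}) = measure lebesgue ((W \<inter> {u..v}) \<union> (W \<inter> {v..w}))"
        using uvw by (intro arg_cong[where f = "measure lebesgue"]) auto
      also have "\<dots> = measure lebesgue (W \<inter> {u..v}) + measure lebesgue (W \<inter> {v..w})"
      proof (rule measure_Un_AE)
        have "AE x in lebesgue. x \<noteq> v" by (intro AE_completion AE_lborel_singleton)
        then show "AE x in lebesgue. x \<notin> W \<inter> {u..v} \<or> x \<notin> W \<inter> {v..w}"
          by eventually_elim auto
      qed (use W(3) in \<open>auto intro: fmeasurable_Int_fmeasurable\<close>)
      finally have m: "measure lebesgue (W \<inter> {u..w}) = measure lebesgue (W \<inter> {u..v}) + measure lebesgue (W \<inter> {v..w})" .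
      show "\<exists>K. R u w K"
        unfolding R_def
      proof (intro exI[of _ "I \<union> J"] conjI)
        show "\<forall>(s, t)\<in>I \<union> J. u \<le> s \<and> s < t \<and> t \<le> w" 
        proof clarify
          fix s t assume "(s, t) \<in> I \<union> J"
          then show "u \<le> s \<and> s < t \<and> t \<le> w"
            using bspec[OF I(2), of "(s, t)"] bspec[OF J(2), of "(s, t)"] uvw by auto
        qed
        show "pairwise (\<lambda>(s, t) (s', t'). t \<le> s' \<or> t' \<le> s) (I \<union> J)"
        proof (rule pairwiseI)
          fix p q assume A: "p \<in> I \<union> J" "q \<in> I \<union> J" "p \<noteq> q"
          obtain s t s' t' where pq: "p = (s, t)" "q = (s', t')" by (cases p, cases q) auto
          show "(\<lambda>(s, t) (s', t'). t \<le> s' \<or> t' \<le> s) p q"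
            using A pq pairwiseD[OF I(3), of "(s, t)" "(s', t')"] pairwiseD[OF J(3), of "(s, t)" "(s', t')"]
              bspec[OF I(2), of "(s, t)"] bspec[OF J(2), of "(s, t)"]
              bspec[OF I(2), of "(s', t')"] bspec[OF J(2), of "(s', t')"] by auto
        qed
        show "\<bar>f w - f u\<bar> \<le> (L + e1) * (w - u) + (\<Sum>(s, t)\<in>I \<union> J. \<bar>f t - f s\<bar>)"
          using I(5) J(5) unfolding sum by (simp add: algebra_simps)
      qed (use I J sum m in auto)
    qed
  next
    fix x assume x: "a \<le> x" "x \<le> b"
    show "\<exists>d>0. \<forall>u v. u \<le> x \<and> x \<le> v \<and> v - u < d \<longrightarrow> P u v"
    proof (cases "x \<in> E")
      case True
      then obtain r where r: "r > 0" "ball x r \<subseteq> W" using W openE by blast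
      have "P u v" if uv: "u \<le> x" "x \<le> v" "v - u < r" for u v
      proof -
        have sub: "{u..v} \<subseteq> W" using uv r(2) by (auto simp: subset_iff dist_real_def)
        show ?thesis unfolding P_def R_def
        proof (intro impI exI[of _ "if u < v then {(u, v)} else {}"] conjI)
          \<comment> \<open>an interval of positive length has a point off \<open>E\<close>, and the bound there shows \<open>L \<ge> 0\<close>\<close>
          have "0 \<le> (L + e1) * (v - u)" if "u < v" "a \<le> u" "v \<le> b"
          proof -
            have "\<not> negligible {u..v}" using that by (simp add: negligible_iff_measure)
            then have "\<not> {u..v} \<subseteq> E" using E negligible_subset by blast
            then obtain t where "t \<in> {u..v}" "t \<notin> E" by blast
            then have "t \<in> {a..b} - E" using \<open>a \<le> u\<close> \<open>v \<le> b\<close> by auto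
            then have "0 \<le> L" using d by force
            then show ?thesis using e1 that by simp
          qed
          then show "\<bar>f v - f u\<bar> \<le> (L + e1) * (v - u)
              + (\<Sum>(s, t)\<in>(if u < v then {(u, v)} else {}). \<bar>f t - f s\<bar>)" if "a \<le> u" "v \<le> b"
            using uv that by (cases "u = v") auto
        qed (use sub uv in \<open>auto simp: Int_absorb1 pairwise_def\<close>)
      qed
      then show ?thesis using r(1) by blast
    next
      case False
      then obtain D where D: "(f has_real_derivative D) (at x within {a..b})" "\<bar>D\<bar> \<le> L"
        using d x by auto
      obtain r where r: "r > 0" "\<And>y. y \<in> {a..b} \<Longrightarrow> \<bar>y - x\<bar> < r \<Longrightarrow> \<bar>f y - f x - D * (y - x)\<bar> \<le> e1 * \<bar>y - x\<bar>"
        using D(1) e1(1) unfolding has_field_derivative_def has_derivative_within_alt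
        by (auto simp: real_norm_def)
      have "P u v" if uv: "u \<le> x" "x \<le> v" "v - u < r" for u v
        unfolding P_def R_def
      proof (intro impI exI[of _ "{}"] conjI)
        assume "a \<le> u" "v \<le> b"
        then have "\<bar>f u - f x - D * (u - x)\<bar> \<le> e1 * \<bar>u - x\<bar>" "\<bar>f v - f x - D * (v - x)\<bar> \<le> e1 * \<bar>v - x\<bar>"
          using r(2)[of u] r(2)[of v] uv x by auto
        moreover have "\<bar>D * (v - u)\<bar> \<le> L * (v - u)"
          using D(2) uv by (auto simp: abs_mult intro!: mult_mono)
        moreover have "f v - f u = (f v - f x - D * (v - x)) - (f u - f x - D * (u - x)) + D * (v - u)"
          by (simp add: algebra_simps)
        ultimately show "\<bar>f v - f u\<bar> \<le> (L + e1) * (v - u) + (\<Sum>(s, t)\<in>{}. \<bar>f t - f s\<bar>)"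
          using uv by (simp add: algebra_simps)
      qed auto
      then show ?thesis using r(1) by blast
    qed
  qed
  then obtain I where I: "finite I" "\<forall>(s, t)\<in>I. a \<le> s \<and> s < t \<and> t \<le> b"
      "pairwise (\<lambda>(s, t) (s', t'). t \<le> s' \<or> t' \<le> s) I"
      "(\<Sum>(s, t)\<in>I. t - s) \<le> measure lebesgue (W \<inter> {a..b})"
      "\<bar>f b - f a\<bar> \<le> (L + e1) * (b - a) + (\<Sum>(s, t)\<in>I. \<bar>f t - f s\<bar>)"
    using ab unfolding P_def R_def by blast
  have "measure lebesgue (W \<inter> {a..b}) \<le> measure lebesgue W"
    using W(3) by (intro measure_mono_fmeasurable) auto
  then have "(\<Sum>(s, t)\<in>I. \<bar>f t - f s\<bar>) < e / 2"
    using I W(4) by (intro ac'[rule_format] conjI) fastforce+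
  then show "\<bar>f b - f a\<bar> \<le> L * (b - a) + e"
    using I(5) e1(2) by (simp add: algebra_simps)
qed

lemma ball_imp_radius_pos: "t \<in> ball a r \<Longrightarrow> 0 < r"
  by (meson mem_ball zero_le_dist le_less_trans)

text \<open>A Vitali covering selects disjoint intervals of slope at least \<open>c\<close> that exhaust \<open>E\<close>; on each of them
  the Stieltjes measure of \<open>F\<close> is at least \<open>c\<close> times its length.\<close>

lemma slopes_imp_measure_le:
  fixes F :: "real \<Rightarrow> real"
  assumes mono: "\<And>x y. x \<le> y \<Longrightarrow> F x \<le> F y" and cont: "continuous_on UNIV F"
    and c: "0 \<le> c" and uv: "u \<le> v" and E: "E \<subseteq> {u<..<v}" "E \<in> sets lebesgue"
    and slope: "\<And>t d. t \<in> E \<Longrightarrow> 0 < d \<Longrightarrow> \<exists>a r. t \<in> ball a r \<and> r < d \<and> c * (2 * r) \<le> F (a + r) - F (a - r)"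
  shows "c * measure lebesgue E \<le> F v - F u"
proof -
  define K where "K = {(a, r). 0 < r \<and> u \<le> a - r \<and> a + r \<le> v \<and> c * (2 * r) \<le> F (a + r) - F (a - r)}"
  have *: "\<exists>i. i \<in> K \<and> t \<in> ball (fst i) (snd i) \<and> snd i < d" if t: "t \<in> E" and d: "0 < d" for t d
  proof -
    have uv: "u < t" "t < v" using E(1) t by auto
    then obtain a r where ar: "t \<in> ball a r" "r < min d (min ((t - u) / 2) ((v - t) / 2))"
        "c * (2 * r) \<le> F (a + r) - F (a - r)"
      using slope[OF t, of "min d (min ((t - u) / 2) ((v - t) / 2))"] d by auto
    then have "0 < r" using ball_imp_radius_pos by blast
    moreover have "\<bar>a - t\<bar> < r" using ar(1) by (simp add: dist_real_def)
    ultimately have "(a, r) \<in> K" using ar(2,3) unfolding K_def by auto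
    then show ?thesis using ar by (intro exI[of _ "(a, r)"]) auto
  qed
  obtain C where C: "countable C" "C \<subseteq> K"
      "pairwise (\<lambda>i j. disjnt (ball (fst i) (snd i)) (ball (fst j) (snd j))) C"
      "negligible (E - (\<Union>i\<in>C. ball (fst i) (snd i)))"
    by (rule Vitali_covering_theorem_balls[of E K fst snd]) (erule (1) *, rule that)
  let ?B = "\<lambda>i. ball (fst i) (snd i) :: real set"
  let ?U = "\<Union>i\<in>C. ?B i"
  let ?\<mu> = "interval_measure F"
  have rc: "continuous (at_right a) F" for a
    using cont by (simp add: continuous_on_eq_continuous_at continuous_at_imp_continuous_at_within)
  have disj: "disjoint_family_on ?B C"
    using C(3) by (auto simp: disjoint_family_on_def pairwise_def disjnt_def)
  have sets: "?U \<in> sets borel" using C(1) by (intro sets.countable_UN') auto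
  have pt: "emeasure ?\<mu> {b} = 0" for b
    using emeasure_interval_measure_Icc[of b b F, OF order_refl mono cont] by simp
  have Bc: "ennreal c * emeasure lborel (?B i) \<le> emeasure ?\<mu> (?B i)" if "i \<in> C" for i
  proof -
    obtain a r where i: "i = (a, r)" by (cases i)
    then have r: "0 < r" "c * (2 * r) \<le> F (a + r) - F (a - r)" using that C(2) by (auto simp: K_def)
    have b: "?B i = {a - r<..<a + r}" by (auto simp: i dist_real_def)
    have "ennreal c * emeasure lborel (?B i) = ennreal (c * (2 * r))"
      unfolding b using r c by (simp add: ennreal_mult'[symmetric])
    also have "\<dots> \<le> ennreal (F (a + r) - F (a - r))" using r by (intro ennreal_leI)
    also have "\<dots> = emeasure ?\<mu> {a - r<..a + r}"
      using emeasure_interval_measure_Ioc[of "a - r" "a + r" F, OF _ mono rc] r by simp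
    also have "\<dots> \<le> emeasure ?\<mu> ({a - r<..<a + r} \<union> {a + r})"
      by (rule emeasure_mono) auto
    also have "\<dots> \<le> emeasure ?\<mu> {a - r<..<a + r} + emeasure ?\<mu> {a + r}"
      by (rule emeasure_subadditive) auto
    finally show ?thesis using pt b by simp
  qed
  have "ennreal c * emeasure lborel ?U = ennreal c * (\<integral>\<^sup>+i. emeasure lborel (?B i) \<partial>count_space C)"
    using C(1) disj by (subst emeasure_UN_countable) auto
  also have "\<dots> = (\<integral>\<^sup>+i. ennreal c * emeasure lborel (?B i) \<partial>count_space C)"
    by (rule nn_integral_cmult[symmetric]) simp
  also have "\<dots> \<le> (\<integral>\<^sup>+i. emeasure ?\<mu> (?B i) \<partial>count_space C)"
    by (intro nn_integral_mono Bc) simp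
  also have "\<dots> = emeasure ?\<mu> ?U"
    using C(1) disj by (subst emeasure_UN_countable) auto
  also have "\<dots> \<le> emeasure ?\<mu> {u<..v}"
  proof (rule emeasure_mono)
    show "?U \<subseteq> {u<..v}"
    proof
      fix x assume "x \<in> ?U"
      then obtain a r where "(a, r) \<in> C" "x \<in> ball a r" by auto
      then have "u \<le> a - r" "a + r \<le> v" "\<bar>a - x\<bar> < r" using C(2) by (auto simp: K_def dist_real_def)
      then show "x \<in> {u<..v}" by auto
    qed
  qed simp
  also have "\<dots> = ennreal (F v - F u)"
    using emeasure_interval_measure_Ioc[of u v F, OF uv mono rc] by simp
  finally have main: "ennreal c * emeasure lborel ?U \<le> ennreal (F v - F u)" .
  have "emeasure lebesgue E \<le> emeasure lebesgue (?U \<union> (E - ?U))"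
    using E(2) sets C(4) by (intro emeasure_mono) (auto simp: negligible_imp_sets intro!: sets.Un)
  also have "\<dots> = emeasure lebesgue ?U"
    using C(4) sets by (intro emeasure_Un_null_set) (auto simp: negligible_iff_null_sets)
  finally have "emeasure lebesgue E \<le> emeasure lborel ?U" using sets by simp
  then have "ennreal c * emeasure lebesgue E \<le> ennreal (F v - F u)"
    using main by (meson mult_left_mono order_trans zero_le)
  moreover have "emeasure lebesgue E = ennreal (measure lebesgue E)"
  proof (rule emeasure_eq_ennreal_measure)
    have "emeasure lebesgue E \<le> emeasure lebesgue {u<..<v}" by (rule emeasure_mono) (use E in auto)
    then show "emeasure lebesgue E \<noteq> top" using uv by (auto simp: top_unique)
  qed
  ultimately show ?thesis
    using c mono[OF uv] by (simp add: ennreal_mult'[symmetric])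
qed

text \<open>An open set slightly larger than \<open>E\<close> is, up to a null set, a disjoint union of intervals, and \<open>E\<close> fills
  at most the fraction \<open>\<theta>\<close> of each of them. So \<open>\<bar>E\<bar> \<le> \<theta> (\<bar>E\<bar> + e)\<close> for every \<open>e > 0\<close>.\<close>

lemma negligible_if_uniformly_thin:
  fixes E :: "real set"
  assumes E: "E \<in> lmeasurable" and \<theta>: "0 \<le> \<theta>" "\<theta> < 1"
    and thin: "\<And>u v. u \<le> v \<Longrightarrow> measure lebesgue (E \<inter> {u<..<v}) \<le> \<theta> * (v - u)"
  shows "negligible E"
proof (rule ccontr)
  assume "\<not> negligible E"
  then have m: "0 < measure lebesgue E" (is "0 < ?m")
    using E negligible_iff_measure zero_less_measure_iff by blast
  define e where "e = (1 - \<theta>) * ?m / 2"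
  have e: "0 < e" "\<theta> * (?m + e) < ?m"
  proof -
    show "0 < e" using m \<theta> by (simp add: e_def)
    have "\<theta> * e \<le> 1 * e" using \<theta> \<open>0 < e\<close> by (intro mult_right_mono) auto
    then have "\<theta> * (?m + e) \<le> \<theta> * ?m + e" by (simp add: algebra_simps)
    also have "\<dots> < ?m" using \<open>0 < e\<close> by (simp add: e_def field_simps)
    finally show "\<theta> * (?m + e) < ?m" .
  qed
  obtain T where T: "open T" "E \<subseteq> T" "T - E \<in> lmeasurable" "emeasure lebesgue (T - E) < ennreal e"
    using sets_lebesgue_outer_open[OF fmeasurableD[OF E] e(1)] by metis
  define K where "K = {(a::real, r::real). ball a r \<subseteq> T}"
  have *: "\<exists>i. i \<in> K \<and> t \<in> ball (fst i) (snd i) \<and> snd i < d" if t: "t \<in> T" and d: "0 < d" for t d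
  proof -
    obtain r where r: "r > 0" "ball t r \<subseteq> T" using T(1) t openE by blast
    then have "ball t (min r (d/2)) \<subseteq> T" using subset_ball[of "min r (d/2)" r t] by auto
    then show ?thesis using r d by (intro exI[of _ "(t, min r (d/2))"]) (auto simp: K_def)
  qed
  obtain C where C: "countable C" "C \<subseteq> K"
      "pairwise (\<lambda>i j. disjnt (ball (fst i) (snd i)) (ball (fst j) (snd j))) C"
      "negligible (T - (\<Union>i\<in>C. ball (fst i) (snd i)))"
    by (rule Vitali_covering_theorem_balls[of T K fst snd]) (erule (1) *, rule that)
  let ?B = "\<lambda>i. ball (fst i) (snd i) :: real set"
  let ?U = "\<Union>i\<in>C. ?B i"
  have disj: "disjoint_family_on ?B C"
    using C(3) by (auto simp: disjoint_family_on_def pairwise_def disjnt_def)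
  have disjE: "disjoint_family_on (\<lambda>i. E \<inter> ?B i) C"
    using disj unfolding disjoint_family_on_def by blast
  have sets: "?U \<in> sets borel" using C(1) by (intro sets.countable_UN') auto
  have UT: "?U \<subseteq> T"
  proof (rule UN_least)
    fix i assume "i \<in> C"
    then have "i \<in> K" using C(2) by blast
    then show "?B i \<subseteq> T" by (simp add: K_def case_prod_unfold)
  qed
  have Eb: "emeasure lebesgue (E \<inter> ?B i) \<le> ennreal \<theta> * emeasure lebesgue (?B i)" for i
  proof -
    obtain a r where i: "i = (a, r)" by (cases i)
    show ?thesis
    proof (cases "0 < r")
      case True
      have b: "?B i = {a - r<..<a + r}" by (auto simp: i dist_real_def)
      have "E \<inter> ?B i \<in> lmeasurable" using E by (intro fmeasurable_Int_fmeasurable) auto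
      then have "emeasure lebesgue (E \<inter> ?B i) = ennreal (measure lebesgue (E \<inter> ?B i))"
        by (rule emeasure_eq_measure2)
      also have "\<dots> \<le> ennreal (\<theta> * (2 * r))"
        unfolding b using thin[of "a - r" "a + r"] True by (intro ennreal_leI) simp
      also have "\<dots> = ennreal \<theta> * emeasure lebesgue (?B i)"
        unfolding b using True \<theta> by (simp add: ennreal_mult'[symmetric])
      finally show ?thesis .
    qed (simp add: i ball_empty not_less)
  qed
  have "emeasure lebesgue E \<le> emeasure lebesgue ((E \<inter> ?U) \<union> (T - ?U))"
    using E sets C(4) T(2) by (intro emeasure_mono) (auto simp: negligible_imp_sets fmeasurableD intro!: sets.Un)
  also have "\<dots> = emeasure lebesgue (E \<inter> ?U)"
    using C(4) sets E by (intro emeasure_Un_null_set) (auto simp: negligible_iff_null_sets fmeasurableD)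
  also have "E \<inter> ?U = (\<Union>i\<in>C. E \<inter> ?B i)" by auto
  also have "emeasure lebesgue (\<Union>i\<in>C. E \<inter> ?B i) = (\<integral>\<^sup>+i. emeasure lebesgue (E \<inter> ?B i) \<partial>count_space C)"
    using C(1) disjE E by (intro emeasure_UN_countable) (auto simp: fmeasurableD)
  also have "\<dots> \<le> (\<integral>\<^sup>+i. ennreal \<theta> * emeasure lebesgue (?B i) \<partial>count_space C)"
    by (intro nn_integral_mono Eb)
  also have "\<dots> = ennreal \<theta> * (\<integral>\<^sup>+i. emeasure lebesgue (?B i) \<partial>count_space C)"
    by (rule nn_integral_cmult) simp
  also have "\<dots> = ennreal \<theta> * emeasure lebesgue ?U"
    using C(1) disj by (subst emeasure_UN_countable) auto
  also have "\<dots> \<le> ennreal \<theta> * emeasure lebesgue (E \<union> (T - E))"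
    using UT T(1) E by (intro mult_left_mono emeasure_mono) (auto simp: fmeasurableD)
  also have "\<dots> \<le> ennreal \<theta> * (emeasure lebesgue E + emeasure lebesgue (T - E))"
    using T(1) E by (intro mult_left_mono emeasure_subadditive) (auto simp: fmeasurableD)
  also have "\<dots> \<le> ennreal \<theta> * (ennreal ?m + ennreal e)"
    using T(4) E by (intro mult_left_mono add_mono) (auto simp: emeasure_eq_measure2)
  also have "\<dots> = ennreal (\<theta> * (?m + e))"
    using e(1) \<theta> by (simp add: ennreal_mult'[symmetric] ennreal_plus[symmetric] del: ennreal_plus)
  finally have "?m \<le> \<theta> * (?m + e)"
    using E e(1) \<theta> by (simp add: emeasure_eq_measure2)
  then show False using e(2) by simp
qed

text \<open>Difference quotients are taken over intervals that contain \<open>t\<close> in their interior, not over those with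
  end point \<open>t\<close>: this makes the set a countable intersection of open sets.\<close>

definition oscillation_set :: "(real \<Rightarrow> real) \<Rightarrow> real \<Rightarrow> real \<Rightarrow> real set" where
  "oscillation_set f \<alpha> \<beta> = {t. \<forall>d>0. (\<exists>a r. t \<in> ball a r \<and> r < d \<and> f (a + r) - f (a - r) < \<alpha> * (2 * r))
     \<and> (\<exists>a r. t \<in> ball a r \<and> r < d \<and> \<beta> * (2 * r) < f (a + r) - f (a - r))}"

lemma oscillation_set_borel: "oscillation_set f \<alpha> \<beta> \<in> sets borel"
proof -
  let ?A = "\<lambda>d. (\<Union>(a, r)\<in>{(a, r). r < d \<and> f (a + r) - f (a - r) < \<alpha> * (2 * r)}. ball a r)"
  let ?B = "\<lambda>d. (\<Union>(a, r)\<in>{(a, r). r < d \<and> \<beta> * (2 * r) < f (a + r) - f (a - r)}. ball a r)"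
  have "oscillation_set f \<alpha> \<beta> = (\<Inter>n. ?A (1 / Suc n) \<inter> ?B (1 / Suc n))"
  proof (intro equalityI subsetI)
    fix t assume "t \<in> oscillation_set f \<alpha> \<beta>"
    then have osc: "(\<exists>a r. t \<in> ball a r \<and> r < d \<and> f (a + r) - f (a - r) < \<alpha> * (2 * r))
     \<and> (\<exists>a r. t \<in> ball a r \<and> r < d \<and> \<beta> * (2 * r) < f (a + r) - f (a - r))" if "d > 0" for d
      using that unfolding oscillation_set_def by blast
    have "t \<in> ?A (1 / Suc n) \<and> t \<in> ?B (1 / Suc n)" for n
      using osc[of "1 / Suc n"] by auto
    then show "t \<in> (\<Inter>n. ?A (1 / Suc n) \<inter> ?B (1 / Suc n))" by blast
  next
    fix t assume t: "t \<in> (\<Inter>n. ?A (1 / Suc n) \<inter> ?B (1 / Suc n))"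
    show "t \<in> oscillation_set f \<alpha> \<beta>"
      unfolding oscillation_set_def
    proof (intro CollectI allI impI)
      fix d :: real assume "0 < d"
      then obtain n where n: "1 / Suc n < d" using nat_approx_posE by blast
      then have "t \<in> ?A (1 / Suc n)" "t \<in> ?B (1 / Suc n)" using t by auto
      then show "(\<exists>a r. t \<in> ball a r \<and> r < d \<and> f (a + r) - f (a - r) < \<alpha> * (2 * r))
          \<and> (\<exists>a r. t \<in> ball a r \<and> r < d \<and> \<beta> * (2 * r) < f (a + r) - f (a - r))"
        using n by (auto; meson less_trans)
    qed
  qed
  moreover have "open (?A d)" "open (?B d)" for d by (auto intro!: open_UN)
  ultimately show ?thesis by (simp add: borel_open)
qed

text \<open>Put \<open>m = (\<alpha> + \<beta>)/2\<close> and \<open>g x = f x - m x\<close>, which is Lipschitz with constant \<open>M\<close>. Then \<open>M x + g x\<close> and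
  \<open>M x - g x\<close> are increasing, and at each point of the set both have slopes at least \<open>M + (\<beta> - \<alpha>)/2\<close> over
  arbitrarily short intervals. Adding the two resulting bounds on the measure of the set in \<open>(u, v)\<close>
  cancels \<open>g\<close> and shows that the set is thin.\<close>

lemma negligible_oscillation_set:
  fixes f :: "real \<Rightarrow> real"
  assumes lip: "\<And>x y. \<bar>f x - f y\<bar> \<le> L * \<bar>x - y\<bar>" and \<alpha>\<beta>: "\<alpha> < \<beta>"
  shows "negligible (oscillation_set f \<alpha> \<beta> \<inter> {-N<..<N})"
proof -
  define m where "m = (\<alpha> + \<beta>) / 2"
  define \<gamma> where "\<gamma> = (\<beta> - \<alpha>) / 2"
  define M where "M = L + \<bar>m\<bar>"
  let ?E = "oscillation_set f \<alpha> \<beta> \<inter> {-N<..<N}"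
  have \<gamma>: "0 < \<gamma>" using \<alpha>\<beta> by (simp add: \<gamma>_def)
  have L: "0 \<le> L" using lip[of 1 0] by auto
  then have M: "0 \<le> M" by (simp add: M_def)
  have lipg: "\<bar>(f x - m * x) - (f y - m * y)\<bar> \<le> M * \<bar>x - y\<bar>" for x y
  proof -
    have "\<bar>(f x - m * x) - (f y - m * y)\<bar> = \<bar>(f x - f y) - m * (x - y)\<bar>"
      by (simp add: algebra_simps)
    also have "\<dots> \<le> \<bar>f x - f y\<bar> + \<bar>m * (x - y)\<bar>" by (rule abs_triangle_ineq4)
    finally have "\<bar>(f x - m * x) - (f y - m * y)\<bar> \<le> \<bar>f x - f y\<bar> + \<bar>m * (x - y)\<bar>" .
    then show ?thesis using lip[of x y] unfolding M_def distrib_right abs_mult by linarith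
  qed
  have cf: "continuous_on UNIV f"
  proof -
    have "L-lipschitz_on UNIV f" using lip L by (intro lipschitz_onI) (auto simp: dist_real_def)
    then show ?thesis by (rule lipschitz_on_continuous_on)
  qed
  have Es: "?E \<in> sets lebesgue" using oscillation_set_borel by auto
  show ?thesis
  proof (rule negligible_if_uniformly_thin[of _ "M / (\<gamma> + M)"])
    show "?E \<in> lmeasurable"
    proof (rule bounded_set_imp_lmeasurable[OF _ Es])
      have "?E \<subseteq> {-N..N}" by auto
      then show "bounded ?E" by (rule bounded_subset[OF bounded_closed_interval])
    qed
    show "0 \<le> M / (\<gamma> + M)" "M / (\<gamma> + M) < 1" using M \<gamma> by auto
    fix u v :: real assume uv: "u \<le> v"
    let ?Ei = "?E \<inter> {u<..<v}"
    let ?F1 = "\<lambda>x. (f x - m * x) + M * x" and ?F2 = "\<lambda>x. M * x - (f x - m * x)"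
    have s: "?Ei \<subseteq> {u<..<v}" "?Ei \<in> sets lebesgue" using Es by auto
    have "(\<gamma> + M) * measure lebesgue ?Ei \<le> ?F1 v - ?F1 u"
    proof (rule slopes_imp_measure_le[OF _ _ _ uv s])
      show "?F1 x \<le> ?F1 y" if "x \<le> y" for x y
        using lipg[of x y] that by (simp add: algebra_simps abs_le_iff)
      show "continuous_on UNIV ?F1" using cf by (intro continuous_intros)
      fix t d assume "t \<in> ?Ei" "(0::real) < d"
      then obtain a r where "t \<in> ball a r" "r < d" "\<beta> * (2 * r) < f (a + r) - f (a - r)"
        unfolding oscillation_set_def by blast
      then show "\<exists>a r. t \<in> ball a r \<and> r < d \<and> (\<gamma> + M) * (2 * r) \<le> ?F1 (a + r) - ?F1 (a - r)"
        by (intro exI[of _ a] exI[of _ r]) (auto simp: \<gamma>_def m_def field_simps)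
    qed (use M \<gamma> in auto)
    moreover have "(\<gamma> + M) * measure lebesgue ?Ei \<le> ?F2 v - ?F2 u"
    proof (rule slopes_imp_measure_le[OF _ _ _ uv s])
      show "?F2 x \<le> ?F2 y" if "x \<le> y" for x y
        using lipg[of x y] that by (simp add: algebra_simps abs_le_iff)
      show "continuous_on UNIV ?F2" using cf by (intro continuous_intros)
      fix t d assume "t \<in> ?Ei" "(0::real) < d"
      then obtain a r where "t \<in> ball a r" "r < d" "f (a + r) - f (a - r) < \<alpha> * (2 * r)"
        unfolding oscillation_set_def by blast
      then show "\<exists>a r. t \<in> ball a r \<and> r < d \<and> (\<gamma> + M) * (2 * r) \<le> ?F2 (a + r) - ?F2 (a - r)"
        by (intro exI[of _ a] exI[of _ r]) (auto simp: \<gamma>_def m_def field_simps)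
    qed (use M \<gamma> in auto)
    ultimately have "(\<gamma> + M) * measure lebesgue ?Ei \<le> M * (v - u)"
      by (simp add: algebra_simps)
    then show "measure lebesgue (?E \<inter> {u<..<v}) \<le> M / (\<gamma> + M) * (v - u)"
      using M \<gamma> by (simp add: field_simps)
  qed
qed

text \<open>Suppose the quotients over shrinking intervals around \<open>t\<close> converge to \<open>D\<close>. Then \<open>D\<close> is the derivative at \<open>t\<close>,
  since an interval with end point \<open>t\<close> can be extended beyond \<open>t\<close> by a small fraction of its length, which by
  the Lipschitz condition changes its quotient little. If they do not converge, rational numbers \<open>\<alpha> < \<beta>\<close>
  between their lower and upper limit put \<open>t\<close> into an oscillation set.\<close>

theorem lipschitz_imp_differentiable_AE:
  fixes f :: "real \<Rightarrow> real"
  assumes lip: "\<And>x y. \<bar>f x - f y\<bar> \<le> L * \<bar>x - y\<bar>"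
  shows "negligible {t. \<not> f differentiable (at t)}"
proof -
  let ?O = "\<Union>(N, \<alpha>, \<beta>)\<in>UNIV \<times> {(\<alpha>, \<beta>). \<alpha> \<in> \<rat> \<and> \<beta> \<in> \<rat> \<and> \<alpha> < \<beta>}. oscillation_set f \<alpha> \<beta> \<inter> {- real N<..<real N}"
  have "countable ((UNIV :: nat set) \<times> {(\<alpha>, \<beta>). \<alpha> \<in> \<rat> \<and> \<beta> \<in> (\<rat>::real set) \<and> \<alpha> < \<beta>})"
    by (rule countable_subset[of _ "UNIV \<times> \<rat> \<times> \<rat>"]) (auto intro!: countable_SIGMA simp: countable_rat)
  then have "negligible ?O"
    using negligible_oscillation_set[OF lip] by (intro negligible_countable_Union) (auto)
  moreover have "{t. \<not> f differentiable (at t)} \<subseteq> ?O"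
  proof clarify
    fix t assume nd: "\<not> f differentiable (at t)"
    define S where "S = (\<lambda>d. {(f (a + r) - f (a - r)) / (2 * r) |a r. t \<in> ball a r \<and> r < d})"
    have L: "0 \<le> L" using lip[of 1 0] by auto
    have bd: "\<bar>s\<bar> \<le> L" if s: "s \<in> S d" for s d
    proof -
      obtain a r where ar: "s = (f (a + r) - f (a - r)) / (2 * r)" "t \<in> ball a r" using s by (auto simp: S_def)
      then have "0 < r" using ball_imp_radius_pos by blast
      moreover have "\<bar>f (a + r) - f (a - r)\<bar> \<le> L * (2 * r)"
        using lip[of "a + r" "a - r"] \<open>0 < r\<close> by simp
      ultimately show ?thesis unfolding ar(1) by (simp add: abs_divide pos_divide_le_eq)
    qed
    have ne: "S d \<noteq> {}" if "d > 0" for d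
    proof -
      have "t \<in> ball t (d/2) \<and> d/2 < d" using that by simp
      then show ?thesis unfolding S_def by blast
    qed
    have ba: "bdd_above (S d)" for d using bd by (meson abs_le_D1 bdd_above.I)
    \<comment> \<open>the upper limit of the quotients\<close>
    define D where "D = Inf ((\<lambda>d. Sup (S d)) ` {0<..})"
    have lb: "- L \<le> Sup (S d)" if d: "d > 0" for d
    proof -
      obtain s where s: "s \<in> S d" using ne[OF d] by blast
      have "- L \<le> s" using bd[OF s] by simp
      then show ?thesis using cSup_upper[OF s ba] by simp
    qed
    have bb: "bdd_below ((\<lambda>d. Sup (S d)) ` {0<..})" using lb by (auto intro!: bdd_belowI2)
    have Dle: "D \<le> Sup (S d)" if "d > 0" for d
      unfolding D_def using that bb by (intro cInf_lower) auto
    have up: "\<exists>d>0. \<forall>s\<in>S d. s < D + e" if e: "e > 0" for e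
    proof -
      have "Inf ((\<lambda>d. Sup (S d)) ` {0<..}) < D + e" using e by (simp add: D_def)
      moreover have "(\<lambda>d. Sup (S d)) ` {0<..} \<noteq> {}" by (simp add: image_is_empty)
      ultimately obtain x where "x \<in> (\<lambda>d. Sup (S d)) ` {0<..}" "x < D + e"
        by (meson cInf_lessD)
      then obtain d where "d > 0" "Sup (S d) < D + e" by auto
      then show ?thesis using cSup_upper[OF _ ba] by (meson le_less_trans)
    qed
    have "\<exists>e>0. \<forall>d>0. \<exists>s\<in>S d. s \<le> D - e"
    proof (rule ccontr)
      assume "\<not> ?thesis"
      then have "\<forall>e>0. \<exists>d>0. \<forall>s\<in>S d. D - e < s" by (simp add: not_le)
      then have lo: "\<exists>d>0. \<forall>s\<in>S d. D - e < s" if "e > 0" for e using that by simp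
      have "(f has_derivative (\<lambda>h. D * h)) (at t)"
        unfolding has_derivative_at_alt
      proof (intro conjI allI impI)
        show "bounded_linear ((*) D)" by (rule bounded_linear_mult_right)
        fix e' :: real assume e': "0 < e'"
        define e where "e = min 1 (e' / (2 + L + \<bar>D\<bar>))"
        have e: "0 < e" "e \<le> 1" "e * (2 + L + \<bar>D\<bar>) \<le> e'"
        proof -
          show "0 < e" "e \<le> 1" using e' L by (auto simp: e_def)
          have "e \<le> e' / (2 + L + \<bar>D\<bar>)" by (simp add: e_def)
          then show "e * (2 + L + \<bar>D\<bar>) \<le> e'" using L by (simp add: field_simps)
        qed
        obtain d1 d2 where d: "d1 > 0" "d2 > 0" "\<forall>s\<in>S d1. s < D + e" "\<forall>s\<in>S d2. D - e < s"
          using up[OF e(1)] lo[OF e(1)] by blast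
        have key: "\<bar>f v - f u - D * (v - u)\<bar> \<le> e * (v - u)" if "u < t" "t < v" "v - u < 2 * min d1 d2" for u v
        proof -
          have "(f v - f u) / (v - u) \<in> S (min d1 d2)"
            unfolding S_def using that
            by (intro CollectI exI[of _ "(u + v) / 2"] exI[of _ "(v - u) / 2"]) (auto simp: dist_real_def field_simps abs_if)
          then have "(f v - f u) / (v - u) \<in> S d1" "(f v - f u) / (v - u) \<in> S d2"
            unfolding S_def by auto
          then have "(f v - f u) / (v - u) < D + e" "D - e < (f v - f u) / (v - u)" using d by auto
          then show ?thesis using that by (simp add: field_simps abs_le_iff)
        qed
        show "\<exists>d>0. \<forall>y. norm (y - t) < d \<longrightarrow> norm (f y - f t - D * (y - t)) \<le> e' * norm (y - t)"
        proof (intro exI[of _ "min d1 d2"] conjI allI impI)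
          fix y assume "norm (y - t) < min d1 d2"
          then have y: "\<bar>y - t\<bar> < min d1 d2" by simp
          define h where "h = \<bar>y - t\<bar>"
          have h: "0 \<le> h" "h < min d1 d2" using y by (auto simp: h_def)
          have eh: "e * h \<le> h" using e h by (simp add: mult_left_le_one_le)
          have fin: "e * (h + e * h) + (L + \<bar>D\<bar>) * (e * h) \<le> e' * h"
          proof -
            have "e * (h + e * h) + (L + \<bar>D\<bar>) * (e * h) \<le> e * (h + h) + (L + \<bar>D\<bar>) * (e * h)"
              using eh e by (intro add_right_mono mult_left_mono) auto
            also have "\<dots> = e * (2 + L + \<bar>D\<bar>) * h" by (simp add: algebra_simps)
            also have "\<dots> \<le> e' * h" using e h by (intro mult_right_mono)
            finally show ?thesis .
          qed
          have De: "\<bar>D * (e * h)\<bar> = \<bar>D\<bar> * (e * h)" using e h by (simp add: abs_mult)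
          consider "y = t" | "y > t" | "y < t" by linarith
          then show "norm (f y - f t - D * (y - t)) \<le> e' * norm (y - t)"
          proof cases
            case 2
            have hy: "h = y - t" "h > 0" using 2 by (auto simp: h_def)
            have "0 < e * h" using e hy by simp
            then have k: "\<bar>f y - f (t - e * h) - D * (y - (t - e * h))\<bar> \<le> e * (y - (t - e * h))"
              using 2 \<open>0 < e * h\<close> eh h(2) hy(1) by (intro key) linarith+
            have "\<bar>f (t - e * h) - f t\<bar> \<le> L * (e * h)"
              using lip[of "t - e * h" t] \<open>0 < e * h\<close> by simp
            moreover have "f y - f t - D * (y - t) = (f y - f (t - e * h) - D * (y - (t - e * h)))
                + (f (t - e * h) - f t) + D * (e * h)" by (simp add: algebra_simps)
            ultimately have "\<bar>f y - f t - D * (y - t)\<bar> \<le> e * (y - (t - e * h)) + L * (e * h) + \<bar>D\<bar> * (e * h)"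
              using k De by linarith
            then show ?thesis using fin hy by (simp add: algebra_simps)
          next
            case 3
            have hy: "h = t - y" "h > 0" using 3 by (auto simp: h_def)
            have "0 < e * h" using e hy by simp
            then have k: "\<bar>f (t + e * h) - f y - D * ((t + e * h) - y)\<bar> \<le> e * ((t + e * h) - y)"
              using 3 \<open>0 < e * h\<close> eh h(2) hy(1) by (intro key) linarith+
            have "\<bar>f (t + e * h) - f t\<bar> \<le> L * (e * h)"
              using lip[of "t + e * h" t] \<open>0 < e * h\<close> by simp
            moreover have "f y - f t - D * (y - t) = - (f (t + e * h) - f y - D * ((t + e * h) - y))
                + (f (t + e * h) - f t) - D * (e * h)" by (simp add: algebra_simps)
            ultimately have "\<bar>f y - f t - D * (y - t)\<bar> \<le> e * ((t + e * h) - y) + L * (e * h) + \<bar>D\<bar> * (e * h)"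
              using k De by linarith
            then show ?thesis using fin hy by (simp add: algebra_simps)
          qed simp
        qed (use d in auto)
      qed
      then show False using nd by (auto simp: differentiable_def)
    qed
    then obtain e where e: "e > 0" "\<And>d. d > 0 \<Longrightarrow> \<exists>s\<in>S d. s \<le> D - e" by blast
    obtain \<alpha> \<beta> where \<alpha>: "\<alpha> \<in> \<rat>" "D - e < \<alpha>" "\<alpha> < D - 2 * e / 3"
      and \<beta>: "\<beta> \<in> \<rat>" "D - 2 * e / 3 < \<beta>" "\<beta> < D - e / 3"
      using Rats_dense_in_real[of "D - e" "D - 2 * e / 3"] Rats_dense_in_real[of "D - 2 * e / 3" "D - e / 3"] e(1)
      by auto
    have "t \<in> oscillation_set f \<alpha> \<beta>"
      unfolding oscillation_set_def
    proof (intro CollectI allI impI conjI)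
      fix d :: real assume d: "0 < d"
      obtain s where "s \<in> S d" "s < \<alpha>" using e(2)[OF d] \<alpha> by force
      then obtain a r where ar: "t \<in> ball a r" "r < d" "(f (a + r) - f (a - r)) / (2 * r) < \<alpha>"
        by (auto simp: S_def)
      then have "0 < r" using ball_imp_radius_pos by blast
      then show "\<exists>a r. t \<in> ball a r \<and> r < d \<and> f (a + r) - f (a - r) < \<alpha> * (2 * r)"
        using ar by (intro exI[of _ a] exI[of _ r]) (auto simp: field_simps)
      have "\<beta> < Sup (S d)" using Dle[OF d] \<beta> e(1) by linarith
      then obtain s where "s \<in> S d" "\<beta> < s" using less_cSup_iff[OF ne[OF d] ba] by blast
      then obtain a r where ar: "t \<in> ball a r" "r < d" "\<beta> < (f (a + r) - f (a - r)) / (2 * r)"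
        by (auto simp: S_def)
      then have "0 < r" using ball_imp_radius_pos by blast
      then show "\<exists>a r. t \<in> ball a r \<and> r < d \<and> \<beta> * (2 * r) < f (a + r) - f (a - r)"
        using ar by (intro exI[of _ a] exI[of _ r]) (auto simp: field_simps)
    qed
    moreover obtain N :: nat where "\<bar>t\<bar> < real N" using reals_Archimedean2 by blast
    ultimately show "t \<in> ?O" using \<alpha> \<beta> by (intro UN_I[of "(N, \<alpha>, \<beta>)"]) auto
  qed
  ultimately show ?thesis using negligible_subset by blast
qed

section \<open>Left-invariant horizontal fields and subunit curves\<close>

lemma sum_fun_apply: "(\<Sum>a\<in>A. F a) x = (\<Sum>a\<in>A. F a x)"
  by (induction A rule: infinite_finite_induct) simp_all

locale carnot_structure =
  fixes G :: "('g::{t2_space, second_countable_topology}, 'e::euclidean_space, 'n::finite) carnot"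
  assumes carnot: "carnot_group G"
begin

abbreviation \<A> where "\<A> \<equiv> gatlas G"
abbreviation mul (infixl "\<star>" 70) where "x \<star> y \<equiv> gmult G x y"
abbreviation one ("\<e>") where "\<e> \<equiv> gone G"
abbreviation iv where "iv \<equiv> ginv G"

lemma lie: "lie_group \<A> (gmult G) \<e> iv"
  using carnot by (simp add: carnot_group_def)

lemma atlas: "smooth_atlas \<A>" by (rule lie_groupD(1)[OF lie])

sublocale grp: group "gmult G" "gone G" "ginv G" by (rule lie_groupD(2)[OF lie])

lemma continuous_mul [continuous_intros]:
  "continuous_on S f \<Longrightarrow> continuous_on S g \<Longrightarrow> continuous_on S (\<lambda>x. f x \<star> g x)"
  by (rule lie_group_mul_continuous[OF lie])

lemma continuous_iv [continuous_intros]: "continuous_on S f \<Longrightarrow> continuous_on S (\<lambda>x. iv (f x))"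
  using continuous_on_compose2[OF lie_groupD(4)[OF lie]] by blast

lemma smooth_continuous: "smooth_fun \<A> h \<Longrightarrow> continuous_on UNIV h"
  by (rule smooth_fun_imp_continuous[OF atlas])

lemma smooth_translate: "smooth_fun \<A> h \<Longrightarrow> smooth_fun \<A> (\<lambda>x. h (g \<star> x))"
  by (rule smooth_fun_left_translate[OF lie])

lemma frame_in_lie_algebra: "frame G j \<in> lie_algebra \<A> (gmult G)"
proof -
  have strat: "stratification (lie_algebra \<A> (gmult G)) (layer G) (gstep G)"
    and sp: "span (range (frame G)) = layer G 1"
    using carnot by (auto simp: carnot_group_def)
  have "frame G j \<in> layer G 1" using sp span_base[of "frame G j" "range (frame G)"] by auto
  moreover have "1 \<le> gstep G"
    using strat unfolding stratification_def by (elim conjE)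
  moreover have "span (\<Union>k\<in>{1..gstep G}. layer G k) = lie_algebra \<A> (gmult G)"
    using strat unfolding stratification_def by (elim conjE)
  ultimately show ?thesis
    using span_base[OF UN_I[of 1 "{1..gstep G}" "frame G j" "layer G"]] by simp
qed

lemma frame_vector_field: "vector_field \<A> (frame G j)"
  using frame_in_lie_algebra by (simp add: lie_algebra_def)

lemma frame_left_invariant:
  "smooth_fun \<A> h \<Longrightarrow> frame G j (\<lambda>x. h (g \<star> x)) y = frame G j h (g \<star> y)"
  using frame_in_lie_algebra[of j] by (auto simp: lie_algebra_def dest: fun_cong)

definition grd :: "('g \<Rightarrow> real) \<Rightarrow> 'g \<Rightarrow> real^'n" where
  "grd h x = (\<chi> j. frame G j h x)"

lemma grd_translate: "smooth_fun \<A> h \<Longrightarrow> grd (\<lambda>x. h (g \<star> x)) y = grd h (g \<star> y)"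
  by (simp add: grd_def frame_left_invariant)

lemma continuous_grd: assumes "smooth_fun \<A> h" shows "continuous_on UNIV (grd h)"
  unfolding grd_def
  by (intro continuous_on_vec_lambda smooth_continuous vector_fieldD(1)[OF frame_vector_field assms])

lemma grd_linear:
  assumes "smooth_fun \<A> h" "smooth_fun \<A> k"
  shows "grd (\<lambda>x. a * h x + b * k x) y = a *\<^sub>R grd h y + b *\<^sub>R grd k y"
  by (simp add: grd_def vec_eq_iff vector_fieldD(2)[OF frame_vector_field assms])

lemma grd_sum:
  assumes "finite I" "\<And>i. i \<in> I \<Longrightarrow> smooth_fun \<A> (h i)"
  shows "grd (\<lambda>x. \<Sum>i\<in>I. a i * h i x) y = (\<Sum>i\<in>I. a i *\<^sub>R grd (h i) y)"
  using assms
proof (induction I)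
  case empty
  then show ?case by (simp add: grd_def vec_eq_iff vector_field_const[OF frame_vector_field atlas])
next
  case (insert i I)
  have "smooth_fun \<A> (\<lambda>x. \<Sum>i\<in>I. a i * h i x)"
    using insert by (intro smooth_fun_sum smooth_fun_mult smooth_fun_const atlas) auto
  then have "grd (\<lambda>x. a i * h i x + 1 * (\<Sum>i\<in>I. a i * h i x)) y
      = a i *\<^sub>R grd (h i) y + 1 *\<^sub>R grd (\<lambda>x. \<Sum>i\<in>I. a i * h i x) y"
    using insert by (intro grd_linear) auto
  then show ?case using insert by simp
qed

text \<open>The differentials \<open>(X\<^sub>1h(e), \<dots>, X\<^sub>n\<^sub>1h(e))\<close> fill the whole space: a relation between the \<open>X\<^sub>j\<close>
  at the identity would, by left invariance, be a relation between the fields.\<close>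

lemma dual_functions:
  obtains \<eta> :: "'n \<Rightarrow> 'g \<Rightarrow> real" where "\<And>i. smooth_fun \<A> (\<eta> i)" "\<And>i. grd (\<eta> i) \<e> = axis i 1"
proof -
  let ?S = "{grd h \<e> |h. smooth_fun \<A> h}"
  have sub: "subspace ?S"
  proof (rule subspaceI)
    have "grd (\<lambda>x. 0) \<e> = 0" by (simp add: grd_def vec_eq_iff vector_field_const[OF frame_vector_field atlas])
    then show "0 \<in> ?S" using smooth_fun_const[OF atlas, of 0] by (metis (mono_tags, lifting) mem_Collect_eq)
  next
    fix x y assume "x \<in> ?S" "y \<in> ?S"
    then obtain h k where hk: "smooth_fun \<A> h" "smooth_fun \<A> k" "x = grd h \<e>" "y = grd k \<e>" by auto
    have "x + y = grd (\<lambda>x. 1 * h x + 1 * k x) \<e>" using grd_linear[OF hk(1,2), of 1 1] hk by simp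
    moreover have "smooth_fun \<A> (\<lambda>x. 1 * h x + 1 * k x)"
      using hk by (intro smooth_fun_add smooth_fun_mult smooth_fun_const atlas)
    ultimately show "x + y \<in> ?S" by blast
  next
    fix c x assume "x \<in> ?S"
    then obtain h where h: "smooth_fun \<A> h" "x = grd h \<e>" by auto
    have "c *\<^sub>R x = grd (\<lambda>x. c * h x + 0 * h x) \<e>" using grd_linear[OF h(1) h(1), of c 0] h by simp
    moreover have "smooth_fun \<A> (\<lambda>x. c * h x + 0 * h x)"
      using h by (intro smooth_fun_add smooth_fun_mult smooth_fun_const atlas)
    ultimately show "c *\<^sub>R x \<in> ?S" by blast
  qed
  have "?S = UNIV"
  proof (rule ccontr)
    assume "?S \<noteq> UNIV"
    then have "dim ?S \<noteq> DIM(real^'n)"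
      using dim_eq_full[of ?S] span_eq_iff[THEN iffD2, OF sub] by simp
    then have "dim ?S < DIM(real^'n)"
      using dim_subset_UNIV[of ?S] by linarith
    then obtain c where c: "c \<noteq> 0" "\<And>y. y \<in> span ?S \<Longrightarrow> orthogonal c y"
      using orthogonal_to_subspace_exists by blast
    have ce: "(\<Sum>j\<in>UNIV. c $ j * frame G j h \<e>) = 0" if "smooth_fun \<A> h" for h
    proof -
      have "grd h \<e> \<in> span ?S" using that by (intro span_base) auto
      then have "c \<bullet> grd h \<e> = 0" using c(2) by (simp add: orthogonal_def)
      then show ?thesis by (simp add: inner_vec_def grd_def)
    qed
    have "(\<Sum>j\<in>UNIV. c $ j *\<^sub>R frame G j) h x = 0" for h x
    proof (cases "smooth_fun \<A> h")
      case True
      have "(\<Sum>j\<in>UNIV. c $ j * frame G j (\<lambda>y. h (x \<star> y)) \<e>) = 0"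
        by (intro ce smooth_translate True)
      then show ?thesis
        by (simp add: frame_left_invariant[OF True] sum_fun_apply scaleR_fun_def)
    next
      case False
      then show ?thesis
        by (simp add: vector_fieldD(4)[OF frame_vector_field] sum_fun_apply scaleR_fun_def)
    qed
    then have 0: "(\<Sum>j\<in>UNIV. c $ j *\<^sub>R frame G j) = 0" by (simp add: fun_eq_iff)
    have inj: "inj (frame G)" and ind: "independent (range (frame G))"
      using carnot by (auto simp: carnot_group_def)
    have "(\<Sum>v\<in>range (frame G). c $ (inv (frame G) v) *\<^sub>R v) = 0"
      using 0 inj by (simp add: sum.reindex)
    then have "c $ (inv (frame G) (frame G j)) = 0" for j
      using independentD[OF ind, of "range (frame G)" "\<lambda>v. c $ (inv (frame G) v)" "frame G j"] by simp
    then have "c = 0" using inj by (simp add: vec_eq_iff)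
    then show False using c(1) by simp
  qed
  have "\<exists>h. smooth_fun \<A> h \<and> grd h \<e> = axis i 1" for i
  proof -
    have "axis i 1 \<in> ?S" using \<open>?S = UNIV\<close> by (simp only: UNIV_I)
    then show ?thesis by (smt (verit) mem_Collect_eq)
  qed
  then have "\<forall>i. \<exists>h. smooth_fun \<A> h \<and> grd h \<e> = axis i 1" by blast
  from choice[OF this] show thesis using that by blast
qed

text \<open>By Cauchy-Schwarz, \<open>\<bar>(h \<circ> \<gamma>)'\<bar> = \<bar>c \<bullet> Xh(\<gamma>)\<bar> \<le> \<bar>Xh(\<gamma>)\<bar>\<close> almost everywhere.\<close>

lemma subunit_curve_estimate:
  assumes \<gamma>: "subunit_curve G T \<gamma>" and T: "0 \<le> T" and h: "smooth_fun \<A> h"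
    and M: "\<And>t. t \<in> {0..T} \<Longrightarrow> norm (grd h (\<gamma> t)) \<le> M"
  shows "\<bar>h (\<gamma> T) - h (\<gamma> 0)\<bar> \<le> M * T"
proof -
  obtain c :: "real \<Rightarrow> real^'n" where c: "\<And>t. t \<in> {0..T} \<Longrightarrow> (\<Sum>j\<in>UNIV. (c t $ j)\<^sup>2) \<le> 1"
      "AE t in lebesgue_on {0..T}. \<forall>h. smooth_fun \<A> h \<longrightarrow>
         ((h \<circ> \<gamma>) has_real_derivative (\<Sum>j\<in>UNIV. c t $ j * frame G j h (\<gamma> t))) (at t within {0..T})"
    and ac: "abs_cont 0 T (h \<circ> \<gamma>)"
    using \<gamma> h unfolding subunit_curve_def by blast
  have "AE t in lebesgue. t \<in> {0..T} \<longrightarrow>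
         ((h \<circ> \<gamma>) has_real_derivative (\<Sum>j\<in>UNIV. c t $ j * frame G j h (\<gamma> t))) (at t within {0..T})"
    using c(2) h by (subst (asm) AE_restrict_space_iff) (auto elim!: eventually_mono)
  then obtain E where E: "E \<in> null_sets lebesgue" "{t. \<not> (t \<in> {0..T} \<longrightarrow>
      ((h \<circ> \<gamma>) has_real_derivative (\<Sum>j\<in>UNIV. c t $ j * frame G j h (\<gamma> t))) (at t within {0..T}))} \<subseteq> E"
    by (auto simp: eventually_ae_filter)
  have "\<bar>(h \<circ> \<gamma>) T - (h \<circ> \<gamma>) 0\<bar> \<le> M * (T - 0)"
  proof (rule abs_cont_bounded_derivative_imp_bound[OF ac T])
    show "negligible E" using E(1) by (simp add: negligible_iff_null_sets)
    fix t assume t: "t \<in> {0..T} - E"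
    have "(\<Sum>j\<in>UNIV. c t $ j * frame G j h (\<gamma> t)) = c t \<bullet> grd h (\<gamma> t)"
      by (simp add: inner_vec_def grd_def)
    moreover have "\<bar>c t \<bullet> grd h (\<gamma> t)\<bar> \<le> norm (c t) * norm (grd h (\<gamma> t))"
      by (rule Cauchy_Schwarz_ineq2)
    moreover have "norm (c t) \<le> 1" using c(1)[of t] t by (simp add: norm_vec_def L2_set_def)
    then have "norm (c t) * norm (grd h (\<gamma> t)) \<le> 1 * M"
      using M[of t] t by (intro mult_mono) auto
    ultimately show "\<exists>D. ((h \<circ> \<gamma>) has_real_derivative D) (at t within {0..T}) \<and> \<bar>D\<bar> \<le> M"
      using E(2) t by force
  qed
  then show ?thesis by simp
qed

lemma abs_cont_shift:
  assumes "abs_cont a b f" "a \<le> a' + s" "b' + s \<le> b"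
  shows "abs_cont a' b' (\<lambda>t. f (s + t))"
  unfolding abs_cont_def
proof (intro allI impI)
  fix e :: real assume "0 < e"
  then obtain d where d: "d > 0" "\<forall>I. finite I \<and> (\<forall>(s, t)\<in>I. a \<le> s \<and> s \<le> t \<and> t \<le> b) \<and>
     pairwise (\<lambda>(s, t) (s', t'). t \<le> s' \<or> t' \<le> s) I \<and> (\<Sum>(s, t)\<in>I. t - s) < d
       \<longrightarrow> (\<Sum>(s, t)\<in>I. \<bar>f t - f s\<bar>) < e"
    using assms(1) unfolding abs_cont_def by blast
  show "\<exists>d>0. \<forall>I. finite I \<and> (\<forall>(s, t)\<in>I. a' \<le> s \<and> s \<le> t \<and> t \<le> b') \<and>
     pairwise (\<lambda>(s, t) (s', t'). t \<le> s' \<or> t' \<le> s) I \<and> (\<Sum>(s, t)\<in>I. t - s) < d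
       \<longrightarrow> (\<Sum>(u, t)\<in>I. \<bar>f (s + t) - f (s + u)\<bar>) < e"
  proof (intro exI[of _ d] conjI allI impI)
    fix I :: "(real \<times> real) set"
    assume I: "finite I \<and> (\<forall>(s, t)\<in>I. a' \<le> s \<and> s \<le> t \<and> t \<le> b') \<and>
     pairwise (\<lambda>(s, t) (s', t'). t \<le> s' \<or> t' \<le> s) I \<and> (\<Sum>(s, t)\<in>I. t - s) < d"
    let ?sh = "\<lambda>(u, t). (s + u, s + t)"
    have "inj_on ?sh I" by (auto simp: inj_on_def)
    then have reindex: "sum F (?sh ` I) = (\<Sum>p\<in>I. F (?sh p))" for F :: "_ \<Rightarrow> real"
      by (subst sum.reindex) (simp_all add: o_def)
    have "finite (?sh ` I)" "\<forall>(s, t)\<in>?sh ` I. a \<le> s \<and> s \<le> t \<and> t \<le> b"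
      using I assms(2,3) by auto
    moreover have "pairwise (\<lambda>(s, t) (s', t'). t \<le> s' \<or> t' \<le> s) (?sh ` I)"
    proof (rule pairwiseI)
      fix p q assume A: "p \<in> ?sh ` I" "q \<in> ?sh ` I" "p \<noteq> q"
      obtain u t u' t' where pq: "p = ?sh (u, t)" "q = ?sh (u', t')" "(u, t) \<in> I" "(u', t') \<in> I"
        using A by auto
      have "pairwise (\<lambda>(s, t) (s', t'). t \<le> s' \<or> t' \<le> s) I" using I by blast
      from pairwiseD[OF this pq(3,4)]
      show "(\<lambda>(s, t) (s', t'). t \<le> s' \<or> t' \<le> s) p q" using pq A(3) by auto
    qed
    moreover have "(\<Sum>(s, t)\<in>?sh ` I. t - s) < d"
      using I unfolding reindex by (simp add: case_prod_unfold)
    ultimately have "(\<Sum>(s, t)\<in>?sh ` I. \<bar>f t - f s\<bar>) < e" using d(2) by blast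
    then show "(\<Sum>(u, t)\<in>I. \<bar>f (s + t) - f (s + u)\<bar>) < e"
      unfolding reindex by (simp add: case_prod_unfold)
  qed (rule d)
qed

text \<open>Left invariance of the frame makes left translates of subunit curves subunit, with the same controls.\<close>

lemma subunit_curve_piece:
  assumes \<gamma>: "subunit_curve G T \<gamma>" and st: "0 \<le> s" "s \<le> t" "t \<le> T"
  shows "subunit_curve G (t - s) (\<lambda>\<tau>. g \<star> \<gamma> (s + \<tau>))"
proof -
  obtain c :: "real \<Rightarrow> real^'n" where c: "c \<in> borel_measurable (lebesgue_on {0..T})"
      "\<And>t. t \<in> {0..T} \<Longrightarrow> (\<Sum>j\<in>UNIV. (c t $ j)\<^sup>2) \<le> 1"
      "AE t in lebesgue_on {0..T}. \<forall>h. smooth_fun \<A> h \<longrightarrow>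
         ((h \<circ> \<gamma>) has_real_derivative (\<Sum>j\<in>UNIV. c t $ j * frame G j h (\<gamma> t))) (at t within {0..T})"
    and ac: "\<And>h. smooth_fun \<A> h \<Longrightarrow> abs_cont 0 T (h \<circ> \<gamma>)" and cont: "continuous_on {0..T} \<gamma>"
    using \<gamma> unfolding subunit_curve_def by blast
  let ?\<gamma> = "\<lambda>\<tau>. g \<star> \<gamma> (s + \<tau>)"
  have shift: "(\<lambda>\<tau>. s + \<tau>) \<in> lebesgue \<rightarrow>\<^sub>M lebesgue"
    using lebesgue_affine_measurable[of "\<lambda>_. 1" s] by simp
  show ?thesis
    unfolding subunit_curve_def
  proof (intro conjI allI impI exI[of _ "\<lambda>\<tau>. c (s + \<tau>)"] ballI)
    show "continuous_on {0..t - s} ?\<gamma>"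
      by (intro continuous_intros continuous_on_compose2[OF cont]) (use st in auto)
  next
    fix h assume h: "smooth_fun \<A> h"
    have "abs_cont 0 (t - s) (\<lambda>\<tau>. ((\<lambda>x. h (g \<star> x)) \<circ> \<gamma>) (s + \<tau>))"
      by (rule abs_cont_shift[OF ac[OF smooth_translate[OF h]]]) (use st in auto)
    then show "abs_cont 0 (t - s) (h \<circ> ?\<gamma>)" by (simp add: o_def)
  next
    show "(\<lambda>\<tau>. c (s + \<tau>)) \<in> borel_measurable (lebesgue_on {0..t - s})"
    proof (rule measurable_compose[OF _ c(1)])
      have "(\<lambda>\<tau>. s + \<tau>) \<in> lebesgue_on {0..t - s} \<rightarrow>\<^sub>M lebesgue"
        using shift by (rule measurable_restrict_space1)
      then show "(\<lambda>\<tau>. s + \<tau>) \<in> lebesgue_on {0..t - s} \<rightarrow>\<^sub>M lebesgue_on {0..T}"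
        by (rule measurable_restrict_space2[rotated]) (use st in \<open>auto simp: space_restrict_space\<close>)
    qed
  next
    fix \<tau> assume "\<tau> \<in> {0..t - s}"
    then show "(\<Sum>j\<in>UNIV. (c (s + \<tau>) $ j)\<^sup>2) \<le> 1" using st by (intro c) auto
  next
    let ?P = "\<lambda>t. \<forall>h. smooth_fun \<A> h \<longrightarrow>
         ((h \<circ> \<gamma>) has_real_derivative (\<Sum>j\<in>UNIV. c t $ j * frame G j h (\<gamma> t))) (at t within {0..T})"
    have "AE t in lebesgue. t \<in> {0..T} \<longrightarrow> ?P t"
      using c(3) by (subst (asm) AE_restrict_space_iff) auto
    then obtain E where E: "E \<in> null_sets lebesgue" "{t. \<not> (t \<in> {0..T} \<longrightarrow> ?P t)} \<subseteq> E"
      by (auto simp: eventually_ae_filter)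
    have "negligible ((\<lambda>x. - s + x) ` E)"
      using E(1) by (intro negligible_translation) (simp add: negligible_iff_null_sets)
    then have N: "(\<lambda>x. - s + x) ` E \<in> null_sets lebesgue" by (simp add: negligible_iff_null_sets)
    have "AE \<tau> in lebesgue. \<tau> \<in> {0..t - s} \<longrightarrow> s + \<tau> \<in> {0..T} \<and> ?P (s + \<tau>)"
    proof (rule AE_I'[OF N], rule subsetI)
      fix \<tau> assume "\<tau> \<in> {\<tau> \<in> space lebesgue. \<not> (\<tau> \<in> {0..t - s} \<longrightarrow> s + \<tau> \<in> {0..T} \<and> ?P (s + \<tau>))}"
      then have "\<not> ?P (s + \<tau>)" "s + \<tau> \<in> {0..T}" using st by auto
      then have "s + \<tau> \<in> E" using E(2) by blast
      then show "\<tau> \<in> (\<lambda>x. - s + x) ` E" by (intro image_eqI[of _ _ "s + \<tau>"]) auto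
    qed
    moreover have "(h \<circ> ?\<gamma> has_real_derivative (\<Sum>j\<in>UNIV. c (s + \<tau>) $ j * frame G j h (?\<gamma> \<tau>))) (at \<tau> within {0..t - s})"
      if P: "?P (s + \<tau>)" and h: "smooth_fun \<A> h" and \<tau>: "\<tau> \<in> {0..t - s}" for \<tau> h
    proof -
      let ?h = "\<lambda>x. h (g \<star> x)"
      have "((?h \<circ> \<gamma>) has_real_derivative (\<Sum>j\<in>UNIV. c (s + \<tau>) $ j * frame G j ?h (\<gamma> (s + \<tau>)))) (at (s + \<tau>) within {0..T})"
        using P smooth_translate[OF h] by blast
      moreover have "(+) s ` {0..t - s} \<subseteq> {0..T}" using st by auto
      ultimately have "((?h \<circ> \<gamma>) has_real_derivative (\<Sum>j\<in>UNIV. c (s + \<tau>) $ j * frame G j ?h (\<gamma> (s + \<tau>)))) (at (s + \<tau>) within (+) s ` {0..t - s})"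
        by (rule DERIV_subset)
      then have "((\<lambda>x. (?h \<circ> \<gamma>) (s + x)) has_real_derivative (\<Sum>j\<in>UNIV. c (s + \<tau>) $ j * frame G j ?h (\<gamma> (s + \<tau>)))) (at \<tau> within {0..t - s})"
        by (simp only: DERIV_at_within_shift)
      then show ?thesis
        by (simp add: o_def frame_left_invariant[OF h])
    qed
    ultimately show "AE \<tau> in lebesgue_on {0..t - s}. \<forall>h. smooth_fun \<A> h \<longrightarrow>
         ((h \<circ> ?\<gamma>) has_real_derivative (\<Sum>j\<in>UNIV. c (s + \<tau>) $ j * frame G j h (?\<gamma> \<tau>))) (at \<tau> within {0..t - s})"
      by (subst AE_restrict_space_iff) (auto elim!: eventually_mono)
  qed
qed

end

context carnot_structure
begin

section \<open>Reachable sets\<close>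

text \<open>Subunit curves have positive length in the definition of the distance, so the identity is added.\<close>

definition reach :: "real \<Rightarrow> 'g set" where
  "reach t = {y. y = \<e> \<or> (\<exists>T \<gamma>. 0 < T \<and> T \<le> t \<and> subunit_curve G T \<gamma> \<and> \<gamma> 0 = \<e> \<and> \<gamma> T = y)}"

lemma one_in_reach: "\<e> \<in> reach t" by (simp add: reach_def)

lemma reach_mono: "s \<le> t \<Longrightarrow> reach s \<subseteq> reach t"
  unfolding reach_def by (blast intro: order_trans)

lemma iv_mul_cancel [simp]: "iv x \<star> (x \<star> y) = y" "x \<star> (iv x \<star> y) = y"
  by (simp_all add: grp.assoc[symmetric])

lemma reach_increment:
  assumes \<gamma>: "subunit_curve G T \<gamma>" and st: "0 \<le> s" "s \<le> t" "t \<le> T"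
  shows "iv (\<gamma> s) \<star> \<gamma> t \<in> reach (t - s)"
proof (cases "s = t")
  case False
  have "subunit_curve G (t - s) (\<lambda>\<tau>. iv (\<gamma> s) \<star> \<gamma> (s + \<tau>))"
    by (rule subunit_curve_piece[OF \<gamma> st])
  then show ?thesis
    unfolding reach_def using False st by (intro CollectI disjI2 exI[of _ "t - s"] exI) auto
qed (simp add: one_in_reach)

text \<open>The curve is cut at time \<open>s\<close> and its second part is translated back to the identity.\<close>

lemma reach_split:
  assumes "0 \<le> s" "0 \<le> t"
  shows "reach (s + t) \<subseteq> (\<lambda>(a, b). a \<star> b) ` (reach s \<times> reach t)"
proof
  fix y assume "y \<in> reach (s + t)"
  then consider "y = \<e>" | T \<gamma> where "0 < T" "T \<le> s + t" "subunit_curve G T \<gamma>" "\<gamma> 0 = \<e>" "\<gamma> T = y"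
    unfolding reach_def by blast
  then show "y \<in> (\<lambda>(a, b). a \<star> b) ` (reach s \<times> reach t)"
  proof cases
    case 1
    then show ?thesis using one_in_reach by (intro image_eqI[of _ _ "(\<e>, \<e>)"]) auto
  next
    case 2
    let ?u = "min s T"
    have "iv (\<gamma> 0) \<star> \<gamma> ?u \<in> reach (?u - 0)" "iv (\<gamma> ?u) \<star> \<gamma> T \<in> reach (T - ?u)"
      by (rule reach_increment[OF 2(3)]; use 2(1) assms in simp)+
    moreover have "iv (\<gamma> 0) \<star> \<gamma> ?u = \<gamma> ?u" using iv_mul_cancel(1)[of \<e> "\<gamma> ?u"] 2(4) by simp
    ultimately have "\<gamma> ?u \<in> reach s" "iv (\<gamma> ?u) \<star> \<gamma> T \<in> reach t"
      using reach_mono[of "?u" s] reach_mono[of "T - ?u" t] 2(2) assms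
      by (auto simp del: diff_le_eq split: split_min)
    then show ?thesis using 2(5) by (intro image_eqI[of _ _ "(\<gamma> ?u, iv (\<gamma> ?u) \<star> \<gamma> T)"]) auto
  qed
qed

lemma reach_estimate:
  assumes c: "c \<in> reach t" and t: "0 \<le> t" and h: "smooth_fun \<A> h"
    and M: "\<And>c'. c' \<in> reach t \<Longrightarrow> norm (grd h (g \<star> c')) \<le> M"
  shows "\<bar>h (g \<star> c) - h g\<bar> \<le> M * t"
proof -
  have M0: "0 \<le> M" using M[OF one_in_reach] norm_ge_zero order_trans by blast
  consider "c = \<e>" | T \<gamma> where "0 < T" "T \<le> t" "subunit_curve G T \<gamma>" "\<gamma> 0 = \<e>" "\<gamma> T = c"
    using c unfolding reach_def by blast
  then show ?thesis
  proof cases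
    case 2
    let ?h = "\<lambda>x. h (g \<star> x)"
    have "\<bar>?h (\<gamma> T) - ?h (\<gamma> 0)\<bar> \<le> M * T"
    proof (rule subunit_curve_estimate[OF 2(3) _ smooth_translate[OF h]])
      fix u assume u: "u \<in> {0..T}"
      have "iv (\<gamma> 0) \<star> \<gamma> u \<in> reach (u - 0)" using u by (intro reach_increment[OF 2(3)]) auto
      moreover have "iv (\<gamma> 0) \<star> \<gamma> u = \<gamma> u" using iv_mul_cancel(1)[of \<e> "\<gamma> u"] 2(4) by simp
      ultimately have "\<gamma> u \<in> reach t" using reach_mono[of u t] u 2(2) by auto
      then show "norm (grd ?h (\<gamma> u)) \<le> M" using M by (simp add: grd_translate[OF h])
    qed (use 2 in simp)
    also have "\<dots> \<le> M * t" using M0 2 by (intro mult_left_mono)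
    finally show ?thesis using 2 by simp
  qed (use M0 t in simp)
qed

definition creach :: "real \<Rightarrow> 'g set" where "creach t = closure (reach t)"

lemma reach_subset_creach: "reach t \<subseteq> creach t" by (simp add: creach_def closure_subset)

lemma one_in_creach: "\<e> \<in> creach t" using one_in_reach reach_subset_creach by blast

lemma creach_mono: "s \<le> t \<Longrightarrow> creach s \<subseteq> creach t"
  unfolding creach_def by (intro closure_mono reach_mono)

lemma creach_estimate:
  assumes c: "c \<in> creach t" and t: "0 \<le> t" and h: "smooth_fun \<A> h"
    and M: "\<And>c'. c' \<in> creach t \<Longrightarrow> norm (grd h (g \<star> c')) \<le> M"
  shows "\<bar>h (g \<star> c) - h g\<bar> \<le> M * t"
proof -
  let ?S = "{c. \<bar>h (g \<star> c) - h g\<bar> \<le> M * t}"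
  have "closed ?S"
    by (intro closed_Collect_le continuous_intros smooth_continuous smooth_translate h)
  moreover have "reach t \<subseteq> ?S"
    using reach_estimate[OF _ t h] M reach_subset_creach by blast
  ultimately have "creach t \<subseteq> ?S" unfolding creach_def by (rule closure_minimal[rotated])
  then show ?thesis using c by blast
qed

lemma bump_at:
  assumes "open N" "x \<in> N"
  obtains \<psi> where "smooth_fun \<A> \<psi>" "\<psi> x > 0" "\<And>y. 0 \<le> \<psi> y"
    "compact (closure {y. \<psi> y \<noteq> 0})" "closure {y. \<psi> y \<noteq> 0} \<subseteq> N"
  by (rule chart_bump[OF atlas assms]) (use that in blast)

text \<open>A bump \<open>\<psi>\<close> at the identity changes by at most \<open>t max|X\<psi>|\<close> on \<open>reach t\<close>, so it stays
  positive for small \<open>t\<close>.\<close>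

lemma creach_small:
  assumes "open N" "\<e> \<in> N"
  obtains \<tau> where "\<tau> > 0" "creach \<tau> \<subseteq> N" "compact (creach \<tau>)"
proof -
  obtain \<psi> where \<psi>: "smooth_fun \<A> \<psi>" "\<psi> \<e> > 0" "\<And>y. 0 \<le> \<psi> y"
    "compact (closure {y. \<psi> y \<noteq> 0})" "closure {y. \<psi> y \<noteq> 0} \<subseteq> N" (is "_ \<subseteq> _")
    by (rule bump_at[OF assms]) (rule that)
  let ?K = "closure {y. \<psi> y \<noteq> 0}"
  have "\<exists>M>0. \<forall>x. \<bar>norm (grd \<psi> x)\<bar> \<le> M"
  proof (rule continuous_compact_support_bounded[of "\<lambda>x. norm (grd \<psi> x)" ?K])
    show "continuous_on UNIV (\<lambda>x. norm (grd \<psi> x))" by (intro continuous_intros continuous_grd \<psi>(1))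
    show "norm (grd \<psi> x) = 0" if "x \<notin> ?K" for x
      using vector_field_support[OF frame_vector_field atlas \<psi>(1) that] by (simp add: grd_def vec_eq_iff)
  qed (use \<psi>(4) in auto)
  then obtain M where M: "M > 0" "\<And>x. norm (grd \<psi> x) \<le> M" by auto
  define \<tau> where "\<tau> = \<psi> \<e> / (2 * M)"
  have \<tau>: "\<tau> > 0" "M * \<tau> = \<psi> \<e> / 2" using M(1) \<psi>(2) by (auto simp: \<tau>_def)
  have sub: "creach \<tau> \<subseteq> ?K"
  proof
    fix c assume "c \<in> creach \<tau>"
    then have "\<bar>\<psi> (\<e> \<star> c) - \<psi> \<e>\<bar> \<le> M * \<tau>"
      using \<tau> M \<psi> by (intro creach_estimate) auto
    then have "\<bar>\<psi> c - \<psi> \<e>\<bar> \<le> \<psi> \<e> / 2" using \<tau>(2) by simp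
    then have "\<psi> c > 0" using \<psi>(2) unfolding abs_le_iff by linarith
    then show "c \<in> ?K" using closure_subset[of "{y. \<psi> y \<noteq> 0}"] by auto
  qed
  moreover have "compact (creach \<tau>)"
    using compact_Int_closed[OF \<psi>(4), of "creach \<tau>"] sub by (simp add: creach_def Int_absorb1)
  ultimately show thesis using that[of \<tau>] \<tau> \<psi>(5) by blast
qed

lemma compact_mul_image:
  assumes "compact K" "compact L" shows "compact ((\<lambda>(a, b). a \<star> b) ` (K \<times> L))"
  by (intro compact_continuous_image compact_Times assms continuous_on_subset[OF lie_groupD(3)[OF lie]]) auto

text \<open>For short times this is the preceding lemma; long curves are cut into short ones, so their end points lie
  in a finite product of compact sets.\<close>

lemma compact_creach: "compact (creach t)"
proof -
  obtain \<tau> where \<tau>: "\<tau> > 0" "compact (creach \<tau>)" using creach_small[of UNIV] by auto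
  have "\<exists>K. compact K \<and> reach (real n * \<tau>) \<subseteq> K" for n
  proof (induction n)
    case 0
    have "reach 0 \<subseteq> {\<e>}" by (auto simp: reach_def)
    then show ?case by (intro exI[of _ "{\<e>}"]) simp
  next
    case (Suc n)
    then obtain K where K: "compact K" "reach (real n * \<tau>) \<subseteq> K" by blast
    have "reach (real (Suc n) * \<tau>) = reach (real n * \<tau> + \<tau>)" by (simp add: algebra_simps)
    also have "\<dots> \<subseteq> (\<lambda>(a, b). a \<star> b) ` (reach (real n * \<tau>) \<times> reach \<tau>)"
      using \<tau> by (intro reach_split) auto
    also have "\<dots> \<subseteq> (\<lambda>(a, b). a \<star> b) ` (K \<times> creach \<tau>)"
      using K(2) reach_subset_creach by (intro image_mono Sigma_mono) auto
    finally show ?case using compact_mul_image[OF K(1) \<tau>(2)] by blast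
  qed
  moreover obtain n where "t \<le> real n * \<tau>" using \<tau>(1) by (meson reals_Archimedean3 less_imp_le)
  ultimately obtain K where "compact K" "reach t \<subseteq> K" using reach_mono[of t] by (meson order_trans)
  then have "closure (reach t) \<subseteq> K" by (simp add: closure_minimal compact_imp_closed)
  then show ?thesis
    using compact_Int_closed[OF \<open>compact K\<close>, of "creach t"] by (simp add: creach_def Int_absorb1)
qed

section \<open>Limits of subunit curves\<close>

text \<open>Subunit curves have this property, and it survives pointwise limits.\<close>

definition relaxed_curve :: "real \<Rightarrow> (real \<Rightarrow> 'g) \<Rightarrow> bool" where
  "relaxed_curve T \<gamma> \<longleftrightarrow> \<gamma> 0 = \<e> \<and> (\<forall>s t. 0 \<le> s \<longrightarrow> s \<le> t \<longrightarrow> t \<le> T \<longrightarrow> iv (\<gamma> s) \<star> \<gamma> t \<in> creach (t - s))"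

text \<open>The relaxed curves with values in the compact set \<open>creach T\<close> form a closed subset of a
  compact product (Tychonoff), so their end points form a compact set. It contains \<open>reach T\<close> and
  therefore its closure.\<close>

lemma relaxed_curve_to:
  assumes T: "0 \<le> T" and y: "y \<in> creach T"
  obtains \<gamma> where "relaxed_curve T \<gamma>" "\<gamma> T = y"
proof -
  let ?\<Gamma> = "{\<gamma>. (\<forall>t. \<gamma> t \<in> creach T) \<and> relaxed_curve T \<gamma>}"
  have ev: "continuous_on UNIV (\<lambda>\<gamma>::real \<Rightarrow> 'g. \<gamma> t)" for t by simp
  have "compactin (product_topology (\<lambda>_::real. euclidean) UNIV) (PiE UNIV (\<lambda>_. creach T))"
    by (simp add: compactin_PiE compact_creach)
  then have cK: "compact (PiE (UNIV::real set) (\<lambda>_. creach T))"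
    by (simp add: euclidean_product_topology)
  have 1: "closed {\<gamma>::real \<Rightarrow> 'g. \<gamma> 0 = \<e>}"
    using closed_vimage[of "{\<e>}" "\<lambda>\<gamma>::real \<Rightarrow> 'g. \<gamma> 0"] ev by (simp add: vimage_def)
  have 2: "closed {\<gamma>::real \<Rightarrow> 'g. iv (\<gamma> s) \<star> \<gamma> t \<in> creach (t - s)}" for s t
    using closed_vimage[of "creach (t - s)" "\<lambda>\<gamma>::real \<Rightarrow> 'g. iv (\<gamma> s) \<star> \<gamma> t"]
    by (simp add: vimage_def creach_def continuous_mul continuous_iv ev)
  have "{\<gamma>. relaxed_curve T \<gamma>} = {\<gamma>. \<gamma> 0 = \<e>} \<inter>
      (\<Inter>(s, t)\<in>{(s, t). 0 \<le> s \<and> s \<le> t \<and> t \<le> T}. {\<gamma>. iv (\<gamma> s) \<star> \<gamma> t \<in> creach (t - s)})"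
    by (auto simp: relaxed_curve_def)
  also have "closed \<dots>" using 1 2 by (intro closed_Int closed_INT) auto
  finally have "compact (PiE UNIV (\<lambda>_. creach T) \<inter> {\<gamma>. relaxed_curve T \<gamma>})"
    using cK by (rule compact_Int_closed[rotated])
  then have "compact ((\<lambda>\<gamma>. \<gamma> T) ` (PiE UNIV (\<lambda>_. creach T) \<inter> {\<gamma>. relaxed_curve T \<gamma>}))"
    by (rule compact_continuous_image[rotated]) (use ev continuous_on_subset in blast)
  moreover have "PiE UNIV (\<lambda>_. creach T) \<inter> {\<gamma>. relaxed_curve T \<gamma>} = ?\<Gamma>"
    by (simp add: PiE_UNIV_domain Pi_iff Int_def)
  ultimately have cl: "closed ((\<lambda>\<gamma>. \<gamma> T) ` ?\<Gamma>)"
    by (simp add: compact_imp_closed)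
  have "reach T \<subseteq> (\<lambda>\<gamma>. \<gamma> T) ` ?\<Gamma>"
  proof
    fix z assume "z \<in> reach T"
    then consider "z = \<e>" | T' \<gamma> where "0 < T'" "T' \<le> T" "subunit_curve G T' \<gamma>" "\<gamma> 0 = \<e>" "\<gamma> T' = z"
      unfolding reach_def by blast
    then show "z \<in> (\<lambda>\<gamma>. \<gamma> T) ` ?\<Gamma>"
    proof cases
      case 1
      then show ?thesis
        by (intro image_eqI[of _ _ "\<lambda>_. \<e>"]) (auto simp: relaxed_curve_def one_in_creach)
    next
      case 2
      let ?\<gamma> = "\<lambda>t. \<gamma> (max 0 (min t T'))"
      have inc: "iv (?\<gamma> s) \<star> ?\<gamma> t \<in> creach (t - s)" if "0 \<le> s" "s \<le> t" for s t
      proof -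
        have "iv (?\<gamma> s) \<star> ?\<gamma> t \<in> reach (max 0 (min t T') - max 0 (min s T'))"
          using that 2(1) by (intro reach_increment[OF 2(3)]) auto
        moreover have "max 0 (min t T') - max 0 (min s T') \<le> t - s" using that 2(1) by auto
        ultimately show ?thesis using reach_mono reach_subset_creach by blast
      qed
      have "?\<gamma> t \<in> creach T" for t
      proof -
        have "iv (?\<gamma> 0) \<star> ?\<gamma> (max 0 (min t T')) \<in> creach (max 0 (min t T') - 0)" by (rule inc) auto
        moreover have "?\<gamma> (max 0 (min t T')) = ?\<gamma> t" by (simp add: min_def max_def)
        moreover have "?\<gamma> 0 = \<e>" using 2(1,4) by simp
        ultimately have "?\<gamma> t \<in> creach (max 0 (min t T'))"
          using iv_mul_cancel(1)[of \<e> "?\<gamma> t"] by simp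
        moreover have "max 0 (min t T') \<le> T" using 2(2) T by (simp add: min_def max_def)
        ultimately show ?thesis using creach_mono by blast
      qed
      moreover have "relaxed_curve T ?\<gamma>" using inc 2(1,4) by (simp add: relaxed_curve_def)
      ultimately have "?\<gamma> \<in> ?\<Gamma>" by blast
      moreover have "?\<gamma> T = z" using 2 by simp
      ultimately show ?thesis by (intro image_eqI[of z _ ?\<gamma>]) simp_all
    qed
  qed
  then have "closure (reach T) \<subseteq> (\<lambda>\<gamma>. \<gamma> T) ` ?\<Gamma>"
    using cl by (rule closure_minimal)
  moreover have "y \<in> closure (reach T)" using y by (simp add: creach_def)
  ultimately show thesis using that by blast
qed

end

context carnot_structure
begin

text \<open>Along a relaxed curve every smooth \<open>h\<close> is Lipschitz, with \<open>\<bar>(h \<circ> \<gamma>)'\<bar> \<le> \<bar>Xh(\<gamma>)\<bar>\<close>. Hence the derivation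
  \<open>h \<mapsto> (h \<circ> \<gamma>)'(t)\<close> vanishes where \<open>Xh\<close> does, so it is \<open>\<Sum>\<^sub>j c\<^sub>j X\<^sub>j\<close>; evaluating it at functions
  dual to the frame gives \<open>c\<close>, its measurability and \<open>\<bar>c\<bar> \<le> 1\<close>.\<close>

lemma relaxed_imp_subunit_curve:
  assumes T: "0 < T" and rel: "relaxed_curve T \<gamma>0"
  shows "subunit_curve G T (\<lambda>t. \<gamma>0 (max 0 (min t T)))"
proof -
  define cl where "cl = (\<lambda>t. max 0 (min t T))"
  define \<gamma> where "\<gamma> = (\<lambda>t. \<gamma>0 (cl t))"
  have cl: "0 \<le> cl t" "cl t \<le> T" "s \<le> t \<Longrightarrow> cl s \<le> cl t" "s \<le> t \<Longrightarrow> cl t - cl s \<le> t - s" for s t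
    using T by (auto simp: cl_def)
  have clt: "cl t = t" if "t \<in> {0..T}" for t using that by (simp add: cl_def)
  have inc: "\<exists>c\<in>creach (t - s). \<gamma> t = \<gamma> s \<star> c" if "s \<le> t" for s t
  proof -
    have "iv (\<gamma> s) \<star> \<gamma> t \<in> creach (cl t - cl s)"
      using rel cl that unfolding relaxed_curve_def \<gamma>_def by blast
    then have "iv (\<gamma> s) \<star> \<gamma> t \<in> creach (t - s)" using creach_mono[OF cl(4)[OF that]] by blast
    then show ?thesis by (intro bexI[of _ "iv (\<gamma> s) \<star> \<gamma> t"]) simp_all
  qed
  have \<gamma>K: "\<gamma> t \<in> creach T" for t
  proof -
    have "iv (\<gamma>0 0) \<star> \<gamma>0 (cl t) \<in> creach (cl t - 0)"
      using rel cl unfolding relaxed_curve_def by blast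
    moreover have "\<gamma>0 0 = \<e>" using rel by (simp add: relaxed_curve_def)
    ultimately have "\<gamma> t \<in> creach (cl t)"
      using iv_mul_cancel(1)[of \<e> "\<gamma> t"] by (simp add: \<gamma>_def)
    then show ?thesis using creach_mono[OF cl(2)] by blast
  qed
  have lip: "\<exists>L. \<forall>s t. \<bar>h (\<gamma> s) - h (\<gamma> t)\<bar> \<le> L * \<bar>s - t\<bar>" if h: "smooth_fun \<A> h" for h
  proof -
    let ?K = "(\<lambda>(a, b). a \<star> b) ` (creach T \<times> creach T)"
    have cK: "compact ?K" by (intro compact_mul_image compact_creach)
    have "compact ((\<lambda>x. norm (grd h x)) ` ?K)"
      by (intro compact_continuous_image cK continuous_on_norm continuous_on_subset[OF continuous_grd[OF h]]) auto
    then obtain L where L: "\<And>x. x \<in> ?K \<Longrightarrow> norm (grd h x) \<le> L"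
      using compact_imp_bounded bounded_imp_bdd_above unfolding bdd_above_def by (metis imageI)
    have one: "\<bar>h (\<gamma> t) - h (\<gamma> s)\<bar> \<le> L * (t - s)" if st: "s \<le> t" for s t
    proof -
      have "iv (\<gamma> s) \<star> \<gamma> t \<in> creach (cl t - cl s)"
        using rel cl st unfolding relaxed_curve_def \<gamma>_def by blast
      then have "\<bar>h (\<gamma> s \<star> (iv (\<gamma> s) \<star> \<gamma> t)) - h (\<gamma> s)\<bar> \<le> L * (cl t - cl s)"
      proof (rule creach_estimate[OF _ _ h])
        show "0 \<le> cl t - cl s" using cl(3)[OF st] by simp
        fix c' assume "c' \<in> creach (cl t - cl s)"
        moreover have "cl t - cl s \<le> T" using cl(1)[of s] cl(2)[of t] by linarith
        ultimately have "c' \<in> creach T" using creach_mono by blast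
        then show "norm (grd h (\<gamma> s \<star> c')) \<le> L" using \<gamma>K by (intro L) force
      qed
      moreover have "0 \<le> L"
        using L[of "\<gamma> s \<star> \<gamma> s"] \<gamma>K by (force intro: order_trans[OF norm_ge_zero])
      then have "L * (cl t - cl s) \<le> L * (t - s)" using cl(4)[OF st] by (intro mult_left_mono)
      ultimately show ?thesis by simp
    qed
    have "\<bar>h (\<gamma> s) - h (\<gamma> t)\<bar> \<le> L * \<bar>s - t\<bar>" for s t
      using one[of s t] one[of t s] by (cases "s \<le> t") (auto simp: abs_minus_commute)
    then show ?thesis by blast
  qed
  have conth: "continuous_on UNIV (\<lambda>t. h (\<gamma> t))" if h: "smooth_fun \<A> h" for h
  proof -
    obtain L where L: "\<And>s t. \<bar>h (\<gamma> s) - h (\<gamma> t)\<bar> \<le> L * \<bar>s - t\<bar>" using lip[OF h] by blast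
    moreover have "0 \<le> L" using L[of 1 0] by auto
    ultimately have "L-lipschitz_on UNIV (\<lambda>t. h (\<gamma> t))"
      by (intro lipschitz_onI) (auto simp: dist_real_def)
    then show ?thesis by (rule lipschitz_on_continuous_on)
  qed
  have cont: "isCont \<gamma> t" for t
    unfolding isCont_def
  proof (rule topological_tendstoI)
    fix N assume N: "open N" "\<gamma> t \<in> N"
    obtain \<psi> where \<psi>: "smooth_fun \<A> \<psi>" "\<psi> (\<gamma> t) > 0" "\<And>y. 0 \<le> \<psi> y"
      "compact (closure {y. \<psi> y \<noteq> 0})" "closure {y. \<psi> y \<noteq> 0} \<subseteq> N"
      by (rule bump_at[OF N]) (rule that)
    have "((\<lambda>s. \<psi> (\<gamma> s)) \<longlongrightarrow> \<psi> (\<gamma> t)) (at t)"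
      using conth[OF \<psi>(1)] by (simp add: continuous_on_eq_continuous_at isCont_def)
    then have "\<forall>\<^sub>F s in at t. 0 < \<psi> (\<gamma> s)" using \<psi>(2) by (rule order_tendstoD)
    then show "\<forall>\<^sub>F s in at t. \<gamma> s \<in> N"
    proof (rule eventually_mono)
      fix s assume "0 < \<psi> (\<gamma> s)"
      then have "\<gamma> s \<in> {y. \<psi> y \<noteq> 0}" by simp
      then have "\<gamma> s \<in> closure {y. \<psi> y \<noteq> 0}" by (rule subsetD[OF closure_subset])
      then show "\<gamma> s \<in> N" by (rule subsetD[OF \<psi>(5)])
    qed
  qed
  \<comment> \<open>By compactness of \<open>creach T\<close>, finitely many test functions decide at which times all \<open>h \<circ> \<gamma>\<close> are
    differentiable, so one null set \<open>E\<close> serves for every \<open>h\<close>.\<close>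
  define good where "good = (\<lambda>x N F. open N \<and> x \<in> N \<and> finite F \<and> (\<forall>f\<in>F. smooth_fun \<A> f) \<and>
      (\<forall>t h. \<gamma> t \<in> N \<longrightarrow> (\<forall>f\<in>F. (f \<circ> \<gamma>) differentiable (at t)) \<longrightarrow> smooth_fun \<A> h \<longrightarrow> (h \<circ> \<gamma>) differentiable (at t)))"
  have "\<exists>N F. good x N F" for x
  proof -
    obtain N F where "open N" "x \<in> N" "finite F" "\<And>f. f \<in> F \<Longrightarrow> smooth_fun \<A> f"
      "\<And>\<gamma> t S h. continuous (at t within S) \<gamma> \<Longrightarrow> t \<in> S \<Longrightarrow> \<gamma> t \<in> N
      \<Longrightarrow> \<forall>f\<in>F. (f \<circ> \<gamma>) differentiable (at (t::real) within S)
      \<Longrightarrow> smooth_fun \<A> h \<Longrightarrow> (h \<circ> \<gamma>) differentiable (at t within S)"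
      by (rule curve_differentiable_test[OF atlas, of x]) (rule that)
    then have "good x N F" unfolding good_def using cont by blast
    then show ?thesis by blast
  qed
  then obtain N where "\<forall>x. \<exists>F. good x (N x) F" using choice[of "\<lambda>x N. \<exists>F. good x N F"] by blast
  then obtain F where "\<forall>x. good x (N x) (F x)" using choice[of "\<lambda>x F. good x (N x) F"] by blast
  then have NF: "\<And>x. open (N x)" "\<And>x. x \<in> N x" "\<And>x. finite (F x)"
      "\<And>x f. f \<in> F x \<Longrightarrow> smooth_fun \<A> f"
      "\<And>x t h. \<gamma> t \<in> N x \<Longrightarrow> \<forall>f\<in>F x. (f \<circ> \<gamma>) differentiable (at t) \<Longrightarrow> smooth_fun \<A> h
         \<Longrightarrow> (h \<circ> \<gamma>) differentiable (at t)"
    unfolding good_def by blast+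
  obtain X0 where X0: "finite X0" "creach T \<subseteq> (\<Union>x\<in>X0. N x)"
  proof (rule compactE_image[OF compact_creach[of T], of UNIV N])
    show "creach T \<subseteq> (\<Union>x\<in>UNIV. N x)" using NF(2) by blast
  qed (use NF(1) in auto)
  define E where "E = (\<Union>x\<in>X0. \<Union>f\<in>F x. {t. \<not> (f \<circ> \<gamma>) differentiable (at t)})"
  have neg: "negligible {t. \<not> (f \<circ> \<gamma>) differentiable (at t)}" if fF: "f \<in> F x" for x f
  proof -
    obtain L where "\<And>s t. \<bar>(f \<circ> \<gamma>) s - (f \<circ> \<gamma>) t\<bar> \<le> L * \<bar>s - t\<bar>" using lip[OF NF(4)[OF fF]] by auto
    then show ?thesis by (rule lipschitz_imp_differentiable_AE)
  qed
  have negE: "negligible E"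
    unfolding E_def by (auto intro!: negligible_Union X0 NF neg)
  define D where "D = (\<lambda>h t. deriv (h \<circ> \<gamma>) t)"
  have D: "((h \<circ> \<gamma>) has_real_derivative D h t) (at t)" if "t \<notin> E" "smooth_fun \<A> h" for h t
  proof -
    obtain x where x: "x \<in> X0" "\<gamma> t \<in> N x" using X0(2) \<gamma>K by blast
    then have "\<forall>f\<in>F x. (f \<circ> \<gamma>) differentiable (at t)" using that(1) by (auto simp: E_def)
    then have "(h \<circ> \<gamma>) differentiable (at t)" using NF(5) x that by blast
    then show ?thesis
      unfolding D_def by (simp add: DERIV_deriv_iff_real_differentiable)
  qed
  have Dsum: "D (\<lambda>x. \<Sum>i\<in>I. a i * h i x) t = (\<Sum>i\<in>I. a i * D (h i) t)"
    if "t \<notin> E" "finite I" "\<And>i. i \<in> I \<Longrightarrow> smooth_fun \<A> (h i)" for I and a :: "'n option \<Rightarrow> real" and h t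
  proof -
    have "((\<lambda>s. \<Sum>i\<in>I. a i * (h i \<circ> \<gamma>) s) has_real_derivative (\<Sum>i\<in>I. a i * D (h i) t)) (at t)"
      by (intro DERIV_sum DERIV_cmult) (rule D[OF that(1) that(3)])
    then have "deriv (\<lambda>s. \<Sum>i\<in>I. a i * (h i \<circ> \<gamma>) s) t = (\<Sum>i\<in>I. a i * D (h i) t)"
      by (rule DERIV_imp_deriv)
    moreover have "D (\<lambda>x. \<Sum>i\<in>I. a i * h i x) t = deriv (\<lambda>s. \<Sum>i\<in>I. a i * (h i \<circ> \<gamma>) s) t"
      by (simp add: D_def o_def)
    ultimately show ?thesis by simp
  qed
  \<comment> \<open>For a short time \<open>\<tau>\<close> the curve stays in \<open>\<gamma> t \<star> creach \<tau>\<close>, where \<open>\<bar>Xh\<bar>\<close> exceeds its value at \<open>\<gamma> t\<close> by at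
    most \<open>e\<close>.\<close>
  have Dle: "\<bar>D h t\<bar> \<le> norm (grd h (\<gamma> t))" if t: "t \<notin> E" "0 < t" "t < T" and h: "smooth_fun \<A> h" for h t
  proof (rule field_le_epsilon)
    fix e :: real assume e: "0 < e"
    let ?M = "norm (grd h (\<gamma> t)) + e"
    let ?N = "{c. norm (grd h (\<gamma> t \<star> c)) < ?M}"
    have "continuous_on UNIV (\<lambda>c. grd h (\<gamma> t \<star> c))"
      by (rule continuous_on_compose2[OF continuous_grd[OF h]]) (auto intro!: continuous_intros)
    then have "open ?N" by (intro open_Collect_less continuous_on_norm continuous_on_const)
    moreover have "\<e> \<in> ?N" using e by simp
    ultimately obtain \<tau> where \<tau>: "\<tau> > 0" "creach \<tau> \<subseteq> ?N" using creach_small by metis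
    let ?q = "\<lambda>k. ((h \<circ> \<gamma>) (t + k) - (h \<circ> \<gamma>) t) / k"
    have "(?q \<longlongrightarrow> D h t) (at 0)" using D[OF t(1) h] by (simp add: DERIV_def)
    then have "((\<lambda>k. \<bar>?q k\<bar>) \<longlongrightarrow> \<bar>D h t\<bar>) (at 0)" by (rule tendsto_rabs)
    then have "((\<lambda>k. \<bar>?q k\<bar>) \<longlongrightarrow> \<bar>D h t\<bar>) (at_right 0)" by (simp add: filterlim_at_split)
    moreover have "\<forall>\<^sub>F k in at_right 0. \<bar>?q k\<bar> \<le> ?M"
    proof (rule eventually_at_rightI[of 0 \<tau>])
      fix k assume k: "k \<in> {0<..<\<tau>}"
      then obtain c where c: "c \<in> creach k" "\<gamma> (t + k) = \<gamma> t \<star> c" using inc[of t "t + k"] by auto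
      have "\<bar>h (\<gamma> t \<star> c) - h (\<gamma> t)\<bar> \<le> ?M * k"
      proof (rule creach_estimate[OF c(1) _ h])
        fix c' assume "c' \<in> creach k"
        then have "c' \<in> ?N" using \<tau>(2) creach_mono[of k \<tau>] k by auto
        then show "norm (grd h (\<gamma> t \<star> c')) \<le> ?M" by simp
      qed (use k in simp)
      then show "\<bar>?q k\<bar> \<le> ?M" using c k by (simp add: pos_divide_le_eq)
    qed (rule \<tau>)
    ultimately show "\<bar>D h t\<bar> \<le> ?M" by (intro tendsto_upperbound) auto
  qed
  obtain \<eta> :: "'n \<Rightarrow> 'g \<Rightarrow> real" where \<eta>: "\<And>i. smooth_fun \<A> (\<eta> i)" "\<And>i. grd (\<eta> i) \<e> = axis i 1"
    by (rule dual_functions) (rule that)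
  define S where "S = {0<..<T} - E"
  define dl where "dl = (\<lambda>i t x. \<eta> i (iv (\<gamma> t) \<star> x))"
  have dls: "smooth_fun \<A> (dl i t)" for i t unfolding dl_def by (intro smooth_translate \<eta>)
  have dlg: "grd (dl i t) (\<gamma> t) = axis i 1" for i t
    unfolding dl_def by (simp add: grd_translate[OF \<eta>(1)] \<eta>(2))
  define c :: "real \<Rightarrow> real^'n" where "c = (\<lambda>t. \<chi> i. if t \<in> S then D (dl i t) t else 0)"
  have ci: "c t $ i = D (dl i t) t" if "t \<in> S" for t i using that by (simp add: c_def)
  have axis_sum: "(\<Sum>i\<in>UNIV. (a $ i) *\<^sub>R axis i 1) = a" for a :: "real^'n"
    by (simp add: vec_eq_iff axis_def if_distrib cong: if_cong)
  have Dh: "D h t = (\<Sum>i\<in>UNIV. c t $ i * frame G i h (\<gamma> t))" if t: "t \<in> S" and h: "smooth_fun \<A> h" for h t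
  proof -
    \<comment> \<open>The combination \<open>h - \<Sum>\<^sub>i (X\<^sub>ih)(\<gamma> t) dl\<^sub>i\<close> has horizontal gradient \<open>0\<close> at \<open>\<gamma> t\<close>; the index \<open>None\<close> stands for \<open>h\<close>.\<close>
    define a where "a = (\<lambda>i. case i of None \<Rightarrow> 1 | Some i \<Rightarrow> - (grd h (\<gamma> t) $ i))"
    define k where "k = (\<lambda>i. case i of None \<Rightarrow> h | Some i \<Rightarrow> dl i t)"
    have ks: "smooth_fun \<A> (k i)" for i using h dls by (simp add: k_def split: option.split)
    let ?k = "\<lambda>x. \<Sum>i\<in>UNIV. a i * k i x"
    have opt: "(\<Sum>i\<in>UNIV. f i) = f None + (\<Sum>i\<in>UNIV. f (Some i))" for f :: "'n option \<Rightarrow> 'z::ab_group_add"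
      by (simp add: UNIV_option_conv sum.reindex)
    have "grd ?k (\<gamma> t) = (\<Sum>i\<in>UNIV. a i *\<^sub>R grd (k i) (\<gamma> t))" by (rule grd_sum) (auto simp: ks)
    also have "\<dots> = grd h (\<gamma> t) - (\<Sum>i\<in>UNIV. (grd h (\<gamma> t) $ i) *\<^sub>R axis i 1)"
      by (simp add: opt a_def k_def dlg sum_negf)
    finally have "grd ?k (\<gamma> t) = 0" by (simp add: axis_sum)
    moreover have "smooth_fun \<A> ?k" by (intro smooth_fun_sum smooth_fun_mult smooth_fun_const atlas ks) auto
    ultimately have "D ?k t = 0" using Dle[of t ?k] t by (simp add: S_def)
    moreover have "D ?k t = (\<Sum>i\<in>UNIV. a i * D (k i) t)"
      using t ks by (intro Dsum) (auto simp: S_def)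
    ultimately have "D h t = (\<Sum>i\<in>UNIV. grd h (\<gamma> t) $ i * D (dl i t) t)"
      by (simp add: opt a_def k_def sum_negf)
    then show ?thesis by (simp add: ci[OF t] grd_def mult.commute)
  qed
  have c1: "(\<Sum>j\<in>UNIV. (c t $ j)\<^sup>2) \<le> 1" for t
  proof (cases "t \<in> S")
    case True
    \<comment> \<open>This function has horizontal gradient \<open>c t\<close> at \<open>\<gamma> t\<close>, so that \<open>\<bar>c t\<bar>\<^sup>2 = D k t \<le> \<bar>c t\<bar>\<close>.\<close>
    let ?k = "\<lambda>x. \<Sum>i\<in>UNIV. c t $ i * dl i t x"
    have ks: "smooth_fun \<A> ?k" by (intro smooth_fun_sum smooth_fun_mult smooth_fun_const atlas dls) auto
    have "grd ?k (\<gamma> t) = (\<Sum>i\<in>UNIV. (c t $ i) *\<^sub>R axis i 1)"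
      using grd_sum[of UNIV "\<lambda>i. dl i t" "\<lambda>i. c t $ i" "\<gamma> t"] dls by (simp add: dlg)
    then have g: "grd ?k (\<gamma> t) = c t" by (simp add: axis_sum)
    then have "frame G i ?k (\<gamma> t) = c t $ i" for i by (simp add: grd_def vec_eq_iff)
    then have "D ?k t = (\<Sum>j\<in>UNIV. (c t $ j)\<^sup>2)" using Dh[OF True ks] by (simp add: power2_eq_square)
    moreover have "\<dots> = (norm (c t))\<^sup>2" by (simp add: norm_vec_def L2_set_def sum_nonneg)
    moreover have "\<bar>D ?k t\<bar> \<le> norm (c t)" using Dle[of t ?k] ks True g by (simp add: S_def)
    ultimately have "(norm (c t))\<^sup>2 \<le> norm (c t)" by simp
    have "norm (c t) \<le> 1"
    proof (rule ccontr)
      assume "\<not> norm (c t) \<le> 1"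
      then have "norm (c t) * 1 < norm (c t) * norm (c t)" by (intro mult_strict_left_mono) auto
      then show False using \<open>(norm (c t))\<^sup>2 \<le> norm (c t)\<close> by (simp add: power2_eq_square)
    qed
    then have "(norm (c t))\<^sup>2 \<le> 1" by (simp add: power_le_one)
    then show ?thesis by (simp add: norm_vec_def L2_set_def sum_nonneg)
  qed (simp add: c_def)
  have Sm: "S \<in> sets lebesgue" using negE by (auto simp: S_def negligible_imp_sets)
  have cont\<gamma>: "continuous_on UNIV \<gamma>" using cont by (simp add: continuous_at_imp_continuous_on)
  have cm: "c \<in> borel_measurable lebesgue"
    unfolding borel_measurable_euclidean_space[of c]
  proof
    fix b :: "real^'n" assume "b \<in> Basis"
    then obtain i where b: "b = axis i 1" by (auto simp: Basis_vec_def)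
    \<comment> \<open>The controls are pointwise limits of continuous difference quotients on \<open>S\<close>.\<close>
    let ?q = "\<lambda>n t. (\<eta> i (iv (\<gamma> t) \<star> \<gamma> (t + inverse (real (Suc n)))) - \<eta> i \<e>) / inverse (real (Suc n))"
    have "(\<lambda>t. indicat_real S t * c t $ i) \<in> borel_measurable lebesgue"
    proof (rule borel_measurable_LIMSEQ_real)
      fix n
      have "continuous_on UNIV (?q n)"
        by (intro continuous_intros continuous_on_compose2[OF smooth_continuous[OF \<eta>(1)[of i]]]
            continuous_on_compose2[OF cont\<gamma>]) auto
      then have "?q n \<in> borel_measurable lebesgue"
        by (intro measurable_completion) (simp add: borel_measurable_continuous_onI)
      then show "(\<lambda>t. indicat_real S t * ?q n t) \<in> borel_measurable lebesgue"
        using Sm by (intro borel_measurable_times) auto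
    next
      fix t :: real assume "t \<in> space lebesgue"
      show "(\<lambda>n. indicat_real S t * ?q n t) \<longlonglongrightarrow> indicat_real S t * c t $ i"
      proof (cases "t \<in> S")
        case True
        have "((\<lambda>k. ((dl i t \<circ> \<gamma>) (t + k) - (dl i t \<circ> \<gamma>) t) / k) \<longlongrightarrow> D (dl i t) t) (at 0)"
          using D[OF _ dls] True by (simp add: DERIV_def S_def)
        moreover have "filterlim (\<lambda>n. inverse (real (Suc n))) (at 0) sequentially"
          by (intro filterlim_atI LIMSEQ_inverse_real_of_nat) simp
        ultimately have "(\<lambda>n. ((dl i t \<circ> \<gamma>) (t + inverse (real (Suc n))) - (dl i t \<circ> \<gamma>) t) / inverse (real (Suc n))) \<longlonglongrightarrow> D (dl i t) t"
          by (rule filterlim_compose)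
        then show ?thesis using True by (simp add: dl_def ci[OF True] divide_inverse)
      qed simp
    qed
    moreover have "(\<lambda>t. indicat_real S t * c t $ i) = (\<lambda>t. c t \<bullet> b)"
      by (auto simp: b inner_axis c_def fun_eq_iff indicator_def)
    ultimately show "(\<lambda>t. c t \<bullet> b) \<in> borel_measurable lebesgue" by simp
  qed
  have "subunit_curve G T \<gamma>"
    unfolding subunit_curve_def
  proof (intro conjI allI impI ballI exI[of _ c])
    show "continuous_on {0..T} \<gamma>" using cont\<gamma> by (rule continuous_on_subset) simp
    show "c \<in> borel_measurable (lebesgue_on {0..T})" using cm by (rule measurable_restrict_space1)
    show "(\<Sum>j\<in>UNIV. (c t $ j)\<^sup>2) \<le> 1" for t by (rule c1)
  next
    fix h assume h: "smooth_fun \<A> h"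
    obtain L where L: "\<And>s t. \<bar>h (\<gamma> s) - h (\<gamma> t)\<bar> \<le> L * \<bar>s - t\<bar>" using lip[OF h] by blast
    have L0: "0 \<le> L" using L[of 1 0] by auto
    show "abs_cont 0 T (h \<circ> \<gamma>)"
      unfolding abs_cont_def
    proof (intro allI impI)
      fix e :: real assume e: "0 < e"
      show "\<exists>\<delta>>0. \<forall>I. finite I \<and> (\<forall>(s, t)\<in>I. 0 \<le> s \<and> s \<le> t \<and> t \<le> T) \<and>
         pairwise (\<lambda>(s, t) (s', t'). t \<le> s' \<or> t' \<le> s) I \<and> (\<Sum>(s, t)\<in>I. t - s) < \<delta>
         \<longrightarrow> (\<Sum>(s, t)\<in>I. \<bar>(h \<circ> \<gamma>) t - (h \<circ> \<gamma>) s\<bar>) < e"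
      proof (intro exI[of _ "e / (L + 1)"] conjI allI impI)
        show "0 < e / (L + 1)" using e L0 by simp
        fix I :: "(real \<times> real) set"
        assume I: "finite I \<and> (\<forall>(s, t)\<in>I. 0 \<le> s \<and> s \<le> t \<and> t \<le> T) \<and>
         pairwise (\<lambda>(s, t) (s', t'). t \<le> s' \<or> t' \<le> s) I \<and> (\<Sum>(s, t)\<in>I. t - s) < e / (L + 1)"
        have "(\<Sum>(s, t)\<in>I. \<bar>(h \<circ> \<gamma>) t - (h \<circ> \<gamma>) s\<bar>) \<le> (\<Sum>(s, t)\<in>I. L * (t - s))"
        proof (rule sum_mono)
          fix p assume "p \<in> I"
          then show "(case p of (s, t) \<Rightarrow> \<bar>(h \<circ> \<gamma>) t - (h \<circ> \<gamma>) s\<bar>) \<le> (case p of (s, t) \<Rightarrow> L * (t - s))"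
            using L[of "snd p" "fst p"] I by (cases p) force
        qed
        also have "\<dots> = L * (\<Sum>(s, t)\<in>I. t - s)" by (simp add: sum_distrib_left case_prod_unfold)
        also have "\<dots> \<le> L * (e / (L + 1))" using I L0 by (intro mult_left_mono) auto
        also have "\<dots> < e" using e L0 by (simp add: field_simps)
        finally show "(\<Sum>(s, t)\<in>I. \<bar>(h \<circ> \<gamma>) t - (h \<circ> \<gamma>) s\<bar>) < e" .
      qed
    qed
  next
    have "E \<union> {0, T} \<in> null_sets lebesgue"
      using negE by (simp add: negligible_iff_null_sets[symmetric] negligible_insert)
    then have "AE t in lebesgue. t \<in> {0..T} \<longrightarrow> t \<in> S"
      by (rule AE_I') (auto simp: S_def)
    moreover have "((h \<circ> \<gamma>) has_real_derivative (\<Sum>j\<in>UNIV. c t $ j * frame G j h (\<gamma> t))) (at t within {0..T})"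
      if "t \<in> S" "smooth_fun \<A> h" for t h
      using D[of t h] that Dh[OF that] by (auto simp: S_def intro: DERIV_subset)
    ultimately show "AE t in lebesgue_on {0..T}. \<forall>h. smooth_fun \<A> h \<longrightarrow>
           ((h \<circ> \<gamma>) has_real_derivative (\<Sum>j\<in>UNIV. c t $ j * frame G j h (\<gamma> t))) (at t within {0..T})"
      by (subst AE_restrict_space_iff) (auto elim!: eventually_mono)
  qed
  then show ?thesis by (simp add: \<gamma>_def cl_def)
qed

section \<open>Carnot-Caratheodory balls have compact closure and are Borel sets\<close>

text \<open>A point at distance less than \<open>r\<close> is reached in some time \<open>T < r\<close>. Conversely, a point in a closed reachable
  set is the end point of a relaxed curve, which is subunit. The offset \<open>2\<close> keeps the times positive.\<close>

lemma cc_ball_eq_UN: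
  assumes "0 < r"
  shows "cc_ball G x r = (\<Union>n. (\<lambda>z. iv x \<star> z) -` creach (r - r / real (n + 2)))"
proof (intro equalityI subsetI)
  fix y assume "y \<in> cc_ball G x r"
  then obtain T \<gamma> where T: "0 < T" "ennreal T < ennreal r" "subunit_curve G T \<gamma>" "\<gamma> 0 = x" "\<gamma> T = y"
    unfolding cc_ball_def cc_dist_def Inf_less_iff by auto
  have "T < r" using T by (simp add: ennreal_less_iff)
  then obtain n where n: "r / real (Suc n) < r - T"
  proof -
    obtain n where "inverse (real (Suc n)) < (r - T) / r"
      using reals_Archimedean[of "(r - T) / r"] \<open>T < r\<close> assms by auto
    then show thesis using that[of n] assms by (simp add: field_simps)
  qed
  have "r / real (n + 2) \<le> r / real (Suc n)" using assms by (intro divide_left_mono) auto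
  then have "T \<le> r - r / real (n + 2)" using n by linarith
  moreover have "iv x \<star> y \<in> reach T"
    using reach_increment[OF T(3), of 0 T] T by simp
  ultimately have "iv x \<star> y \<in> creach (r - r / real (n + 2))"
    using reach_mono reach_subset_creach by blast
  then show "y \<in> (\<Union>n. (\<lambda>z. iv x \<star> z) -` creach (r - r / real (n + 2)))" by blast
next
  fix y assume "y \<in> (\<Union>n. (\<lambda>z. iv x \<star> z) -` creach (r - r / real (n + 2)))"
  then obtain n where y: "iv x \<star> y \<in> creach (r - r / real (n + 2))" by auto
  let ?t = "r - r / real (n + 2)"
  have t: "0 < ?t" "?t < r" using assms by (auto simp: field_simps intro!: add_pos_nonneg)
  obtain \<gamma> where \<gamma>: "relaxed_curve ?t \<gamma>" "\<gamma> ?t = iv x \<star> y"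
    using relaxed_curve_to[of ?t "iv x \<star> y"] t y by auto
  let ?\<gamma> = "\<lambda>s. \<gamma> (max 0 (min s ?t))"
  have "subunit_curve G ?t ?\<gamma>" by (rule relaxed_imp_subunit_curve[OF t(1) \<gamma>(1)])
  then have "subunit_curve G (?t - 0) (\<lambda>\<tau>. x \<star> ?\<gamma> (0 + \<tau>))"
    by (rule subunit_curve_piece) (use t in auto)
  then have "subunit_curve G ?t (\<lambda>\<tau>. x \<star> ?\<gamma> \<tau>)" by simp
  moreover have "\<gamma> 0 = \<e>" using \<gamma> by (simp add: relaxed_curve_def)
  then have "x \<star> ?\<gamma> 0 = x" using t by simp
  moreover have "x \<star> ?\<gamma> ?t = y" using \<gamma>(2) t by simp
  ultimately have "cc_dist G x y \<le> ennreal ?t"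
    unfolding cc_dist_def using t by (intro Inf_lower) blast
  also have "\<dots> < ennreal r" using t by (simp add: ennreal_less_iff)
  finally show "y \<in> cc_ball G x r" by (simp add: cc_ball_def)
qed

lemma cc_ball_borel: assumes "0 < r" shows "cc_ball G x r \<in> sets borel"
proof -
  have "closed ((\<lambda>z. iv x \<star> z) -` creach t)" for t
    by (intro closed_vimage continuous_intros) (simp add: creach_def)
  then show ?thesis unfolding cc_ball_eq_UN[OF assms] by (intro sets.countable_UN) auto
qed

lemma cc_ball_subset_compact: assumes "0 < r" obtains K where "compact K" "cc_ball G x r \<subseteq> K"
proof
  show "compact ((\<lambda>z. x \<star> z) ` creach r)"
    by (intro compact_continuous_image compact_creach continuous_intros)
  show "cc_ball G x r \<subseteq> (\<lambda>z. x \<star> z) ` creach r"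
  proof
    fix y assume "y \<in> cc_ball G x r"
    then obtain n where "iv x \<star> y \<in> creach (r - r / real (n + 2))" using cc_ball_eq_UN[OF assms] by auto
    moreover have "r - r / real (n + 2) \<le> r" using assms by simp
    ultimately have "iv x \<star> y \<in> creach r" using creach_mono by blast
    then show "y \<in> (\<lambda>z. x \<star> z) ` creach r" by (intro image_eqI[of _ _ "iv x \<star> y"]) simp_all
  qed
qed

end

section \<open>Weak derivatives\<close>

locale carnot_open = carnot_structure G
  for G :: "('g::{t2_space, second_countable_topology}, 'e::euclidean_space, 'n::finite) carnot" +
  fixes \<Omega> :: "'g set"
  assumes open_\<Omega>: "open \<Omega>"
begin

lemma sets_haar: "sets (haar G) = sets borel" and haar_compact: "compact K \<Longrightarrow> emeasure (haar G) K < \<infinity>"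
  using carnot by (auto simp: carnot_group_def haar_measure_def)

lemma space_haar [simp]: "space (haar G) = UNIV"
  using sets_haar by (metis sets_eq_imp_space_eq space_borel)

lemma space_vol [simp]: "space (vol G) = UNIV" by (simp add: vol_def)

lemma borel_sets_vol: "S \<in> sets borel \<Longrightarrow> S \<in> sets (vol G)"
  using sets_haar by (simp add: vol_def sets_completionI_sets)

lemma emeasure_vol: "S \<in> sets borel \<Longrightarrow> emeasure (vol G) S = emeasure (haar G) S"
  using sets_haar by (simp add: vol_def)

lemma borel_measurable_vol: "f \<in> borel_measurable borel \<Longrightarrow> f \<in> borel_measurable (vol G)"
  unfolding vol_def using sets_haar by (intro measurable_completion) (simp cong: measurable_cong_sets)

lemma \<Omega>_sets [simp]: "\<Omega> \<in> sets (vol G)" "\<Omega> \<inter> space (vol G) \<in> sets (vol G)"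
  using open_\<Omega> by (auto intro: borel_sets_vol)

lemma continuous_measurable_vol: "continuous_on UNIV f \<Longrightarrow> f \<in> borel_measurable (vol G)"
  by (intro borel_measurable_vol borel_measurable_continuous_onI)

lemma enn2real_eqD: "enn2real a = enn2real b \<Longrightarrow> a < \<infinity> \<Longrightarrow> b < \<infinity> \<Longrightarrow> a = b"
  by (metis ennreal_enn2real infinity_ennreal_def)

text \<open>The measures with densities \<open>g\<^sup>+\<close> and \<open>g\<^sup>-\<close> agree on open sets, and these form an intersection-stable
  generator of the Borel sets. Since \<open>vol\<close> is a completion, \<open>g\<close> is first replaced by a Borel function.\<close>

lemma integral_zero_on_open_imp_AE_zero:
  assumes g: "integrable (vol G) (g :: 'g \<Rightarrow> real)"
    and zero: "\<And>W. open W \<Longrightarrow> (LINT x|vol G. g x * indicator W x) = 0"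
  shows "AE x in vol G. g x = 0"
proof -
  obtain g' where g': "g' \<in> borel_measurable (haar G)" "AE x in haar G. g x = g' x"
    using completion_ex_borel_measurable_real[of g "haar G"] g by (auto simp: vol_def dest: borel_measurable_integrable)
  have AEv: "AE x in vol G. g x = g' x" using g'(2) unfolding vol_def by (rule AE_completion)
  have g'v: "g' \<in> borel_measurable (vol G)" using g'(1) by (simp add: vol_def measurable_completion)
  have iv: "integrable (vol G) g'" using g by (rule integrable_cong_AE_imp) (use g'v AEv in auto)
  then have ih: "integrable (haar G) g'" using g'(1) by (simp add: vol_def integrable_completion)
  have z: "(LINT x|haar G. g' x * indicator W x) = 0" if "open W" for W
  proof -
    have "(LINT x|haar G. g' x * indicator W x) = (LINT x|vol G. g' x * indicator W x)"
      unfolding vol_def using g'(1) that sets_haar by (intro integral_completion[symmetric] borel_measurable_times borel_measurable_indicator) auto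
    also have "\<dots> = (LINT x|vol G. g x * indicator W x)"
      using g'v g AEv that
      by (intro integral_cong_AE borel_measurable_times borel_measurable_indicator borel_sets_vol)
        (auto dest: borel_measurable_integrable)
    finally show ?thesis using zero[OF that] by simp
  qed
  define \<nu> where "\<nu> = (\<lambda>s::real. density (haar G) (\<lambda>x. ennreal (s * g' x)))"
  have meas: "(\<lambda>x. ennreal (s * g' x)) \<in> borel_measurable (haar G)" for s using g'(1) by simp
  have fin: "(\<integral>\<^sup>+x. ennreal (s * g' x) * indicator W x \<partial>haar G) < \<infinity>" if s: "\<bar>s\<bar> = 1" for s W
  proof -
    have "(\<integral>\<^sup>+x. ennreal (s * g' x) * indicator W x \<partial>haar G) \<le> (\<integral>\<^sup>+x. ennreal (norm (g' x)) \<partial>haar G)"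
    proof (rule nn_integral_mono)
      fix x
      have "s * g' x \<le> \<bar>g' x\<bar>" using s by (auto simp: abs_if split: if_splits)
      then show "ennreal (s * g' x) * indicator W x \<le> ennreal (norm (g' x))"
        by (auto simp: indicator_def intro: ennreal_leI)
    qed
    also have "\<dots> < \<infinity>" using ih by (simp add: integrable_iff_bounded)
    finally show ?thesis .
  qed
  have eqW: "emeasure (\<nu> 1) W = emeasure (\<nu> (-1)) W" if W: "open W" for W
  proof -
    have Ws: "W \<in> sets (haar G)" using W sets_haar by simp
    have iW: "integrable (haar G) (\<lambda>x. g' x * indicator W x)"
      using ih Ws by (rule integrable_real_mult_indicator[rotated])
    have "(\<integral>\<^sup>+x. ennreal (s * g' x) * indicator W x \<partial>haar G) = (\<integral>\<^sup>+x. ennreal (s * (g' x * indicator W x)) \<partial>haar G)" for s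
      by (intro nn_integral_cong) (auto simp: indicator_def)
    moreover have "enn2real (\<integral>\<^sup>+x. ennreal (1 * (g' x * indicator W x)) \<partial>haar G)
        = enn2real (\<integral>\<^sup>+x. ennreal (-1 * (g' x * indicator W x)) \<partial>haar G)"
      using real_lebesgue_integral_def[OF iW] z[OF W] by simp
    ultimately have "enn2real (\<integral>\<^sup>+x. ennreal (1 * g' x) * indicator W x \<partial>haar G)
        = enn2real (\<integral>\<^sup>+x. ennreal (-1 * g' x) * indicator W x \<partial>haar G)" by (simp only:)
    then have "(\<integral>\<^sup>+x. ennreal (1 * g' x) * indicator W x \<partial>haar G)
        = (\<integral>\<^sup>+x. ennreal (-1 * g' x) * indicator W x \<partial>haar G)"
      using fin[of 1 W] fin[of "-1" W] by (intro enn2real_eqD) simp_all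
    then show ?thesis unfolding \<nu>_def
      by (simp only: emeasure_density[OF meas[of 1] Ws] emeasure_density[OF meas[of "-1"] Ws])
  qed
  have "\<nu> 1 = \<nu> (-1)"
  proof (rule measure_eqI_generator_eq[where E = "Collect open" and \<Omega> = UNIV and A = "\<lambda>_. UNIV"])
    show "Int_stable (Collect open :: 'g set set)" by (auto simp: Int_stable_def)
    show "sets (\<nu> 1) = sigma_sets UNIV (Collect open)" "sets (\<nu> (-1)) = sigma_sets UNIV (Collect open)"
      using sets_haar by (simp_all add: \<nu>_def borel_def sets_measure_of)
    show "emeasure (\<nu> 1) UNIV \<noteq> \<infinity>"
      using fin[of 1 UNIV] emeasure_density[OF meas[of 1], of UNIV] sets_haar unfolding \<nu>_def by simp
  qed (auto simp: eqW)
  have nonpos: "AE x in haar G. s * g' x \<le> 0" if s: "s = 1 \<or> s = -1" for s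
  proof -
    let ?B = "{x. 0 < s * g' x}"
    have "{x \<in> space (haar G). 0 < s * g' x} \<in> sets (haar G)" using g'(1) by measurable
    then have B: "?B \<in> sets (haar G)" by simp
    have "(\<integral>\<^sup>+x. ennreal (s * g' x) * indicator ?B x \<partial>haar G) = (\<integral>\<^sup>+x. ennreal (- s * g' x) * indicator ?B x \<partial>haar G)"
      using \<open>\<nu> 1 = \<nu> (-1)\<close> s emeasure_density[OF meas[of 1] B] emeasure_density[OF meas[of "-1"] B]
      unfolding \<nu>_def by auto
    also have "\<dots> = (\<integral>\<^sup>+x. 0 \<partial>haar G)"
      by (intro nn_integral_cong) (auto simp: indicator_def ennreal_neg)
    finally have "(\<integral>\<^sup>+x. ennreal (s * g' x) * indicator ?B x \<partial>haar G) = 0" by simp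
    then have "AE x in haar G. ennreal (s * g' x) * indicator ?B x = 0"
      by (subst (asm) nn_integral_0_iff_AE) (use B meas in auto)
    then show ?thesis by eventually_elim (auto simp: indicator_def ennreal_eq_0_iff split: if_splits)
  qed
  have "AE x in haar G. g' x = 0"
    using nonpos[OF disjI1[OF refl]] nonpos[OF disjI2[OF refl]] by eventually_elim auto
  then have "AE x in vol G. g' x = 0" unfolding vol_def by (rule AE_completion)
  with AEv show ?thesis by eventually_elim simp
qed

text \<open>The fundamental lemma of the calculus of variations. A bump makes \<open>g\<close> integrable near each
  point; there \<open>g\<close> has integral zero over every open set, because indicators of open sets are
  limits of test functions.\<close>

lemma fundamental_lemma:
  assumes g: "g \<in> borel_measurable (restrict_space (vol G) \<Omega>)"
    and int: "\<And>\<phi>. \<phi> \<in> test_functions G \<Omega> \<Longrightarrow> set_integrable (vol G) \<Omega> (\<lambda>x. g x * \<phi> x)"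
    and zero: "\<And>\<phi>. \<phi> \<in> test_functions G \<Omega> \<Longrightarrow> (LINT x:\<Omega>|vol G. g x * \<phi> x) = 0"
  shows "AE x\<in>\<Omega> in vol G. g x = 0"
proof -
  define g0 where "g0 = (\<lambda>x. indicator \<Omega> x * g x)"
  have g0: "g0 \<in> borel_measurable (vol G)"
    using g by (simp add: g0_def borel_measurable_restrict_space_iff)
  have int0: "integrable (vol G) (\<lambda>x. g0 x * \<phi> x)" "(LINT x|vol G. g0 x * \<phi> x) = 0"
    if "\<phi> \<in> test_functions G \<Omega>" for \<phi>
    using int[OF that] zero[OF that]
    by (simp_all add: g0_def set_integrable_def set_lebesgue_integral_def mult.assoc)
  have ex: "\<exists>W. open W \<and> x0 \<in> W \<and> (AE x in vol G. x \<in> W \<longrightarrow> g0 x = 0)" if x0: "x0 \<in> \<Omega>" for x0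
  proof -
    obtain \<psi> where \<psi>: "smooth_fun \<A> \<psi>" "\<psi> x0 > 0" "\<And>y. 0 \<le> \<psi> y"
      "compact (closure {y. \<psi> y \<noteq> 0})" "closure {y. \<psi> y \<noteq> 0} \<subseteq> \<Omega>"
      by (rule bump_at[OF open_\<Omega> x0]) (rule that)
    have \<psi>t: "\<psi> \<in> test_functions G \<Omega>" using \<psi> by (intro test_functionsI)
    define W where "W = {y. \<psi> x0 / 2 < \<psi> y}"
    have W: "open W" unfolding W_def
      by (intro open_Collect_less continuous_on_const smooth_continuous \<psi>(1))
    have WO: "W \<subseteq> \<Omega>"
    proof
      fix x assume "x \<in> W"
      then have "x \<in> {y. \<psi> y \<noteq> 0}" using \<psi>(2) by (auto simp: W_def)
      then have "x \<in> closure {y. \<psi> y \<noteq> 0}" by (rule subsetD[OF closure_subset])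
      then show "x \<in> \<Omega>" by (rule subsetD[OF \<psi>(5)])
    qed
    have Wm: "(indicator W :: 'g \<Rightarrow> real) \<in> borel_measurable (vol G)" using W by (intro borel_measurable_indicator borel_sets_vol) simp
    define g1 where "g1 = (\<lambda>x. g0 x * indicator W x)"
    have ig1: "integrable (vol G) g1"
    proof (rule Bochner_Integration.integrable_bound)
      show "integrable (vol G) (\<lambda>x. (2 / \<psi> x0) * (g0 x * \<psi> x))"
        by (intro integrable_mult_right int0(1) \<psi>t)
      show "g1 \<in> borel_measurable (vol G)" using g0 Wm by (simp add: g1_def)
      have "norm (g1 x) \<le> norm (2 / \<psi> x0 * (g0 x * \<psi> x))" for x
      proof (cases "x \<in> W")
        case True
        then have "1 \<le> 2 / \<psi> x0 * \<psi> x" using \<psi>(2) by (simp add: W_def field_simps)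
        then have "\<bar>g0 x\<bar> * 1 \<le> \<bar>g0 x\<bar> * (2 / \<psi> x0 * \<psi> x)" by (intro mult_left_mono) auto
        then show ?thesis using True \<psi>(2,3) by (simp add: g1_def abs_mult mult_ac)
      qed (simp add: g1_def)
      then show "AE x in vol G. norm (g1 x) \<le> norm (2 / \<psi> x0 * (g0 x * \<psi> x))" by simp
    qed
    have "AE x in vol G. g1 x = 0"
    proof (rule integral_zero_on_open_imp_AE_zero[OF ig1])
      fix V :: "'g set" assume V: "open V"
      obtain S where S: "\<And>n::nat. S n \<in> test_functions G (V \<inter> W)" "\<And>n x. 0 \<le> S n x \<and> S n x \<le> 1"
          "\<And>x. x \<in> V \<inter> W \<Longrightarrow> (\<lambda>n. S n x) \<longlonglongrightarrow> 1"
        using test_functions_exhaust_open[OF atlas open_Int[OF V W]] by metis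
      have S0: "S n x = 0" if "x \<notin> V \<inter> W" for n x using test_functionsD(4)[OF S(1) that] .
      have St: "S n \<in> test_functions G \<Omega>" for n
        using S(1)[of n] WO by (auto simp: test_functions_def compactly_supported_def)
      have "(\<lambda>n. LINT x|vol G. g0 x * S n x) \<longlonglongrightarrow> (LINT x|vol G. g1 x * indicator V x)"
      proof (rule integral_dominated_convergence[where w = "\<lambda>x. norm (g1 x)"])
        show "(\<lambda>x. g1 x * indicator V x) \<in> borel_measurable (vol G)"
          using ig1 V by (intro borel_measurable_times borel_measurable_indicator borel_sets_vol)
            (auto dest: borel_measurable_integrable)
        show "(\<lambda>x. g0 x * S n x) \<in> borel_measurable (vol G)" for n
          using int0(1)[OF St] by (rule borel_measurable_integrable)
        show "integrable (vol G) (\<lambda>x. norm (g1 x))" using ig1 by (rule integrable_norm)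
        have "(\<lambda>n. g0 x * S n x) \<longlonglongrightarrow> g1 x * indicator V x" for x
        proof (cases "x \<in> V \<inter> W")
          case True
          then have "(\<lambda>n. g0 x * S n x) \<longlonglongrightarrow> g0 x * 1" by (intro tendsto_mult tendsto_const S(3))
          then show ?thesis using True by (simp add: g1_def)
        next
          case False
          then show ?thesis using S0[OF False] by (auto simp: g1_def indicator_def)
        qed
        then show "AE x in vol G. (\<lambda>n. g0 x * S n x) \<longlonglongrightarrow> g1 x * indicator V x" by simp
        have "norm (g0 x * S n x) \<le> norm (g1 x)" for n x
        proof (cases "x \<in> V \<inter> W")
          case True
          then show ?thesis using S(2)[of n x] by (simp add: g1_def abs_mult mult_left_le)
        qed (simp add: S0)
        then show "AE x in vol G. norm (g0 x * S n x) \<le> norm (g1 x)" for n by simp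
      qed
      then show "(LINT x|vol G. g1 x * indicator V x) = 0"
        using int0(2)[OF St] by (simp add: LIMSEQ_const_iff)
    qed
    then have "AE x in vol G. x \<in> W \<longrightarrow> g0 x = 0"
      by eventually_elim (auto simp: g1_def)
    moreover have "x0 \<in> W" using \<psi>(2) by (simp add: W_def)
    ultimately show ?thesis using W by blast
  qed
  let ?F = "{W. open W \<and> (AE x in vol G. x \<in> W \<longrightarrow> g0 x = 0)}"
  have "\<And>S. S \<in> ?F \<Longrightarrow> open S" by simp
  then obtain F where F: "F \<subseteq> ?F" "countable F" "\<Union>F = \<Union>?F"
    by (rule Lindelof[of ?F]) (simp, rule that)
  have "AE x in vol G. \<forall>W\<in>F. x \<in> W \<longrightarrow> g0 x = 0"
    using F(1) by (subst AE_ball_countable[OF F(2)]) blast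
  moreover have sub: "\<Omega> \<subseteq> \<Union>F" using ex F(3) by fastforce
  ultimately show ?thesis
    by eventually_elim (use sub in \<open>auto simp: g0_def\<close>)
qed

lemma weak_deriv_unique:
  assumes "weak_deriv G \<Omega> j u g" "weak_deriv G \<Omega> j u g'"
  shows "AE x\<in>\<Omega> in vol G. g x = g' x"
proof -
  have "AE x\<in>\<Omega> in vol G. g x - g' x = 0"
  proof (rule fundamental_lemma)
    show "(\<lambda>x. g x - g' x) \<in> borel_measurable (restrict_space (vol G) \<Omega>)"
      using assms by (auto simp: weak_deriv_def)
    fix \<phi> assume \<phi>: "\<phi> \<in> test_functions G \<Omega>"
    have i: "set_integrable (vol G) \<Omega> (\<lambda>x. g x * \<phi> x)" "set_integrable (vol G) \<Omega> (\<lambda>x. g' x * \<phi> x)"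
      "(LINT x:\<Omega>|vol G. g x * \<phi> x) = (LINT x:\<Omega>|vol G. g' x * \<phi> x)"
      using assms \<phi> unfolding weak_deriv_def by fastforce+
    then show "set_integrable (vol G) \<Omega> (\<lambda>x. (g x - g' x) * \<phi> x)"
      by (simp add: left_diff_distrib set_integral_diff)
    show "(LINT x:\<Omega>|vol G. (g x - g' x) * \<phi> x) = 0"
      using i by (simp add: left_diff_distrib set_integral_diff)
  qed
  then show ?thesis by simp
qed

lemma weak_deriv_linear:
  assumes "weak_deriv G \<Omega> j u g" "weak_deriv G \<Omega> j v h"
  shows "weak_deriv G \<Omega> j (\<lambda>x. a * u x + b * v x) (\<lambda>x. a * g x + b * h x)"
  unfolding weak_deriv_def
proof (intro conjI ballI)
  show "(\<lambda>x. a * u x + b * v x) \<in> borel_measurable (restrict_space (vol G) \<Omega>)"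
    "(\<lambda>x. a * g x + b * h x) \<in> borel_measurable (restrict_space (vol G) \<Omega>)"
    using assms by (auto simp: weak_deriv_def)
  fix \<phi> assume \<phi>: "\<phi> \<in> test_functions G \<Omega>"
  have i: "set_integrable (vol G) \<Omega> (\<lambda>x. a * (u x * frame G j \<phi> x))" "set_integrable (vol G) \<Omega> (\<lambda>x. b * (v x * frame G j \<phi> x))"
     "set_integrable (vol G) \<Omega> (\<lambda>x. a * (g x * \<phi> x))" "set_integrable (vol G) \<Omega> (\<lambda>x. b * (h x * \<phi> x))"
    using assms \<phi> by (auto simp: weak_deriv_def)
  have e: "(LINT x:\<Omega>|vol G. u x * frame G j \<phi> x) = - (LINT x:\<Omega>|vol G. g x * \<phi> x)"
    "(LINT x:\<Omega>|vol G. v x * frame G j \<phi> x) = - (LINT x:\<Omega>|vol G. h x * \<phi> x)"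
    using assms \<phi> by (auto simp: weak_deriv_def)
  have r: "(a * u x + b * v x) * y = a * (u x * y) + b * (v x * y)" "(a * g x + b * h x) * y = a * (g x * y) + b * (h x * y)" for x y
    by (simp_all add: algebra_simps)
  show "set_integrable (vol G) \<Omega> (\<lambda>x. (a * u x + b * v x) * frame G j \<phi> x)"
    "set_integrable (vol G) \<Omega> (\<lambda>x. (a * g x + b * h x) * \<phi> x)"
    unfolding r using i by (auto intro: set_integral_add)
  show "(LINT x:\<Omega>|vol G. (a * u x + b * v x) * frame G j \<phi> x) = - (LINT x:\<Omega>|vol G. (a * g x + b * h x) * \<phi> x)"
    unfolding r set_integral_add(2)[OF i(1,2)] set_integral_add(2)[OF i(3,4)] by (simp add: e)
qed

definition weakly_differentiable :: "('g \<Rightarrow> real) \<Rightarrow> bool" where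
  "weakly_differentiable u \<longleftrightarrow> (\<forall>j. \<exists>g. weak_deriv G \<Omega> j u g)"

lemma hgrad_weak_deriv:
  assumes "weakly_differentiable u" shows "weak_deriv G \<Omega> j u (\<lambda>x. hgrad G \<Omega> u x $ j)"
proof -
  have "\<forall>j. \<exists>g. weak_deriv G \<Omega> j u g" using assms by (simp add: weakly_differentiable_def)
  then obtain g where g: "\<And>j. weak_deriv G \<Omega> j u (g j)" by metis
  have "\<forall>j. weak_deriv G \<Omega> j u (\<lambda>x. (\<chi> j. g j x) $ j)" using g by simp
  then have "\<exists>D. \<forall>j. weak_deriv G \<Omega> j u (\<lambda>x. D x $ j)" by (rule exI[of _ "\<lambda>x. \<chi> j. g j x"])
  then show ?thesis unfolding hgrad_def by (rule someI2_ex) blast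
qed

lemma hgrad_unique:
  assumes "\<And>j. weak_deriv G \<Omega> j u (\<lambda>x. D x $ j)"
  shows "AE x\<in>\<Omega> in vol G. hgrad G \<Omega> u x = D x"
proof -
  have "weakly_differentiable u" using assms unfolding weakly_differentiable_def by blast
  then have "AE x in vol G. \<forall>j\<in>UNIV. x \<in> \<Omega> \<longrightarrow> hgrad G \<Omega> u x $ j = D x $ j"
    using weak_deriv_unique[OF hgrad_weak_deriv assms] by (subst AE_ball_countable) auto
  then show ?thesis by eventually_elim (simp add: vec_eq_iff)
qed

lemma weakly_differentiable_linear: "weakly_differentiable u \<Longrightarrow> weakly_differentiable v \<Longrightarrow> weakly_differentiable (\<lambda>x. a * u x + b * v x)"
  unfolding weakly_differentiable_def using weak_deriv_linear by blast

lemma hgrad_linear: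
  assumes "weakly_differentiable u" "weakly_differentiable v"
  shows "AE x\<in>\<Omega> in vol G. hgrad G \<Omega> (\<lambda>x. a * u x + b * v x) x = a *\<^sub>R hgrad G \<Omega> u x + b *\<^sub>R hgrad G \<Omega> v x"
proof (rule hgrad_unique)
  fix j
  show "weak_deriv G \<Omega> j (\<lambda>x. a * u x + b * v x) (\<lambda>x. (a *\<^sub>R hgrad G \<Omega> u x + b *\<^sub>R hgrad G \<Omega> v x) $ j)"
    using weak_deriv_linear[OF hgrad_weak_deriv[OF assms(1)] hgrad_weak_deriv[OF assms(2)], of j a b] by simp
qed

lemma weak_deriv_measurable:
  "weak_deriv G \<Omega> j u g \<Longrightarrow> u \<in> borel_measurable (restrict_space (vol G) \<Omega>)"
  "weak_deriv G \<Omega> j u g \<Longrightarrow> g \<in> borel_measurable (restrict_space (vol G) \<Omega>)"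
  by (simp_all add: weak_deriv_def)

lemma hgrad_measurable:
  assumes "weakly_differentiable u" shows "hgrad G \<Omega> u \<in> borel_measurable (restrict_space (vol G) \<Omega>)"
  unfolding borel_measurable_euclidean_space[of "hgrad G \<Omega> u"]
proof
  fix b :: "real^'n" assume "b \<in> Basis"
  then obtain i where "b = axis i 1" by (auto simp: Basis_vec_def)
  then show "(\<lambda>x. hgrad G \<Omega> u x \<bullet> b) \<in> borel_measurable (restrict_space (vol G) \<Omega>)"
    using weak_deriv_measurable(2)[OF hgrad_weak_deriv[OF assms, of i]] by (simp add: inner_axis)
qed

end

section \<open>Modulars of exponents bounded away from infinity\<close>

text \<open>The essential supremum in the modular extends over a null set.\<close>

lemma modular_bounded_exponent_eq:
  assumes E: "E \<in> sets M" and q: "q \<in> borel_measurable (restrict_space M E)"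
    and fin: "AE x in restrict_space M E. q x < \<infinity>"
    and F: "F \<in> borel_measurable (restrict_space M E)" and l: "0 < l"
  shows "modular M E q (\<lambda>x. ennreal \<bar>F x\<bar> / ennreal l)
    = (\<integral>\<^sup>+x. ennreal ((\<bar>F x\<bar> / l) powr enn2real (q x)) \<partial>restrict_space M E)"
proof -
  let ?N = "restrict_space M E"
  let ?I = "{x \<in> E. q x = \<infinity>}"
  have spE: "E \<subseteq> space M" using sets.sets_into_space[OF E] .
  have "{x \<in> space ?N. q x = \<infinity>} \<in> sets ?N" using q by measurable
  then have "?I \<in> sets ?N" using spE by (simp add: space_restrict_space Int_absorb2)
  then have IM: "?I \<in> sets M" using E by (auto simp: sets_restrict_space_iff)
  have AEM: "AE x in M. x \<in> E \<longrightarrow> q x < \<infinity>" using fin E by (simp add: AE_restrict_space_iff)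
  have "AE x in M. x \<notin> ?I" using AEM by eventually_elim auto
  then have "AE x in restrict_space M ?I. False"
    using IM by (simp add: AE_restrict_space_iff)
  then have AEz: "AE x in restrict_space M ?I. P x" for P by eventually_elim simp
  have "(\<lambda>x. ennreal \<bar>F x\<bar> / ennreal l) \<in> borel_measurable ?N" using F by measurable
  then have "(\<lambda>x. ennreal \<bar>F x\<bar> / ennreal l) \<in> borel_measurable (restrict_space ?N ?I)"
    by (rule measurable_restrict_space1)
  then have meas: "(\<lambda>x. ennreal \<bar>F x\<bar> / ennreal l) \<in> borel_measurable (restrict_space M ?I)"
  proof -
    have "restrict_space ?N ?I = restrict_space M (E \<inter> ?I)"
      using E IM by (intro restrict_restrict_space) auto
    moreover have "E \<inter> ?I = ?I" by auto
    ultimately show "(\<lambda>x. ennreal \<bar>F x\<bar> / ennreal l) \<in> borel_measurable (restrict_space ?N ?I)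
      \<Longrightarrow> (\<lambda>x. ennreal \<bar>F x\<bar> / ennreal l) \<in> borel_measurable (restrict_space M ?I)" by simp
  qed
  have ess: "esssup (restrict_space M ?I) (\<lambda>x. ennreal \<bar>F x\<bar> / ennreal l) = 0"
    unfolding esssup_eq_AE[OF meas] using AEz by (simp add: bot_ennreal)
  have "(\<integral>\<^sup>+x\<in>{x\<in>E. q x < \<infinity>}. ennreal_powr (ennreal \<bar>F x\<bar> / ennreal l) (enn2real (q x)) \<partial>M)
     = (\<integral>\<^sup>+x. ennreal ((\<bar>F x\<bar> / l) powr enn2real (q x)) * indicator E x \<partial>M)"
  proof (rule nn_integral_cong_AE)
    show "AE x in M. ennreal_powr (ennreal \<bar>F x\<bar> / ennreal l) (enn2real (q x)) * indicator {x \<in> E. q x < \<infinity>} x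
        = ennreal ((\<bar>F x\<bar> / l) powr enn2real (q x)) * indicator E x"
      using AEM by eventually_elim (use l in \<open>auto simp: indicator_def ennreal_powr_def divide_ennreal\<close>)
  qed
  also have "\<dots> = (\<integral>\<^sup>+x. ennreal ((\<bar>F x\<bar> / l) powr enn2real (q x)) \<partial>?N)"
    using E spE by (intro nn_integral_restrict_space[symmetric]) (simp add: Int_absorb2)
  finally show ?thesis by (simp only: modular_def ess add_0_right)
qed

locale bounded_exponent =
  fixes M :: "'a measure" and E :: "'a set" and q :: "'a \<Rightarrow> ennreal" and q2 :: real
  assumes E: "E \<in> sets M" and q_meas: "q \<in> borel_measurable (restrict_space M E)"
    and q_bounds: "AE x in restrict_space M E. q x < \<infinity> \<and> 1 \<le> enn2real (q x) \<and> enn2real (q x) \<le> q2"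
begin

abbreviation "mod1 F \<equiv> (\<integral>\<^sup>+x. ennreal (\<bar>F x\<bar> powr enn2real (q x)) \<partial>restrict_space M E)"

lemma mod_meas:
  assumes [measurable]: "F \<in> borel_measurable (restrict_space M E)"
  shows "(\<lambda>x. ennreal (\<bar>F x\<bar> powr enn2real (q x))) \<in> borel_measurable (restrict_space M E)"
proof -
  note q_meas [measurable]
  show ?thesis by measurable
qed

lemma mod_scaled_le:
  assumes F: "F \<in> borel_measurable (restrict_space M E)" and l: "0 < l"
  shows "mod1 (\<lambda>x. F x * l) \<le> ennreal (max 1 l powr q2) * mod1 F"
    "l \<le> 1 \<Longrightarrow> mod1 (\<lambda>x. F x * l) \<le> ennreal l * mod1 F"
proof -
  have "mod1 (\<lambda>x. F x * l) \<le> (\<integral>\<^sup>+x. ennreal (max 1 l powr q2) * ennreal (\<bar>F x\<bar> powr enn2real (q x)) \<partial>restrict_space M E)"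
  proof (rule nn_integral_mono_AE)
    show "AE x in restrict_space M E. ennreal (\<bar>F x * l\<bar> powr enn2real (q x))
        \<le> ennreal (max 1 l powr q2) * ennreal (\<bar>F x\<bar> powr enn2real (q x))"
      using q_bounds
    proof eventually_elim
      case (elim x)
      have "l powr enn2real (q x) \<le> max 1 l powr enn2real (q x)"
        using l elim by (intro powr_mono2) auto
      also have "\<dots> \<le> max 1 l powr q2" using elim by (intro powr_mono) auto
      finally have "\<bar>F x\<bar> powr enn2real (q x) * l powr enn2real (q x) \<le> \<bar>F x\<bar> powr enn2real (q x) * max 1 l powr q2"
        by (intro mult_left_mono) auto
      then show ?case
        using l by (simp add: abs_mult powr_mult ennreal_mult'[symmetric] mult.commute)
    qed
  qed
  then show "mod1 (\<lambda>x. F x * l) \<le> ennreal (max 1 l powr q2) * mod1 F"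
    by (simp add: nn_integral_cmult[OF mod_meas[OF F]])
  assume l1: "l \<le> 1"
  have "mod1 (\<lambda>x. F x * l) \<le> (\<integral>\<^sup>+x. ennreal l * ennreal (\<bar>F x\<bar> powr enn2real (q x)) \<partial>restrict_space M E)"
  proof (rule nn_integral_mono_AE)
    show "AE x in restrict_space M E. ennreal (\<bar>F x * l\<bar> powr enn2real (q x))
        \<le> ennreal l * ennreal (\<bar>F x\<bar> powr enn2real (q x))"
      using q_bounds
    proof eventually_elim
      case (elim x)
      have "l powr enn2real (q x) \<le> l powr 1" using l l1 elim by (intro powr_mono') auto
      then have "\<bar>F x\<bar> powr enn2real (q x) * l powr enn2real (q x) \<le> \<bar>F x\<bar> powr enn2real (q x) * l"
        using l by (intro mult_left_mono) auto
      then show ?case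
        using l by (simp add: abs_mult powr_mult ennreal_mult'[symmetric] mult.commute)
    qed
  qed
  then show "mod1 (\<lambda>x. F x * l) \<le> ennreal l * mod1 F"
    by (simp add: nn_integral_cmult[OF mod_meas[OF F]])
qed

lemma Lp_norm_eq:
  assumes F: "F \<in> borel_measurable (restrict_space M E)"
  shows "Lp_norm M E q (\<lambda>x. ennreal \<bar>F x\<bar>) = Inf {ennreal l |l. 0 < l \<and> mod1 (\<lambda>x. F x * inverse l) \<le> 1}"
proof -
  have "AE x in restrict_space M E. q x < \<infinity>" using q_bounds by eventually_elim simp
  then have "modular M E q (\<lambda>x. ennreal \<bar>F x\<bar> / ennreal l) = mod1 (\<lambda>x. F x * inverse l)" if "0 < l" for l
    using modular_bounded_exponent_eq[OF E q_meas _ F that] that by (simp add: abs_mult divide_inverse)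
  then show ?thesis unfolding Lp_norm_def by (intro arg_cong[where f = Inf]) auto
qed

text \<open>For a bounded exponent, scaling a function by \<open>l\<close> changes its modular by at most a power of \<open>l\<close>. Hence the
  norm and the modular are finite together and small together.\<close>

lemma Lp_norm_finite_iff:
  assumes F: "F \<in> borel_measurable (restrict_space M E)"
  shows "Lp_norm M E q (\<lambda>x. ennreal \<bar>F x\<bar>) < \<infinity> \<longleftrightarrow> mod1 F < \<infinity>"
proof
  assume "Lp_norm M E q (\<lambda>x. ennreal \<bar>F x\<bar>) < \<infinity>"
  then obtain l where l: "0 < l" "mod1 (\<lambda>x. F x * inverse l) \<le> 1"
    unfolding Lp_norm_eq[OF F] Inf_less_iff by auto
  have "mod1 (\<lambda>x. (F x * inverse l) * l) \<le> ennreal (max 1 l powr q2) * mod1 (\<lambda>x. F x * inverse l)"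
    using F l by (intro mod_scaled_le) auto
  also have "\<dots> \<le> ennreal (max 1 l powr q2) * 1" using l by (intro mult_left_mono) auto
  finally show "mod1 F < \<infinity>" using l(1) by (simp add: mult.assoc le_less_trans)
next
  assume fin: "mod1 F < \<infinity>"
  define l where "l = max 1 (enn2real (mod1 F))"
  have "mod1 F = ennreal (enn2real (mod1 F))" using fin by simp
  also have "\<dots> \<le> ennreal l" by (intro ennreal_leI) (simp add: l_def)
  finally have l: "1 \<le> l" "mod1 F \<le> ennreal l" by (simp_all add: l_def)
  have "mod1 (\<lambda>x. F x * inverse l) \<le> ennreal (inverse l) * mod1 F"
    using l(1) by (intro mod_scaled_le(2)[OF F]) (auto simp: field_simps)
  also have "\<dots> \<le> ennreal (inverse l) * ennreal l" using l by (intro mult_left_mono) auto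
  also have "\<dots> = 1" using l(1) by (simp add: ennreal_mult'[symmetric])
  finally have "Lp_norm M E q (\<lambda>x. ennreal \<bar>F x\<bar>) \<le> ennreal l"
    unfolding Lp_norm_eq[OF F] using l(1) by (intro Inf_lower) auto
  then show "Lp_norm M E q (\<lambda>x. ennreal \<bar>F x\<bar>) < \<infinity>" by (simp add: le_less_trans)
qed

lemma Lp_norm_small_imp_mod_small:
  assumes F: "F \<in> borel_measurable (restrict_space M E)" and e: "e \<le> 1"
    and small: "Lp_norm M E q (\<lambda>x. ennreal \<bar>F x\<bar>) < ennreal e"
  shows "mod1 F \<le> ennreal e"
proof -
  obtain l where l: "0 < l" "ennreal l < ennreal e" "mod1 (\<lambda>x. F x * inverse l) \<le> 1"
    using small unfolding Lp_norm_eq[OF F] Inf_less_iff by auto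
  have le: "l < e" using l by (simp add: ennreal_less_iff)
  have "mod1 (\<lambda>x. (F x * inverse l) * l) \<le> ennreal l * mod1 (\<lambda>x. F x * inverse l)"
    using F l le e by (intro mod_scaled_le(2)) auto
  also have "\<dots> \<le> ennreal l * 1" using l by (intro mult_left_mono) auto
  finally show ?thesis using l le by (simp add: mult.assoc)
qed

lemma mod_small_imp_Lp_norm_small:
  assumes F: "F \<in> borel_measurable (restrict_space M E)" and l: "0 < l" "l \<le> 1"
    and small: "mod1 F \<le> ennreal (l powr q2)"
  shows "Lp_norm M E q (\<lambda>x. ennreal \<bar>F x\<bar>) \<le> ennreal l"
proof -
  have "max 1 (inverse l) = inverse l" using l by (simp add: max_def field_simps)
  then have "mod1 (\<lambda>x. F x * inverse l) \<le> ennreal (inverse l powr q2) * mod1 F"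
    using mod_scaled_le(1)[OF F, of "inverse l"] l by simp
  also have "\<dots> \<le> ennreal (inverse l powr q2) * ennreal (l powr q2)" using small by (intro mult_left_mono) auto
  also have "\<dots> = 1" using l by (simp add: ennreal_mult'[symmetric] powr_mult[symmetric])
  finally show ?thesis unfolding Lp_norm_eq[OF F] using l by (intro Inf_lower) auto
qed

lemma Lp_norm_zero_imp_AE_zero:
  assumes F: "F \<in> borel_measurable (restrict_space M E)"
    and z: "Lp_norm M E q (\<lambda>x. ennreal \<bar>F x\<bar>) = 0"
  shows "AE x in restrict_space M E. F x = 0"
proof -
  have "mod1 F \<le> 0"
  proof (rule ennreal_le_epsilon)
    fix e :: real assume "0 < e"
    then have "mod1 F \<le> ennreal (min 1 e)"
      using z by (intro Lp_norm_small_imp_mod_small[OF F]) auto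
    also have "\<dots> \<le> ennreal e" by (intro ennreal_leI) simp
    finally show "mod1 F \<le> 0 + ennreal e" by simp
  qed
  then have "AE x in restrict_space M E. ennreal (\<bar>F x\<bar> powr enn2real (q x)) = 0"
    by (subst nn_integral_0_iff_AE[symmetric]) (use mod_meas[OF F] in auto)
  then show ?thesis by eventually_elim simp
qed

lemma wLp_iff:
  assumes w: "w \<in> borel_measurable (restrict_space M E)"
  shows "f \<in> wLp M E q w \<longleftrightarrow> f \<in> borel_measurable (restrict_space M E) \<and> mod1 (\<lambda>x. f x * w x) < \<infinity>"
  unfolding wLp_def wLp_norm_def using w Lp_norm_finite_iff[of "\<lambda>x. f x * w x"] by auto

end

section \<open>The weighted Sobolev space in terms of modulars\<close>

text \<open>The Muckenhoupt condition enters through the last assumption, which says that \<open>\<omega>\<^sup>-\<^sup>1\<close> lies in the dual space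
  over \<open>\<Omega>\<close>.\<close>

locale weighted_domain = carnot_open G \<Omega>
  for G :: "('g::{t2_space, second_countable_topology}, 'e::euclidean_space, 'n::finite) carnot" and \<Omega> +
  fixes p :: "'g \<Rightarrow> ennreal" and \<omega> :: "'g \<Rightarrow> real" and p1 p2 :: real
  assumes p_meas [measurable]: "p \<in> borel_measurable (restrict_space (vol G) \<Omega>)"
    and p1: "1 < p1" and p12: "p1 \<le> p2"
    and p_bounds: "AE x in restrict_space (vol G) \<Omega>. p x < \<infinity> \<and> p1 \<le> enn2real (p x) \<and> enn2real (p x) \<le> p2"
    and \<omega>_meas [measurable]: "\<omega> \<in> borel_measurable (restrict_space (vol G) \<Omega>)"
    and \<omega>_pos: "AE x in restrict_space (vol G) \<Omega>. 0 < \<omega> x"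
    and dual_finite: "(\<integral>\<^sup>+x. ennreal ((1 / \<omega> x) powr (enn2real (p x) / (enn2real (p x) - 1))) \<partial>restrict_space (vol G) \<Omega>) < \<infinity>"
begin

abbreviation "\<mu> \<equiv> restrict_space (vol G) \<Omega>"
abbreviation "P x \<equiv> enn2real (p x)"
abbreviation "W0 \<equiv> sobolev0 G \<Omega> p \<omega>"
abbreviation "W1 \<equiv> sobolev G \<Omega> p \<omega>"
abbreviation "grad u \<equiv> hgrad G \<Omega> u"

sublocale exponent: bounded_exponent "vol G" \<Omega> p p2
proof unfold_locales
  show "AE x in restrict_space (vol G) \<Omega>. p x < \<infinity> \<and> 1 \<le> P x \<and> P x \<le> p2"
    using p_bounds by eventually_elim (use p1 in auto)
qed (use p1 p12 in auto)

lemma AE_\<mu>: "(AE x in \<mu>. Q x) \<longleftrightarrow> (AE x\<in>\<Omega> in vol G. Q x)"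
  by (simp add: AE_restrict_space_iff)

lemma good_AE: "AE x in \<mu>. 0 < \<omega> x \<and> p1 \<le> P x \<and> P x \<le> p2"
  using p_bounds \<omega>_pos by eventually_elim simp

text \<open>Norm convergence is expressed through this modular. It is not homogeneous, but it is an integral, so
  that Fatou's lemma and pointwise inequalities apply to it directly.\<close>

definition rho :: "('g \<Rightarrow> 'v::euclidean_space) \<Rightarrow> ennreal" where
  "rho F = (\<integral>\<^sup>+x. ennreal ((norm (F x) * \<omega> x) powr P x) \<partial>\<mu>)"

lemma rho_meas: assumes [measurable]: "F \<in> borel_measurable \<mu>"
  shows "(\<lambda>x. ennreal ((norm (F x) * \<omega> x) powr P x)) \<in> borel_measurable \<mu>"
  by measurable

lemma rho_cong: "AE x in \<mu>. F x = H x \<Longrightarrow> rho F = rho H"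
  unfolding rho_def by (intro nn_integral_cong_AE) (auto elim!: eventually_mono)

lemma rho_mono:
  fixes F :: "'g \<Rightarrow> 'v::euclidean_space" and H :: "'g \<Rightarrow> 'w::euclidean_space"
  assumes "AE x in \<mu>. norm (F x) \<le> norm (H x)" shows "rho F \<le> rho H"
  unfolding rho_def
proof (rule nn_integral_mono_AE)
  show "AE x in \<mu>. ennreal ((norm (F x) * \<omega> x) powr P x) \<le> ennreal ((norm (H x) * \<omega> x) powr P x)"
    using assms good_AE
    by eventually_elim (use p1 in \<open>auto intro!: ennreal_leI powr_mono2 mult_right_mono\<close>)
qed

lemma rho_scale:
  fixes F :: "'g \<Rightarrow> 'v::euclidean_space"
  assumes F: "F \<in> borel_measurable \<mu>"
  shows "rho (\<lambda>x. c *\<^sub>R F x) \<le> ennreal (max 1 \<bar>c\<bar> powr p2) * rho F"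
proof -
  have "rho (\<lambda>x. c *\<^sub>R F x) \<le> (\<integral>\<^sup>+x. ennreal (max 1 \<bar>c\<bar> powr p2) * ennreal ((norm (F x) * \<omega> x) powr P x) \<partial>\<mu>)"
    unfolding rho_def
  proof (rule nn_integral_mono_AE)
    show "AE x in \<mu>. ennreal ((norm (c *\<^sub>R F x) * \<omega> x) powr P x)
        \<le> ennreal (max 1 \<bar>c\<bar> powr p2) * ennreal ((norm (F x) * \<omega> x) powr P x)"
      using good_AE
    proof eventually_elim
      case (elim x)
      have "\<bar>c\<bar> powr P x \<le> max 1 \<bar>c\<bar> powr P x" using elim p1 by (intro powr_mono2) auto
      also have "\<dots> \<le> max 1 \<bar>c\<bar> powr p2" using elim by (intro powr_mono) auto
      finally have "\<bar>c\<bar> powr P x * (norm (F x) * \<omega> x) powr P x \<le> max 1 \<bar>c\<bar> powr p2 * (norm (F x) * \<omega> x) powr P x"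
        by (intro mult_right_mono) auto
      then show ?case using elim by (simp add: powr_mult ennreal_mult'[symmetric] mult.assoc)
    qed
  qed
  then show ?thesis by (simp add: rho_def nn_integral_cmult[OF rho_meas[OF F]])
qed

lemma rho_add:
  fixes F H :: "'g \<Rightarrow> 'v::euclidean_space"
  assumes F: "F \<in> borel_measurable \<mu>" and H: "H \<in> borel_measurable \<mu>"
  shows "rho (\<lambda>x. F x + H x) \<le> ennreal (2 powr p2) * (rho F + rho H)"
proof -
  have "rho (\<lambda>x. F x + H x) \<le> (\<integral>\<^sup>+x. ennreal (2 powr p2) * (ennreal ((norm (F x) * \<omega> x) powr P x)
      + ennreal ((norm (H x) * \<omega> x) powr P x)) \<partial>\<mu>)"
    unfolding rho_def
  proof (rule nn_integral_mono_AE)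
    show "AE x in \<mu>. ennreal ((norm (F x + H x) * \<omega> x) powr P x)
        \<le> ennreal (2 powr p2) * (ennreal ((norm (F x) * \<omega> x) powr P x) + ennreal ((norm (H x) * \<omega> x) powr P x))"
      using good_AE
    proof eventually_elim
      case (elim x)
      let ?m = "max (norm (F x)) (norm (H x)) * \<omega> x"
      have "norm (F x + H x) \<le> 2 * max (norm (F x)) (norm (H x))"
        using norm_triangle_ineq[of "F x" "H x"] by linarith
      then have "norm (F x + H x) * \<omega> x \<le> 2 * max (norm (F x)) (norm (H x)) * \<omega> x"
        using elim by (intro mult_right_mono) auto
      then have "(norm (F x + H x) * \<omega> x) powr P x \<le> (2 * ?m) powr P x"
        using elim p1 by (intro powr_mono2) (auto simp: mult.assoc)
      also have "\<dots> = 2 powr P x * ?m powr P x"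
        using elim by (intro powr_mult)
      also have "\<dots> \<le> 2 powr p2 * ?m powr P x" using elim by (intro mult_right_mono powr_mono) auto
      also have "?m powr P x \<le> (norm (F x) * \<omega> x) powr P x + (norm (H x) * \<omega> x) powr P x"
        by (cases "norm (F x) \<le> norm (H x)") (simp_all add: max_def)
      finally have "(norm (F x + H x) * \<omega> x) powr P x
          \<le> 2 powr p2 * ((norm (F x) * \<omega> x) powr P x + (norm (H x) * \<omega> x) powr P x)" by simp
      then show ?case by (simp add: ennreal_mult'[symmetric] ennreal_plus[symmetric] del: ennreal_plus)
    qed
  qed
  also have "\<dots> = ennreal (2 powr p2) * (rho F + rho H)"
    using rho_meas[OF F] rho_meas[OF H] by (simp add: rho_def nn_integral_cmult nn_integral_add)
  finally show ?thesis .
qed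

lemma rho_zero [simp]: "rho (\<lambda>x. 0) = 0" by (simp add: rho_def)

lemma rho_zero_imp:
  assumes "F \<in> borel_measurable \<mu>" "rho F = 0" shows "AE x in \<mu>. F x = 0"
proof -
  have "AE x in \<mu>. ennreal ((norm (F x) * \<omega> x) powr P x) = 0"
    using assms(2) unfolding rho_def by (subst nn_integral_0_iff_AE[symmetric]) (use rho_meas[OF assms(1)] in auto)
  with good_AE show ?thesis by eventually_elim auto
qed

definition dual_mass :: real where
  "dual_mass = enn2real (\<integral>\<^sup>+x. ennreal ((1 / \<omega> x) powr (P x / (P x - 1))) \<partial>\<mu>)"

lemma young:
  fixes a b r :: real
  assumes "0 \<le> a" "0 \<le> b" "1 < r" shows "a * b \<le> a powr r + b powr (r / (r - 1))"
proof -
  have "a * b \<le> a powr r / r + b powr (r / (r - 1)) / (r / (r - 1))"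
    by (rule Youngs_inequality) (use assms in \<open>auto simp: field_simps\<close>)
  also have "\<dots> \<le> a powr r / 1 + b powr (r / (r - 1)) / 1"
    using assms by (intro add_mono divide_left_mono) (auto simp: pos_le_divide_eq)
  finally have "a * b \<le> a powr r / 1 + b powr (r / (r - 1)) / 1" .
  then show ?thesis by simp
qed

text \<open>Young's inequality with a parameter. Because \<open>\<omega>\<^sup>-\<^sup>1\<close> has finite dual modular on \<open>\<Omega>\<close>,
  convergence in the modular implies convergence in \<open>L\<^sup>1(\<Omega>)\<close>.\<close>

lemma L1_le_rho:
  fixes F :: "'g \<Rightarrow> 'v::euclidean_space"
  assumes F: "F \<in> borel_measurable \<mu>" and e: "0 < e" "e \<le> 1"
  shows "(\<integral>\<^sup>+x. ennreal (norm (F x)) \<partial>\<mu>) \<le> ennreal (inverse e powr p2) * rho F + ennreal (e * dual_mass)"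
proof -
  let ?d = "\<lambda>x. ennreal ((1 / \<omega> x) powr (P x / (P x - 1)))"
  have "(\<integral>\<^sup>+x. ennreal (norm (F x)) \<partial>\<mu>)
      \<le> (\<integral>\<^sup>+x. ennreal (inverse e powr p2) * ennreal ((norm (F x) * \<omega> x) powr P x) + ennreal e * ?d x \<partial>\<mu>)"
  proof (rule nn_integral_mono_AE)
    show "AE x in \<mu>. ennreal (norm (F x))
      \<le> ennreal (inverse e powr p2) * ennreal ((norm (F x) * \<omega> x) powr P x) + ennreal e * ?d x"
      using good_AE
    proof eventually_elim
      case (elim x)
      let ?a = "norm (F x) * \<omega> x" and ?r = "P x / (P x - 1)"
      have P1: "1 < P x" using elim p1 by simp
      have r1: "1 \<le> ?r" using P1 by (simp add: field_simps)
      have "norm (F x) = (inverse e * ?a) * (e * (1 / \<omega> x))" using elim e by simp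
      also have "\<dots> \<le> (inverse e * ?a) powr P x + (e * (1 / \<omega> x)) powr ?r"
        using elim e P1 by (intro young) auto
      also have "(inverse e * ?a) powr P x = inverse e powr P x * ?a powr P x"
        using elim e by (intro powr_mult)
      also have "\<dots> \<le> inverse e powr p2 * ?a powr P x"
        using elim e by (intro mult_right_mono powr_mono) (auto simp: one_le_inverse_iff)
      also have "(e * (1 / \<omega> x)) powr ?r = e powr ?r * (1 / \<omega> x) powr ?r"
        using elim e by (intro powr_mult)
      also have "e powr ?r \<le> e powr 1" using e r1 by (intro powr_mono') auto
      finally have "norm (F x) \<le> inverse e powr p2 * ?a powr P x + e * (1 / \<omega> x) powr ?r"
        using e by (simp add: mult_right_mono)
      then have "ennreal (norm (F x)) \<le> ennreal (inverse e powr p2 * ?a powr P x + e * (1 / \<omega> x) powr ?r)"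
        by (rule ennreal_leI)
      then show ?case using e by (simp add: ennreal_mult')
    qed
  qed
  also have "\<dots> = ennreal (inverse e powr p2) * rho F + ennreal e * (\<integral>\<^sup>+x. ?d x \<partial>\<mu>)"
    using rho_meas[OF F] by (simp add: rho_def nn_integral_add nn_integral_cmult)
  also have "(\<integral>\<^sup>+x. ?d x \<partial>\<mu>) = ennreal dual_mass"
    using dual_finite by (simp add: dual_mass_def)
  finally show ?thesis using e by (simp add: ennreal_mult' dual_mass_def)
qed

lemma rho_finite_imp_integrable:
  fixes F :: "'g \<Rightarrow> 'v::euclidean_space"
  assumes F: "F \<in> borel_measurable \<mu>" "rho F < \<infinity>" shows "integrable \<mu> F"
  unfolding integrable_iff_bounded
proof
  have "(\<integral>\<^sup>+x. ennreal (norm (F x)) \<partial>\<mu>) \<le> ennreal (inverse 1 powr p2) * rho F + ennreal (1 * dual_mass)"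
    by (rule L1_le_rho[OF F(1)]) auto
  also have "\<dots> < \<infinity>" using F(2) by (simp add: ennreal_mult_less_top)
  finally show "(\<integral>\<^sup>+x. ennreal (norm (F x)) \<partial>\<mu>) < \<infinity>" .
qed (rule F(1))

lemma rho_component:
  fixes D :: "'g \<Rightarrow> real^'n"
  shows "rho (\<lambda>x. D x $ j) \<le> rho D"
  by (intro rho_mono) (simp add: component_le_norm_cart)

lemma rho_le_components:
  fixes D :: "'g \<Rightarrow> real^'n"
  assumes D: "\<And>j. (\<lambda>x. D x $ j) \<in> borel_measurable \<mu>"
  shows "rho D \<le> (\<Sum>j\<in>UNIV. ennreal (real CARD('n) powr p2) * rho (\<lambda>x. D x $ j))"
proof -
  let ?n = "real CARD('n)"
  have "rho D \<le> (\<integral>\<^sup>+x. (\<Sum>j\<in>UNIV. ennreal ((norm (?n *\<^sub>R (D x $ j)) * \<omega> x) powr P x)) \<partial>\<mu>)"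
    unfolding rho_def
  proof (rule nn_integral_mono_AE)
    show "AE x in \<mu>. ennreal ((norm (D x) * \<omega> x) powr P x) \<le> (\<Sum>j\<in>UNIV. ennreal ((norm (?n *\<^sub>R (D x $ j)) * \<omega> x) powr P x))"
      using good_AE
    proof eventually_elim
      case (elim x)
      obtain j where j: "\<And>i. \<bar>D x $ i\<bar> \<le> \<bar>D x $ j\<bar>"
      proof -
        have "Max (range (\<lambda>i. \<bar>D x $ i\<bar>)) \<in> range (\<lambda>i. \<bar>D x $ i\<bar>)" by (rule Max_in) auto
        then obtain j where "Max (range (\<lambda>i. \<bar>D x $ i\<bar>)) = \<bar>D x $ j\<bar>" by (rule rangeE)
        then have "\<bar>D x $ i\<bar> \<le> \<bar>D x $ j\<bar>" for i using Max_ge[of "range (\<lambda>i. \<bar>D x $ i\<bar>)"] by simp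
        then show thesis using that by blast
      qed
      have "norm (D x) \<le> (\<Sum>i\<in>UNIV. \<bar>D x $ i\<bar>)" by (rule norm_le_l1_cart)
      also have "\<dots> \<le> (\<Sum>i\<in>(UNIV::'n set). \<bar>D x $ j\<bar>)" by (intro sum_mono j)
      finally have "norm (D x) \<le> norm (?n *\<^sub>R (D x $ j))" by simp
      then have "(norm (D x) * \<omega> x) powr P x \<le> (norm (?n *\<^sub>R (D x $ j)) * \<omega> x) powr P x"
        using elim p1 by (intro powr_mono2 mult_right_mono) auto
      then have "ennreal ((norm (D x) * \<omega> x) powr P x) \<le> ennreal ((norm (?n *\<^sub>R (D x $ j)) * \<omega> x) powr P x)"
        by (rule ennreal_leI)
      also have "\<dots> \<le> (\<Sum>j\<in>UNIV. ennreal ((norm (?n *\<^sub>R (D x $ j)) * \<omega> x) powr P x))"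
        by (rule member_le_sum) auto
      finally show ?case .
    qed
  qed
  also have "\<dots> = (\<Sum>j\<in>UNIV. rho (\<lambda>x. ?n *\<^sub>R (D x $ j)))"
    unfolding rho_def using D by (intro nn_integral_sum rho_meas) auto
  also have "\<dots> \<le> (\<Sum>j\<in>UNIV. ennreal (max 1 \<bar>?n\<bar> powr p2) * rho (\<lambda>x. D x $ j))"
    by (intro sum_mono rho_scale D)
  also have "max 1 \<bar>?n\<bar> = ?n" by (simp add: Suc_leI max_def)
  finally show ?thesis .
qed

lemma mod1_eq_rho: "exponent.mod1 (\<lambda>x. f x * \<omega> x) = rho f"
  unfolding rho_def
  by (rule nn_integral_cong_AE) (use good_AE in \<open>eventually_elim, simp add: abs_mult\<close>)

lemma wLp_iff_rho: "f \<in> wLp (vol G) \<Omega> p \<omega> \<longleftrightarrow> f \<in> borel_measurable \<mu> \<and> rho f < \<infinity>"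
  using exponent.wLp_iff[OF \<omega>_meas] by (simp add: mod1_eq_rho)

lemma sobolev_iff:
  "u \<in> W1 \<longleftrightarrow> weakly_differentiable u \<and> rho u < \<infinity> \<and> rho (grad u) < \<infinity>"
proof
  assume u: "u \<in> W1"
  then have wd: "weakly_differentiable u" by (auto simp: sobolev_def weakly_differentiable_def)
  have "rho (\<lambda>x. grad u x $ j) < \<infinity>" for j
  proof -
    obtain g where g: "g \<in> wLp (vol G) \<Omega> p \<omega>" "weak_deriv G \<Omega> j u g" using u by (auto simp: sobolev_def)
    have "rho (\<lambda>x. grad u x $ j) = rho g"
      by (intro rho_cong) (use weak_deriv_unique[OF hgrad_weak_deriv[OF wd] g(2)] AE_\<mu> in simp)
    then show ?thesis using g(1) by (simp add: wLp_iff_rho)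
  qed
  then have "(\<Sum>j\<in>UNIV. ennreal (real CARD('n) powr p2) * rho (\<lambda>x. grad u x $ j)) < \<infinity>"
    by (simp add: ennreal_mult_less_top)
  then have "rho (grad u) < \<infinity>"
    using rho_le_components[of "grad u"] weak_deriv_measurable(2)[OF hgrad_weak_deriv[OF wd]] le_less_trans by blast
  then show "weakly_differentiable u \<and> rho u < \<infinity> \<and> rho (grad u) < \<infinity>"
    using wd u by (simp add: sobolev_def wLp_iff_rho)
next
  assume u: "weakly_differentiable u \<and> rho u < \<infinity> \<and> rho (grad u) < \<infinity>"
  have w: "(\<lambda>x. grad u x $ j) \<in> wLp (vol G) \<Omega> p \<omega>" for j
    using u rho_component[of "grad u" j] weak_deriv_measurable(2)[OF hgrad_weak_deriv, of u j]
    by (auto simp: wLp_iff_rho intro: le_less_trans)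
  have "\<exists>g\<in>wLp (vol G) \<Omega> p \<omega>. weak_deriv G \<Omega> j u g" for j
    using w[of j] hgrad_weak_deriv u by blast
  then show "u \<in> W1"
    using u weak_deriv_measurable(1)[OF hgrad_weak_deriv, of u]
    by (simp add: sobolev_def wLp_iff_rho)
qed

lemma sobolevD:
  assumes "u \<in> W1"
  shows "weakly_differentiable u" "rho u < \<infinity>" "rho (grad u) < \<infinity>" "u \<in> borel_measurable \<mu>" "grad u \<in> borel_measurable \<mu>"
  using assms weak_deriv_measurable(1)[OF hgrad_weak_deriv, of u] hgrad_measurable[of u]
  by (auto simp: sobolev_iff)

lemma grad_linear:
  assumes "u \<in> W1" "v \<in> W1"
  shows "AE x in \<mu>. grad (\<lambda>x. a * u x + b * v x) x = a *\<^sub>R grad u x + b *\<^sub>R grad v x"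
  using hgrad_linear[OF sobolevD(1) sobolevD(1), OF assms] by (simp add: AE_\<mu>)

lemma grad_diff:
  assumes "u \<in> W1" "v \<in> W1"
  shows "AE x in \<mu>. grad (\<lambda>x. u x - v x) x = grad u x - grad v x"
  using grad_linear[OF assms, of 1 "-1"] by simp

definition lin_const :: "real \<Rightarrow> real \<Rightarrow> ennreal" where
  "lin_const a b = ennreal (2 powr p2) * (ennreal (max 1 \<bar>a\<bar> powr p2) + ennreal (max 1 \<bar>b\<bar> powr p2))"

lemma lin_const_finite: "lin_const a b < \<infinity>"
  by (simp add: lin_const_def ennreal_mult_less_top)

lemma rho_linear_le:
  fixes F H :: "'g \<Rightarrow> 'v::euclidean_space"
  assumes F: "F \<in> borel_measurable \<mu>" and H: "H \<in> borel_measurable \<mu>"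
  shows "rho (\<lambda>x. a *\<^sub>R F x + b *\<^sub>R H x) \<le> lin_const a b * (rho F + rho H)"
proof -
  let ?A = "ennreal (max 1 \<bar>a\<bar> powr p2)" and ?B = "ennreal (max 1 \<bar>b\<bar> powr p2)"
  have "rho (\<lambda>x. a *\<^sub>R F x + b *\<^sub>R H x) \<le> ennreal (2 powr p2) * (rho (\<lambda>x. a *\<^sub>R F x) + rho (\<lambda>x. b *\<^sub>R H x))"
    using F H by (intro rho_add) auto
  also have "\<dots> \<le> ennreal (2 powr p2) * (?A * rho F + ?B * rho H)"
    using rho_scale[OF F] rho_scale[OF H] by (intro mult_left_mono add_mono) auto
  also have "\<dots> \<le> ennreal (2 powr p2) * ((?A + ?B) * rho F + (?A + ?B) * rho H)"
    by (intro mult_left_mono add_mono mult_right_mono) auto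
  finally show ?thesis by (simp only: lin_const_def distrib_left[symmetric] mult.assoc)
qed

lemma rho_linear_finite:
  fixes F H :: "'g \<Rightarrow> 'v::euclidean_space"
  assumes "F \<in> borel_measurable \<mu>" "H \<in> borel_measurable \<mu>" "rho F < \<infinity>" "rho H < \<infinity>"
  shows "rho (\<lambda>x. a *\<^sub>R F x + b *\<^sub>R H x) < \<infinity>"
proof -
  have "lin_const a b * (rho F + rho H) < \<infinity>"
    using assms(3,4) lin_const_finite by (simp add: ennreal_mult_less_top)
  then show ?thesis using rho_linear_le[OF assms(1,2)] by (rule le_less_trans[rotated])
qed

lemma sobolev_linear:
  assumes u: "u \<in> W1" and v: "v \<in> W1" shows "(\<lambda>x. a * u x + b * v x) \<in> W1"
proof -
  note U = sobolevD[OF u] and V = sobolevD[OF v]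
  have "rho (\<lambda>x. a * u x + b * v x) < \<infinity>"
    using rho_linear_finite[OF U(4) V(4) U(2) V(2), of a b] by simp
  moreover have "rho (\<lambda>x. a *\<^sub>R grad u x + b *\<^sub>R grad v x) < \<infinity>"
    using rho_linear_finite[OF U(5) V(5) U(3) V(3), of a b] .
  then have "rho (grad (\<lambda>x. a * u x + b * v x)) < \<infinity>" using rho_cong[OF grad_linear[OF u v]] by simp
  ultimately show ?thesis using weakly_differentiable_linear[OF U(1) V(1)] by (simp add: sobolev_iff)
qed

lemma sobolev_zero: "(\<lambda>x. 0) \<in> W1"
proof -
  have wd: "weak_deriv G \<Omega> j (\<lambda>x. 0) (\<lambda>x. (0::real^'n) $ j)" for j
    by (simp add: weak_deriv_def set_integrable_def set_lebesgue_integral_def)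
  then have "AE x in \<mu>. grad (\<lambda>x. 0) x = 0" using hgrad_unique[OF wd] by (simp add: AE_\<mu>)
  then have "rho (grad (\<lambda>x. 0)) = 0" using rho_cong[of "grad (\<lambda>x. 0)" "\<lambda>x. 0"] by simp
  moreover have "weakly_differentiable (\<lambda>x. 0)" using wd unfolding weakly_differentiable_def by blast
  ultimately show ?thesis by (simp add: sobolev_iff)
qed

text \<open>The modular counterpart of the Sobolev norm.\<close>

definition emod :: "('g \<Rightarrow> real) \<Rightarrow> ennreal" where "emod u = rho u + rho (grad u)"

lemma emod_linear_le:
  assumes u: "u \<in> W1" and v: "v \<in> W1"
  shows "emod (\<lambda>x. a * u x + b * v x) \<le> lin_const a b * (emod u + emod v)"
proof -
  note U = sobolevD[OF u] and V = sobolevD[OF v]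
  have "emod (\<lambda>x. a * u x + b * v x) = rho (\<lambda>x. a *\<^sub>R u x + b *\<^sub>R v x) + rho (\<lambda>x. a *\<^sub>R grad u x + b *\<^sub>R grad v x)"
    using rho_cong[OF grad_linear[OF u v]] by (simp add: emod_def)
  also have "\<dots> \<le> lin_const a b * (rho u + rho v) + lin_const a b * (rho (grad u) + rho (grad v))"
    by (intro add_mono rho_linear_le U V)
  also have "\<dots> = lin_const a b * (emod u + emod v)" by (simp add: emod_def distrib_left add_ac)
  finally show ?thesis .
qed

end

context weighted_domain
begin

section \<open>Completeness of \<open>W\<^sub>0\<close>\<close>

lemma share_le: "0 \<le> c \<Longrightarrow> 0 \<le> e \<Longrightarrow> c * (e / (c + 1) / 2 + e / (c + 1) / 2) \<le> (e::real)"
  by (simp add: pos_divide_le_eq add_nonneg_pos algebra_simps)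

lemma wLp_norm_eq: "wLp_norm (vol G) \<Omega> p \<omega> f = Lp_norm (vol G) \<Omega> p (\<lambda>x. ennreal \<bar>f x * \<omega> x\<bar>)"
  by (simp add: wLp_norm_def)

lemma small_norm_imp_rho:
  assumes "f \<in> borel_measurable \<mu>" "e \<le> 1" "wLp_norm (vol G) \<Omega> p \<omega> f < ennreal e"
  shows "rho f \<le> ennreal e"
  using exponent.Lp_norm_small_imp_mod_small[of "\<lambda>x. f x * \<omega> x" e] assms
  by (simp add: wLp_norm_eq mod1_eq_rho)

lemma small_rho_imp_norm:
  assumes "f \<in> borel_measurable \<mu>" "0 < l" "l \<le> 1" "rho f \<le> ennreal (l powr p2)"
  shows "wLp_norm (vol G) \<Omega> p \<omega> f \<le> ennreal l"
  using exponent.mod_small_imp_Lp_norm_small[of "\<lambda>x. f x * \<omega> x" l] assms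
  by (simp add: wLp_norm_eq mod1_eq_rho)

lemma small_sobolev_norm_imp_emod:
  assumes u: "u \<in> W1" and e: "0 \<le> e" "e \<le> 1" and small: "sobolev_norm G \<Omega> p \<omega> u < ennreal e"
  shows "emod u \<le> ennreal ((1 + real CARD('n) * real CARD('n) powr p2) * e)"
proof -
  note U = sobolevD[OF u]
  have Dj: "(\<lambda>x. grad u x $ j) \<in> borel_measurable \<mu>" for j
    by (rule weak_deriv_measurable(2)[OF hgrad_weak_deriv[OF U(1)]])
  have "wLp_norm (vol G) \<Omega> p \<omega> u < ennreal e"
    using small unfolding sobolev_norm_def by (rule le_less_trans[rotated]) simp
  then have 1: "rho u \<le> ennreal e" by (rule small_norm_imp_rho[OF U(4) e(2)])
  have 2: "rho (\<lambda>x. grad u x $ j) \<le> ennreal e" for j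
  proof (rule small_norm_imp_rho[OF Dj e(2)])
    have "wLp_norm (vol G) \<Omega> p \<omega> (\<lambda>x. grad u x $ j) \<le> (\<Sum>j\<in>UNIV. wLp_norm (vol G) \<Omega> p \<omega> (\<lambda>x. grad u x $ j))"
      by (rule member_le_sum) auto
    also have "\<dots> \<le> sobolev_norm G \<Omega> p \<omega> u" by (simp add: sobolev_norm_def)
    finally show "wLp_norm (vol G) \<Omega> p \<omega> (\<lambda>x. grad u x $ j) < ennreal e" using small by (rule le_less_trans)
  qed
  have "rho (grad u) \<le> (\<Sum>j\<in>(UNIV::'n set). ennreal (real CARD('n) powr p2) * ennreal e)"
    using rho_le_components[OF Dj] by (rule order_trans) (intro sum_mono mult_left_mono 2, simp)
  also have "\<dots> = ennreal (real CARD('n) * real CARD('n) powr p2 * e)"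
    using e by (simp add: ennreal_mult'[symmetric] ennreal_of_nat_eq_real_of_nat mult.assoc)
  finally have "emod u \<le> ennreal e + ennreal (real CARD('n) * real CARD('n) powr p2 * e)"
    unfolding emod_def using 1 by (intro add_mono)
  also have "\<dots> = ennreal ((1 + real CARD('n) * real CARD('n) powr p2) * e)"
    using e by (simp add: ennreal_plus[symmetric] algebra_simps del: ennreal_plus)
  finally show ?thesis .
qed

lemma small_emod_imp_sobolev_norm:
  assumes u: "u \<in> W1" and l: "0 < l" "l \<le> 1" and small: "emod u \<le> ennreal (l powr p2)"
  shows "sobolev_norm G \<Omega> p \<omega> u \<le> ennreal ((1 + real CARD('n)) * l)"
proof -
  note U = sobolevD[OF u]
  have r: "rho u \<le> ennreal (l powr p2)" "rho (grad u) \<le> ennreal (l powr p2)"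
    using small unfolding emod_def by (auto elim: order_trans[rotated])
  have Dj: "(\<lambda>x. grad u x $ j) \<in> borel_measurable \<mu>" for j
    by (rule weak_deriv_measurable(2)[OF hgrad_weak_deriv[OF U(1)]])
  have "wLp_norm (vol G) \<Omega> p \<omega> u \<le> ennreal l" by (rule small_rho_imp_norm[OF U(4) l r(1)])
  moreover have "wLp_norm (vol G) \<Omega> p \<omega> (\<lambda>x. grad u x $ j) \<le> ennreal l" for j
    by (rule small_rho_imp_norm[OF Dj l order_trans[OF rho_component r(2)]])
  ultimately have "sobolev_norm G \<Omega> p \<omega> u \<le> ennreal l + (\<Sum>j\<in>(UNIV::'n set). ennreal l)"
    unfolding sobolev_norm_def by (intro add_mono sum_mono)
  also have "\<dots> = ennreal ((1 + real CARD('n)) * l)"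
    using l by (simp add: ennreal_mult'[symmetric] ennreal_of_nat_eq_real_of_nat ennreal_plus[symmetric] algebra_simps del: ennreal_plus)
  finally show ?thesis .
qed

lemma sobolev_diff: "u \<in> W1 \<Longrightarrow> v \<in> W1 \<Longrightarrow> (\<lambda>x. u x - v x) \<in> W1"
  using sobolev_linear[of u v 1 "-1"] by simp

lemma sobolev0_iff:
  "u \<in> W0 \<longleftrightarrow> u \<in> W1 \<and> (\<forall>e>0. \<exists>\<phi>\<in>C1_0 G \<Omega> \<inter> W1. emod (\<lambda>x. u x - \<phi> x) \<le> ennreal e)"
proof (intro iffI conjI allI impI)
  assume "u \<in> W0"
  then have u: "u \<in> W1" and ap: "\<And>e. e > 0 \<Longrightarrow> \<exists>\<phi>\<in>C1_0 G \<Omega> \<inter> W1. sobolev_norm G \<Omega> p \<omega> (\<lambda>x. u x - \<phi> x) < ennreal e"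
    by (auto simp: sobolev0_def)
  show "u \<in> W1" by fact
  fix e :: real assume e: "0 < e"
  let ?C = "1 + real CARD('n) * real CARD('n) powr p2"
  have C: "0 < ?C" by (simp add: add_pos_nonneg)
  define d where "d = min 1 (e / ?C)"
  have "?C * d \<le> ?C * (e / ?C)" using C by (intro mult_left_mono) (auto simp: d_def)
  also have "\<dots> = e" using C by simp
  finally have d: "0 < d" "d \<le> 1" "?C * d \<le> e" using e C by (auto simp: d_def)
  obtain \<phi> where \<phi>: "\<phi> \<in> C1_0 G \<Omega>" "\<phi> \<in> W1" "sobolev_norm G \<Omega> p \<omega> (\<lambda>x. u x - \<phi> x) < ennreal d"
    using ap[OF d(1)] by auto
  have "emod (\<lambda>x. u x - \<phi> x) \<le> ennreal (?C * d)"
    using d \<phi> u by (intro small_sobolev_norm_imp_emod sobolev_diff) auto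
  also have "\<dots> \<le> ennreal e" using d by (intro ennreal_leI)
  finally show "\<exists>\<phi>\<in>C1_0 G \<Omega> \<inter> W1. emod (\<lambda>x. u x - \<phi> x) \<le> ennreal e" using \<phi> by blast
next
  assume "u \<in> W1 \<and> (\<forall>e>0. \<exists>\<phi>\<in>C1_0 G \<Omega> \<inter> W1. emod (\<lambda>x. u x - \<phi> x) \<le> ennreal e)"
  then have u: "u \<in> W1" and ap: "\<And>e. e > 0 \<Longrightarrow> \<exists>\<phi>\<in>C1_0 G \<Omega> \<inter> W1. emod (\<lambda>x. u x - \<phi> x) \<le> ennreal e"
    by auto
  have "\<exists>\<phi>\<in>C1_0 G \<Omega> \<inter> W1. sobolev_norm G \<Omega> p \<omega> (\<lambda>x. u x - \<phi> x) < ennreal e" if e: "0 < e" for e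
  proof -
    define l where "l = min 1 (e / (2 * (1 + real CARD('n))))"
    have l: "0 < l" "l \<le> 1" "(1 + real CARD('n)) * l < e"
    proof -
      show "0 < l" "l \<le> 1" using e by (auto simp: l_def add_pos_nonneg)
      have "(1 + real CARD('n)) * l \<le> (1 + real CARD('n)) * (e / (2 * (1 + real CARD('n))))" by (intro mult_left_mono) (auto simp: l_def)
      also have "\<dots> < e" using e by (simp add: field_simps add_pos_nonneg)
      finally show "(1 + real CARD('n)) * l < e" .
    qed
    obtain \<phi> where \<phi>: "\<phi> \<in> C1_0 G \<Omega>" "\<phi> \<in> W1" "emod (\<lambda>x. u x - \<phi> x) \<le> ennreal (l powr p2)"
      using ap[of "l powr p2"] l by auto
    have "sobolev_norm G \<Omega> p \<omega> (\<lambda>x. u x - \<phi> x) \<le> ennreal ((1 + real CARD('n)) * l)"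
      using l \<phi> u by (intro small_emod_imp_sobolev_norm sobolev_diff) auto
    also have "\<dots> < ennreal e" using l e by (intro ennreal_lessI)
    finally show ?thesis using \<phi> by blast
  qed
  then show "u \<in> W0" using u by (simp add: sobolev0_def)
qed

lemma C1_0_linear:
  assumes "\<phi> \<in> C1_0 G \<Omega>" "\<theta> \<in> C1_0 G \<Omega>" shows "(\<lambda>x. a * \<phi> x + b * \<theta> x) \<in> C1_0 G \<Omega>"
proof -
  let ?K = "closure {x. \<phi> x \<noteq> 0} \<union> closure {x. \<theta> x \<noteq> 0}"
  have K: "compact ?K" "?K \<subseteq> \<Omega>" using assms by (auto simp: C1_0_def compactly_supported_def)
  have "{x. a * \<phi> x + b * \<theta> x \<noteq> 0} \<subseteq> {x. \<phi> x \<noteq> 0} \<union> {x. \<theta> x \<noteq> 0}" by auto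
  also have "\<dots> \<subseteq> ?K" by (intro Un_mono closure_subset)
  finally have cl: "closure {x. a * \<phi> x + b * \<theta> x \<noteq> 0} \<subseteq> ?K"
    using K(1) by (simp add: closure_minimal compact_imp_closed)
  then have "compact (closure {x. a * \<phi> x + b * \<theta> x \<noteq> 0})"
    using compact_Int_closed[OF K(1) closed_closure, of "{x. a * \<phi> x + b * \<theta> x \<noteq> 0}"] by (simp add: Int_absorb1)
  moreover have "Ck_fun \<A> 1 (\<lambda>x. a * \<phi> x + b * \<theta> x)"
    using assms by (intro Ck_fun_add Ck_fun_mult Ck_fun_const atlas) (auto simp: C1_0_def)
  ultimately show ?thesis using cl K(2) by (auto simp: C1_0_def compactly_supported_def)
qed

lemma sobolev0_subset: "u \<in> W0 \<Longrightarrow> u \<in> W1" by (simp add: sobolev0_def)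

lemma sobolev0_linear:
  assumes u: "u \<in> W0" and v: "v \<in> W0" shows "(\<lambda>x. a * u x + b * v x) \<in> W0"
  unfolding sobolev0_iff
proof (intro conjI allI impI)
  show "(\<lambda>x. a * u x + b * v x) \<in> W1" by (intro sobolev_linear sobolev0_subset u v)
  fix e :: real assume e: "0 < e"
  obtain c where c: "lin_const a b = ennreal c" "0 \<le> c" using lin_const_finite[of a b] by (cases "lin_const a b") auto
  define d where "d = e / (c + 1) / 2"
  have d: "0 < d" "c * (d + d) \<le> e" using e c share_le[of c e] by (auto simp: d_def add_nonneg_pos)
  obtain \<phi> \<theta> where \<phi>: "\<phi> \<in> C1_0 G \<Omega>" "\<phi> \<in> W1" "emod (\<lambda>x. u x - \<phi> x) \<le> ennreal d"
    and \<theta>: "\<theta> \<in> C1_0 G \<Omega>" "\<theta> \<in> W1" "emod (\<lambda>x. v x - \<theta> x) \<le> ennreal d"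
    using u v d(1) unfolding sobolev0_iff by blast
  have "emod (\<lambda>x. a * (u x - \<phi> x) + b * (v x - \<theta> x)) \<le> lin_const a b * (emod (\<lambda>x. u x - \<phi> x) + emod (\<lambda>x. v x - \<theta> x))"
    by (intro emod_linear_le sobolev_diff sobolev0_subset u v \<phi> \<theta>)
  also have "\<dots> \<le> ennreal c * (ennreal d + ennreal d)"
    unfolding c(1) by (intro mult_left_mono add_mono \<phi> \<theta>) simp
  also have "\<dots> = ennreal (c * (d + d))"
    using c d by (simp add: ennreal_mult' ennreal_plus[symmetric] del: ennreal_plus)
  also have "\<dots> \<le> ennreal e" using d by (intro ennreal_leI)
  finally have "emod (\<lambda>x. (a * u x + b * v x) - (a * \<phi> x + b * \<theta> x)) \<le> ennreal e"
    by (simp add: algebra_simps)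
  moreover have "(\<lambda>x. a * \<phi> x + b * \<theta> x) \<in> C1_0 G \<Omega> \<inter> W1"
    by (intro IntI C1_0_linear sobolev_linear \<phi> \<theta>)
  ultimately show "\<exists>\<phi>\<in>C1_0 G \<Omega> \<inter> W1. emod (\<lambda>x. a * u x + b * v x - \<phi> x) \<le> ennreal e"
    by (rule bexI[of _ "\<lambda>x. a * \<phi> x + b * \<theta> x"])
qed

lemma sobolev0_zero: "(\<lambda>x. 0) \<in> W0"
proof -
  have "(\<lambda>x. 0) \<in> C1_0 G \<Omega>" by (auto simp: C1_0_def compactly_supported_def intro: Ck_fun_const atlas)
  moreover have "rho (grad (\<lambda>x. 0)) = 0"
    using rho_cong[OF grad_linear[OF sobolev_zero sobolev_zero, of 0 0]] by simp
  then have "emod (\<lambda>x. 0 - 0) = 0" by (simp add: emod_def)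
  ultimately show ?thesis using sobolev_zero unfolding sobolev0_iff by force
qed

text \<open>A modular Cauchy sequence has a subsequence with \<open>\<Sum>\<^sub>k \<integral>(2\<^sup>k \<bar>F\<^sub>k\<^sub>+\<^sub>1 - F\<^sub>k\<bar> \<omega>)\<^sup>p < \<infinity>\<close>, which converges almost
  everywhere; Fatou's lemma identifies the limit.\<close>

lemma rho_complete:
  fixes F :: "nat \<Rightarrow> 'g \<Rightarrow> 'v::euclidean_space"
  assumes F [measurable]: "\<And>n. F n \<in> borel_measurable \<mu>"
    and cauchy: "\<And>e. e > 0 \<Longrightarrow> \<exists>N. \<forall>m\<ge>N. \<forall>n\<ge>N. rho (\<lambda>x. F m x - F n x) \<le> ennreal e"
  obtains H where "H \<in> borel_measurable \<mu>" "\<And>e. e > 0 \<Longrightarrow> \<exists>N. \<forall>n\<ge>N. rho (\<lambda>x. F n x - H x) \<le> ennreal e"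
proof -
  \<comment> \<open>so small that \<open>2\<^sup>k\<close> times a function of modular \<open>a k\<close> has modular at most \<open>2\<^sup>-\<^sup>k\<close>\<close>
  define a where "a = (\<lambda>k::nat. (1/2)^k * (2^k) powr - p2 :: real)"
  have a: "0 < a k" for k by (simp add: a_def)
  obtain N where N: "\<And>k m n. m \<ge> N k \<Longrightarrow> n \<ge> N k \<Longrightarrow> rho (\<lambda>x. F m x - F n x) \<le> ennreal (a k)"
    using cauchy[OF a] by metis
  define r where "r = (\<lambda>k. (\<Sum>i\<le>k. N i) + k)"
  have rN: "N k \<le> r k" for k unfolding r_def by (rule trans_le_add1) (rule member_le_sum, auto)
  have rm: "r k \<le> r (Suc k)" for k by (simp add: r_def)
  have rk: "k \<le> r k" for k by (simp add: r_def)
  define h where "h = (\<lambda>k x. F (r (Suc k)) x - F (r k) x)"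
  have h [measurable]: "h k \<in> borel_measurable \<mu>" for k by (simp add: h_def)
  have "rho (\<lambda>x. 2^k *\<^sub>R h k x) \<le> ennreal ((1/2)^k)" for k
  proof -
    have "rho (\<lambda>x. (2^k) *\<^sub>R h k x) \<le> ennreal (max 1 \<bar>2^k\<bar> powr p2) * rho (h k)" by (rule rho_scale[OF h])
    also have "\<dots> \<le> ennreal (max 1 \<bar>2^k\<bar> powr p2) * ennreal (a k)"
      unfolding h_def using rN[of k] rm[of k] by (intro mult_left_mono N) auto
    also have "\<dots> = ennreal ((1/2)^k)"
      by (simp add: ennreal_mult'[symmetric] a_def max_def powr_minus field_simps)
    finally show ?thesis .
  qed
  then have "(\<Sum>k. rho (\<lambda>x. 2^k *\<^sub>R h k x)) \<le> (\<Sum>k. ennreal ((1/2)^k))"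
    by (intro suminf_le) auto
  also have "\<dots> = ennreal (\<Sum>k. (1/2)^k)" by (rule suminf_ennreal2) (auto intro: summable_geometric)
  finally have "(\<integral>\<^sup>+x. (\<Sum>k. ennreal ((norm (2^k *\<^sub>R h k x) * \<omega> x) powr P x)) \<partial>\<mu>) < \<infinity>"
    unfolding rho_def by (subst nn_integral_suminf) (auto simp: le_less_trans)
  then have "AE x in \<mu>. (\<Sum>k. ennreal ((norm (2^k *\<^sub>R h k x) * \<omega> x) powr P x)) \<noteq> \<infinity>"
    by (intro nn_integral_PInf_AE) auto
  then have conv: "AE x in \<mu>. convergent (\<lambda>k. F (r k) x)"
    using good_AE
  proof eventually_elim
    case (elim x)
    let ?t = "\<lambda>k. (norm (2^k *\<^sub>R h k x) * \<omega> x) powr P x"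
    have "summable ?t" using elim by (intro summable_suminf_not_top) auto
    then have "?t \<longlonglongrightarrow> 0" by (rule summable_LIMSEQ_zero)
    then have "\<forall>\<^sub>F k in sequentially. ?t k < 1" by (rule order_tendstoD) simp
    then have "\<forall>\<^sub>F k in sequentially. norm (h k x) \<le> (1/2)^k * (1 / \<omega> x)"
    proof eventually_elim
      case (elim k)
      have "norm (2^k *\<^sub>R h k x) * \<omega> x \<le> 1"
      proof (rule ccontr)
        assume "\<not> ?thesis"
        then have "1 \<le> ?t k" using \<open>0 < \<omega> x \<and> _\<close> p1 by (intro ge_one_powr_ge_zero) auto
        then show False using elim by simp
      qed
      then show ?case using \<open>0 < \<omega> x \<and> _\<close> by (simp add: field_simps power_divide)
    qed
    then have "summable (\<lambda>k. h k x)"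
      by (rule summable_comparison_test_ev) (auto intro!: summable_mult2 summable_geometric)
    then have "convergent (\<lambda>n. \<Sum>k<n. h k x)" by (simp add: summable_iff_convergent)
    moreover have "(\<Sum>k<n. h k x) = F (r n) x - F (r 0) x" for n
      unfolding h_def by (rule sum_lessThan_telescope)
    ultimately have "convergent (\<lambda>n. (F (r n) x - F (r 0) x) + F (r 0) x)"
      by (intro convergent_add convergent_const) simp
    then show ?case by simp
  qed
  define H where "H = (\<lambda>x. lim (\<lambda>k. F (r k) x))"
  have Hm [measurable]: "H \<in> borel_measurable \<mu>" unfolding H_def by (rule borel_measurable_lim_metric) simp
  have "\<exists>N. \<forall>n\<ge>N. rho (\<lambda>x. F n x - H x) \<le> ennreal e" if e: "e > 0" for e
  proof -
    obtain N where N: "\<And>m n. m \<ge> N \<Longrightarrow> n \<ge> N \<Longrightarrow> rho (\<lambda>x. F m x - F n x) \<le> ennreal e" using cauchy[OF e] by blast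
    have "rho (\<lambda>x. F n x - H x) \<le> ennreal e" if n: "n \<ge> N" for n
    proof -
      let ?f = "\<lambda>k x. ennreal ((norm (F n x - F (r k) x) * \<omega> x) powr P x)"
      have "rho (\<lambda>x. F n x - H x) = (\<integral>\<^sup>+x. liminf (\<lambda>k. ?f k x) \<partial>\<mu>)"
        unfolding rho_def
      proof (rule nn_integral_cong_AE)
        show "AE x in \<mu>. ennreal ((norm (F n x - H x) * \<omega> x) powr P x) = liminf (\<lambda>k. ?f k x)"
          using conv good_AE
        proof eventually_elim
          case (elim x)
          have "(\<lambda>k. F (r k) x) \<longlonglongrightarrow> H x" using elim(1) by (simp add: H_def convergent_LIMSEQ_iff)
          then have "(\<lambda>k. (norm (F n x - F (r k) x) * \<omega> x) powr P x) \<longlonglongrightarrow> (norm (F n x - H x) * \<omega> x) powr P x"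
            using elim(2) p1 by (intro tendsto_powr2 tendsto_intros) auto
          then have "(\<lambda>k. ?f k x) \<longlonglongrightarrow> ennreal ((norm (F n x - H x) * \<omega> x) powr P x)"
            by (rule tendsto_ennrealI)
          then show ?case by (intro lim_imp_Liminf[symmetric]) auto
        qed
      qed
      also have "\<dots> \<le> liminf (\<lambda>k. \<integral>\<^sup>+x. ?f k x \<partial>\<mu>)" by (rule nn_integral_liminf) simp
      also have "\<dots> \<le> liminf (\<lambda>k::nat. ennreal e)"
      proof (rule Liminf_mono)
        show "\<forall>\<^sub>F k in sequentially. (\<integral>\<^sup>+x. ?f k x \<partial>\<mu>) \<le> ennreal e"
          using N[OF n] rk unfolding rho_def eventually_sequentially by (meson order_trans)
      qed
      finally show ?thesis by (simp add: Liminf_const)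
    qed
    then show ?thesis by blast
  qed
  then show thesis using that Hm by blast
qed

lemma rho_limit_imp_integral_limit:
  fixes F :: "nat \<Rightarrow> 'g \<Rightarrow> real"
  assumes F [measurable]: "\<And>n. F n \<in> borel_measurable \<mu>"
    and lim: "\<And>e. e > 0 \<Longrightarrow> \<exists>N. \<forall>n\<ge>N. rho (F n) \<le> ennreal e"
    and \<psi> [measurable]: "\<psi> \<in> borel_measurable \<mu>" and M: "\<And>x. \<bar>\<psi> x\<bar> \<le> M"
  shows "(\<lambda>n. \<integral>x. F n x * \<psi> x \<partial>\<mu>) \<longlonglongrightarrow> 0"
proof (rule LIMSEQ_I)
  fix e :: real assume e: "0 < e"
  have M0: "0 \<le> M" using M[of undefined] by simp
  have dm: "0 \<le> dual_mass" by (simp add: dual_mass_def)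
  define d where "d = min 1 (e / (4 * (M + 1) * (dual_mass + 1)))"
  define b where "b = e / (4 * (M + 1) * inverse d powr p2)"
  have d: "0 < d" "d \<le> 1" using e M0 dm by (auto simp: d_def)
  have b: "0 < b" using e M0 d by (auto simp: b_def)
  obtain N where N: "\<And>n. n \<ge> N \<Longrightarrow> rho (F n) \<le> ennreal b" using lim[OF b] by blast
  show "\<exists>N. \<forall>n\<ge>N. norm ((\<integral>x. F n x * \<psi> x \<partial>\<mu>) - 0) < e"
  proof (intro exI[of _ N] allI impI)
    fix n assume "n \<ge> N"
    then have rb: "rho (F n) \<le> ennreal b" by (rule N)
    then have int: "integrable \<mu> (F n)"
      by (intro rho_finite_imp_integrable F) (simp add: le_less_trans)
    have "(\<integral>\<^sup>+x. ennreal (norm (F n x)) \<partial>\<mu>) \<le> ennreal (inverse d powr p2) * rho (F n) + ennreal (d * dual_mass)"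
      by (rule L1_le_rho[OF F d])
    also have "\<dots> \<le> ennreal (inverse d powr p2) * ennreal b + ennreal (d * dual_mass)"
      using rb by (intro add_mono mult_left_mono) auto
    also have "\<dots> = ennreal (inverse d powr p2 * b + d * dual_mass)"
      using b d dm by (simp add: ennreal_mult')
    finally have "(\<integral>\<^sup>+x. ennreal (norm (F n x)) \<partial>\<mu>) \<le> ennreal (inverse d powr p2 * b + d * dual_mass)" .
    moreover have "(\<integral>\<^sup>+x. ennreal (norm (F n x)) \<partial>\<mu>) = ennreal (\<integral>x. norm (F n x) \<partial>\<mu>)"
      by (rule nn_integral_eq_integral[OF integrable_norm[OF int]]) simp
    ultimately have L1: "(\<integral>x. norm (F n x) \<partial>\<mu>) \<le> inverse d powr p2 * b + d * dual_mass"
      using b d dm by (simp only:) (subst (asm) ennreal_le_iff, auto)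
    have 1: "(M + 1) * (inverse d powr p2 * b) = e / 4"
    proof -
      have "m * (q * (e / (4 * m * q))) = e / 4" if "m > 0" "q > 0" for m q :: real
        using that by (simp add: field_simps)
      from this[of "M + 1" "inverse d powr p2"] show ?thesis using M0 d by (simp add: b_def)
    qed
    have "(M + 1) * (d * dual_mass) \<le> (M + 1) * (d * (dual_mass + 1))" using M0 d by (intro mult_left_mono) auto
    also have "\<dots> \<le> (M + 1) * (e / (4 * (M + 1) * (dual_mass + 1)) * (dual_mass + 1))"
      using M0 dm by (intro mult_left_mono mult_right_mono) (auto simp: d_def)
    also have "\<dots> = e / 4"
    proof -
      have "m * (e / (4 * m * k) * k) = e / 4" if "m > 0" "k > 0" for m k :: real
        using that by (simp add: field_simps)
      from this[of "M + 1" "dual_mass + 1"] show ?thesis using M0 dm by simp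
    qed
    finally have 2: "(M + 1) * (d * dual_mass) \<le> e / 4" .
    have int\<psi>: "integrable \<mu> (\<lambda>x. F n x * \<psi> x)"
    proof (rule Bochner_Integration.integrable_bound[OF integrable_mult_right[OF int, of M]])
      show "AE x in \<mu>. norm (F n x * \<psi> x) \<le> norm (M * F n x)"
        using M M0 by (auto simp: abs_mult mult.commute[of M] intro!: mult_left_mono)
    qed simp
    have "norm (\<integral>x. F n x * \<psi> x \<partial>\<mu>) \<le> (\<integral>x. norm (F n x * \<psi> x) \<partial>\<mu>)" by (rule integral_norm_bound)
    also have "\<dots> \<le> (\<integral>x. M * norm (F n x) \<partial>\<mu>)"
      using M M0 int integrable_norm[OF int\<psi>] by (intro integral_mono) (auto simp: abs_mult mult.commute[of M] intro!: mult_left_mono)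
    also have "\<dots> = M * (\<integral>x. norm (F n x) \<partial>\<mu>)" by simp
    also have "\<dots> \<le> (M + 1) * (\<integral>x. norm (F n x) \<partial>\<mu>)" by (intro mult_right_mono) auto
    also have "\<dots> \<le> (M + 1) * (inverse d powr p2 * b + d * dual_mass)" using L1 M0 by (intro mult_left_mono) auto
    also have "\<dots> \<le> e / 4 + e / 4" using 1 2 by (simp add: distrib_left)
    finally show "norm ((\<integral>x. F n x * \<psi> x \<partial>\<mu>) - 0) < e" using e by simp
  qed
qed

lemma test_function_bounds:
  assumes \<phi>: "\<phi> \<in> test_functions G \<Omega>"
  obtains M where "\<And>x. \<bar>\<phi> x\<bar> \<le> M" "\<And>x. \<bar>frame G j \<phi> x\<bar> \<le> M"
    "\<phi> \<in> borel_measurable \<mu>" "frame G j \<phi> \<in> borel_measurable \<mu>"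
proof -
  let ?K = "closure {x. \<phi> x \<noteq> 0}"
  note T = test_functionsD[OF \<phi>]
  have sX: "smooth_fun \<A> (frame G j \<phi>)" by (rule vector_fieldD(1)[OF frame_vector_field T(1)])
  have z: "\<phi> x = 0" "frame G j \<phi> x = 0" if "x \<notin> ?K" for x
    using that closure_subset[of "{x. \<phi> x \<noteq> 0}"] vector_field_support[OF frame_vector_field atlas T(1) that] by auto
  obtain M where M: "M > 0" "\<And>x. \<bar>\<phi> x\<bar> \<le> M"
    using continuous_compact_support_bounded[OF smooth_continuous[OF T(1)] T(2) z(1)] by blast
  obtain M' where M': "M' > 0" "\<And>x. \<bar>frame G j \<phi> x\<bar> \<le> M'"
    using continuous_compact_support_bounded[OF smooth_continuous[OF sX] T(2) z(2)] by blast
  have "\<bar>\<phi> x\<bar> \<le> max M M'" "\<bar>frame G j \<phi> x\<bar> \<le> max M M'" for x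
    using M(2)[of x] M'(2)[of x] by auto
  moreover have "\<phi> \<in> borel_measurable \<mu>" "frame G j \<phi> \<in> borel_measurable \<mu>"
    by (intro measurable_restrict_space1 continuous_measurable_vol smooth_continuous T(1) sX)+
  ultimately show thesis using that by blast
qed

lemma set_integral_\<mu>:
  "set_integrable (vol G) \<Omega> f \<longleftrightarrow> integrable \<mu> (f :: 'g \<Rightarrow> real)" "(LINT x:\<Omega>|vol G. f x) = (\<integral>x. f x \<partial>\<mu>)"
  by (simp_all add: set_integrable_def set_lebesgue_integral_def integrable_restrict_space integral_restrict_space)

lemma integrable_bounded_mult:
  fixes F \<psi> :: "'g \<Rightarrow> real"
  assumes "integrable \<mu> F" "\<psi> \<in> borel_measurable \<mu>" "\<And>x. \<bar>\<psi> x\<bar> \<le> M"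
  shows "integrable \<mu> (\<lambda>x. F x * \<psi> x)"
proof (rule Bochner_Integration.integrable_bound[OF integrable_mult_right[OF assms(1), of M]])
  have "0 \<le> M" using assms(3)[of undefined] by simp
  then show "AE x in \<mu>. norm (F x * \<psi> x) \<le> norm (M * F x)"
    using assms(3) by (auto simp: abs_mult mult.commute[of M] intro!: mult_left_mono)
qed (use assms in auto)

text \<open>Test functions and their horizontal derivatives are bounded, so convergence in \<open>L\<^sup>1(\<Omega>)\<close> passes to the limit
  in the identity that defines weak derivatives.\<close>

lemma weak_deriv_limit:
  fixes u g :: "nat \<Rightarrow> 'g \<Rightarrow> real"
  assumes wd: "\<And>n. weak_deriv G \<Omega> j (u n) (g n)"
    and fin: "\<And>n. rho (u n) < \<infinity>" "\<And>n. rho (g n) < \<infinity>"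
    and m: "v \<in> borel_measurable \<mu>" "k \<in> borel_measurable \<mu>" "rho v < \<infinity>" "rho k < \<infinity>"
    and lim: "\<And>e. e > 0 \<Longrightarrow> \<exists>N. \<forall>n\<ge>N. rho (\<lambda>x. u n x - v x) \<le> ennreal e"
      "\<And>e. e > 0 \<Longrightarrow> \<exists>N. \<forall>n\<ge>N. rho (\<lambda>x. g n x - k x) \<le> ennreal e"
  shows "weak_deriv G \<Omega> j v k"
  unfolding weak_deriv_def set_integral_\<mu>
proof (intro conjI ballI m)
  fix \<phi> assume \<phi>: "\<phi> \<in> test_functions G \<Omega>"
  obtain M where M: "\<And>x. \<bar>\<phi> x\<bar> \<le> M" "\<And>x. \<bar>frame G j \<phi> x\<bar> \<le> M"
    and meas: "\<phi> \<in> borel_measurable \<mu>" "frame G j \<phi> \<in> borel_measurable \<mu>"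
    using test_function_bounds[OF \<phi>] by metis
  note um = weak_deriv_measurable[OF wd]
  note iu = rho_finite_imp_integrable[OF um(1) fin(1)] rho_finite_imp_integrable[OF um(2) fin(2)]
  note iv = rho_finite_imp_integrable[OF m(1,3)] rho_finite_imp_integrable[OF m(2,4)]
  show 1: "integrable \<mu> (\<lambda>x. v x * frame G j \<phi> x)" "integrable \<mu> (\<lambda>x. k x * \<phi> x)"
    by (rule integrable_bounded_mult[OF iv(1) meas(2) M(2)], rule integrable_bounded_mult[OF iv(2) meas(1) M(1)])
  have 2: "integrable \<mu> (\<lambda>x. u n x * frame G j \<phi> x)" "integrable \<mu> (\<lambda>x. g n x * \<phi> x)" for n
    by (rule integrable_bounded_mult[OF iu(1) meas(2) M(2)], rule integrable_bounded_mult[OF iu(2) meas(1) M(1)])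
  have "(\<lambda>n. \<integral>x. (u n x - v x) * frame G j \<phi> x \<partial>\<mu>) \<longlonglongrightarrow> 0"
    using um m by (intro rho_limit_imp_integral_limit[OF _ lim(1) meas(2) M(2)]) auto
  then have A: "(\<lambda>n. (\<integral>x. u n x * frame G j \<phi> x \<partial>\<mu>) - (\<integral>x. v x * frame G j \<phi> x \<partial>\<mu>)) \<longlonglongrightarrow> 0"
    using 1 2 by (simp add: left_diff_distrib)
  have "(\<lambda>n. \<integral>x. (g n x - k x) * \<phi> x \<partial>\<mu>) \<longlonglongrightarrow> 0"
    using um m by (intro rho_limit_imp_integral_limit[OF _ lim(2) meas(1) M(1)]) auto
  then have B: "(\<lambda>n. (\<integral>x. g n x * \<phi> x \<partial>\<mu>) - (\<integral>x. k x * \<phi> x \<partial>\<mu>)) \<longlonglongrightarrow> 0"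
    using 1 2 by (simp add: left_diff_distrib)
  have e: "(\<integral>x. u n x * frame G j \<phi> x \<partial>\<mu>) = - (\<integral>x. g n x * \<phi> x \<partial>\<mu>)" for n
    using wd[of n] \<phi> unfolding weak_deriv_def set_integral_\<mu> by blast
  have "(\<lambda>n. ((\<integral>x. u n x * frame G j \<phi> x \<partial>\<mu>) - (\<integral>x. v x * frame G j \<phi> x \<partial>\<mu>))
      + ((\<integral>x. g n x * \<phi> x \<partial>\<mu>) - (\<integral>x. k x * \<phi> x \<partial>\<mu>))) \<longlonglongrightarrow> 0 + 0"
    by (rule tendsto_add[OF A B])
  then have "- (\<integral>x. v x * frame G j \<phi> x \<partial>\<mu>) - (\<integral>x. k x * \<phi> x \<partial>\<mu>) = 0"
    by (simp add: e LIMSEQ_const_iff)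
  then show "(\<integral>x. v x * frame G j \<phi> x \<partial>\<mu>) = - (\<integral>x. k x * \<phi> x \<partial>\<mu>)" by simp
qed

text \<open>The functions and their gradients converge separately, and weak derivatives are closed under such limits.
  An approximation of \<open>u n\<close> by functions of class \<open>C\<^sup>1\<close> is one of the limit for large \<open>n\<close>.\<close>

theorem sobolev0_complete:
  assumes u: "\<And>n::nat. u n \<in> W0"
    and cauchy: "\<And>e. e > 0 \<Longrightarrow> \<exists>N. \<forall>m\<ge>N. \<forall>n\<ge>N. emod (\<lambda>x. u m x - u n x) \<le> ennreal e"
  obtains v where "v \<in> W0" "\<And>e. e > 0 \<Longrightarrow> \<exists>N. \<forall>n\<ge>N. emod (\<lambda>x. u n x - v x) \<le> ennreal e"
proof -
  have u1: "u n \<in> W1" for n by (rule sobolev0_subset[OF u])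
  note U = sobolevD[OF u1]
  have ed: "emod (\<lambda>x. u m x - u n x) = rho (\<lambda>x. u m x - u n x) + rho (\<lambda>x. grad (u m) x - grad (u n) x)" for m n
    using rho_cong[OF grad_diff[OF u1 u1]] by (simp add: emod_def)
  have le: "rho (\<lambda>x. u m x - u n x) \<le> emod (\<lambda>x. u m x - u n x)"
    "rho (\<lambda>x. grad (u m) x - grad (u n) x) \<le> emod (\<lambda>x. u m x - u n x)" for m n
    unfolding ed by simp_all
  have c: "\<exists>N. \<forall>m\<ge>N. \<forall>n\<ge>N. rho (\<lambda>x. u m x - u n x) \<le> ennreal e"
      "\<exists>N. \<forall>m\<ge>N. \<forall>n\<ge>N. rho (\<lambda>x. grad (u m) x - grad (u n) x) \<le> ennreal e" if "e > 0" for e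
    using cauchy[OF that] order_trans[OF le(1)] order_trans[OF le(2)] by blast+
  obtain v where v: "v \<in> borel_measurable \<mu>" "\<And>e. e > 0 \<Longrightarrow> \<exists>N. \<forall>n\<ge>N. rho (\<lambda>x. u n x - v x) \<le> ennreal e"
    by (rule rho_complete[of u, OF U(4) c(1)]) (assumption, rule that)
  obtain D where D: "D \<in> borel_measurable \<mu>" "\<And>e. e > 0 \<Longrightarrow> \<exists>N. \<forall>n\<ge>N. rho (\<lambda>x. grad (u n) x - D x) \<le> ennreal e"
    by (rule rho_complete[of "\<lambda>n. grad (u n)", OF U(5) c(2)]) (assumption, rule that)
  have fv: "rho v < \<infinity>"
  proof -
    obtain n where "rho (\<lambda>x. u n x - v x) \<le> ennreal 1" using v(2)[of 1] by auto
    then have f: "rho (\<lambda>x. u n x - v x) < \<infinity>" by (simp add: le_less_trans)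
    have "rho (\<lambda>x. 1 *\<^sub>R u n x + (-1) *\<^sub>R (u n x - v x)) < \<infinity>"
      by (rule rho_linear_finite) (use U v f in auto)
    then show ?thesis by simp
  qed
  have fD: "rho D < \<infinity>"
  proof -
    obtain n where "rho (\<lambda>x. grad (u n) x - D x) \<le> ennreal 1" using D(2)[of 1] by auto
    then have f: "rho (\<lambda>x. grad (u n) x - D x) < \<infinity>" by (simp add: le_less_trans)
    have "rho (\<lambda>x. 1 *\<^sub>R grad (u n) x + (-1) *\<^sub>R (grad (u n) x - D x)) < \<infinity>"
      by (rule rho_linear_finite) (use U D f in auto)
    then show ?thesis by simp
  qed
  have wd: "weak_deriv G \<Omega> j v (\<lambda>x. D x $ j)" for j
  proof (rule weak_deriv_limit[of _ u "\<lambda>n x. grad (u n) x $ j"])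
    show "weak_deriv G \<Omega> j (u n) (\<lambda>x. grad (u n) x $ j)" for n by (rule hgrad_weak_deriv[OF U(1)])
    show "rho (\<lambda>x. grad (u n) x $ j) < \<infinity>" for n using rho_component U(3) by (rule le_less_trans)
    show "rho (\<lambda>x. D x $ j) < \<infinity>" using rho_component fD by (rule le_less_trans)
    show "(\<lambda>x. D x $ j) \<in> borel_measurable \<mu>"
      using D(1) by (simp add: cart_eq_inner_axis)
    have "rho (\<lambda>x. grad (u n) x $ j - D x $ j) \<le> rho (\<lambda>x. grad (u n) x - D x)" for n
      using rho_component[of "\<lambda>x. grad (u n) x - D x" j] by simp
    then show "\<exists>N. \<forall>n\<ge>N. rho (\<lambda>x. grad (u n) x $ j - D x $ j) \<le> ennreal e" if "e > 0" for e
      using D(2)[OF that] by (meson order_trans)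
  qed (use U v fv in auto)
  have gv: "AE x in \<mu>. grad v x = D x" using hgrad_unique[OF wd] by (simp add: AE_\<mu>)
  have v1: "v \<in> W1"
    unfolding sobolev_iff using wd fv fD rho_cong[OF gv] by (auto simp: weakly_differentiable_def)
  have lim: "\<exists>N. \<forall>n\<ge>N. emod (\<lambda>x. u n x - v x) \<le> ennreal e" if e: "e > 0" for e
  proof -
    obtain N1 N2 where N: "\<And>n. n \<ge> N1 \<Longrightarrow> rho (\<lambda>x. u n x - v x) \<le> ennreal (e/2)"
      "\<And>n. n \<ge> N2 \<Longrightarrow> rho (\<lambda>x. grad (u n) x - D x) \<le> ennreal (e/2)"
      using v(2)[of "e/2"] D(2)[of "e/2"] e by auto
    have "emod (\<lambda>x. u n x - v x) \<le> ennreal e" if n: "n \<ge> max N1 N2" for n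
    proof -
      have "AE x in \<mu>. grad (\<lambda>x. u n x - v x) x = grad (u n) x - D x"
        using grad_diff[OF u1 v1] gv by eventually_elim simp
      from rho_cong[OF this]
      have "emod (\<lambda>x. u n x - v x) = rho (\<lambda>x. u n x - v x) + rho (\<lambda>x. grad (u n) x - D x)"
        by (simp add: emod_def)
      also have "\<dots> \<le> ennreal (e/2) + ennreal (e/2)" using n N by (intro add_mono) auto
      also have "\<dots> = ennreal e" using e by (simp add: ennreal_plus[symmetric] del: ennreal_plus)
      finally show ?thesis .
    qed
    then show ?thesis by blast
  qed
  have "\<exists>\<phi>\<in>C1_0 G \<Omega> \<inter> W1. emod (\<lambda>x. v x - \<phi> x) \<le> ennreal e" if e: "e > 0" for e
  proof -
    obtain c where c: "lin_const (-1) 1 = ennreal c" "0 \<le> c" using lin_const_finite[of "-1" 1] by (cases "lin_const (-1) 1") auto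
    define d where "d = e / (c + 1) / 2"
    have d: "0 < d" "c * (d + d) \<le> e" using e c share_le[of c e] by (auto simp: d_def add_nonneg_pos)
    obtain n where n: "emod (\<lambda>x. u n x - v x) \<le> ennreal d" using lim[OF d(1)] by auto
    obtain \<phi> where \<phi>: "\<phi> \<in> C1_0 G \<Omega>" "\<phi> \<in> W1" "emod (\<lambda>x. u n x - \<phi> x) \<le> ennreal d"
      using u[of n] d(1) unfolding sobolev0_iff by blast
    have "emod (\<lambda>x. (-1) * (u n x - v x) + 1 * (u n x - \<phi> x)) \<le> lin_const (-1) 1 * (emod (\<lambda>x. u n x - v x) + emod (\<lambda>x. u n x - \<phi> x))"
      by (intro emod_linear_le sobolev_diff u1 v1 \<phi>)
    also have "\<dots> \<le> ennreal c * (ennreal d + ennreal d)"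
      unfolding c(1) by (intro mult_left_mono add_mono \<phi> n) simp
    also have "\<dots> = ennreal (c * (d + d))"
      using c d by (simp add: ennreal_mult' ennreal_plus[symmetric] del: ennreal_plus)
    also have "\<dots> \<le> ennreal e" using d by (intro ennreal_leI)
    finally have "emod (\<lambda>x. v x - \<phi> x) \<le> ennreal e" by simp
    then show ?thesis using \<phi> by blast
  qed
  then have "v \<in> W0" unfolding sobolev0_iff using v1 by blast
  then show thesis using that lim by blast
qed

end

section \<open>Uniform convexity of powers of quadratic forms\<close>

text \<open>The mean value theorem on the two halves of \<open>[a, b]\<close>, together with strict monotonicity of the derivative.\<close>

lemma powr_midpoint_strict:
  fixes a b p :: real
  assumes "0 \<le> a" "a < b" "1 < p"
  shows "((a + b) / 2) powr p < (a powr p + b powr p) / 2"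
proof -
  let ?m = "(a + b) / 2"
  have m: "a < ?m" "?m < b" using assms by auto
  have c: "continuous_on {s..t} (\<lambda>x. x powr p)" if "0 \<le> s" for s t
    using that assms by (intro continuous_on_powr' continuous_intros) auto
  have d: "((\<lambda>x. x powr p) has_derivative (*) (p * x powr (p - 1))) (at x)" if "0 < x" for x
    using has_real_derivative_powr[OF that, of p] unfolding has_field_derivative_def .
  obtain \<xi> where \<xi>: "a < \<xi>" "\<xi> < ?m" "?m powr p - a powr p = p * \<xi> powr (p - 1) * (?m - a)"
    by (rule mvt[OF m(1) c[OF assms(1)], of "\<lambda>x. (*) (p * x powr (p - 1))"]) (use d assms(1) in auto)
  have "0 \<le> ?m" using assms by simp
  obtain \<eta> where \<eta>: "?m < \<eta>" "\<eta> < b" "b powr p - ?m powr p = p * \<eta> powr (p - 1) * (b - ?m)"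
    by (rule mvt[OF m(2) c[OF \<open>0 \<le> ?m\<close>], of "\<lambda>x. (*) (p * x powr (p - 1))"]) (use d \<open>0 \<le> ?m\<close> in auto)
  have "\<xi> powr (p - 1) < \<eta> powr (p - 1)" using \<xi> \<eta> assms by (intro powr_less_mono2) auto
  then have "p * \<xi> powr (p - 1) * (?m - a) < p * \<eta> powr (p - 1) * (?m - a)"
    using assms m by (intro mult_strict_right_mono mult_strict_left_mono) auto
  moreover have "b - ?m = ?m - a" by (simp add: field_simps)
  then have "b powr p - ?m powr p = p * \<eta> powr (p - 1) * (?m - a)" using \<eta>(3) by (simp only:)
  ultimately have "?m powr p - a powr p < b powr p - ?m powr p" using \<xi>(3) by linarith
  then show ?thesis by simp
qed

lemma powr_half: "0 \<le> x \<Longrightarrow> x powr (p / 2) = sqrt x powr p"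
  by (simp add: powr_half_sqrt[symmetric] powr_powr)

text \<open>\<open>\<alpha>\<close>, \<open>\<beta>\<close> and \<open>d\<close> stand for the squared norms of \<open>x\<close>, \<open>y\<close> and \<open>(x - y)/2\<close>; the squared norm of the
  midpoint is then \<open>(\<alpha> + \<beta>)/2 - d\<close>. If \<open>\<alpha> \<noteq> \<beta>\<close>, the inequality is strict because \<open>t \<mapsto> t\<^sup>p\<close> is strictly convex;
  if \<open>\<alpha> = \<beta>\<close>, because \<open>d > 0\<close> makes the midpoint strictly shorter.\<close>

lemma midpoint_gap_pos:
  fixes \<alpha> \<beta> d p :: real
  assumes "0 \<le> \<alpha>" "0 \<le> \<beta>" "1 < p" "0 < d" "d \<le> (\<alpha> + \<beta>) / 2" "((sqrt \<alpha> - sqrt \<beta>) / 2)\<^sup>2 \<le> d"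
  shows "((\<alpha> + \<beta>) / 2 - d) powr (p / 2) < (\<alpha> powr (p / 2) + \<beta> powr (p / 2)) / 2"
proof -
  let ?a = "sqrt \<alpha>" and ?b = "sqrt \<beta>"
  have sq: "\<alpha> = ?a\<^sup>2" "\<beta> = ?b\<^sup>2" using assms by auto
  have ab: "0 \<le> ?a" "0 \<le> ?b" using assms by auto
  have "(?a\<^sup>2 + ?b\<^sup>2) / 2 - ((?a - ?b) / 2)\<^sup>2 = ((?a + ?b) / 2)\<^sup>2"
    by (simp add: power2_eq_square field_simps)
  then have e: "(\<alpha> + \<beta>) / 2 - ((?a - ?b) / 2)\<^sup>2 = ((?a + ?b) / 2)\<^sup>2"
    using assms by simp
  have pa: "\<alpha> powr (p / 2) = ?a powr p" "\<beta> powr (p / 2) = ?b powr p" using assms by (simp_all add: powr_half)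
  show ?thesis
  proof (cases "?a = ?b")
    case True
    then have "\<alpha> = \<beta>" by simp
    then have "((\<alpha> + \<beta>) / 2 - d) powr (p / 2) < \<alpha> powr (p / 2)"
      using assms by (intro powr_less_mono2) auto
    then show ?thesis using \<open>\<alpha> = \<beta>\<close> by simp
  next
    case False
    have "(\<alpha> + \<beta>) / 2 - d \<le> ((?a + ?b) / 2)\<^sup>2" using assms(6) e by linarith
    then have "((\<alpha> + \<beta>) / 2 - d) powr (p / 2) \<le> (((?a + ?b) / 2)\<^sup>2) powr (p / 2)"
      using assms by (intro powr_mono2) auto
    also have "\<dots> = ((?a + ?b) / 2) powr p" using ab by (simp add: powr_half)
    also have "\<dots> < (?a powr p + ?b powr p) / 2"
      using powr_midpoint_strict[of ?a ?b p] powr_midpoint_strict[of ?b ?a p] False ab assms(3)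
      by (cases "?a < ?b") (auto simp: add.commute)
    finally show ?thesis using pa by simp
  qed
qed

lemma midpoint_gap_nonneg:
  fixes \<alpha> \<beta> d p :: real
  assumes "0 \<le> \<alpha>" "0 \<le> \<beta>" "1 < p" "0 \<le> d" "d \<le> (\<alpha> + \<beta>) / 2" "((sqrt \<alpha> - sqrt \<beta>) / 2)\<^sup>2 \<le> d"
  shows "((\<alpha> + \<beta>) / 2 - d) powr (p / 2) \<le> (\<alpha> powr (p / 2) + \<beta> powr (p / 2)) / 2"
proof (cases "d = 0")
  case True
  then have "sqrt \<alpha> = sqrt \<beta>" using assms(6) by simp
  then show ?thesis using True by simp
next
  case False
  then show ?thesis using midpoint_gap_pos[of \<alpha> \<beta> p d] assms by simp
qed

text \<open>The constant comes from compactness: after scaling to \<open>\<alpha> + \<beta> = 2\<close>, the gap is a positive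
  continuous function on the compact set where \<open>d \<ge> \<delta>\<close>.\<close>

lemma midpoint_gap_normalized:
  fixes p1 p2 \<delta> :: real
  assumes p: "1 < p1" and \<delta>: "0 < \<delta>"
  obtains \<kappa> where "0 < \<kappa>" "\<And>\<alpha> d p. \<alpha> \<in> {0..2} \<Longrightarrow> d \<in> {\<delta>..1} \<Longrightarrow> p \<in> {p1..p2}
    \<Longrightarrow> ((sqrt \<alpha> - sqrt (2 - \<alpha>)) / 2)\<^sup>2 \<le> d
    \<Longrightarrow> \<kappa> \<le> (\<alpha> powr (p / 2) + (2 - \<alpha>) powr (p / 2)) / 2 - (1 - d) powr (p / 2)"
proof -
  let ?g = "\<lambda>(\<alpha>, d, p). (\<alpha> powr (p / 2) + (2 - \<alpha>) powr (p / 2)) / 2 - (1 - d) powr (p / 2) :: real"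
  let ?B = "{0..2} \<times> {\<delta>..1} \<times> {p1..p2} :: (real \<times> real \<times> real) set"
  let ?S = "?B \<inter> {(\<alpha>, d, p). ((sqrt \<alpha> - sqrt (2 - \<alpha>)) / 2)\<^sup>2 \<le> d}"
  have "closed {(\<alpha>, d, p :: real). ((sqrt \<alpha> - sqrt (2 - \<alpha>)) / 2)\<^sup>2 \<le> (d::real)}"
    unfolding case_prod_unfold by (intro closed_Collect_le continuous_intros) auto
  then have S: "compact ?S" by (intro compact_Int_closed compact_Times compact_Icc)
  have cont: "continuous_on ?S ?g"
    unfolding case_prod_unfold
    by (intro continuous_intros continuous_on_powr') (use p in auto)
  have pos: "0 < ?g z" if "z \<in> ?S" for z
  proof -
    obtain \<alpha> d q where z: "z = (\<alpha>, d, q)" by (cases z)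
    then have "(1 - d) powr (q / 2) < (\<alpha> powr (q / 2) + (2 - \<alpha>) powr (q / 2)) / 2"
      using midpoint_gap_pos[of \<alpha> "2 - \<alpha>" q d] that p \<delta> by auto
    then show ?thesis by (simp add: z)
  qed
  show thesis
  proof (cases "?S = {}")
    case True
    then have "(\<alpha>, d, q) \<notin> ?S" for \<alpha> d q by blast
    then show thesis using that[of 1] by auto
  next
    case False
    then obtain z where z: "z \<in> ?S" "\<And>y. y \<in> ?S \<Longrightarrow> ?g z \<le> ?g y"
      using continuous_attains_inf[OF S False cont] by blast
    have "?g z \<le> ?g (\<alpha>, d, q)" if "\<alpha> \<in> {0..2}" "d \<in> {\<delta>..1}" "q \<in> {p1..p2}"
      "((sqrt \<alpha> - sqrt (2 - \<alpha>)) / 2)\<^sup>2 \<le> d" for \<alpha> d q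
      using z(2)[of "(\<alpha>, d, q)"] that by blast
    then show thesis using that[of "?g z"] pos[OF z(1)] by simp
  qed
qed

text \<open>Let \<open>\<sigma> = (\<alpha> + \<beta>)/2\<close>. If \<open>d < \<delta> \<sigma>\<close> with \<open>\<delta>\<close> small, the first term on the right suffices; otherwise, after
  division by \<open>\<sigma>\<close>, the gap is at least \<open>\<kappa>\<close>, and \<open>K = 1/\<kappa>\<close> makes the second term sufficient.\<close>

lemma uniform_convexity_scalar:
  fixes p1 p2 \<epsilon> :: real
  assumes p: "1 < p1" and \<epsilon>: "0 < \<epsilon>"
  obtains K where "0 \<le> K" "\<And>\<alpha> \<beta> d p. 0 \<le> \<alpha> \<Longrightarrow> 0 \<le> \<beta> \<Longrightarrow> 0 \<le> d \<Longrightarrow> p \<in> {p1..p2} \<Longrightarrow> d \<le> (\<alpha> + \<beta>) / 2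
    \<Longrightarrow> ((sqrt \<alpha> - sqrt \<beta>) / 2)\<^sup>2 \<le> d
    \<Longrightarrow> d powr (p / 2) \<le> \<epsilon> * (\<alpha> powr (p / 2) + \<beta> powr (p / 2))
        + K * ((\<alpha> powr (p / 2) + \<beta> powr (p / 2)) / 2 - ((\<alpha> + \<beta>) / 2 - d) powr (p / 2))"
proof -
  define \<delta> where "\<delta> = min 1 (\<epsilon> powr (2 / p1))"
  have \<delta>: "0 < \<delta>" "\<delta> \<le> 1" using \<epsilon> by (auto simp: \<delta>_def)
  have \<delta>p: "\<delta> powr (q / 2) \<le> \<epsilon>" if "q \<ge> p1" for q
  proof -
    have "\<delta> powr (q / 2) \<le> \<delta> powr (p1 / 2)" using \<delta> that by (intro powr_mono') auto
    also have "\<dots> \<le> (\<epsilon> powr (2 / p1)) powr (p1 / 2)" using \<delta> p by (intro powr_mono2) (auto simp: \<delta>_def)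
    also have "\<dots> = \<epsilon>" using p \<epsilon> by (simp add: powr_powr)
    finally show ?thesis .
  qed
  obtain \<kappa> where \<kappa>: "0 < \<kappa>" "\<And>\<alpha> d p. \<alpha> \<in> {0..2} \<Longrightarrow> d \<in> {\<delta>..1} \<Longrightarrow> p \<in> {p1..p2}
    \<Longrightarrow> ((sqrt \<alpha> - sqrt (2 - \<alpha>)) / 2)\<^sup>2 \<le> d
    \<Longrightarrow> \<kappa> \<le> (\<alpha> powr (p / 2) + (2 - \<alpha>) powr (p / 2)) / 2 - (1 - d) powr (p / 2)"
    by (rule midpoint_gap_normalized[OF p \<delta>(1), of p2]) (rule that)
  show thesis
  proof (rule that[of "1 / \<kappa>"])
    fix \<alpha> \<beta> d q :: real
    assume A: "0 \<le> \<alpha>" "0 \<le> \<beta>" "0 \<le> d" "q \<in> {p1..p2}" "d \<le> (\<alpha> + \<beta>) / 2" "((sqrt \<alpha> - sqrt \<beta>) / 2)\<^sup>2 \<le> d"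
    let ?s = "\<alpha> powr (q / 2) + \<beta> powr (q / 2)"
    let ?gap = "?s / 2 - ((\<alpha> + \<beta>) / 2 - d) powr (q / 2)"
    have q: "1 < q" using A p by simp
    have gap: "0 \<le> ?gap" using midpoint_gap_nonneg[of \<alpha> \<beta> q d] A q by simp
    define \<sigma> where "\<sigma> = (\<alpha> + \<beta>) / 2"
    have s0: "0 \<le> ?s" by simp
    have \<sigma>s: "\<sigma> powr (q / 2) \<le> ?s"
    proof -
      have "\<sigma> powr (q / 2) \<le> max \<alpha> \<beta> powr (q / 2)" using A q by (intro powr_mono2) (auto simp: \<sigma>_def)
      also have "\<dots> \<le> ?s" by (auto simp: max_def)
      finally show ?thesis .
    qed
    show "d powr (q / 2) \<le> \<epsilon> * ?s + 1 / \<kappa> * ?gap"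
    proof (cases "d < \<delta> * \<sigma>")
      case True
      then have "d powr (q / 2) \<le> (\<delta> * \<sigma>) powr (q / 2)" using A q by (intro powr_mono2) auto
      also have "\<dots> = \<delta> powr (q / 2) * \<sigma> powr (q / 2)" using \<delta> A by (intro powr_mult) 
      also have "\<dots> \<le> \<epsilon> * ?s" using \<delta>p[of q] \<sigma>s A \<epsilon> by (intro mult_mono) auto
      finally show ?thesis using gap \<kappa>(1) by (simp add: add_increasing2)
    next
      case False
      show ?thesis
      proof (cases "\<sigma> = 0")
        case True
        then have "d = 0" using A by (simp add: \<sigma>_def)
        then show ?thesis using gap \<kappa>(1) s0 \<epsilon> by simp
      next
        case \<sigma>0: False
        then have \<sigma>: "0 < \<sigma>" using A by (simp add: \<sigma>_def)
        have \<beta>: "\<beta> / \<sigma> = 2 - \<alpha> / \<sigma>" using \<sigma> by (simp add: \<sigma>_def field_simps)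
        have "\<kappa> \<le> ((\<alpha> / \<sigma>) powr (q / 2) + (2 - \<alpha> / \<sigma>) powr (q / 2)) / 2 - (1 - d / \<sigma>) powr (q / 2)"
        proof (rule \<kappa>(2))
          show "\<alpha> / \<sigma> \<in> {0..2}" using A \<sigma> by (auto simp: \<sigma>_def pos_divide_le_eq)
          show "d / \<sigma> \<in> {\<delta>..1}" using False A \<sigma> by (auto simp: \<sigma>_def[symmetric] pos_le_divide_eq pos_divide_le_eq)
          show "q \<in> {p1..p2}" by fact
          have "((sqrt (\<alpha> / \<sigma>) - sqrt (\<beta> / \<sigma>)) / 2)\<^sup>2 = ((sqrt \<alpha> - sqrt \<beta>) / 2)\<^sup>2 / \<sigma>"
            using \<sigma> by (simp add: real_sqrt_divide diff_divide_distrib[symmetric] power_divide)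
          then show "((sqrt (\<alpha> / \<sigma>) - sqrt (2 - \<alpha> / \<sigma>)) / 2)\<^sup>2 \<le> d / \<sigma>"
            using A(6) \<sigma> \<beta> by (simp add: divide_right_mono)
        qed
        then have "\<kappa> * \<sigma> powr (q / 2) \<le> (((\<alpha> / \<sigma>) powr (q / 2) + (\<beta> / \<sigma>) powr (q / 2)) / 2 - (1 - d / \<sigma>) powr (q / 2)) * \<sigma> powr (q / 2)"
          unfolding \<beta> by (intro mult_right_mono) auto
        also have "\<dots> = ((\<alpha> / \<sigma>) powr (q / 2) * \<sigma> powr (q / 2) + (\<beta> / \<sigma>) powr (q / 2) * \<sigma> powr (q / 2)) / 2
            - (1 - d / \<sigma>) powr (q / 2) * \<sigma> powr (q / 2)"
          by (simp only: left_diff_distrib distrib_right add_divide_distrib times_divide_eq_left)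
        also have "\<dots> = ?gap"
        proof -
          have "(\<alpha> / \<sigma>) powr (q / 2) * \<sigma> powr (q / 2) = \<alpha> powr (q / 2)"
            using powr_mult[of "\<alpha> / \<sigma>" \<sigma> "q / 2"] A \<sigma> by simp
          moreover have "(\<beta> / \<sigma>) powr (q / 2) * \<sigma> powr (q / 2) = \<beta> powr (q / 2)"
            using powr_mult[of "\<beta> / \<sigma>" \<sigma> "q / 2"] A \<sigma> by simp
          moreover have "(1 - d / \<sigma>) powr (q / 2) * \<sigma> powr (q / 2) = (\<sigma> - d) powr (q / 2)"
            using powr_mult[of "1 - d / \<sigma>" \<sigma> "q / 2"] A \<sigma> by (simp add: left_diff_distrib \<sigma>_def[symmetric])
          ultimately show ?thesis by (simp only: \<sigma>_def)
        qed
        finally have "\<sigma> powr (q / 2) \<le> 1 / \<kappa> * ?gap" using \<kappa>(1) by (simp add: field_simps)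
        moreover have "d powr (q / 2) \<le> \<sigma> powr (q / 2)" using A q by (intro powr_mono2) (auto simp: \<sigma>_def)
        ultimately show ?thesis using s0 \<epsilon> by (simp add: add_increasing)
      qed
    qed
  qed (use \<kappa> in simp)
qed

locale quad_form =
  fixes b :: "'v::real_vector \<Rightarrow> 'v \<Rightarrow> real"
  assumes add_left: "b (x + y) z = b x z + b y z"
    and scale_left: "b (c *\<^sub>R x) z = c * b x z"
    and sym: "b x y = b y x"
    and pos: "0 \<le> b x x"
begin

lemma add_right: "b z (x + y) = b z x + b z y" using add_left sym by metis
lemma scale_right: "b z (c *\<^sub>R x) = c * b z x" using scale_left sym by metis
lemma minus_left: "b (x - y) z = b x z - b y z"
  using add_left[of x "(-1) *\<^sub>R y" z] scale_left[of "-1" y z] by simp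
lemma minus_right: "b z (x - y) = b z x - b z y" using minus_left sym by metis

lemma sq_sum: "b (x + t *\<^sub>R y) (x + t *\<^sub>R y) = b x x + 2 * t * b x y + t\<^sup>2 * b y y"
  by (simp add: add_left add_right scale_left scale_right sym[of y x] power2_eq_square algebra_simps)

lemma Cauchy_Schwarz: "\<bar>b x y\<bar> \<le> sqrt (b x x) * sqrt (b y y)"
proof -
  have "(b x y)\<^sup>2 \<le> b x x * b y y"
  proof (cases "b y y = 0")
    case False
    then have y: "0 < b y y" using pos[of y] by simp
    have "0 \<le> b x x + 2 * (- b x y / b y y) * b x y + (- b x y / b y y)\<^sup>2 * b y y"
      using pos[of "x + (- b x y / b y y) *\<^sub>R y"] unfolding sq_sum .
    then show ?thesis using y by (simp add: power2_eq_square field_simps)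
  next
    case True
    have "b x y = 0"
    proof (rule ccontr)
      assume n: "b x y \<noteq> 0"
      have "0 \<le> b x x + 2 * (- (b x x + 1) / (2 * b x y)) * b x y"
        using pos[of "x + (- (b x x + 1) / (2 * b x y)) *\<^sub>R y"] unfolding sq_sum by (simp add: True)
      moreover have "b x x + 2 * (- (b x x + 1) / (2 * b x y)) * b x y = - 1" using n by (simp add: field_simps)
      ultimately show False by simp
    qed
    then show ?thesis using True by simp
  qed
  then have "sqrt ((b x y)\<^sup>2) \<le> sqrt (b x x * b y y)" by (rule real_sqrt_le_mono)
  then show ?thesis by (simp add: real_sqrt_mult)
qed

lemma half_diff: "b ((1/2) *\<^sub>R (x - y)) ((1/2) *\<^sub>R (x - y)) = (b x x + b y y) / 4 - b x y / 2"
  unfolding scale_left scale_right minus_left minus_right sym[of y x] by (simp add: field_simps)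

text \<open>The parallelogram identity.\<close>

lemma half_sum: "b ((1/2) *\<^sub>R (x + y)) ((1/2) *\<^sub>R (x + y)) = (b x x + b y y) / 2 - b ((1/2) *\<^sub>R (x - y)) ((1/2) *\<^sub>R (x - y))"
  unfolding half_diff unfolding scale_left scale_right add_left add_right sym[of y x] by (simp add: field_simps)

lemma half_diff_bounds:
  "b ((1/2) *\<^sub>R (x - y)) ((1/2) *\<^sub>R (x - y)) \<le> (b x x + b y y) / 2"
  "((sqrt (b x x) - sqrt (b y y)) / 2)\<^sup>2 \<le> b ((1/2) *\<^sub>R (x - y)) ((1/2) *\<^sub>R (x - y))"
proof -
  show "b ((1/2) *\<^sub>R (x - y)) ((1/2) *\<^sub>R (x - y)) \<le> (b x x + b y y) / 2"
    using half_sum[of x y] pos[of "(1/2) *\<^sub>R (x + y)"] by linarith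
  have "((sqrt (b x x) - sqrt (b y y)) / 2)\<^sup>2 = (b x x + b y y) / 4 - sqrt (b x x) * sqrt (b y y) / 2"
    using pos[of x] pos[of y] by (simp add: power2_eq_square field_simps)
  then show "((sqrt (b x x) - sqrt (b y y)) / 2)\<^sup>2 \<le> b ((1/2) *\<^sub>R (x - y)) ((1/2) *\<^sub>R (x - y))"
    using Cauchy_Schwarz[of x y] unfolding half_diff by simp
qed

lemma triangle: "sqrt (b (x + y) (x + y)) \<le> sqrt (b x x) + sqrt (b y y)"
proof (rule real_le_lsqrt)
  show "0 \<le> sqrt (b x x) + sqrt (b y y)" by (simp add: pos)
  have "b (x + y) (x + y) = b x x + 2 * b x y + b y y" using sq_sum[of x 1 y] by simp
  also have "\<dots> \<le> b x x + 2 * (sqrt (b x x) * sqrt (b y y)) + b y y"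
    using Cauchy_Schwarz[of x y] by simp
  also have "\<dots> = (sqrt (b x x) + sqrt (b y y))\<^sup>2" by (simp add: power2_sum pos)
  finally show "b (x + y) (x + y) \<le> (sqrt (b x x) + sqrt (b y y))\<^sup>2" .
qed

text \<open>The vector \<open>b x x powr ((p - 2) / 2) * x\<close> is the gradient of \<open>b x x powr (p / 2) / p\<close>, that is, of \<open>N(x)\<^sup>p / p\<close>
  with the seminorm \<open>N\<close> of \<open>b\<close>. For \<open>N(x) = 0\<close> both sides vanish, because \<open>0 powr a = 0\<close>.\<close>

lemma flux_le: "\<bar>b x x powr ((p - 2) / 2) * b x y\<bar> \<le> sqrt (b x x) powr (p - 1) * sqrt (b y y)"
proof (cases "b x x = 0")
  case False
  then have x: "0 < b x x" using pos[of x] by simp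
  have "\<bar>b x x powr ((p - 2) / 2) * b x y\<bar> = sqrt (b x x) powr (p - 2) * \<bar>b x y\<bar>"
    using x powr_half[of "b x x" "p - 2"] by (simp add: abs_mult)
  also have "\<dots> \<le> sqrt (b x x) powr (p - 2) * (sqrt (b x x) * sqrt (b y y))"
    by (intro mult_left_mono Cauchy_Schwarz) simp
  also have "\<dots> = sqrt (b x x) powr (p - 2) * sqrt (b x x) powr 1 * sqrt (b y y)"
    using x by simp
  also have "\<dots> = sqrt (b x x) powr (p - 1) * sqrt (b y y)"
    using x by (subst powr_add[symmetric]) simp
  finally show ?thesis .
qed simp

lemma flux_young:
  assumes p: "1 < p" "p \<le> p2" and s: "0 < s" "s \<le> 1"
  shows "\<bar>b x x powr ((p - 2) / 2) * b x y\<bar> \<le> s * b x x powr (p / 2) + inverse s powr p2 * b y y powr (p / 2)"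
proof -
  let ?a = "sqrt (b x x)" and ?h = "sqrt (b y y)" and ?r = "p / (p - 1)"
  have ah: "0 \<le> ?a" "0 \<le> ?h" by (simp_all add: pos)
  have r: "1 \<le> ?r" "1 < ?r" using p by (simp_all add: field_simps)
  have "?a powr (p - 1) * ?h = (s * ?a powr (p - 1)) * (inverse s * ?h)" using s by simp
  also have "\<dots> \<le> (s * ?a powr (p - 1)) powr ?r / ?r + (inverse s * ?h) powr p / p"
    using p s ah r by (intro Youngs_inequality) (auto simp: field_simps)
  also have "\<dots> \<le> (s * ?a powr (p - 1)) powr ?r / 1 + (inverse s * ?h) powr p / 1"
    using p r by (intro add_mono divide_left_mono) auto
  also have "(s * ?a powr (p - 1)) powr ?r = s powr ?r * ?a powr p"
    using s p by (simp add: powr_mult powr_powr)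
  also have "(inverse s * ?h) powr p = inverse s powr p * ?h powr p"
    using s ah by (intro powr_mult)
  also have "s powr ?r * ?a powr p / 1 + inverse s powr p * ?h powr p / 1 \<le> s * ?a powr p + inverse s powr p2 * ?h powr p"
  proof -
    have "s powr ?r \<le> s powr 1" using s r by (intro powr_mono') auto
    moreover have "inverse s powr p \<le> inverse s powr p2" using s p by (intro powr_mono) (auto simp: one_le_inverse_iff)
    ultimately show ?thesis using s by (intro add_mono) (auto intro!: mult_right_mono)
  qed
  finally show ?thesis
    using flux_le[of x p y] powr_half[OF pos, of x p] powr_half[OF pos, of y p] by simp
qed

text \<open>Convexity of \<open>N\<^sup>p / p\<close>: Young's inequality bounds \<open>N(x)\<^sup>p\<^sup>-\<^sup>1 N(y)\<close> by \<open>N(x)\<^sup>p (p - 1)/p + N(y)\<^sup>p / p\<close>.\<close>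

lemma gradient_inequality:
  assumes p: "1 < p"
  shows "b x x powr (p / 2) / p + b x x powr ((p - 2) / 2) * b x (y - x) \<le> b y y powr (p / 2) / p"
proof -
  let ?a = "sqrt (b x x)" and ?h = "sqrt (b y y)" and ?r = "p / (p - 1)"
  have ah: "0 \<le> ?a" "0 \<le> ?h" by (simp_all add: pos)
  have "b x x powr ((p - 2) / 2) * b x y \<le> ?a powr (p - 1) * ?h" using flux_le[of x p y] by simp
  also have "\<dots> \<le> (?a powr (p - 1)) powr ?r / ?r + ?h powr p / p"
    using p ah by (intro Youngs_inequality) (auto simp: field_simps)
  also have "(?a powr (p - 1)) powr ?r = ?a powr p" using p by (simp add: powr_powr)
  finally have 1: "b x x powr ((p - 2) / 2) * b x y \<le> b x x powr (p / 2) / ?r + b y y powr (p / 2) / p"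
    using powr_half[OF pos, of x p] powr_half[OF pos, of y p] by simp
  have 2: "b x x powr ((p - 2) / 2) * b x x = b x x powr (p / 2)"
  proof (cases "b x x = 0")
    case False
    then have "b x x powr ((p - 2) / 2) * b x x = b x x powr ((p - 2) / 2) * b x x powr 1"
      using pos[of x] by simp
    also have "\<dots> = b x x powr ((p - 2) / 2 + 1)" by (rule powr_add[symmetric])
    also have "(p - 2) / 2 + 1 = p / 2" by (simp add: field_simps)
    finally show ?thesis .
  qed simp
  have "1 / p + 1 / ?r = 1" using p by (simp add: field_simps)
  then have "b x x powr (p / 2) / p + b x x powr (p / 2) / ?r = b x x powr (p / 2)"
    by (metis distrib_left mult.right_neutral times_divide_eq_right)
  then show ?thesis using 1 2 by (simp add: minus_right right_diff_distrib)
qed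

lemma uniform_convexity:
  assumes K: "\<And>\<alpha> \<beta> d p. 0 \<le> \<alpha> \<Longrightarrow> 0 \<le> \<beta> \<Longrightarrow> 0 \<le> d \<Longrightarrow> p \<in> {p1..p2} \<Longrightarrow> d \<le> (\<alpha> + \<beta>) / 2
    \<Longrightarrow> ((sqrt \<alpha> - sqrt \<beta>) / 2)\<^sup>2 \<le> d
    \<Longrightarrow> d powr (p / 2) \<le> \<epsilon> * (\<alpha> powr (p / 2) + \<beta> powr (p / 2))
        + K * ((\<alpha> powr (p / 2) + \<beta> powr (p / 2)) / 2 - ((\<alpha> + \<beta>) / 2 - d) powr (p / 2))"
    and p: "p \<in> {p1..p2}"
  shows "b ((1/2) *\<^sub>R (x - y)) ((1/2) *\<^sub>R (x - y)) powr (p / 2)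
    \<le> \<epsilon> * (b x x powr (p / 2) + b y y powr (p / 2))
      + K * ((b x x powr (p / 2) + b y y powr (p / 2)) / 2 - b ((1/2) *\<^sub>R (x + y)) ((1/2) *\<^sub>R (x + y)) powr (p / 2))"
  unfolding half_sum by (rule K[OF pos pos pos p half_diff_bounds])

lemma convex_midpoint:
  assumes "1 < p"
  shows "b ((1/2) *\<^sub>R (x + y)) ((1/2) *\<^sub>R (x + y)) powr (p / 2) \<le> (b x x powr (p / 2) + b y y powr (p / 2)) / 2"
  unfolding half_sum by (rule midpoint_gap_nonneg[OF pos pos assms pos half_diff_bounds])

text \<open>At \<open>b x x = 0\<close> the flux is continuous because it is at most \<open>N(x + t y)\<^sup>p\<^sup>-\<^sup>1 N(y)\<close> and \<open>p > 1\<close>.\<close>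

lemma flux_continuous:
  assumes p: "1 < p" and t: "t \<longlonglongrightarrow> 0"
  shows "(\<lambda>n. b (x + t n *\<^sub>R y) (x + t n *\<^sub>R y) powr ((p - 2) / 2) * b (x + t n *\<^sub>R y) y)
    \<longlonglongrightarrow> b x x powr ((p - 2) / 2) * b x y"
proof -
  have q: "(\<lambda>n. b (x + t n *\<^sub>R y) (x + t n *\<^sub>R y)) \<longlonglongrightarrow> b x x"
  proof -
    have "(\<lambda>n. b x x + 2 * t n * b x y + (t n)\<^sup>2 * b y y) \<longlonglongrightarrow> b x x + 2 * 0 * b x y + 0\<^sup>2 * b y y"
      by (intro tendsto_intros t)
    then show ?thesis by (simp add: sq_sum)
  qed
  have l: "(\<lambda>n. b (x + t n *\<^sub>R y) y) \<longlonglongrightarrow> b x y"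
  proof -
    have "(\<lambda>n. b x y + t n * b y y) \<longlonglongrightarrow> b x y + 0 * b y y" by (intro tendsto_intros t)
    then show ?thesis by (simp add: add_left scale_left)
  qed
  show ?thesis
  proof (cases "b x x = 0")
    case False
    then show ?thesis by (intro tendsto_mult l tendsto_powr q tendsto_const) simp
  next
    case True
    have "(\<lambda>n. sqrt (b (x + t n *\<^sub>R y) (x + t n *\<^sub>R y)) powr (p - 1) * sqrt (b y y)) \<longlonglongrightarrow> sqrt (b x x) powr (p - 1) * sqrt (b y y)"
      using p by (intro tendsto_mult tendsto_powr2 tendsto_real_sqrt q tendsto_const always_eventually) (auto simp: pos)
    then have "(\<lambda>n. sqrt (b (x + t n *\<^sub>R y) (x + t n *\<^sub>R y)) powr (p - 1) * sqrt (b y y)) \<longlonglongrightarrow> 0"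
      using True by simp
    then have "(\<lambda>n. b (x + t n *\<^sub>R y) (x + t n *\<^sub>R y) powr ((p - 2) / 2) * b (x + t n *\<^sub>R y) y) \<longlonglongrightarrow> 0"
      by (rule Lim_null_comparison[rotated]) (use flux_le in auto)
    then show ?thesis using True by simp
  qed
qed

end

section \<open>The integral functionals\<close>

text \<open>One term of the energy, for a measurable field of quadratic forms comparable to \<open>\<omega>\<^sup>2 \<bar>\<xi>\<bar>\<^sup>2\<close>. The two instances
  are \<open>\<langle>A \<xi>, \<zeta>\<rangle>\<close> for the gradient and \<open>\<omega>\<^sup>2 t u\<close> for the function itself.\<close>

locale energy_term = weighted_domain G \<Omega> p \<omega> p1 p2
  for G :: "('g::{t2_space, second_countable_topology}, 'e::euclidean_space, 'n::finite) carnot"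
    and \<Omega> p \<omega> p1 p2 +
  fixes b :: "'g \<Rightarrow> 'v::euclidean_space \<Rightarrow> 'v \<Rightarrow> real" and c1 c2 :: real
  assumes c1: "0 < c1" and c2: "0 < c2"
    and form: "AE x in \<mu>. quad_form (b x)"
    and form_bounds: "AE x in \<mu>. \<forall>\<xi>. c1 * (norm \<xi> * \<omega> x)\<^sup>2 \<le> b x \<xi> \<xi> \<and> b x \<xi> \<xi> \<le> c2 * (norm \<xi> * \<omega> x)\<^sup>2"
    and form_meas: "\<And>F H. F \<in> borel_measurable \<mu> \<Longrightarrow> H \<in> borel_measurable \<mu> \<Longrightarrow> (\<lambda>x. b x (F x) (H x)) \<in> borel_measurable \<mu>"
begin

definition fin :: "('g \<Rightarrow> 'v) \<Rightarrow> bool" where "fin F \<longleftrightarrow> F \<in> borel_measurable \<mu> \<and> rho F < \<infinity>"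

definition J :: "('g \<Rightarrow> 'v) \<Rightarrow> real" where
  "J F = (\<integral>x. b x (F x) (F x) powr (P x / 2) / P x \<partial>\<mu>)"

definition dJ :: "('g \<Rightarrow> 'v) \<Rightarrow> ('g \<Rightarrow> 'v) \<Rightarrow> real" where
  "dJ F H = (\<integral>x. b x (F x) (F x) powr ((P x - 2) / 2) * b x (F x) (H x) \<partial>\<mu>)"

lemma form_AE: "AE x in \<mu>. quad_form (b x) \<and> 0 < \<omega> x \<and> p1 \<le> P x \<and> P x \<le> p2 \<and> 1 < P x"
  using form good_AE by eventually_elim (use p1 in auto)

lemma fin_linear: "fin F \<Longrightarrow> fin H \<Longrightarrow> fin (\<lambda>x. s *\<^sub>R F x + t *\<^sub>R H x)"
  unfolding fin_def using rho_linear_finite[of F H s t] by auto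

lemma fin_diff: "fin F \<Longrightarrow> fin H \<Longrightarrow> fin (\<lambda>x. F x - H x)"
  using fin_linear[of F H 1 "-1"] by simp

lemma fin_half: "fin F \<Longrightarrow> fin H \<Longrightarrow> fin (\<lambda>x. (1/2) *\<^sub>R (F x + H x))" "fin F \<Longrightarrow> fin H \<Longrightarrow> fin (\<lambda>x. (1/2) *\<^sub>R (F x - H x))"
  using fin_linear[of F H "1/2" "1/2"] fin_linear[of F H "1/2" "-1/2"] by (simp_all add: scaleR_add_right scaleR_diff_right)

definition R :: "('g \<Rightarrow> 'v) \<Rightarrow> real" where "R F = (\<integral>x. (norm (F x) * \<omega> x) powr P x \<partial>\<mu>)"

lemma R_integrable: assumes "fin F" shows "integrable \<mu> (\<lambda>x. (norm (F x) * \<omega> x) powr P x)"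
proof -
  note p_meas [measurable] \<omega>_meas [measurable]
  have [measurable]: "F \<in> borel_measurable \<mu>" using assms by (simp add: fin_def)
  have "(\<lambda>x. (norm (F x) * \<omega> x) powr P x) \<in> borel_measurable \<mu>" by measurable
  then show ?thesis using assms by (simp add: fin_def integrable_iff_bounded rho_def)
qed

lemma rho_eq_R: assumes "fin F" shows "rho F = ennreal (R F)"
  unfolding rho_def R_def by (rule nn_integral_eq_integral[OF R_integrable[OF assms]]) simp

definition "C1 = max 1 (1 / c1) powr (p2 / 2)"
definition "C2 = max 1 c2 powr (p2 / 2)"

lemma C_pos: "0 < C1" "0 < C2" by (simp_all add: C1_def C2_def)

lemma form_powr_bounds:
  "AE x in \<mu>. \<forall>\<xi>. b x \<xi> \<xi> powr (P x / 2) \<le> C2 * (norm \<xi> * \<omega> x) powr P x \<and>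
     (norm \<xi> * \<omega> x) powr P x \<le> C1 * b x \<xi> \<xi> powr (P x / 2)"
  using form_AE form_bounds
proof eventually_elim
  case (elim x)
  have P: "0 < P x" "P x \<le> p2" "1 < P x" and w: "0 < \<omega> x" using elim by auto
  interpret quad_form "b x" using elim by simp
  show ?case
  proof (intro allI conjI)
    fix \<xi> :: 'v
    let ?t = "norm \<xi> * \<omega> x"
    have t: "0 \<le> ?t" using w by simp
    have t2: "(?t\<^sup>2) powr (P x / 2) = ?t powr P x" using t by (simp add: powr_half)
    have "b x \<xi> \<xi> powr (P x / 2) \<le> (c2 * ?t\<^sup>2) powr (P x / 2)"
      using elim(2) pos P by (intro powr_mono2) auto
    also have "\<dots> = c2 powr (P x / 2) * (?t\<^sup>2) powr (P x / 2)" by (rule powr_mult)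
    also have "\<dots> \<le> C2 * (?t\<^sup>2) powr (P x / 2)"
    proof (rule mult_right_mono)
      have "c2 powr (P x / 2) \<le> max 1 c2 powr (P x / 2)" using c2 P by (intro powr_mono2) auto
      also have "\<dots> \<le> C2" unfolding C2_def using P by (intro powr_mono) auto
      finally show "c2 powr (P x / 2) \<le> C2" .
    qed simp
    finally show "b x \<xi> \<xi> powr (P x / 2) \<le> C2 * ?t powr P x" using t2 by simp
    have "?t\<^sup>2 \<le> (1 / c1) * b x \<xi> \<xi>" using elim(2)[rule_format, of \<xi>] c1 by (simp add: field_simps)
    then have "(?t\<^sup>2) powr (P x / 2) \<le> ((1 / c1) * b x \<xi> \<xi>) powr (P x / 2)"
      using P by (intro powr_mono2) auto
    also have "\<dots> = (1 / c1) powr (P x / 2) * b x \<xi> \<xi> powr (P x / 2)" by (rule powr_mult)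
    also have "\<dots> \<le> C1 * b x \<xi> \<xi> powr (P x / 2)"
    proof (rule mult_right_mono)
      have "(1 / c1) powr (P x / 2) \<le> max 1 (1 / c1) powr (P x / 2)" using c1 P by (intro powr_mono2) auto
      also have "\<dots> \<le> C1" unfolding C1_def using P by (intro powr_mono) auto
      finally show "(1 / c1) powr (P x / 2) \<le> C1" .
    qed simp
    finally show "?t powr P x \<le> C1 * b x \<xi> \<xi> powr (P x / 2)" using t2 by simp
  qed
qed

lemma form_measI [measurable]:
  assumes "F \<in> borel_measurable \<mu>" "H \<in> borel_measurable \<mu>"
  shows "(\<lambda>x. b x (F x) (H x)) \<in> borel_measurable \<mu>"
  by (rule form_meas[OF assms])

lemma power_integrable: assumes F: "fin F" shows "integrable \<mu> (\<lambda>x. b x (F x) (F x) powr (P x / 2))"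
proof (rule Bochner_Integration.integrable_bound[OF integrable_mult_right[OF R_integrable[OF F], of C2]])
  have [measurable]: "F \<in> borel_measurable \<mu>" using F by (simp add: fin_def)
  show "(\<lambda>x. b x (F x) (F x) powr (P x / 2)) \<in> borel_measurable \<mu>" by measurable
  show "AE x in \<mu>. norm (b x (F x) (F x) powr (P x / 2)) \<le> norm (C2 * (norm (F x) * \<omega> x) powr P x)"
    using form_powr_bounds by eventually_elim (use C_pos in simp)
qed

lemma J_integrable: assumes F: "fin F" shows "integrable \<mu> (\<lambda>x. b x (F x) (F x) powr (P x / 2) / P x)"
proof (rule Bochner_Integration.integrable_bound[OF power_integrable[OF F]])
  have [measurable]: "F \<in> borel_measurable \<mu>" using F by (simp add: fin_def)
  show "(\<lambda>x. b x (F x) (F x) powr (P x / 2) / P x) \<in> borel_measurable \<mu>" by measurable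
  show "AE x in \<mu>. norm (b x (F x) (F x) powr (P x / 2) / P x) \<le> norm (b x (F x) (F x) powr (P x / 2))"
    using form_AE
  proof eventually_elim
    case (elim x)
    have "b x (F x) (F x) powr (P x / 2) / P x \<le> b x (F x) (F x) powr (P x / 2) / 1"
      using elim by (intro divide_left_mono) auto
    then show ?case using elim by simp
  qed
qed

definition I :: "('g \<Rightarrow> 'v) \<Rightarrow> real" where "I F = (\<integral>x. b x (F x) (F x) powr (P x / 2) \<partial>\<mu>)"

lemma I_le_J: assumes F: "fin F" shows "I F \<le> p2 * J F"
proof -
  have "I F \<le> (\<integral>x. p2 * (b x (F x) (F x) powr (P x / 2) / P x) \<partial>\<mu>)"
    unfolding I_def
  proof (rule integral_mono_AE[OF power_integrable[OF F] integrable_mult_right[OF J_integrable[OF F]]])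
    show "AE x in \<mu>. b x (F x) (F x) powr (P x / 2) \<le> p2 * (b x (F x) (F x) powr (P x / 2) / P x)"
      using form_AE
    proof eventually_elim
      case (elim x)
      then have "P x * b x (F x) (F x) powr (P x / 2) \<le> p2 * b x (F x) (F x) powr (P x / 2)"
        by (intro mult_right_mono) auto
      then show ?case using elim by (simp add: pos_le_divide_eq mult.commute)
    qed
  qed
  then show ?thesis by (simp only: J_def integral_mult_right_zero)
qed

lemma J_nonneg: "0 \<le> J F"
  unfolding J_def by (intro integral_nonneg_AE) (use form_AE in \<open>eventually_elim, simp\<close>)

lemma J_le_R: assumes F: "fin F" shows "J F \<le> C2 * R F"
proof -
  have "J F \<le> (\<integral>x. C2 * (norm (F x) * \<omega> x) powr P x \<partial>\<mu>)"
    unfolding J_def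
  proof (rule integral_mono_AE[OF J_integrable[OF F] integrable_mult_right[OF R_integrable[OF F]]])
    show "AE x in \<mu>. b x (F x) (F x) powr (P x / 2) / P x \<le> C2 * (norm (F x) * \<omega> x) powr P x"
      using form_AE form_powr_bounds
    proof eventually_elim
      case (elim x)
      have "b x (F x) (F x) powr (P x / 2) / P x \<le> b x (F x) (F x) powr (P x / 2) / 1"
        using elim by (intro divide_left_mono) auto
      also have "\<dots> \<le> C2 * (norm (F x) * \<omega> x) powr P x" using elim by simp
      finally show ?case .
    qed
  qed
  then show ?thesis by (simp add: R_def)
qed

lemma R_le_J: assumes F: "fin F" shows "R F \<le> C1 * p2 * J F"
proof -
  have "R F \<le> (\<integral>x. C1 * b x (F x) (F x) powr (P x / 2) \<partial>\<mu>)"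
    unfolding R_def
  proof (rule integral_mono_AE[OF R_integrable[OF F] integrable_mult_right[OF power_integrable[OF F]]])
    show "AE x in \<mu>. (norm (F x) * \<omega> x) powr P x \<le> C1 * b x (F x) (F x) powr (P x / 2)"
      using form_powr_bounds by eventually_elim simp
  qed
  also have "\<dots> = C1 * I F" by (simp add: I_def)
  also have "\<dots> \<le> C1 * (p2 * J F)" using C_pos I_le_J[OF F] by (intro mult_left_mono) auto
  finally show ?thesis by simp
qed

lemma J_cong: "AE x in \<mu>. F x = H x \<Longrightarrow> fin F \<Longrightarrow> fin H \<Longrightarrow> J F = J H"
  unfolding J_def
  by (intro integral_cong_AE borel_measurable_integrable J_integrable) (auto elim: eventually_mono)

lemma J_midpoint:
  assumes F: "fin F" and H: "fin H" shows "J (\<lambda>x. (1/2) *\<^sub>R (F x + H x)) \<le> (J F + J H) / 2"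
proof -
  have "J (\<lambda>x. (1/2) *\<^sub>R (F x + H x)) \<le> (\<integral>x. (1/2) * (b x (F x) (F x) powr (P x / 2) / P x + b x (H x) (H x) powr (P x / 2) / P x) \<partial>\<mu>)"
    unfolding J_def
  proof (rule integral_mono_AE)
    show "AE x in \<mu>. b x ((1/2) *\<^sub>R (F x + H x)) ((1/2) *\<^sub>R (F x + H x)) powr (P x / 2) / P x
        \<le> (1/2) * (b x (F x) (F x) powr (P x / 2) / P x + b x (H x) (H x) powr (P x / 2) / P x)"
      using form_AE
    proof eventually_elim
      case (elim x)
      interpret quad_form "b x" using elim by simp
      show ?case
        using divide_right_mono[OF convex_midpoint[of "P x" "F x" "H x"], of "P x"] elim
        by (simp add: add_divide_distrib)
    qed
  qed (use J_integrable F H fin_half in auto)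
  also have "\<dots> = (J F + J H) / 2" using J_integrable F H by (simp add: J_def)
  finally show ?thesis .
qed

lemma J_uniformly_convex:
  assumes \<epsilon>: "0 < \<epsilon>"
  obtains K where "0 \<le> K" "\<And>F H. fin F \<Longrightarrow> fin H \<Longrightarrow> J (\<lambda>x. (1/2) *\<^sub>R (F x - H x))
     \<le> \<epsilon> * (J F + J H) + K * ((J F + J H) / 2 - J (\<lambda>x. (1/2) *\<^sub>R (F x + H x)))"
proof -
  obtain K where K: "0 \<le> K" "\<And>\<alpha> \<beta> d p. 0 \<le> \<alpha> \<Longrightarrow> 0 \<le> \<beta> \<Longrightarrow> 0 \<le> d \<Longrightarrow> p \<in> {p1..p2} \<Longrightarrow> d \<le> (\<alpha> + \<beta>) / 2
    \<Longrightarrow> ((sqrt \<alpha> - sqrt \<beta>) / 2)\<^sup>2 \<le> d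
    \<Longrightarrow> d powr (p / 2) \<le> \<epsilon> * (\<alpha> powr (p / 2) + \<beta> powr (p / 2))
        + K * ((\<alpha> powr (p / 2) + \<beta> powr (p / 2)) / 2 - ((\<alpha> + \<beta>) / 2 - d) powr (p / 2))"
    by (rule uniform_convexity_scalar[OF p1 \<epsilon>, of p2]) (rule that)
  have "J (\<lambda>x. (1/2) *\<^sub>R (F x - H x)) \<le> \<epsilon> * (J F + J H) + K * ((J F + J H) / 2 - J (\<lambda>x. (1/2) *\<^sub>R (F x + H x)))"
    if F: "fin F" and H: "fin H" for F H
  proof -
    let ?q = "\<lambda>F x. b x (F x) (F x) powr (P x / 2) / P x"
    let ?m = "\<lambda>x. (1/2) *\<^sub>R (F x + H x)" and ?d = "\<lambda>x. (1/2) *\<^sub>R (F x - H x)"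
    note int = J_integrable[OF F] J_integrable[OF H] J_integrable[OF fin_half(1)[OF F H]] J_integrable[OF fin_half(2)[OF F H]]
    have "J ?d \<le> (\<integral>x. \<epsilon> * (?q F x + ?q H x) + K * ((1/2) * (?q F x + ?q H x) - ?q ?m x) \<partial>\<mu>)"
      unfolding J_def
    proof (rule integral_mono_AE)
      show "AE x in \<mu>. ?q ?d x \<le> \<epsilon> * (?q F x + ?q H x) + K * ((1/2) * (?q F x + ?q H x) - ?q ?m x)"
        using form_AE
      proof eventually_elim
        case (elim x)
        interpret quad_form "b x" using elim by simp
        have "b x (?d x) (?d x) powr (P x / 2) / P x
          \<le> (\<epsilon> * (b x (F x) (F x) powr (P x / 2) + b x (H x) (H x) powr (P x / 2))
          + K * ((b x (F x) (F x) powr (P x / 2) + b x (H x) (H x) powr (P x / 2)) / 2 - b x (?m x) (?m x) powr (P x / 2))) / P x"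
          using elim by (intro divide_right_mono uniform_convexity[OF K(2), of p1 p2]) auto
        also have "\<dots> = \<epsilon> * (?q F x + ?q H x) + K * ((1/2) * (?q F x + ?q H x) - ?q ?m x)"
          using elim by (simp add: field_simps)
        finally show ?case .
      qed
    qed (use int in \<open>auto intro!: Bochner_Integration.integrable_add Bochner_Integration.integrable_diff integrable_mult_right\<close>)
    also have "\<dots> = \<epsilon> * (J F + J H) + K * ((J F + J H) / 2 - J ?m)"
      using int by (simp add: J_def)
    finally show ?thesis .
  qed
  then show thesis using that K(1) by blast
qed

lemma flux_integrable:
  assumes F: "fin F" and H: "fin H"
  shows "integrable \<mu> (\<lambda>x. b x (F x) (F x) powr ((P x - 2) / 2) * b x (F x) (H x))"
proof (rule Bochner_Integration.integrable_bound[OF Bochner_Integration.integrable_add[OF power_integrable[OF F] power_integrable[OF H]]])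
  have [measurable]: "F \<in> borel_measurable \<mu>" "H \<in> borel_measurable \<mu>" using F H by (auto simp: fin_def)
  show "(\<lambda>x. b x (F x) (F x) powr ((P x - 2) / 2) * b x (F x) (H x)) \<in> borel_measurable \<mu>" by measurable
  show "AE x in \<mu>. norm (b x (F x) (F x) powr ((P x - 2) / 2) * b x (F x) (H x))
      \<le> norm (b x (F x) (F x) powr (P x / 2) + b x (H x) (H x) powr (P x / 2))"
    using form_AE
  proof eventually_elim
    case (elim x)
    interpret quad_form "b x" using elim by simp
    show ?case using flux_young[of "P x" p2 1 "F x" "H x"] elim by simp
  qed
qed

lemma dJ_young:
  assumes F: "fin F" and H: "fin H" and s: "0 < s" "s \<le> 1"
  shows "\<bar>dJ F H\<bar> \<le> s * I F + inverse s powr p2 * I H"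
proof -
  have "\<bar>dJ F H\<bar> \<le> (\<integral>x. \<bar>b x (F x) (F x) powr ((P x - 2) / 2) * b x (F x) (H x)\<bar> \<partial>\<mu>)"
    unfolding dJ_def by (rule integral_abs_bound)
  also have "\<dots> \<le> (\<integral>x. s * b x (F x) (F x) powr (P x / 2) + inverse s powr p2 * b x (H x) (H x) powr (P x / 2) \<partial>\<mu>)"
  proof (rule integral_mono_AE)
    show "AE x in \<mu>. \<bar>b x (F x) (F x) powr ((P x - 2) / 2) * b x (F x) (H x)\<bar>
        \<le> s * b x (F x) (F x) powr (P x / 2) + inverse s powr p2 * b x (H x) (H x) powr (P x / 2)"
      using form_AE
    proof eventually_elim
      case (elim x)
      interpret quad_form "b x" using elim by simp
      show ?case using flux_young[of "P x" p2 s "F x" "H x"] elim s by simp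
    qed
  qed (use power_integrable F H integrable_abs[OF flux_integrable[OF F H]] in auto)
  also have "\<dots> = s * I F + inverse s powr p2 * I H" using power_integrable F H by (simp add: I_def)
  finally show ?thesis .
qed

lemma dJ_cong:
  assumes "AE x in \<mu>. F x = F' x" "AE x in \<mu>. H x = H' x" "fin F" "fin F'" "fin H" "fin H'"
  shows "dJ F H = dJ F' H'"
  unfolding dJ_def
proof (intro integral_cong_AE borel_measurable_integrable flux_integrable assms)
  show "AE x in \<mu>. b x (F x) (F x) powr ((P x - 2) / 2) * b x (F x) (H x)
      = b x (F' x) (F' x) powr ((P x - 2) / 2) * b x (F' x) (H' x)"
    using assms(1,2) by eventually_elim simp
qed

lemma dJ_scale:
  assumes F: "fin F" and H: "fin H" shows "dJ F (\<lambda>x. c *\<^sub>R H x) = c * dJ F H"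
proof -
  have cH: "fin (\<lambda>x. c *\<^sub>R H x)" using fin_linear[OF H H, of c 0] by simp
  have "dJ F (\<lambda>x. c *\<^sub>R H x) = (\<integral>x. c * (b x (F x) (F x) powr ((P x - 2) / 2) * b x (F x) (H x)) \<partial>\<mu>)"
    unfolding dJ_def
  proof (intro integral_cong_AE borel_measurable_integrable flux_integrable integrable_mult_right F H cH)
    show "AE x in \<mu>. b x (F x) (F x) powr ((P x - 2) / 2) * b x (F x) (c *\<^sub>R H x)
        = c * (b x (F x) (F x) powr ((P x - 2) / 2) * b x (F x) (H x))"
      using form_AE
    proof eventually_elim
      case (elim x)
      interpret quad_form "b x" using elim by simp
      show ?case by (simp add: scale_right)
    qed
  qed
  then show ?thesis by (simp add: dJ_def)
qed

lemma J_subgradient: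
  assumes F: "fin F" and H: "fin H" shows "J F + dJ F (\<lambda>x. H x - F x) \<le> J H"
proof -
  note int = J_integrable[OF F] flux_integrable[OF F fin_diff[OF H F]]
  have "J F + dJ F (\<lambda>x. H x - F x) = (\<integral>x. b x (F x) (F x) powr (P x / 2) / P x
      + b x (F x) (F x) powr ((P x - 2) / 2) * b x (F x) (H x - F x) \<partial>\<mu>)"
    using int by (simp add: J_def dJ_def)
  also have "\<dots> \<le> J H"
    unfolding J_def
  proof (rule integral_mono_AE)
    show "AE x in \<mu>. b x (F x) (F x) powr (P x / 2) / P x
      + b x (F x) (F x) powr ((P x - 2) / 2) * b x (F x) (H x - F x) \<le> b x (H x) (H x) powr (P x / 2) / P x"
      using form_AE
    proof eventually_elim
      case (elim x)
      interpret quad_form "b x" using elim by simp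
      show ?case using gradient_inequality elim by simp
    qed
  qed (use int J_integrable[OF H] in auto)
  finally show ?thesis .
qed

text \<open>Dominated convergence; the flux at \<open>F + t H\<close> is bounded by Young's inequality and the triangle inequality
  for the seminorm of \<open>b\<close>.\<close>

lemma dJ_tendsto:
  assumes F: "fin F" and H: "fin H" and t: "t \<longlonglongrightarrow> 0" "\<And>n. 0 \<le> t n" "\<And>n. t n \<le> 1"
  shows "(\<lambda>n. dJ (\<lambda>x. F x + t n *\<^sub>R H x) H) \<longlonglongrightarrow> dJ F H"
  unfolding dJ_def
proof (rule integral_dominated_convergence)
  let ?qF = "\<lambda>x. b x (F x) (F x) powr (P x / 2)" and ?qH = "\<lambda>x. b x (H x) (H x) powr (P x / 2)"
  let ?w = "\<lambda>x. 2 powr p2 * (?qF x + ?qH x) + ?qH x"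
  have fn: "fin (\<lambda>x. F x + t n *\<^sub>R H x)" for n using fin_linear[OF F H, of 1 "t n"] by simp
  show "(\<lambda>x. b x (F x) (F x) powr ((P x - 2) / 2) * b x (F x) (H x)) \<in> borel_measurable \<mu>"
    by (intro borel_measurable_integrable flux_integrable F H)
  show "(\<lambda>x. b x (F x + t n *\<^sub>R H x) (F x + t n *\<^sub>R H x) powr ((P x - 2) / 2) * b x (F x + t n *\<^sub>R H x) (H x)) \<in> borel_measurable \<mu>" for n
    by (intro borel_measurable_integrable flux_integrable fn H)
  show "integrable \<mu> ?w"
    by (intro Bochner_Integration.integrable_add integrable_mult_right power_integrable F H)
  show "AE x in \<mu>. (\<lambda>n. b x (F x + t n *\<^sub>R H x) (F x + t n *\<^sub>R H x) powr ((P x - 2) / 2) * b x (F x + t n *\<^sub>R H x) (H x))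
      \<longlonglongrightarrow> b x (F x) (F x) powr ((P x - 2) / 2) * b x (F x) (H x)"
    using form_AE
  proof eventually_elim
    case (elim x)
    interpret quad_form "b x" using elim by simp
    show ?case using elim t(1) by (intro flux_continuous) auto
  qed
  show "AE x in \<mu>. norm (b x (F x + t n *\<^sub>R H x) (F x + t n *\<^sub>R H x) powr ((P x - 2) / 2) * b x (F x + t n *\<^sub>R H x) (H x)) \<le> ?w x" for n
    using form_AE
  proof eventually_elim
    case (elim x)
    interpret quad_form "b x" using elim by simp
    let ?z = "F x + t n *\<^sub>R H x"
    let ?M = "max (sqrt (b x (F x) (F x))) (sqrt (b x (H x) (H x)))"
    have "b x (t n *\<^sub>R H x) (t n *\<^sub>R H x) = (t n)\<^sup>2 * b x (H x) (H x)"
      by (simp add: scale_left scale_right power2_eq_square)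
    then have "sqrt (b x (t n *\<^sub>R H x) (t n *\<^sub>R H x)) = t n * sqrt (b x (H x) (H x))"
      using t(2) by (simp add: real_sqrt_mult)
    also have "\<dots> \<le> 1 * sqrt (b x (H x) (H x))" using t(3) pos by (intro mult_right_mono) auto
    finally have "sqrt (b x ?z ?z) \<le> 2 * ?M"
      using triangle[of "F x" "t n *\<^sub>R H x"] max.cobounded1[of "sqrt (b x (F x) (F x))" "sqrt (b x (H x) (H x))"]
        max.cobounded2[of "sqrt (b x (H x) (H x))" "sqrt (b x (F x) (F x))"] by linarith
    then have "b x ?z ?z powr (P x / 2) \<le> (2 * ?M) powr P x"
      unfolding powr_half[OF pos] using elim pos by (intro powr_mono2) auto
    also have "\<dots> = 2 powr P x * ?M powr P x" by (rule powr_mult)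
    also have "\<dots> \<le> 2 powr p2 * ?M powr P x" using elim by (intro mult_right_mono powr_mono) auto
    also have "?M powr P x \<le> ?qF x + ?qH x"
      unfolding powr_half[OF pos] by (auto simp: max_def)
    finally have "b x ?z ?z powr (P x / 2) \<le> 2 powr p2 * (?qF x + ?qH x)" by simp
    then show ?case using flux_young[of "P x" p2 1 ?z "H x"] elim by simp
  qed
qed

end

section \<open>The direct method\<close>

text \<open>\<open>E\<close> is the gradient term of the energy and \<open>S\<close> its zero-order term; \<open>f\<close> lies in the space dual to that of \<open>u\<close>.\<close>

locale dirichlet_problem = weighted_domain G \<Omega> p \<omega> p1 p2 +
  E: energy_term G \<Omega> p \<omega> p1 p2 a a1 a2 + S: energy_term G \<Omega> p \<omega> p1 p2 s s1 s2
  for G :: "('g::{t2_space, second_countable_topology}, 'e::euclidean_space, 'n::finite) carnot"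
    and \<Omega> p \<omega> p1 p2 and a :: "'g \<Rightarrow> real^'n \<Rightarrow> real^'n \<Rightarrow> real" and a1 a2 :: real
    and s :: "'g \<Rightarrow> real \<Rightarrow> real \<Rightarrow> real" and s1 s2 :: real +
  fixes f :: "'g \<Rightarrow> real"
  assumes f_meas [measurable]: "f \<in> borel_measurable \<mu>"
    and f_dual: "(\<integral>\<^sup>+x. ennreal (\<bar>f x * inverse (\<omega> x)\<bar> powr (P x / (P x - 1))) \<partial>\<mu>) < \<infinity>"
begin

definition f_mass :: real where "f_mass = (\<integral>x. \<bar>f x * inverse (\<omega> x)\<bar> powr (P x / (P x - 1)) \<partial>\<mu>)"

lemma f_integrable: "integrable \<mu> (\<lambda>x. \<bar>f x * inverse (\<omega> x)\<bar> powr (P x / (P x - 1)))"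
  using f_dual unfolding integrable_iff_bounded by simp

definition ell :: "('g \<Rightarrow> real) \<Rightarrow> real" where "ell u = (\<integral>x. f x * u x \<partial>\<mu>)"

text \<open>Young's inequality in both weightings: the first absorbs the linear term into the energy,
  the second gives continuity of the linear term.\<close>

lemma load_young_pointwise:
  assumes "0 < t" "t \<le> 1"
  shows "AE x in \<mu>. \<bar>f x * u x\<bar> \<le> t * (norm (u x) * \<omega> x) powr P x
      + inverse t powr (p1 / (p1 - 1)) * \<bar>f x * inverse (\<omega> x)\<bar> powr (P x / (P x - 1))"
    "AE x in \<mu>. \<bar>f x * u x\<bar> \<le> inverse t powr p2 * (norm (u x) * \<omega> x) powr P x
      + t * \<bar>f x * inverse (\<omega> x)\<bar> powr (P x / (P x - 1))"
proof -
  have base: "\<bar>f x * u x\<bar> \<le> r powr P x * (norm (u x) * \<omega> x) powr P x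
      + inverse r powr (P x / (P x - 1)) * \<bar>f x * inverse (\<omega> x)\<bar> powr (P x / (P x - 1))"
    if r: "0 < r" and x: "0 < \<omega> x" "1 < P x" for r x
  proof -
    have "\<bar>f x * u x\<bar> = (r * (norm (u x) * \<omega> x)) * (inverse r * \<bar>f x * inverse (\<omega> x)\<bar>)"
      using r x by (simp add: abs_mult field_simps)
    also have "\<dots> \<le> (r * (norm (u x) * \<omega> x)) powr P x + (inverse r * \<bar>f x * inverse (\<omega> x)\<bar>) powr (P x / (P x - 1))"
      using r x by (intro young) auto
    finally show ?thesis by (simp only: powr_mult)
  qed
  show "AE x in \<mu>. \<bar>f x * u x\<bar> \<le> t * (norm (u x) * \<omega> x) powr P x
      + inverse t powr (p1 / (p1 - 1)) * \<bar>f x * inverse (\<omega> x)\<bar> powr (P x / (P x - 1))"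
    using good_AE
  proof eventually_elim
    case (elim x)
    have P: "1 < P x" using elim p1 by simp
    have "t powr P x \<le> t powr 1" using assms P by (intro powr_mono') auto
    then have h1: "t powr P x \<le> t" using assms by simp
    have "P x / (P x - 1) \<le> p1 / (p1 - 1)"
      using elim P p1 by (simp add: divide_simps algebra_simps)
    then have h2: "inverse t powr (P x / (P x - 1)) \<le> inverse t powr (p1 / (p1 - 1))"
      using assms by (intro powr_mono) (auto simp: one_le_inverse_iff)
    have "\<bar>f x * u x\<bar> \<le> t powr P x * (norm (u x) * \<omega> x) powr P x
      + inverse t powr (P x / (P x - 1)) * \<bar>f x * inverse (\<omega> x)\<bar> powr (P x / (P x - 1))"
      using elim P by (intro base assms) auto
    also have "\<dots> \<le> t * (norm (u x) * \<omega> x) powr P x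
      + inverse t powr (p1 / (p1 - 1)) * \<bar>f x * inverse (\<omega> x)\<bar> powr (P x / (P x - 1))"
      by (intro add_mono mult_right_mono h1 h2) auto
    finally show ?case .
  qed
  show "AE x in \<mu>. \<bar>f x * u x\<bar> \<le> inverse t powr p2 * (norm (u x) * \<omega> x) powr P x
      + t * \<bar>f x * inverse (\<omega> x)\<bar> powr (P x / (P x - 1))"
    using good_AE
  proof eventually_elim
    case (elim x)
    have P: "1 < P x" using elim p1 by simp
    have "1 \<le> P x / (P x - 1)" using P by (simp add: field_simps)
    then have "t powr (P x / (P x - 1)) \<le> t powr 1" using assms by (intro powr_mono') auto
    then have h1: "t powr (P x / (P x - 1)) \<le> t" using assms by simp
    have h2: "inverse t powr P x \<le> inverse t powr p2"
      using assms elim by (intro powr_mono) (auto simp: one_le_inverse_iff)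
    have "\<bar>f x * u x\<bar> \<le> inverse t powr P x * (norm (u x) * \<omega> x) powr P x
      + t powr (P x / (P x - 1)) * \<bar>f x * inverse (\<omega> x)\<bar> powr (P x / (P x - 1))"
      using base[of "inverse t" x] elim P assms by simp
    also have "\<dots> \<le> inverse t powr p2 * (norm (u x) * \<omega> x) powr P x
      + t * \<bar>f x * inverse (\<omega> x)\<bar> powr (P x / (P x - 1))"
      by (intro add_mono mult_right_mono h1 h2) auto
    finally show ?case .
  qed
qed

lemma load_integrable: assumes u: "S.fin u" shows "integrable \<mu> (\<lambda>x. f x * u x)"
proof (rule Bochner_Integration.integrable_bound)
  show "integrable \<mu> (\<lambda>x. 1 * (norm (u x) * \<omega> x) powr P x
      + inverse 1 powr (p1 / (p1 - 1)) * \<bar>f x * inverse (\<omega> x)\<bar> powr (P x / (P x - 1)))"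
    by (intro Bochner_Integration.integrable_add integrable_mult_right S.R_integrable u f_integrable)
  show "AE x in \<mu>. norm (f x * u x) \<le> norm (1 * (norm (u x) * \<omega> x) powr P x
      + inverse 1 powr (p1 / (p1 - 1)) * \<bar>f x * inverse (\<omega> x)\<bar> powr (P x / (P x - 1)))"
    using load_young_pointwise(1)[OF zero_less_one order_refl, of u] by eventually_elim simp
  show "(\<lambda>x. f x * u x) \<in> borel_measurable \<mu>" using u by (auto simp: S.fin_def)
qed

lemma ell_young:
  assumes u: "S.fin u" and t: "0 < t" "t \<le> 1"
  shows "\<bar>ell u\<bar> \<le> t * S.R u + inverse t powr (p1 / (p1 - 1)) * f_mass"
    "\<bar>ell u\<bar> \<le> inverse t powr p2 * S.R u + t * f_mass"
proof -
  have *: "\<bar>ell u\<bar> \<le> c * S.R u + d * f_mass"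
    if "AE x in \<mu>. \<bar>f x * u x\<bar> \<le> c * (norm (u x) * \<omega> x) powr P x + d * \<bar>f x * inverse (\<omega> x)\<bar> powr (P x / (P x - 1))" for c d
  proof -
    have "\<bar>ell u\<bar> \<le> (\<integral>x. \<bar>f x * u x\<bar> \<partial>\<mu>)" unfolding ell_def by (rule integral_abs_bound)
    also have "\<dots> \<le> (\<integral>x. c * (norm (u x) * \<omega> x) powr P x + d * \<bar>f x * inverse (\<omega> x)\<bar> powr (P x / (P x - 1)) \<partial>\<mu>)"
      by (intro integral_mono_AE that integrable_abs load_integrable u Bochner_Integration.integrable_add
          integrable_mult_right S.R_integrable f_integrable)
    also have "\<dots> = c * S.R u + d * f_mass"
      using S.R_integrable[OF u] f_integrable by (simp add: S.R_def f_mass_def)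
    finally show ?thesis .
  qed
  show "\<bar>ell u\<bar> \<le> t * S.R u + inverse t powr (p1 / (p1 - 1)) * f_mass"
    "\<bar>ell u\<bar> \<le> inverse t powr p2 * S.R u + t * f_mass"
    by (rule *[OF load_young_pointwise(1)[OF t]], rule *[OF load_young_pointwise(2)[OF t]])
qed

lemma f_mass_nonneg: "0 \<le> f_mass" by (simp add: f_mass_def)

lemma ell_linear:
  assumes "S.fin u" "S.fin v" shows "ell (\<lambda>x. c * u x + d * v x) = c * ell u + d * ell v"
proof -
  have "ell (\<lambda>x. c * u x + d * v x) = (\<integral>x. c * (f x * u x) + d * (f x * v x) \<partial>\<mu>)"
    unfolding ell_def by (intro Bochner_Integration.integral_cong) (auto simp: algebra_simps)
  then show ?thesis using load_integrable assms by (simp add: ell_def)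
qed

definition T :: "('g \<Rightarrow> real) \<Rightarrow> real" where "T u = E.J (grad u) + S.J u"

definition dT :: "('g \<Rightarrow> real) \<Rightarrow> ('g \<Rightarrow> real) \<Rightarrow> real" where "dT u v = E.dJ (grad u) (grad v) + S.dJ u v"

definition En :: "('g \<Rightarrow> real) \<Rightarrow> real" where "En u = T u - ell u"

lemma W1_fin: assumes "u \<in> W1" shows "S.fin u" "E.fin (grad u)"
  using sobolevD[OF assms] by (auto simp: S.fin_def E.fin_def)

lemma T_nonneg: "0 \<le> T u" by (simp add: T_def E.J_nonneg S.J_nonneg)

lemma grad_cong:
  assumes u: "u \<in> W1" and v: "v \<in> W1"
  shows "E.J (grad (\<lambda>x. c * u x + d * v x)) = E.J (\<lambda>x. c *\<^sub>R grad u x + d *\<^sub>R grad v x)"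
  by (intro E.J_cong grad_linear u v E.fin_linear W1_fin sobolev_linear)

lemma T_linear:
  assumes u: "u \<in> W1" and v: "v \<in> W1"
  shows "T (\<lambda>x. c * u x + d * v x) = E.J (\<lambda>x. c *\<^sub>R grad u x + d *\<^sub>R grad v x) + S.J (\<lambda>x. c *\<^sub>R u x + d *\<^sub>R v x)"
  using grad_cong[OF u v, of c d] by (simp add: T_def)

lemma T_half:
  assumes u: "u \<in> W1" and v: "v \<in> W1"
  shows "T (\<lambda>x. 1/2 * u x + 1/2 * v x) = E.J (\<lambda>x. (1/2) *\<^sub>R (grad u x + grad v x)) + S.J (\<lambda>x. (1/2) *\<^sub>R (u x + v x))"
    "T (\<lambda>x. 1/2 * u x + (-1/2) * v x) = E.J (\<lambda>x. (1/2) *\<^sub>R (grad u x - grad v x)) + S.J (\<lambda>x. (1/2) *\<^sub>R (u x - v x))"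
  using T_linear[OF u v, of "1/2" "1/2"] T_linear[OF u v, of "1/2" "-1/2"]
  by (simp_all add: scaleR_add_right scaleR_diff_right diff_divide_distrib add_divide_distrib)

lemma T_uniformly_convex:
  assumes \<epsilon>: "0 < \<epsilon>"
  obtains K where "0 \<le> K" "\<And>u v. u \<in> W1 \<Longrightarrow> v \<in> W1 \<Longrightarrow> T (\<lambda>x. 1/2 * u x + (-1/2) * v x)
     \<le> \<epsilon> * (T u + T v) + K * ((T u + T v) / 2 - T (\<lambda>x. 1/2 * u x + 1/2 * v x))"
proof -
  obtain K1 where K1: "0 \<le> K1" "\<And>F H. E.fin F \<Longrightarrow> E.fin H \<Longrightarrow> E.J (\<lambda>x. (1/2) *\<^sub>R (F x - H x))
     \<le> \<epsilon> * (E.J F + E.J H) + K1 * ((E.J F + E.J H) / 2 - E.J (\<lambda>x. (1/2) *\<^sub>R (F x + H x)))"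
    by (rule E.J_uniformly_convex[OF \<epsilon>]) (rule that)
  obtain K2 where K2: "0 \<le> K2" "\<And>F H. S.fin F \<Longrightarrow> S.fin H \<Longrightarrow> S.J (\<lambda>x. (1/2) *\<^sub>R (F x - H x))
     \<le> \<epsilon> * (S.J F + S.J H) + K2 * ((S.J F + S.J H) / 2 - S.J (\<lambda>x. (1/2) *\<^sub>R (F x + H x)))"
    by (rule S.J_uniformly_convex[OF \<epsilon>]) (rule that)
  let ?K = "max K1 K2"
  have "T (\<lambda>x. 1/2 * u x + (-1/2) * v x)
     \<le> \<epsilon> * (T u + T v) + ?K * ((T u + T v) / 2 - T (\<lambda>x. 1/2 * u x + 1/2 * v x))" if u: "u \<in> W1" and v: "v \<in> W1" for u v
  proof -
    let ?g1 = "(E.J (grad u) + E.J (grad v)) / 2 - E.J (\<lambda>x. (1/2) *\<^sub>R (grad u x + grad v x))"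
    let ?g2 = "(S.J u + S.J v) / 2 - S.J (\<lambda>x. (1/2) *\<^sub>R (u x + v x))"
    have g: "0 \<le> ?g1" "0 \<le> ?g2" using E.J_midpoint S.J_midpoint W1_fin u v by auto
    have "K1 * ?g1 \<le> ?K * ?g1" "K2 * ?g2 \<le> ?K * ?g2" by (rule mult_right_mono[OF _ g(1)], simp) (rule mult_right_mono[OF _ g(2)], simp)
    moreover have "E.J (\<lambda>x. (1/2) *\<^sub>R (grad u x - grad v x)) \<le> \<epsilon> * (E.J (grad u) + E.J (grad v)) + K1 * ?g1"
      by (rule K1(2)) (use W1_fin u v in auto)
    moreover have "S.J (\<lambda>x. (1/2) *\<^sub>R (u x - v x)) \<le> \<epsilon> * (S.J u + S.J v) + K2 * ?g2"
      by (rule K2(2)) (use W1_fin u v in auto)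
    moreover have "(T u + T v) / 2 - T (\<lambda>x. 1/2 * u x + 1/2 * v x) = ?g1 + ?g2"
      unfolding T_half[OF u v] by (simp add: T_def field_simps)
    ultimately show ?thesis
      unfolding T_half(2)[OF u v] by (simp only: distrib_left T_def)
  qed
  then show thesis using that[of ?K] K1(1) by simp
qed

lemma T_subgradient:
  assumes u: "u \<in> W1" and v: "v \<in> W1" shows "T u + dT u (\<lambda>x. v x - u x) \<le> T v"
proof -
  note F = W1_fin[OF u] W1_fin[OF v]
  have "E.dJ (grad u) (grad (\<lambda>x. v x - u x)) = E.dJ (grad u) (\<lambda>x. grad v x - grad u x)"
    by (intro E.dJ_cong grad_diff u v E.fin_diff F W1_fin sobolev_diff) simp
  then show ?thesis
    using E.J_subgradient[OF F(2,4)] S.J_subgradient[OF F(1,3)] by (simp add: T_def dT_def)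
qed

lemma T_le_emod:
  assumes u: "u \<in> W1" and c: "0 \<le> c" "emod u \<le> ennreal c"
  shows "T u \<le> (E.C2 + S.C2) * c" "S.R u \<le> c"
proof -
  note F = W1_fin[OF u]
  have "ennreal (S.R u) \<le> ennreal c" "ennreal (E.R (grad u)) \<le> ennreal c"
    using c(2) unfolding emod_def S.rho_eq_R[OF F(1)] E.rho_eq_R[OF F(2)] by (auto elim: order_trans[rotated])
  then have R: "S.R u \<le> c" "E.R (grad u) \<le> c" using c(1) by simp_all
  show "S.R u \<le> c" by (rule R)
  have "T u \<le> E.C2 * E.R (grad u) + S.C2 * S.R u"
    unfolding T_def by (intro add_mono E.J_le_R S.J_le_R F)
  also have "\<dots> \<le> E.C2 * c + S.C2 * c"
    using R E.C_pos S.C_pos by (intro add_mono mult_left_mono) auto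
  finally show "T u \<le> (E.C2 + S.C2) * c" by (simp add: distrib_right)
qed

lemma emod_le_T:
  assumes u: "u \<in> W1" shows "emod u \<le> ennreal ((E.C1 + S.C1) * p2 * T u)"
proof -
  note F = W1_fin[OF u]
  have p2: "0 \<le> p2" using p1 p12 by simp
  have nn: "0 \<le> S.R u" "0 \<le> E.R (grad u)" by (simp_all add: S.R_def E.R_def)
  have "S.R u + E.R (grad u) \<le> S.C1 * p2 * S.J u + E.C1 * p2 * E.J (grad u)"
    by (intro add_mono S.R_le_J E.R_le_J F)
  also have "\<dots> \<le> S.C1 * p2 * T u + E.C1 * p2 * T u"
    using p2 S.C_pos E.C_pos S.J_nonneg E.J_nonneg by (intro add_mono mult_left_mono) (auto simp: T_def)
  finally have "S.R u + E.R (grad u) \<le> (E.C1 + S.C1) * p2 * T u" by (simp add: algebra_simps)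
  then show ?thesis
    unfolding emod_def S.rho_eq_R[OF F(1)] E.rho_eq_R[OF F(2)]
    using nn by (simp add: ennreal_plus[symmetric] ennreal_leI del: ennreal_plus)
qed

lemma dT_young:
  assumes u: "u \<in> W1" and v: "v \<in> W1" and t: "0 < t" "t \<le> 1"
  shows "\<bar>dT u v\<bar> \<le> p2 * (t * T u + inverse t powr p2 * T v)"
proof -
  note F = W1_fin[OF u] W1_fin[OF v]
  have p2: "0 \<le> p2" using p1 p12 by simp
  have "\<bar>E.dJ (grad u) (grad v)\<bar> \<le> t * E.I (grad u) + inverse t powr p2 * E.I (grad v)"
    by (rule E.dJ_young[OF F(2,4) t])
  also have "\<dots> \<le> t * (p2 * E.J (grad u)) + inverse t powr p2 * (p2 * E.J (grad v))"
    using t by (intro add_mono mult_left_mono E.I_le_J F) auto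
  finally have 1: "\<bar>E.dJ (grad u) (grad v)\<bar> \<le> t * (p2 * E.J (grad u)) + inverse t powr p2 * (p2 * E.J (grad v))" .
  have "\<bar>S.dJ u v\<bar> \<le> t * S.I u + inverse t powr p2 * S.I v" by (rule S.dJ_young[OF F(1,3) t])
  also have "\<dots> \<le> t * (p2 * S.J u) + inverse t powr p2 * (p2 * S.J v)"
    using t by (intro add_mono mult_left_mono S.I_le_J F) auto
  finally have 2: "\<bar>S.dJ u v\<bar> \<le> t * (p2 * S.J u) + inverse t powr p2 * (p2 * S.J v)" .
  have "\<bar>dT u v\<bar> \<le> \<bar>E.dJ (grad u) (grad v)\<bar> + \<bar>S.dJ u v\<bar>" unfolding dT_def by (rule abs_triangle_ineq)
  then show ?thesis using 1 2 by (simp add: T_def algebra_simps)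
qed

text \<open>The zero-order term of the energy controls \<open>u\<close> in the space dual to that of \<open>f\<close>, so half of it absorbs the
  linear term.\<close>

lemma coercive: obtains C where "\<And>u. u \<in> W1 \<Longrightarrow> T u / 2 - C \<le> En u"
proof -
  have p2: "0 < p2" using p1 p12 by simp
  define t where "t = min 1 (1 / (2 * S.C1 * p2))"
  have t: "0 < t" "t \<le> 1" using p2 S.C_pos by (auto simp: t_def)
  have "t * (S.C1 * p2) \<le> 1 / (2 * S.C1 * p2) * (S.C1 * p2)"
    using p2 S.C_pos by (intro mult_right_mono) (auto simp: t_def)
  also have "\<dots> = 1 / 2" using p2 S.C_pos by simp
  finally have th: "t * (S.C1 * p2) \<le> 1 / 2" .
  have "T u / 2 - inverse t powr (p1 / (p1 - 1)) * f_mass \<le> En u" if u: "u \<in> W1" for u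
  proof -
    note F = W1_fin[OF u]
    have "\<bar>ell u\<bar> \<le> t * S.R u + inverse t powr (p1 / (p1 - 1)) * f_mass" by (rule ell_young(1)[OF F(1) t])
    also have "t * S.R u \<le> t * (S.C1 * p2 * S.J u)" using t by (intro mult_left_mono S.R_le_J F) auto
    also have "\<dots> = t * (S.C1 * p2) * S.J u" by simp
    also have "\<dots> \<le> 1 / 2 * S.J u" using th S.J_nonneg by (intro mult_right_mono)
    also have "\<dots> \<le> T u / 2" using E.J_nonneg by (simp add: T_def)
    finally have "\<bar>ell u\<bar> \<le> T u / 2 + inverse t powr (p1 / (p1 - 1)) * f_mass" by simp
    then show ?thesis unfolding En_def by (simp add: abs_le_iff field_simps)
  qed
  then show thesis using that by blast
qed

lemma En_midpoint_gap:
  assumes u: "u \<in> W1" and v: "v \<in> W1" and m: "m \<le> En (\<lambda>x. 1/2 * u x + 1/2 * v x)"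
  shows "(T u + T v) / 2 - T (\<lambda>x. 1/2 * u x + 1/2 * v x) \<le> (En u + En v) / 2 - m"
proof -
  have "ell (\<lambda>x. 1/2 * u x + 1/2 * v x) = 1/2 * ell u + 1/2 * ell v"
    by (rule ell_linear) (use W1_fin u v in auto)
  then show ?thesis using m unfolding En_def by (simp add: field_simps)
qed

definition weak_sol :: "('g \<Rightarrow> real) \<Rightarrow> bool" where
  "weak_sol u \<longleftrightarrow> u \<in> W0 \<and> (\<forall>v\<in>W0. dT u v = ell v)"

definition minimizer :: "('g \<Rightarrow> real) \<Rightarrow> bool" where
  "minimizer u \<longleftrightarrow> u \<in> W0 \<and> (\<forall>v\<in>W0. En u \<le> En v)"

text \<open>A critical point of a convex functional is a minimizer.\<close>

lemma weak_sol_imp_minimizer: assumes "weak_sol u" shows "minimizer u"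
  unfolding minimizer_def
proof (intro conjI ballI)
  show u: "u \<in> W0" using assms by (simp add: weak_sol_def)
  fix v assume v: "v \<in> W0"
  have w: "(\<lambda>x. v x - u x) \<in> W0" using sobolev0_linear[OF v u, of 1 "-1"] by simp
  have "ell (\<lambda>x. 1 * v x + (-1) * u x) = 1 * ell v + (-1) * ell u"
    by (rule ell_linear) (use W1_fin sobolev0_subset u v in auto)
  moreover have "dT u (\<lambda>x. v x - u x) = ell (\<lambda>x. v x - u x)" using assms w by (simp add: weak_sol_def)
  ultimately show "En u \<le> En v"
    using T_subgradient[OF sobolev0_subset sobolev0_subset, OF u v] by (simp add: En_def)
qed

text \<open>The gradient inequality at \<open>u + t v\<close> gives \<open>dT(u + t v, v) \<ge> ell(v)\<close> for \<open>t > 0\<close>; then let \<open>t \<rightarrow> 0\<close>.\<close>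

lemma minimizer_imp_weak_sol: assumes "minimizer u" shows "weak_sol u"
proof -
  have u: "u \<in> W0" and min: "\<And>v. v \<in> W0 \<Longrightarrow> En u \<le> En v" using assms by (auto simp: minimizer_def)
  note u1 = sobolev0_subset[OF u]
  have ge: "ell v \<le> dT u v" if v: "v \<in> W0" for v
  proof -
    note v1 = sobolev0_subset[OF v]
    define t where "t = (\<lambda>n::nat. inverse (real (Suc n)))"
    have t: "t \<longlonglongrightarrow> 0" "\<And>n. 0 < t n" "\<And>n. t n \<le> 1"
      using LIMSEQ_inverse_real_of_nat by (auto simp: t_def field_simps)
    have dd: "ell v \<le> E.dJ (\<lambda>x. grad u x + t n *\<^sub>R grad v x) (grad v) + S.dJ (\<lambda>x. u x + t n *\<^sub>R v x) v" for n
    proof -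
      let ?w = "\<lambda>x. 1 * u x + t n * v x"
      have w: "?w \<in> W0" by (rule sobolev0_linear[OF u v])
      note w1 = sobolev0_subset[OF w]
      have "(\<lambda>x. u x - ?w x) = (\<lambda>x. (- t n) * v x + 0 * v x)" by (auto simp: fun_eq_iff)
      then have sub: "T ?w + dT ?w (\<lambda>x. (- t n) * v x + 0 * v x) \<le> T u"
        using T_subgradient[OF w1 u1] by simp
      have "E.dJ (grad ?w) (grad (\<lambda>x. (- t n) * v x + 0 * v x)) = E.dJ (\<lambda>x. 1 *\<^sub>R grad u x + t n *\<^sub>R grad v x) (\<lambda>x. (- t n) *\<^sub>R grad v x + 0 *\<^sub>R grad v x)"
        by (intro E.dJ_cong grad_linear u1 v1 E.fin_linear W1_fin w1 sobolev_linear)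
      also have "\<dots> = - t n * E.dJ (\<lambda>x. grad u x + t n *\<^sub>R grad v x) (grad v)"
        using E.dJ_scale[of "\<lambda>x. grad u x + t n *\<^sub>R grad v x" "grad v" "- t n"]
          E.fin_linear[OF W1_fin(2)[OF u1] W1_fin(2)[OF v1], of 1 "t n"] W1_fin(2)[OF v1] by simp
      finally have 1: "E.dJ (grad ?w) (grad (\<lambda>x. (- t n) * v x + 0 * v x)) = - t n * E.dJ (\<lambda>x. grad u x + t n *\<^sub>R grad v x) (grad v)" .
      have 2: "S.dJ ?w (\<lambda>x. (- t n) * v x + 0 * v x) = - t n * S.dJ (\<lambda>x. u x + t n *\<^sub>R v x) v"
        using S.dJ_scale[of ?w v "- t n"] W1_fin(1)[OF w1] W1_fin(1)[OF v1] by simp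
      have l: "ell ?w = 1 * ell u + t n * ell v" by (rule ell_linear) (use W1_fin u1 v1 in auto)
      have "T u - ell u \<le> T ?w - ell ?w" using min[OF w] by (simp only: En_def)
      then have "t n * ell v \<le> t n * (E.dJ (\<lambda>x. grad u x + t n *\<^sub>R grad v x) (grad v) + S.dJ (\<lambda>x. u x + t n *\<^sub>R v x) v)"
        using sub 1 2 l by (simp add: dT_def distrib_left)
      then show ?thesis using t(2)[of n] by simp
    qed
    have "(\<lambda>n. E.dJ (\<lambda>x. grad u x + t n *\<^sub>R grad v x) (grad v) + S.dJ (\<lambda>x. u x + t n *\<^sub>R v x) v)
        \<longlonglongrightarrow> E.dJ (grad u) (grad v) + S.dJ u v"
      by (intro tendsto_add E.dJ_tendsto S.dJ_tendsto W1_fin u1 v1 t less_imp_le[OF t(2)])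
    then show ?thesis unfolding dT_def by (rule LIMSEQ_le_const) (use dd in auto)
  qed
  have "dT u v = ell v" if v: "v \<in> W0" for v
  proof -
    note v1 = sobolev0_subset[OF v]
    have nv: "(\<lambda>x. (-1) * v x + 0 * v x) \<in> W0" by (rule sobolev0_linear[OF v v])
    have "ell (\<lambda>x. (-1) * v x + 0 * v x) = (-1) * ell v + 0 * ell v" by (rule ell_linear) (use W1_fin v1 in auto)
    moreover have "E.dJ (grad u) (grad (\<lambda>x. (-1) * v x + 0 * v x)) = E.dJ (grad u) (\<lambda>x. (-1) *\<^sub>R grad v x + 0 *\<^sub>R grad v x)"
      by (intro E.dJ_cong grad_linear u1 v1 E.fin_linear W1_fin sobolev_linear) simp
    then have "E.dJ (grad u) (grad (\<lambda>x. (-1) * v x + 0 * v x)) = - E.dJ (grad u) (grad v)"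
      using E.dJ_scale[OF W1_fin(2)[OF u1] W1_fin(2)[OF v1], of "-1"] by simp
    moreover have "S.dJ u (\<lambda>x. (-1) * v x + 0 * v x) = - S.dJ u v"
      using S.dJ_scale[OF W1_fin(1)[OF u1] W1_fin(1)[OF v1], of "-1"] by simp
    ultimately have "dT u v \<le> ell v" using ge[OF nv] by (simp add: dT_def)
    then show ?thesis using ge[OF v] by simp
  qed
  then show ?thesis using u by (simp add: weak_sol_def)
qed

text \<open>The midpoint of two minimizers has no smaller energy, so the gap in the uniform convexity estimate is
  zero and the difference has energy zero.\<close>

lemma minimizer_unique:
  assumes u: "minimizer u" and v: "minimizer v" shows "AE x in \<mu>. u x = v x"
proof -
  have W: "u \<in> W0" "v \<in> W0" using u v by (auto simp: minimizer_def)
  note W1 = sobolev0_subset[OF W(1)] sobolev0_subset[OF W(2)]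
  have eq: "En u = En v" using u v by (auto simp: minimizer_def intro: antisym)
  let ?d = "\<lambda>x. 1/2 * u x + (-1/2) * v x"
  have d: "?d \<in> W1" by (intro sobolev_linear W1)
  have "En u \<le> En (\<lambda>x. 1/2 * u x + 1/2 * v x)"
    using u sobolev0_linear[OF W, of "1/2" "1/2"] unfolding minimizer_def by blast
  then have gap: "(T u + T v) / 2 - T (\<lambda>x. 1/2 * u x + 1/2 * v x) \<le> 0"
    using En_midpoint_gap[OF W1] eq by fastforce
  have "T ?d \<le> 0"
  proof (rule field_le_epsilon)
    fix e :: real assume e: "0 < e"
    define B where "B = T u + T v + 1"
    have B: "0 < B" "T u + T v \<le> B" using T_nonneg[of u] T_nonneg[of v] by (auto simp: B_def)
    then have "0 < e / B" using e by simp
    then obtain K where K: "0 \<le> K" "\<And>u v. u \<in> W1 \<Longrightarrow> v \<in> W1 \<Longrightarrow> T (\<lambda>x. 1/2 * u x + (-1/2) * v x)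
       \<le> e / B * (T u + T v) + K * ((T u + T v) / 2 - T (\<lambda>x. 1/2 * u x + 1/2 * v x))"
      by (rule T_uniformly_convex) (rule that)
    have "T ?d \<le> e / B * (T u + T v) + K * ((T u + T v) / 2 - T (\<lambda>x. 1/2 * u x + 1/2 * v x))"
      by (rule K(2)[OF W1])
    also have "\<dots> \<le> e / B * B + K * 0"
      using K(1) B e gap by (intro add_mono mult_left_mono) auto
    also have "\<dots> = e" using B by simp
    finally show "T ?d \<le> 0 + e" by simp
  qed
  then have "T ?d = 0" using T_nonneg[of ?d] by simp
  then have "emod ?d \<le> 0" using emod_le_T[OF d] by simp
  then have "rho ?d = 0" by (simp add: emod_def)
  then have "AE x in \<mu>. ?d x = 0" by (rule rho_zero_imp[OF sobolevD(4)[OF d]])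
  then show ?thesis by eventually_elim simp
qed

text \<open>The midpoint gap of two members is at most the mean excess of their energies over \<open>m\<close>, so uniform
  convexity makes the sequence Cauchy, with a limit \<open>v\<close>. By the gradient inequality,
  \<open>En v \<le> En (u n) - dT v (u n - v) + ell (u n - v)\<close>, and the last two terms tend to zero.\<close>

lemma minimizing_sequence_limit:
  assumes u: "\<And>n::nat. u n \<in> W0" and lower: "\<And>v. v \<in> W0 \<Longrightarrow> m \<le> En v"
    and min: "\<And>n. En (u n) \<le> m + inverse (real (Suc n))"
  obtains v where "v \<in> W0" "En v \<le> m"
proof -
  note u1 = sobolev0_subset[OF u]
  have p2: "0 < p2" using p1 p12 by simp
  obtain C where C: "\<And>u. u \<in> W1 \<Longrightarrow> T u / 2 - C \<le> En u" by (rule coercive) (rule that)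
  define B where "B = 2 * (max 0 (2 * (m + 1 + C)) + 1)"
  have inv1: "inverse (real (Suc n)) \<le> 1" for n by (simp add: field_simps)
  have TB: "T (u k) + T (u n) \<le> B" for k n
  proof -
    have "T (u j) \<le> max 0 (2 * (m + 1 + C)) + 1" for j
      using C[OF u1, of j] min[of j] inv1[of j] by (simp add: max_def)
    from this[of k] this[of n] show ?thesis by (simp add: B_def)
  qed
  have B: "0 < B" by (simp add: B_def max_def)
  obtain L where L: "lin_const 2 0 = ennreal L" "0 \<le> L" using lin_const_finite[of 2 0] by (cases "lin_const 2 0") auto
  define M where "M = L * (2 * ((E.C1 + S.C1) * p2))"
  have M: "0 \<le> M" using L(2) E.C_pos S.C_pos p2 by (simp add: M_def)
  have diff: "emod (\<lambda>x. u k x - u n x) \<le> ennreal (M * T (\<lambda>x. 1/2 * u k x + (-1/2) * u n x))" for k n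
  proof -
    let ?d = "\<lambda>x. 1/2 * u k x + (-1/2) * u n x"
    have d: "?d \<in> W1" by (intro sobolev_linear u1)
    define y where "y = (E.C1 + S.C1) * p2 * T ?d"
    have y: "0 \<le> y" using E.C_pos S.C_pos p2 T_nonneg[of ?d] unfolding y_def by (intro mult_nonneg_nonneg) auto
    have "(\<lambda>x. u k x - u n x) = (\<lambda>x. 2 * ?d x + 0 * ?d x)" by (auto simp: fun_eq_iff)
    then have "emod (\<lambda>x. u k x - u n x) = emod (\<lambda>x. 2 * ?d x + 0 * ?d x)" by (simp only:)
    also have "\<dots> \<le> lin_const 2 0 * (emod ?d + emod ?d)" by (rule emod_linear_le[OF d d])
    also have "\<dots> \<le> ennreal L * (ennreal y + ennreal y)"
      unfolding L(1) y_def by (intro mult_left_mono add_mono emod_le_T d) simp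
    also have "\<dots> = ennreal (L * (y + y))"
      by (simp only: ennreal_mult'[OF L(2)] ennreal_plus[OF y y])
    also have "L * (y + y) = M * T ?d" by (simp add: M_def y_def algebra_simps)
    finally show ?thesis .
  qed
  have cauchy: "\<exists>N. \<forall>k\<ge>N. \<forall>n\<ge>N. emod (\<lambda>x. u k x - u n x) \<le> ennreal e" if e: "0 < e" for e
  proof -
    \<comment> \<open>half of \<open>e / (M + 1)\<close> is left for each of the two terms of the uniform convexity estimate\<close>
    define \<epsilon> where "\<epsilon> = e / (M + 1) / 2 / B"
    have \<epsilon>: "0 < \<epsilon>" "\<epsilon> * B = e / (M + 1) / 2" using e M B by (auto simp: \<epsilon>_def)
    obtain K where K: "0 \<le> K" "\<And>u v. u \<in> W1 \<Longrightarrow> v \<in> W1 \<Longrightarrow> T (\<lambda>x. 1/2 * u x + (-1/2) * v x)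
       \<le> \<epsilon> * (T u + T v) + K * ((T u + T v) / 2 - T (\<lambda>x. 1/2 * u x + 1/2 * v x))"
      by (rule T_uniformly_convex[OF \<epsilon>(1)]) (rule that)
    define \<delta> where "\<delta> = e / (M + 1) / 2 / (K + 1)"
    have \<delta>: "0 < \<delta>" using e M K(1) by (simp add: \<delta>_def)
    have K\<delta>: "K * \<delta> \<le> e / (M + 1) / 2"
    proof -
      have "K * \<delta> \<le> (K + 1) * \<delta>" using \<delta> by (intro mult_right_mono) auto
      also have "\<dots> = e / (M + 1) / 2" using K(1) by (simp add: \<delta>_def)
      finally show ?thesis .
    qed
    obtain N where N: "inverse (real (Suc N)) < \<delta>" using reals_Archimedean[OF \<delta>] by blast
    have "emod (\<lambda>x. u k x - u n x) \<le> ennreal e" if kn: "k \<ge> N" "n \<ge> N" for k n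
    proof -
      have iN: "inverse (real (Suc j)) \<le> \<delta>" if "j \<ge> N" for j
      proof -
        have "inverse (real (Suc j)) \<le> inverse (real (Suc N))" using that by (intro le_imp_inverse_le) auto
        then show ?thesis using N by linarith
      qed
      have "m \<le> En (\<lambda>x. 1/2 * u k x + 1/2 * u n x)" by (intro lower sobolev0_linear u)
      then have "(T (u k) + T (u n)) / 2 - T (\<lambda>x. 1/2 * u k x + 1/2 * u n x) \<le> (En (u k) + En (u n)) / 2 - m"
        by (rule En_midpoint_gap[OF u1 u1])
      also have "\<dots> \<le> \<delta>"
      proof -
        have "En (u k) \<le> m + \<delta>" "En (u n) \<le> m + \<delta>"
          by (rule order_trans[OF min add_left_mono[OF iN[OF kn(1)]]], rule order_trans[OF min add_left_mono[OF iN[OF kn(2)]]])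
        moreover have "(y + z) / 2 - m \<le> \<delta>" if "y \<le> m + \<delta>" "z \<le> m + \<delta>" for y z :: real
          using that by (simp add: field_simps)
        ultimately show ?thesis by blast
      qed
      finally have gap: "(T (u k) + T (u n)) / 2 - T (\<lambda>x. 1/2 * u k x + 1/2 * u n x) \<le> \<delta>" .
      have "T (\<lambda>x. 1/2 * u k x + (-1/2) * u n x)
        \<le> \<epsilon> * (T (u k) + T (u n)) + K * ((T (u k) + T (u n)) / 2 - T (\<lambda>x. 1/2 * u k x + 1/2 * u n x))"
        by (rule K(2)[OF u1 u1])
      also have "\<dots> \<le> \<epsilon> * B + K * \<delta>" using TB gap K(1) \<epsilon>(1) by (intro add_mono mult_left_mono) auto
      also have "\<dots> \<le> e / (M + 1)" 
      proof -
        have "x + y \<le> z" if "x = z / 2" "y \<le> z / 2" for x y z :: real using that by simp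
        from this[OF \<epsilon>(2) K\<delta>] show ?thesis .
      qed
      finally have "M * T (\<lambda>x. 1/2 * u k x + (-1/2) * u n x) \<le> M * (e / (M + 1))" using M by (intro mult_left_mono)
      also have "\<dots> \<le> e" using M e by (simp add: pos_divide_le_eq algebra_simps add_nonneg_pos)
      finally show ?thesis using diff[of k n] by (meson ennreal_leI order_trans)
    qed
    then show ?thesis by blast
  qed
  obtain v where v: "v \<in> W0" "\<And>e. e > 0 \<Longrightarrow> \<exists>N. \<forall>n\<ge>N. emod (\<lambda>x. u n x - v x) \<le> ennreal e"
    by (rule sobolev0_complete[OF u cauchy]) (assumption, rule that)
  note v1 = sobolev0_subset[OF v(1)]
  have "En v \<le> m"
  proof (rule field_le_epsilon)
    fix e :: real assume e: "0 < e"
    define h where "h = e / 4"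
    have h: "0 < h" using e by (simp add: h_def)
    \<comment> \<open>parameters of the two Young inequalities, then the size of \<open>emod (u\<^sub>n - v)\<close> that they ask for\<close>
    define t where "t = min 1 (h / 2 / (p2 * T v + f_mass + 1))"
    have den: "0 < p2 * T v + f_mass + 1" using p2 T_nonneg[of v] f_mass_nonneg by (simp add: add_nonneg_pos)
    have t: "0 < t" "t \<le> 1" using h den by (auto simp: t_def)
    have "t * (p2 * T v + f_mass + 1) \<le> h / 2 / (p2 * T v + f_mass + 1) * (p2 * T v + f_mass + 1)"
      using den by (intro mult_right_mono) (auto simp: t_def)
    moreover have "h / 2 / D * D = h / 2" if "0 < D" for D :: real using that by simp
    ultimately have tb: "t * (p2 * T v + f_mass + 1) \<le> h / 2" using den by (simp only:)
    have pv: "0 \<le> p2 * T v" using p2 T_nonneg[of v] by simp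
    have t1: "p2 * (t * T v) \<le> h / 2" "t * f_mass \<le> h / 2"
    proof -
      have "t * (p2 * T v) \<le> t * (p2 * T v + f_mass + 1)" "t * f_mass \<le> t * (p2 * T v + f_mass + 1)"
        using t f_mass_nonneg pv by (auto intro!: mult_left_mono)
      then show "p2 * (t * T v) \<le> h / 2" "t * f_mass \<le> h / 2" using tb by (auto simp: mult.left_commute)
    qed
    define Z where "Z = inverse t powr p2 * (p2 * (E.C2 + S.C2) + 1)"
    have Z: "0 < Z" using t p2 E.C_pos S.C_pos by (simp add: Z_def add_pos_pos)
    define d where "d = h / 2 / Z"
    have d: "0 < d" "Z * d = h / 2" using h Z by (auto simp: d_def)
    have Zd: "inverse t powr p2 * (p2 * (E.C2 + S.C2)) * d \<le> h / 2" "inverse t powr p2 * d \<le> h / 2"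
    proof -
      have "inverse t powr p2 * (p2 * (E.C2 + S.C2)) \<le> Z" "inverse t powr p2 \<le> Z"
        using p2 E.C_pos S.C_pos by (auto simp: Z_def distrib_left)
      then have "inverse t powr p2 * (p2 * (E.C2 + S.C2)) * d \<le> Z * d" "inverse t powr p2 * d \<le> Z * d"
        using d(1) by (auto intro: mult_right_mono)
      then show "inverse t powr p2 * (p2 * (E.C2 + S.C2)) * d \<le> h / 2" "inverse t powr p2 * d \<le> h / 2" using d(2) by auto
    qed
    obtain N1 where N1: "\<And>n. n \<ge> N1 \<Longrightarrow> emod (\<lambda>x. u n x - v x) \<le> ennreal d" using v(2)[OF d(1)] by blast
    obtain N2 where N2: "inverse (real (Suc N2)) < h" using reals_Archimedean[OF h] by blast
    define n where "n = max N1 N2"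
    have "inverse (real (Suc n)) \<le> inverse (real (Suc N2))" by (intro le_imp_inverse_le) (auto simp: n_def)
    also have "\<dots> \<le> h" using N2 by (rule less_imp_le)
    finally have En: "En (u n) \<le> m + h" by (rule order_trans[OF min add_left_mono])
    let ?w = "\<lambda>x. u n x - v x"
    have w: "?w \<in> W1" by (intro sobolev_diff u1 v1)
    have ew: "emod ?w \<le> ennreal d" by (rule N1) (simp add: n_def)
    note Tw = T_le_emod[OF w less_imp_le[OF d(1)] ew]
    have "\<bar>dT v ?w\<bar> \<le> p2 * (t * T v + inverse t powr p2 * T ?w)" by (rule dT_young[OF v1 w t])
    also have "\<dots> \<le> p2 * (t * T v + inverse t powr p2 * ((E.C2 + S.C2) * d))"
      using p2 Tw(1) by (intro mult_left_mono add_mono order_refl) auto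
    also have "\<dots> = p2 * (t * T v) + inverse t powr p2 * (p2 * (E.C2 + S.C2)) * d" by (simp add: algebra_simps)
    also have "\<dots> \<le> h" using t1(1) Zd(1) by simp
    finally have 1: "- h \<le> dT v ?w" by simp
    have "\<bar>ell ?w\<bar> \<le> inverse t powr p2 * S.R ?w + t * f_mass" by (rule ell_young(2)[OF W1_fin(1)[OF w] t])
    also have "\<dots> \<le> inverse t powr p2 * d + t * f_mass" using Tw(2) by (intro add_mono mult_left_mono order_refl) auto
    also have "\<dots> \<le> h" using t1(2) Zd(2) by simp
    finally have 2: "ell ?w \<le> h" by simp
    have "ell (\<lambda>x. 1 * u n x + (-1) * v x) = 1 * ell (u n) + (-1) * ell v"
      by (rule ell_linear) (use W1_fin u1 v1 in auto)
    then have "ell ?w = ell (u n) - ell v" by simp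
    then have "En v \<le> En (u n) + 2 * h"
      using T_subgradient[OF v1 u1, of n] 1 2 by (simp add: En_def)
    then show "En v \<le> m + e" using En e by (simp add: h_def)
  qed
  then show thesis using that v(1) by blast
qed

theorem minimizer_exists: obtains u where "minimizer u"
proof -
  obtain C where C: "\<And>u. u \<in> W1 \<Longrightarrow> T u / 2 - C \<le> En u" by (rule coercive) (rule that)
  have lb: "- C \<le> En v" if "v \<in> W0" for v
    using C[OF sobolev0_subset[OF that]] T_nonneg[of v] by simp
  define m where "m = Inf (En ` W0)"
  have ne: "En ` W0 \<noteq> {}" using sobolev0_zero by blast
  have bb: "bdd_below (En ` W0)" using lb by (auto intro!: bdd_belowI2)
  have lower: "m \<le> En v" if "v \<in> W0" for v unfolding m_def using that bb by (intro cInf_lower) auto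
  have "\<exists>u\<in>W0. En u \<le> m + inverse (real (Suc n))" for n
  proof -
    have "Inf (En ` W0) < m + inverse (real (Suc n))" by (simp add: m_def)
    then obtain y where "y \<in> En ` W0" "y < m + inverse (real (Suc n))"
      using cInf_lessD[OF ne] by meson
    then show ?thesis by (auto intro: less_imp_le)
  qed
  then have "\<forall>n. \<exists>u. u \<in> W0 \<and> En u \<le> m + inverse (real (Suc n))" by blast
  from choice[OF this] obtain u where "\<And>n. u n \<in> W0" "\<And>n. En (u n) \<le> m + inverse (real (Suc n))" by blast
  from minimizing_sequence_limit[OF this(1) lower this(2)]
  obtain v where v: "v \<in> W0" "En v \<le> m" .
  then have "minimizer v" unfolding minimizer_def using lower order_trans by blast
  then show thesis by (rule that)
qed

end

section \<open>Muckenhoupt weights have locally integrable duals\<close>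

text \<open>The supremum is attained along a sequence, and countably many null sets are null.\<close>

lemma exp_minus_le_AE: "AE x in restrict_space M F. exp_minus M F p \<le> p x"
proof -
  let ?S = "{z. AE x in restrict_space M F. z \<le> p x}"
  have ne: "z \<in> S \<Longrightarrow> S \<noteq> {}" for z and S :: "ennreal set" by auto
  have "0 \<in> ?S" by simp
  then have "?S \<noteq> {}" by (rule ne)
  then obtain z :: "nat \<Rightarrow> ennreal" where z: "range z \<subseteq> ?S" "Sup ?S = (SUP n. z n)"
    by (elim exE[OF ennreal_Sup_countable_SUP] conjE) (rule that)
  have "AE x in restrict_space M F. \<forall>n. z n \<le> p x"
    using z(1) by (subst AE_all_countable) auto
  then show ?thesis
    unfolding exp_minus_def z(2) by eventually_elim (auto intro: SUP_least)
qed

lemma exponent_range_AE: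
  assumes "1 < exp_minus M F p" "exp_minus M F p \<le> exp_plus M F p" "exp_plus M F p < of_nat Q"
  obtains m1 m2 where "exp_minus M F p = ennreal m1" "1 < m1" "m1 \<le> m2" "m2 < real Q"
    "AE x in restrict_space M F. p x < \<infinity> \<and> m1 \<le> enn2real (p x) \<and> enn2real (p x) \<le> m2"
proof -
  have "exp_plus M F p < \<infinity>"
    by (rule order.strict_trans[OF assms(3)]) (simp add: ennreal_of_nat_eq_real_of_nat)
  then obtain m2 where m2: "exp_plus M F p = ennreal m2" "0 \<le> m2" by (cases "exp_plus M F p") auto
  have "exp_minus M F p < \<infinity>" using assms(2) m2(1) by (metis ennreal_less_top infinity_ennreal_def le_less_trans)
  then obtain m1 where m1: "exp_minus M F p = ennreal m1" "0 \<le> m1" by (cases "exp_minus M F p") auto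
  show thesis
  proof
    show "exp_minus M F p = ennreal m1" by fact
    show "1 < m1" using assms(1) m1 by (metis ennreal_1 ennreal_less_iff zero_le_one)
    show "m1 \<le> m2" using assms(2) m1 m2 by simp
    show "m2 < real Q" using assms(3) m2 by (simp add: ennreal_of_nat_eq_real_of_nat ennreal_less_iff)
    have "AE x in restrict_space M F. p x \<le> exp_plus M F p" unfolding exp_plus_def by (rule esssup_AE)
    then show "AE x in restrict_space M F. p x < \<infinity> \<and> m1 \<le> enn2real (p x) \<and> enn2real (p x) \<le> m2"
      using exp_minus_le_AE[of M F p]
    proof eventually_elim
      case (elim x)
      then have "ennreal m1 \<le> p x" "p x \<le> ennreal m2" using m1 m2 by simp_all
      moreover from this have "p x < \<infinity>" by (simp add: le_less_trans)
      ultimately show ?case using m1(2) m2(2) by (cases "p x") auto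
    qed
  qed
qed

lemma conj_exp_eq:
  assumes "p < \<infinity>" "1 < enn2real p"
  shows "conj_exp p = ennreal (enn2real p / (enn2real p - 1))"
proof -
  define P where "P = enn2real p"
  have p: "p = ennreal P" "1 < P" using assms by (simp_all add: P_def)
  have "1 - inverse p = ennreal (1 - inverse P)"
    using p by (simp add: inverse_ennreal ennreal_minus flip: ennreal_1)
  moreover have "0 < 1 - inverse P" using p(2) by (simp add: field_simps)
  ultimately have "conj_exp p = ennreal (inverse (1 - inverse P))"
    by (simp add: conj_exp_def inverse_ennreal)
  also have "inverse (1 - inverse P) = P / (P - 1)" using p(2) by (simp add: field_simps)
  finally show ?thesis by (simp only: P_def)
qed

lemma sobolev_exp_eq:
  assumes "p < \<infinity>" "enn2real p < real Q"
  shows "sobolev_exp Q p = ennreal (real Q * enn2real p / (real Q - enn2real p))"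
proof -
  define P where "P = enn2real p"
  have p: "p = ennreal P" "0 \<le> P" "P < real Q" using assms by (simp_all add: P_def)
  then show ?thesis
    by (simp add: sobolev_exp_def ennreal_of_nat_eq_real_of_nat ennreal_minus divide_ennreal ennreal_mult'[symmetric])
qed

lemma restrict_space_whole: "space M = UNIV \<Longrightarrow> restrict_space M UNIV = M"
  by (intro measure_eqI) (auto simp: sets_restrict_space emeasure_restrict_space)

context carnot_open
begin

lemma restrict_vol_UNIV [simp]: "restrict_space (vol G) UNIV = vol G"
  by (rule restrict_space_whole) simp

lemma weight_measurable_pos:
  assumes "weight G \<omega>" shows "\<omega> \<in> borel_measurable (vol G)" "AE x in vol G. 0 < \<omega> x"
proof -
  obtain w a where w: "w \<in> borel_measurable (vol G)" "AE x in vol G. 0 < w x" "AE x in vol G. \<omega> x = w x powr a"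
    using assms unfolding weight_def by blast
  have m: "(\<lambda>x. w x powr a) \<in> borel_measurable (vol G)" using w(1) by measurable
  show "\<omega> \<in> borel_measurable (vol G)"
  proof (rule measurableI)
    fix S :: "real set" assume S: "S \<in> sets borel"
    have "\<omega> -` S \<inter> space (completion (haar G)) \<in> sets (completion (haar G))"
    proof (rule completion.in_sets_AE)
      show "(\<lambda>x. w x powr a) -` S \<inter> space (vol G) \<in> sets (completion (haar G))"
        using measurable_sets[OF m S] by (simp add: vol_def)
      show "AE x in completion (haar G). x \<in> (\<lambda>x. w x powr a) -` S \<inter> space (vol G) \<longleftrightarrow> x \<in> \<omega> -` S \<inter> space (completion (haar G))"
        using w(3) unfolding vol_def[symmetric] by eventually_elim auto
    qed auto
    then show "\<omega> -` S \<inter> space (vol G) \<in> sets (vol G)" by (simp only: vol_def)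
  qed auto
  show "AE x in vol G. 0 < \<omega> x" using w(2,3) by eventually_elim simp
qed

text \<open>In the Muckenhoupt supremum the factors of one ball \<open>B\<close> are \<open>|B|\<^bsup>\<gamma>-1\<^esup>\<close> and the norm of
  \<open>\<omega>\<close>, both nonzero since \<open>\<omega> > 0\<close> almost everywhere, and the dual norm of \<open>\<omega>\<^sup>-\<^sup>1\<close>. As the product
  is finite, so is the last factor.\<close>

lemma muckenhoupt_dual_integrable:
  assumes A: "muckenhoupt G q (\<lambda>x. sobolev_exp Q (q x)) \<omega>"
    and q: "AE x in vol G. q x < \<infinity> \<and> m1 \<le> enn2real (q x) \<and> enn2real (q x) \<le> m2" "1 < m1" "m2 < real Q"
    and B: "B \<in> cc_balls G" "B \<in> sets borel" "emeasure (vol G) B \<noteq> 0" "emeasure (vol G) B < \<infinity>"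
  shows "(\<integral>\<^sup>+x. ennreal ((1 / \<omega> x) powr (enn2real (q x) / (enn2real (q x) - 1))) * indicator B x \<partial>vol G) < \<infinity>"
proof -
  let ?q = "\<lambda>x. enn2real (q x)" and ?s = "\<lambda>x. sobolev_exp Q (q x)" and ?c = "\<lambda>x. conj_exp (q x)"
  have w: "\<omega> \<in> borel_measurable (vol G)" "AE x in vol G. 0 < \<omega> x"
    using A weight_measurable_pos unfolding muckenhoupt_def by auto
  note [measurable] = w(1) borel_sets_vol[OF B(2)]
  have qm [measurable]: "q \<in> borel_measurable (vol G)" and sm: "?s \<in> borel_measurable (vol G)"
    using A unfolding muckenhoupt_def var_exponent_def by auto
  have cm: "?c \<in> borel_measurable (vol G)" unfolding conj_exp_def by measurable
  have "ae_filter (vol G) \<noteq> bot"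
    using B(3) emeasure_space[of "vol G" B] by (auto simp: ae_filter_eq_bot_iff)
  then have "\<exists>x. m1 \<le> ?q x \<and> ?q x \<le> m2" 
    using eventually_happens'[OF _ q(1)] by blast
  then have m12: "m1 \<le> m2" by auto
  interpret s: bounded_exponent "vol G" UNIV ?s "max 1 (real Q * m2 / (real Q - m2))"
  proof unfold_locales
    show "AE x in restrict_space (vol G) UNIV. ?s x < \<infinity> \<and> 1 \<le> enn2real (?s x) \<and> enn2real (?s x) \<le> max 1 (real Q * m2 / (real Q - m2))"
      unfolding restrict_vol_UNIV using q(1)
    proof eventually_elim
      case (elim x)
      have pos: "1 < ?q x" "0 < real Q - m2" "real Q - m2 \<le> real Q - ?q x" using elim q by auto
      have eq: "?s x = ennreal (real Q * ?q x / (real Q - ?q x))" by (rule sobolev_exp_eq) (use elim q(3) in linarith)+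
      have "real Q * 1 \<le> real Q * ?q x" using pos by (intro mult_left_mono) auto
      then have "real Q - ?q x \<le> real Q * ?q x" using pos by linarith
      then have "1 \<le> real Q * ?q x / (real Q - ?q x)" using pos by (simp add: le_divide_eq)
      moreover have "real Q * ?q x / (real Q - ?q x) \<le> real Q * m2 / (real Q - m2)"
        using pos elim by (intro frac_le mult_left_mono) auto
      ultimately show ?case unfolding eq by simp
    qed
  qed (use sm in \<open>auto intro: borel_sets_vol\<close>)
  interpret c: bounded_exponent "vol G" UNIV ?c "m1 / (m1 - 1)"
  proof unfold_locales
    show "AE x in restrict_space (vol G) UNIV. ?c x < \<infinity> \<and> 1 \<le> enn2real (?c x) \<and> enn2real (?c x) \<le> m1 / (m1 - 1)"
      unfolding restrict_vol_UNIV using q(1)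
    proof eventually_elim
      case (elim x)
      have pos: "1 < ?q x" using elim q by auto
      have eq: "?c x = ennreal (?q x / (?q x - 1))" using elim pos by (intro conj_exp_eq) auto
      have "1 \<le> ?q x / (?q x - 1)" "?q x / (?q x - 1) \<le> m1 / (m1 - 1)"
        using pos elim q by (simp_all add: divide_simps algebra_simps)
      then show ?case unfolding eq by simp
    qed
  qed (use cm in \<open>auto intro: borel_sets_vol\<close>)
  define g where "g = (\<lambda>x. indicator B x * inverse (\<omega> x))"
  have gm: "g \<in> borel_measurable (restrict_space (vol G) UNIV)" unfolding g_def restrict_vol_UNIV by measurable
  define h where "h = (\<lambda>x. indicator B x * \<omega> x)"
  have hm: "h \<in> borel_measurable (restrict_space (vol G) UNIV)" unfolding h_def restrict_vol_UNIV by measurable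
  let ?Ns = "Lp_norm (vol G) UNIV ?s (\<lambda>x. ennreal \<bar>h x\<bar>)" and ?Nc = "Lp_norm (vol G) UNIV ?c (\<lambda>x. ennreal \<bar>g x\<bar>)"
  obtain \<gamma> where "(SUP B\<in>cc_balls G. ennreal (measure (vol G) B powr (\<gamma> - 1))
           * wLp_norm (vol G) UNIV ?s \<omega> (indicator B)
           * wLp_norm (vol G) UNIV ?c (\<lambda>x. inverse (\<omega> x)) (indicator B)) < \<infinity>"
    using A unfolding muckenhoupt_def by blast
  then have fin: "ennreal (measure (vol G) B powr (\<gamma> - 1)) * ?Ns * ?Nc < \<infinity>"
    unfolding wLp_norm_def g_def h_def by (rule le_less_trans[OF SUP_upper[OF B(1)]])
  have "0 < measure (vol G) B" using B(3,4) by (simp add: measure_def enn2real_positive_iff zero_less_iff_neq_zero)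
  then have "ennreal (measure (vol G) B powr (\<gamma> - 1)) \<noteq> 0" by simp
  moreover have "?Ns \<noteq> 0"
  proof
    assume "?Ns = 0"
    then have "AE x in vol G. h x = 0" using s.Lp_norm_zero_imp_AE_zero[OF hm] unfolding restrict_vol_UNIV by blast
    then have "AE x in vol G. x \<notin> B" using w(2) by eventually_elim (auto simp: h_def)
    then show False using B(3) AE_iff_measurable[of B "vol G" "\<lambda>x. x \<notin> B"] borel_sets_vol[OF B(2)] by simp
  qed
  ultimately have "?Nc < \<infinity>" using fin by (auto simp: less_top[symmetric] ennreal_mult_eq_top_iff)
  then have "c.mod1 g < \<infinity>" using c.Lp_norm_finite_iff[OF gm] by simp
  moreover have "(\<integral>\<^sup>+x. ennreal ((1 / \<omega> x) powr (?q x / (?q x - 1))) * indicator B x \<partial>vol G) = c.mod1 g"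
    unfolding restrict_vol_UNIV
  proof (rule nn_integral_cong_AE)
    show "AE x in vol G. ennreal ((1 / \<omega> x) powr (?q x / (?q x - 1))) * indicator B x = ennreal (\<bar>g x\<bar> powr enn2real (?c x))"
      using q(1) w(2)
    proof eventually_elim
      case (elim x)
      then have "?c x = ennreal (?q x / (?q x - 1))" "0 \<le> ?q x / (?q x - 1)" using q(2) by (auto intro!: conj_exp_eq)
      then show ?case using elim by (auto simp: g_def indicator_def inverse_eq_divide)
    qed
  qed
  ultimately show ?thesis by (simp only:)
qed

end

section \<open>The Dirichlet problem of the theorem\<close>

context carnot_open
begin

lemma domain_ball:
  assumes dom: "carnot_domain G \<Omega>" and nonnull: "emeasure (vol G) \<Omega> \<noteq> 0"
  obtains B where "B \<in> cc_balls G" "\<Omega> \<subseteq> B" "B \<in> sets borel" "emeasure (vol G) B \<noteq> 0" "emeasure (vol G) B < \<infinity>"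
proof -
  obtain B where B: "B \<in> cc_balls G" "\<Omega> \<subseteq> B" using dom unfolding carnot_domain_def by blast
  then obtain y r where r: "B = cc_ball G y r" "0 < r" unfolding cc_balls_def by blast
  have Bs: "B \<in> sets borel" using cc_ball_borel[OF r(2)] r(1) by simp
  obtain K where K: "compact K" "cc_ball G y r \<subseteq> K" by (rule cc_ball_subset_compact[OF r(2)])
  have Ks: "K \<in> sets borel" using K(1) by (simp add: borel_compact)
  have "emeasure (vol G) B \<le> emeasure (vol G) K"
    using K r(1) Ks by (intro emeasure_mono borel_sets_vol) auto
  also have "\<dots> < \<infinity>" using haar_compact[OF K(1)] Ks by (simp add: emeasure_vol)
  finally have fin: "emeasure (vol G) B < \<infinity>" .
  have "emeasure (vol G) \<Omega> \<le> emeasure (vol G) B" using B(2) Bs by (intro emeasure_mono borel_sets_vol)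
  then have "emeasure (vol G) B \<noteq> 0" using nonnull by auto
  then show thesis using that B Bs fin by blast
qed

text \<open>On a set of finite volume, the dual modular at the larger exponent \<open>p(\<cdot>) \<ge> p\<^sup>-\<close> is controlled by
  the one at \<open>p\<^sup>-\<close>, because the conjugate exponents are ordered the other way round.\<close>

lemma dual_integrable_of_constant:
  assumes m1: "1 < m1" and P: "AE x in restrict_space (vol G) \<Omega>. m1 \<le> P x"
    and \<Omega>B: "\<Omega> \<subseteq> B" and B: "B \<in> sets borel" "emeasure (vol G) B < \<infinity>"
    and w [measurable]: "\<omega> \<in> borel_measurable (vol G)"
    and pos: "AE x in vol G. 0 < \<omega> x"
    and fin: "(\<integral>\<^sup>+x. ennreal ((1 / \<omega> x) powr (m1 / (m1 - 1))) * indicator B x \<partial>vol G) < \<infinity>"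
  shows "(\<integral>\<^sup>+x. ennreal ((1 / \<omega> x) powr (P x / (P x - 1))) \<partial>restrict_space (vol G) \<Omega>) < \<infinity>"
proof -
  note [measurable] = borel_sets_vol[OF B(1)]
  have "(\<integral>\<^sup>+x. ennreal ((1 / \<omega> x) powr (P x / (P x - 1))) \<partial>restrict_space (vol G) \<Omega>)
      = (\<integral>\<^sup>+x. ennreal ((1 / \<omega> x) powr (P x / (P x - 1))) * indicator \<Omega> x \<partial>vol G)"
    by (intro nn_integral_restrict_space) auto
  also have "\<dots> \<le> (\<integral>\<^sup>+x. indicator B x + ennreal ((1 / \<omega> x) powr (m1 / (m1 - 1))) * indicator B x \<partial>vol G)"
  proof (rule nn_integral_mono_AE)
    have "AE x in vol G. x \<in> \<Omega> \<longrightarrow> m1 \<le> P x" using P by (simp add: AE_restrict_space_iff)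
    then show "AE x in vol G. ennreal ((1 / \<omega> x) powr (P x / (P x - 1))) * indicator \<Omega> x
        \<le> indicator B x + ennreal ((1 / \<omega> x) powr (m1 / (m1 - 1))) * indicator B x"
      using pos
    proof eventually_elim
      case (elim x)
      show ?case
      proof (cases "x \<in> \<Omega>")
        case True
        define y where "y = 1 / \<omega> x"
        have y: "0 < y" using elim by (simp add: y_def)
        have Px: "m1 \<le> P x" using elim True by simp
        then have le: "P x / (P x - 1) \<le> m1 / (m1 - 1)" and ge: "0 \<le> P x / (P x - 1)"
          using m1 by (simp_all add: divide_simps algebra_simps)
        have "y powr (P x / (P x - 1)) \<le> 1 + y powr (m1 / (m1 - 1))"
        proof (cases "1 \<le> y")
          case True
          then have "y powr (P x / (P x - 1)) \<le> y powr (m1 / (m1 - 1))" using le by (intro powr_mono)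
          then show ?thesis by simp
        next
          case False
          then have "y powr (P x / (P x - 1)) \<le> 1 powr (P x / (P x - 1))" using y ge by (intro powr_mono2) auto
          then show ?thesis by (simp add: add_increasing2)
        qed
        then have "ennreal (y powr (P x / (P x - 1))) \<le> ennreal 1 + ennreal (y powr (m1 / (m1 - 1)))"
          unfolding ennreal_plus[OF zero_le_one powr_ge_zero, symmetric] by (rule ennreal_leI)
        then show ?thesis using True \<Omega>B by (auto simp: y_def indicator_def)
      qed simp
    qed
  qed
  also have "\<dots> = emeasure (vol G) B + (\<integral>\<^sup>+x. ennreal ((1 / \<omega> x) powr (m1 / (m1 - 1))) * indicator B x \<partial>vol G)"
    by (subst nn_integral_add) auto
  also have "\<dots> < \<infinity>" using B(2) fin by simp
  finally show ?thesis .
qed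

end

text \<open>The data of the Dirichlet problem, with the Muckenhoupt condition replaced by its consequence, the
  integrability of the dual weight on the domain.\<close>

locale carnot_dirichlet = weighted_domain G \<Omega> p \<omega> p1 p2
  for G :: "('g::{t2_space, second_countable_topology}, 'e::euclidean_space, 'n::finite) carnot"
    and \<Omega> p \<omega> p1 p2 +
  fixes A :: "'g \<Rightarrow> real^'n^'n" and \<eta>1 \<eta>2 :: real and f :: "'g \<Rightarrow> real"
  assumes A_meas [measurable]: "A \<in> borel_measurable \<mu>"
    and A_sym: "\<And>x. x \<in> \<Omega> \<Longrightarrow> transpose (A x) = A x"
    and \<eta>: "0 < \<eta>1" "0 < \<eta>2"
    and A_bounds: "\<And>x \<xi>. x \<in> \<Omega> \<Longrightarrow> (\<omega> x)\<^sup>2 * \<eta>1 * (norm \<xi>)\<^sup>2 \<le> (A x *v \<xi>) \<bullet> \<xi> \<and>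
                                 (A x *v \<xi>) \<bullet> \<xi> \<le> (\<omega> x)\<^sup>2 * \<eta>2 * (norm \<xi>)\<^sup>2"
    and f: "f \<in> wLp (vol G) \<Omega> (\<lambda>x. conj_exp (p x)) (\<lambda>x. inverse (\<omega> x))"
begin

lemma load_dual:
  "f \<in> borel_measurable \<mu>" "(\<integral>\<^sup>+x. ennreal (\<bar>f x * inverse (\<omega> x)\<bar> powr (P x / (P x - 1))) \<partial>\<mu>) < \<infinity>"
proof -
  have conj: "AE x in \<mu>. conj_exp (p x) = ennreal (P x / (P x - 1)) \<and> 1 \<le> P x / (P x - 1) \<and> P x / (P x - 1) \<le> p1 / (p1 - 1)"
    using p_bounds
  proof eventually_elim
    case (elim x)
    have "1 < P x" using elim p1 by simp
    then show ?case using elim p1 by (auto intro!: conj_exp_eq simp: divide_simps algebra_simps)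
  qed
  interpret c: bounded_exponent "vol G" \<Omega> "\<lambda>x. conj_exp (p x)" "p1 / (p1 - 1)"
  proof unfold_locales
    show "(\<lambda>x. conj_exp (p x)) \<in> borel_measurable \<mu>" unfolding conj_exp_def by measurable
    show "AE x in \<mu>. conj_exp (p x) < \<infinity> \<and> 1 \<le> enn2real (conj_exp (p x)) \<and> enn2real (conj_exp (p x)) \<le> p1 / (p1 - 1)"
      using conj by eventually_elim auto
  qed auto
  have "(\<lambda>x. inverse (\<omega> x)) \<in> borel_measurable \<mu>" by measurable
  from c.wLp_iff[OF this] f have 1: "f \<in> borel_measurable \<mu>" "c.mod1 (\<lambda>x. f x * inverse (\<omega> x)) < \<infinity>" by auto
  have "c.mod1 (\<lambda>x. f x * inverse (\<omega> x)) = (\<integral>\<^sup>+x. ennreal (\<bar>f x * inverse (\<omega> x)\<bar> powr (P x / (P x - 1))) \<partial>\<mu>)"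
  proof (rule nn_integral_cong_AE)
    show "AE x in \<mu>. ennreal (\<bar>f x * inverse (\<omega> x)\<bar> powr enn2real (conj_exp (p x)))
        = ennreal (\<bar>f x * inverse (\<omega> x)\<bar> powr (P x / (P x - 1)))"
      using conj by eventually_elim auto
  qed
  then show "(\<integral>\<^sup>+x. ennreal (\<bar>f x * inverse (\<omega> x)\<bar> powr (P x / (P x - 1))) \<partial>\<mu>) < \<infinity>" using 1(2) by simp
  show "f \<in> borel_measurable \<mu>" by (rule 1)
qed

lemma AE_\<Omega>I: "(\<And>x. x \<in> \<Omega> \<Longrightarrow> R x) \<Longrightarrow> AE x in \<mu>. R x"
  unfolding AE_\<mu> by (intro AE_I2) simp

sublocale grad_term: energy_term G \<Omega> p \<omega> p1 p2 "\<lambda>x \<xi> \<zeta>. (A x *v \<xi>) \<bullet> \<zeta>" \<eta>1 \<eta>2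
proof unfold_locales
  show "AE x in \<mu>. quad_form (\<lambda>\<xi> \<zeta>. (A x *v \<xi>) \<bullet> \<zeta>)"
  proof (rule AE_\<Omega>I)
    fix x assume x: "x \<in> \<Omega>"
    have "(A x *v \<xi>) \<bullet> \<zeta> = (A x *v \<zeta>) \<bullet> \<xi>" for \<xi> \<zeta>
      using A_sym[OF x] by (metis dot_lmul_matrix inner_commute vector_transpose_matrix)
    moreover have "0 \<le> (A x *v \<xi>) \<bullet> \<xi>" for \<xi>
    proof -
      have "0 \<le> (\<omega> x)\<^sup>2 * \<eta>1 * (norm \<xi>)\<^sup>2" using \<eta> by simp
      also have "\<dots> \<le> (A x *v \<xi>) \<bullet> \<xi>" using A_bounds[OF x] by blast
      finally show ?thesis .
    qed
    ultimately show "quad_form (\<lambda>\<xi> \<zeta>. (A x *v \<xi>) \<bullet> \<zeta>)"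
      by unfold_locales (auto simp: matrix_vector_right_distrib inner_add_left matrix_vector_mult_scaleR)
  qed
  show "AE x in \<mu>. \<forall>\<xi>. \<eta>1 * (norm \<xi> * \<omega> x)\<^sup>2 \<le> (A x *v \<xi>) \<bullet> \<xi> \<and> (A x *v \<xi>) \<bullet> \<xi> \<le> \<eta>2 * (norm \<xi> * \<omega> x)\<^sup>2"
  proof (rule AE_\<Omega>I)
    fix x assume "x \<in> \<Omega>"
    from A_bounds[OF this]
    show "\<forall>\<xi>. \<eta>1 * (norm \<xi> * \<omega> x)\<^sup>2 \<le> (A x *v \<xi>) \<bullet> \<xi> \<and> (A x *v \<xi>) \<bullet> \<xi> \<le> \<eta>2 * (norm \<xi> * \<omega> x)\<^sup>2"
      by (simp add: power_mult_distrib mult_ac)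
  qed
  fix F H :: "'g \<Rightarrow> real^'n"
  assume [measurable]: "F \<in> borel_measurable \<mu>" "H \<in> borel_measurable \<mu>"
  have c: "(\<lambda>x. K x $ i) \<in> borel_measurable \<mu>" if "K \<in> borel_measurable \<mu>" for K :: "'g \<Rightarrow> real^'n" and i
    using measurable_compose[OF that borel_measurable_continuous_onI[of "\<lambda>v. v $ i"]] by (simp add: continuous_on_component)
  have c2: "(\<lambda>x. A x $ i $ j) \<in> borel_measurable \<mu>" for i j
    using measurable_compose[OF A_meas borel_measurable_continuous_onI[of "\<lambda>v. v $ i $ j"]] by (simp add: continuous_on_component)
  show "(\<lambda>x. (A x *v F x) \<bullet> H x) \<in> borel_measurable \<mu>"
    unfolding inner_vec_def matrix_vector_mult_def
    by (simp, intro borel_measurable_sum borel_measurable_times c c2) measurable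
qed (use \<eta> in auto)

sublocale mass_term: energy_term G \<Omega> p \<omega> p1 p2 "\<lambda>x t u. (\<omega> x)\<^sup>2 * (t * u)" 1 1
proof unfold_locales
  show "AE x in \<mu>. quad_form (\<lambda>t u. (\<omega> x)\<^sup>2 * (t * u))"
    by (rule AE_\<Omega>I, unfold_locales) (auto simp: distrib_left distrib_right)
  show "AE x in \<mu>. \<forall>t. 1 * (norm t * \<omega> x)\<^sup>2 \<le> (\<omega> x)\<^sup>2 * (t * t) \<and> (\<omega> x)\<^sup>2 * (t * t) \<le> 1 * (norm t * \<omega> x)\<^sup>2"
    by (rule AE_\<Omega>I) (auto simp: power2_eq_square algebra_simps)
  fix F H :: "'g \<Rightarrow> real"
  assume [measurable]: "F \<in> borel_measurable \<mu>" "H \<in> borel_measurable \<mu>"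
  show "(\<lambda>x. (\<omega> x)\<^sup>2 * (F x * H x)) \<in> borel_measurable \<mu>" by measurable
qed auto

sublocale dirichlet_problem G \<Omega> p \<omega> p1 p2 "\<lambda>x \<xi> \<zeta>. (A x *v \<xi>) \<bullet> \<zeta>" \<eta>1 \<eta>2 "\<lambda>x t u. (\<omega> x)\<^sup>2 * (t * u)" 1 1 f
  by unfold_locales (rule load_dual)+

lemma energy_eq: "energy G \<Omega> p \<omega> A f u = En u"
proof -
  have "(\<integral>x. \<bar>u x * \<omega> x\<bar> powr P x / P x \<partial>\<mu>) = mass_term.J u"
  proof -
    have "\<bar>t\<bar> powr r = (t\<^sup>2) powr (r / 2)" for t r :: real
      by (subst powr_half) (simp_all add: real_sqrt_abs)
    then show ?thesis unfolding mass_term.J_def by (simp add: power_mult_distrib power2_eq_square mult_ac)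
  qed
  then show ?thesis
    unfolding energy_def set_integral_\<mu> En_def T_def ell_def grad_term.J_def by simp
qed

lemma weak_form_eq:
  assumes "u \<in> W0" "v \<in> W0"
  shows "(LINT x:\<Omega>|vol G. \<bar>u x\<bar> powr (P x - 2) * u x * v x * \<omega> x powr P x) = mass_term.dJ u v"
  unfolding mass_term.dJ_def set_integral_\<mu>
proof (rule integral_cong_AE)
  note [measurable] = sobolevD(4)[OF sobolev0_subset[OF assms(1)]] sobolevD(4)[OF sobolev0_subset[OF assms(2)]]
  show "(\<lambda>x. \<bar>u x\<bar> powr (P x - 2) * u x * v x * \<omega> x powr P x) \<in> borel_measurable \<mu>"
    "(\<lambda>x. ((\<omega> x)\<^sup>2 * (u x * u x)) powr ((P x - 2) / 2) * ((\<omega> x)\<^sup>2 * (u x * v x))) \<in> borel_measurable \<mu>"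
    by measurable
  show "AE x in \<mu>. \<bar>u x\<bar> powr (P x - 2) * u x * v x * \<omega> x powr P x
      = ((\<omega> x)\<^sup>2 * (u x * u x)) powr ((P x - 2) / 2) * ((\<omega> x)\<^sup>2 * (u x * v x))"
    using \<omega>_pos
  proof eventually_elim
    case (elim x)
    have "((\<omega> x)\<^sup>2 * (u x * u x)) powr ((P x - 2) / 2) = sqrt ((\<omega> x * u x)\<^sup>2) powr (P x - 2)"
    proof -
      have "(\<omega> x)\<^sup>2 * (u x * u x) = (\<omega> x * u x)\<^sup>2" by (simp add: power2_eq_square mult_ac)
      then show ?thesis by (simp only: powr_half[OF zero_le_power2])
    qed
    also have "\<dots> = \<omega> x powr (P x - 2) * \<bar>u x\<bar> powr (P x - 2)"
      using elim by (simp add: abs_mult powr_mult)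
    finally have 1: "((\<omega> x)\<^sup>2 * (u x * u x)) powr ((P x - 2) / 2) = \<omega> x powr (P x - 2) * \<bar>u x\<bar> powr (P x - 2)" .
    have "\<omega> x powr (P x - 2 + 2) = \<omega> x powr (P x - 2) * (\<omega> x)\<^sup>2"
      unfolding powr_add using elim by simp
    then have "\<omega> x powr P x = \<omega> x powr (P x - 2) * (\<omega> x)\<^sup>2" by simp
    then show ?case unfolding 1 by (simp only: mult_ac)
  qed
qed

lemma weak_solution_iff: "weak_solution G \<Omega> p \<omega> A f u \<longleftrightarrow> weak_sol u"
  unfolding weak_solution_def weak_sol_def
proof (rule conj_cong[OF refl], rule ball_cong[OF refl])
  fix v assume "u \<in> W0" "v \<in> W0"
  note w = weak_form_eq[OF this]
  show "(LINT x:\<Omega>|vol G. ((A x *v grad u x) \<bullet> grad u x) powr ((P x - 2) / 2) * ((A x *v grad u x) \<bullet> grad v x))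
      + (LINT x:\<Omega>|vol G. \<bar>u x\<bar> powr (P x - 2) * u x * v x * \<omega> x powr P x) = (LINT x:\<Omega>|vol G. f x * v x)
      \<longleftrightarrow> dT u v = ell v"
    unfolding w dT_def ell_def grad_term.dJ_def unfolding set_integral_\<mu> ..
qed

theorem unique_minimizer_and_weak_solution:
  "\<exists>u\<in>sobolev0 G \<Omega> p \<omega>.
     (\<forall>v\<in>sobolev0 G \<Omega> p \<omega>. energy G \<Omega> p \<omega> A f u \<le> energy G \<Omega> p \<omega> A f v) \<and>
     (\<forall>w\<in>sobolev0 G \<Omega> p \<omega>.
        (\<forall>v\<in>sobolev0 G \<Omega> p \<omega>. energy G \<Omega> p \<omega> A f w \<le> energy G \<Omega> p \<omega> A f v)
          \<longrightarrow> (AE x\<in>\<Omega> in vol G. w x = u x)) \<and>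
     weak_solution G \<Omega> p \<omega> A f u \<and>
     (\<forall>w. weak_solution G \<Omega> p \<omega> A f w \<longrightarrow> (AE x\<in>\<Omega> in vol G. w x = u x))"
proof -
  obtain u where u: "minimizer u" by (rule minimizer_exists)
  have unique: "AE x\<in>\<Omega> in vol G. w x = u x" if "minimizer w" for w
    using minimizer_unique[OF that u] unfolding AE_\<mu> .
  show ?thesis
    unfolding energy_eq weak_solution_iff
  proof (intro bexI[of _ u] conjI ballI allI impI)
    show "weak_sol u" by (rule minimizer_imp_weak_sol[OF u])
    show "u \<in> W0" "\<And>v. v \<in> W0 \<Longrightarrow> En u \<le> En v" using u by (auto simp: minimizer_def)
    show "AE x\<in>\<Omega> in vol G. w x = u x" if "w \<in> W0" "\<forall>v\<in>W0. En w \<le> En v" for w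
      using that by (intro unique) (simp add: minimizer_def)
    show "AE x\<in>\<Omega> in vol G. w x = u x" if "weak_sol w" for w
      by (rule unique[OF weak_sol_imp_minimizer[OF that]])
  qed
qed

end

theorem theorem1p7:
  fixes G :: "('g::{t2_space, second_countable_topology}, 'e::euclidean_space, 'n::finite) carnot"
    and \<Omega> :: "'g set"
    and p :: "'g \<Rightarrow> ennreal"
    and \<omega> f :: "'g \<Rightarrow> real"
    and A :: "'g \<Rightarrow> real^'n^'n"
    and \<eta>1 \<eta>2 :: real
    and Q :: nat
  defines "Q \<equiv> hom_dim G"
  assumes G: "carnot_group G"
    and dom: "carnot_domain G \<Omega>"
    and p: "var_exponent (vol G) \<Omega> p"
    and p_range: "1 < exp_minus (vol G) \<Omega> p" "exp_minus (vol G) \<Omega> p \<le> exp_plus (vol G) \<Omega> p"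
      "exp_plus (vol G) \<Omega> p < of_nat Q"
    and \<omega>: "weight G \<omega>"
    and A: "A \<in> borel_measurable (restrict_space (vol G) \<Omega>)"
    and A_sym: "\<And>x. x \<in> \<Omega> \<Longrightarrow> transpose (A x) = A x"
    and \<eta>: "0 < \<eta>1" "0 < \<eta>2"
    and A_bounds: "\<And>x \<xi>. x \<in> \<Omega> \<Longrightarrow> (\<omega> x)\<^sup>2 * \<eta>1 * (norm \<xi>)\<^sup>2 \<le> (A x *v \<xi>) \<bullet> \<xi> \<and>
                                 (A x *v \<xi>) \<bullet> \<xi> \<le> (\<omega> x)\<^sup>2 * \<eta>2 * (norm \<xi>)\<^sup>2"
    and f: "f \<in> wLp (vol G) \<Omega> (\<lambda>x. conj_exp (p x)) (\<lambda>x. inverse (\<omega> x))"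
    and cases:
      "(\<exists>P. var_exponent (vol G) UNIV P \<and> (\<forall>x\<in>\<Omega>. P x = p x) \<and>
            1 < exp_minus (vol G) UNIV P \<and> exp_minus (vol G) UNIV P \<le> exp_plus (vol G) UNIV P \<and>
            exp_plus (vol G) UNIV P < of_nat Q \<and>
            muckenhoupt G P (\<lambda>x. sobolev_exp Q (P x)) \<omega> \<and>
            M_pair G (\<lambda>x. sobolev_exp Q (P x) / ennreal (real Q / (real Q - 1)))
                     (\<lambda>x. \<omega> x powr (real Q / (real Q - 1))))
       \<or>
       (\<exists>\<delta>>0. jump_condition G \<Omega> \<delta> p \<and>
            muckenhoupt G (\<lambda>_. exp_minus (vol G) \<Omega> p)
                          (\<lambda>_. sobolev_exp Q (exp_minus (vol G) \<Omega> p)) \<omega>)"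
  shows "\<exists>u\<in>sobolev0 G \<Omega> p \<omega>.
           (\<forall>v\<in>sobolev0 G \<Omega> p \<omega>. energy G \<Omega> p \<omega> A f u \<le> energy G \<Omega> p \<omega> A f v) \<and>
           (\<forall>w\<in>sobolev0 G \<Omega> p \<omega>.
              (\<forall>v\<in>sobolev0 G \<Omega> p \<omega>. energy G \<Omega> p \<omega> A f w \<le> energy G \<Omega> p \<omega> A f v)
                \<longrightarrow> (AE x\<in>\<Omega> in vol G. w x = u x)) \<and>
           weak_solution G \<Omega> p \<omega> A f u \<and>
           (\<forall>w. weak_solution G \<Omega> p \<omega> A f w \<longrightarrow> (AE x\<in>\<Omega> in vol G. w x = u x))"
proof -
  interpret carnot_open G \<Omega>
    using G dom by unfold_locales (auto simp: carnot_domain_def)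
  note p_meas = p[unfolded var_exponent_def, THEN conjunct1]
  from p_range obtain m1 m2 where m: "exp_minus (vol G) \<Omega> p = ennreal m1" "1 < m1" "m1 \<le> m2" "m2 < real Q"
    and pm: "AE x in restrict_space (vol G) \<Omega>. p x < \<infinity> \<and> m1 \<le> enn2real (p x) \<and> enn2real (p x) \<le> m2"
    by (rule exponent_range_AE)
  \<comment> \<open>On a null set every number is an essential lower bound, so \<open>p\<^sup>-\<close> would be infinite.\<close>
  have nonnull: "emeasure (vol G) \<Omega> \<noteq> 0"
  proof
    assume "emeasure (vol G) \<Omega> = 0"
    then have "\<Omega> \<in> null_sets (vol G)" by (simp add: null_sets_def)
    then have "AE x in restrict_space (vol G) \<Omega>. top \<le> p x"
      by (simp add: AE_restrict_space_iff) (auto dest: AE_not_in)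
    then have "top \<le> exp_minus (vol G) \<Omega> p" unfolding exp_minus_def by (intro Sup_upper) simp
    then show False using m(1) by (simp add: top_unique)
  qed
  obtain B where B: "B \<in> cc_balls G" "\<Omega> \<subseteq> B" "B \<in> sets borel" "emeasure (vol G) B \<noteq> 0" "emeasure (vol G) B < \<infinity>"
    by (rule domain_ball[OF dom nonnull])
  note w = weight_measurable_pos[OF \<omega>]
  have w\<Omega>: "\<omega> \<in> borel_measurable (restrict_space (vol G) \<Omega>)" by (rule measurable_restrict_space1[OF w(1)])
  have w_pos: "AE x in restrict_space (vol G) \<Omega>. 0 < \<omega> x"
    using w(2) by (simp add: AE_restrict_space_iff) (auto elim: eventually_mono)
  have dual: "(\<integral>\<^sup>+x. ennreal ((1 / \<omega> x) powr (enn2real (p x) / (enn2real (p x) - 1))) \<partial>restrict_space (vol G) \<Omega>) < \<infinity>"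
    using cases
  proof (elim disjE exE conjE)
    fix P assume P: "\<forall>x\<in>\<Omega>. P x = p x" "muckenhoupt G P (\<lambda>x. sobolev_exp Q (P x)) \<omega>"
      "1 < exp_minus (vol G) UNIV P" "exp_minus (vol G) UNIV P \<le> exp_plus (vol G) UNIV P"
      "exp_plus (vol G) UNIV P < of_nat Q"
    obtain n1 n2 where n: "1 < n1" "n2 < real Q"
      "AE x in restrict_space (vol G) UNIV. P x < \<infinity> \<and> n1 \<le> enn2real (P x) \<and> enn2real (P x) \<le> n2"
      by (rule exponent_range_AE[OF P(3-5)]) (rule that)
    note n(3)[unfolded restrict_vol_UNIV]
    from muckenhoupt_dual_integrable[OF P(2) this n(1,2) B(1,3-5)]
    have fin: "(\<integral>\<^sup>+x. ennreal ((1 / \<omega> x) powr (enn2real (P x) / (enn2real (P x) - 1))) * indicator B x \<partial>vol G) < \<infinity>" .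
    have "(\<integral>\<^sup>+x. ennreal ((1 / \<omega> x) powr (enn2real (p x) / (enn2real (p x) - 1))) \<partial>restrict_space (vol G) \<Omega>)
        = (\<integral>\<^sup>+x. ennreal ((1 / \<omega> x) powr (enn2real (p x) / (enn2real (p x) - 1))) * indicator \<Omega> x \<partial>vol G)"
      by (intro nn_integral_restrict_space) auto
    also have "\<dots> \<le> (\<integral>\<^sup>+x. ennreal ((1 / \<omega> x) powr (enn2real (P x) / (enn2real (P x) - 1))) * indicator B x \<partial>vol G)"
      using P(1) B(2) by (intro nn_integral_mono) (auto simp: indicator_def)
    finally show ?thesis using fin by (rule le_less_trans)
  next
    assume "muckenhoupt G (\<lambda>_. exp_minus (vol G) \<Omega> p) (\<lambda>_. sobolev_exp Q (exp_minus (vol G) \<Omega> p)) \<omega>"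
    then have A1: "muckenhoupt G (\<lambda>_. ennreal m1) (\<lambda>x. sobolev_exp Q (ennreal m1)) \<omega>" by (simp only: m(1))
    have "(\<integral>\<^sup>+x. ennreal ((1 / \<omega> x) powr (enn2real (ennreal m1) / (enn2real (ennreal m1) - 1))) * indicator B x \<partial>vol G) < \<infinity>"
      by (rule muckenhoupt_dual_integrable[OF A1 _ m(2) _ B(1,3-5), where ?m2.0 = m1]) (use m in auto)
    then have fin: "(\<integral>\<^sup>+x. ennreal ((1 / \<omega> x) powr (m1 / (m1 - 1))) * indicator B x \<partial>vol G) < \<infinity>" using m(2) by simp
    have "AE x in restrict_space (vol G) \<Omega>. m1 \<le> enn2real (p x)" using pm by eventually_elim simp
    then show ?thesis by (rule dual_integrable_of_constant[OF m(2) _ B(2,3,5) w fin])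
  qed
  interpret weighted_domain G \<Omega> p \<omega> m1 m2
    by unfold_locales (fact p_meas m pm w\<Omega> w_pos dual)+
  interpret carnot_dirichlet G \<Omega> p \<omega> m1 m2 A \<eta>1 \<eta>2 f
    by unfold_locales (fact A A_sym \<eta> A_bounds f)+
  show ?thesis by (rule unique_minimizer_and_weak_solution)
qed

end
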